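(* Let $\mathcal H$ be a Hamiltonian of PW-type. Then $\det\mathcal H(t)\neq0$ for a.e. $t\ge0$ and $\int_0^\infty\sqrt{\det\mathcal H(t)}\,dt=\infty$. Moreover, for every $t>0$ the space $\mathcal B_t$ has the same elements as $\mathrm{PW}_{s(t)}$, where $s(t)=\int_0^t\sqrt{\det\mathcal H(\tau)}\,d\tau$.
   Context: Canonical system (CS): $\Omega\dot X=z\mathcal H(t)X$ on $[0,\infty)$, where $\Omega=\begin{pmatrix}0&1\\-1&0\end{pmatrix}$, $z\in\mathbb C$, and the Hamiltonian $\mathcal H$ is a real symmetric $2\times2$ matrix function with entries in $L^1_{\rm loc}[0,\infty)$, $\mathcal H(t)\ge0$ and $\mathcal H(t)\ne0$ for a.e. $t$, and $\mathcal H$ is not equal to a constant rank-one matrix on any open interval. The transfer matrix $M(t,z)=\begin{pmatrix}A_t(z)&B_t(z)\\C_t(z)&D_t(z)\end{pmatrix}$ is the solution of $\Omega\partial_tM=z\mathcal HM$, $M(0,z)=I$; its entries are real entire functions of $z$. An entire $E$ is Hermite–Biehler if $|E(z)|>|E(\bar z)|$ for $z$ in the upper half-plane $\mathbb C_+$; $E^\#(z)=\overline{E(\bar z)}$. The de Branges space $\mathcal B(E)$ is the Hilbert space of entire $G$ with $G/E,\,G^\#/E\in H^2(\mathbb C_+)$, normed by $\|G\|^2=\int_{\mathbb R}|G|^2|E|^{-2}dx$. For the CS, $E_t=A_t-iC_t$ is Hermite–Biehler and $\mathcal B_t=\mathcal B(E_t)$. For $a>0$, $\mathrm{PW}_a$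 denotes the entire functions of exponential type at most $a$ whose restrictions to $\mathbb R$ lie in $L^2(\mathbb R)$, with the $L^2(\mathbb R)$ norm. A Hamiltonian $\mathcal H$ is of PW-type if for every $t>0$ there is $s(t)>0$ with $s(t)\to\infty$ as $t\to\infty$ such that $\mathcal B_t$ and $\mathrm{PW}_{s(t)}$ have the same elements (not necessarily the same norms). *)

theory Defs
  imports "HOL-Complex_Analysis.Complex_Analysis"
begin

definition Omega_c :: "complex^2^2" where
  "Omega_c = (\<chi> i j. if i = 1 \<and> j = 2 then 1 else if i = 2 \<and> j = 1 then -1 else 0)"

definition cscale :: "complex \<Rightarrow> complex^2^2 \<Rightarrow> complex^2^2" where
  "cscale z A = (\<chi> i j. z * A $ i $ j)"

definition cmat_of :: "real^2^2 \<Rightarrow> complex^2^2" where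
  "cmat_of A = (\<chi> i j. complex_of_real (A $ i $ j))"

text \<open>Hamiltonian on [0,\<infinity>) (values for t<0 are irrelevant).\<close>
definition hamiltonian :: "(real \<Rightarrow> real^2^2) \<Rightarrow> bool" where
  "hamiltonian H \<longleftrightarrow>
     (\<forall>t\<ge>0. transpose (H t) = H t) \<and>
     (\<forall>T\<ge>0. \<forall>i j. set_integrable lborel {0..T} (\<lambda>t. H t $ i $ j)) \<and>
     (AE t in lborel. t \<ge> 0 \<longrightarrow> (\<forall>v. 0 \<le> v \<bullet> (H t *v v)) \<and> H t \<noteq> 0) \<and>
     \<not> (\<exists>a b P. 0 \<le> a \<and> a < b \<and> rank P = 1 \<and>
            (AE t in lborel. t \<in> {a<..<b} \<longrightarrow> H t = P))"

text \<open>Transfer matrix: solution of  Omega dM/dt = z H M,  M(0,z) = I,  in integrated form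
  Omega (M(t,z) - I) = z \<integral>_0^t H(s) M(s,z) ds.\<close>
definition transfer_matrix :: "(real \<Rightarrow> real^2^2) \<Rightarrow> (real \<Rightarrow> complex \<Rightarrow> complex^2^2) \<Rightarrow> bool" where
  "transfer_matrix H M \<longleftrightarrow>
     (\<forall>z t. t \<ge> 0 \<longrightarrow>
        set_integrable lborel {0..t} (\<lambda>s. cmat_of (H s) ** M s z) \<and>
        Omega_c ** (M t z - mat 1) =
          cscale z (set_lebesgue_integral lborel {0..t} (\<lambda>s. cmat_of (H s) ** M s z)))"

definition upper_half :: "complex set" where
  "upper_half = {z. Im z > 0}"

definition hardy2_upper :: "(complex \<Rightarrow> complex) \<Rightarrow> bool" where
  "hardy2_upper f \<longleftrightarrow> f holomorphic_on upper_half \<and>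
     (\<exists>C. \<forall>y>0. integrable lborel (\<lambda>x. (cmod (f (Complex x y)))\<^sup>2) \<and>
                 integral\<^sup>L lborel (\<lambda>x. (cmod (f (Complex x y)))\<^sup>2) \<le> C)"

definition hermite_biehler :: "(complex \<Rightarrow> complex) \<Rightarrow> bool" where
  "hermite_biehler E \<longleftrightarrow> E holomorphic_on UNIV \<and>
     (\<forall>z. Im z > 0 \<longrightarrow> cmod (E z) > cmod (E (cnj z)))"

text \<open>Elements of the de Branges space B(E) (as a set; the norm is not needed).\<close>
definition de_branges_space :: "(complex \<Rightarrow> complex) \<Rightarrow> (complex \<Rightarrow> complex) set" where
  "de_branges_space E = {G. G holomorphic_on UNIV \<and>
      hardy2_upper (\<lambda>z. G z / E z) \<and> hardy2_upper (\<lambda>z. cnj (G (cnj z)) / E z)}"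

definition exp_type_le :: "(complex \<Rightarrow> complex) \<Rightarrow> real \<Rightarrow> bool" where
  "exp_type_le f a \<longleftrightarrow> (\<forall>\<epsilon>>0. \<exists>C. \<forall>z. cmod (f z) \<le> C * exp ((a + \<epsilon>) * cmod z))"

definition paley_wiener :: "real \<Rightarrow> (complex \<Rightarrow> complex) set" where
  "paley_wiener a = {f. f holomorphic_on UNIV \<and> exp_type_le f a \<and>
      integrable lborel (\<lambda>x::real. (cmod (f (complex_of_real x)))\<^sup>2)}"

definition E_of :: "(real \<Rightarrow> complex \<Rightarrow> complex^2^2) \<Rightarrow> real \<Rightarrow> complex \<Rightarrow> complex" where
  "E_of M t z = M t z $ 1 $ 1 - \<i> * M t z $ 2 $ 1"

definition PW_type :: "(real \<Rightarrow> real^2^2) \<Rightarrow> (real \<Rightarrow> complex \<Rightarrow> complex^2^2) \<Rightarrow> bool" where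
  "PW_type H M \<longleftrightarrow> (\<exists>s::real \<Rightarrow> real.
      (\<forall>t>0. s t > 0 \<and> de_branges_space (E_of M t) = paley_wiener (s t)) \<and>
      filterlim s at_top at_top)"

end

theory Submission
  imports Defs
begin

text \<open>
  Let \<open>K\<^sub>t\<close> be the reproducing kernel of \<open>\<B>\<^sub>t\<close>. If two de Branges spaces are nested as sets,
  uniform boundedness makes their kernels comparable on the diagonal. Comparing \<open>\<B>\<^sub>t\<close> with the
  Paley--Wiener space along \<open>z = \<i>y\<close> gives
  \<open>ln Q(t2, y) - ln Q(t1, y) = 2 y (s(t2) - s(t1)) + O(1)\<close>, where \<open>Q(t, y) = Im (cnj A * C)\<close> at
  \<open>\<i>y\<close>. The logarithmic derivative of \<open>Q\<close> in \<open>t\<close> is at least \<open>2 y sqrt (det H)\<close> by the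
  arithmetic--geometric mean inequality, so \<open>s(t) - s(t') \<ge> \<integral> sqrt (det H)\<close>; a Gronwall estimate
  on short intervals, in a norm adapted to the mean of \<open>H\<close> there, gives the converse bound on the
  exponential type.

  With equality established, the excess of the logarithmic derivative over \<open>2 y sqrt (det H)\<close> has
  integral \<open>O(1)\<close> as \<open>y \<rightarrow> \<infinity>\<close>. If \<open>det H\<close> vanished on a set of positive measure, then, after a
  rotation, at some point \<open>t0\<close> of that set one component of the solution would be smaller than the other by a
  factor \<open>1 / y\<close>. The Riccati equation of their ratio carries this backwards and forces a diagonal
  entry of \<open>H\<close> to vanish on an interval to the left of \<open>t0\<close>. On that interval the component is
  constant and \<open>Q\<close> changes by a bounded factor, so the argument can be repeated from its left end, and
  the maximal such interval reaches \<open>0\<close>. Then \<open>s(t0) = 0\<close>, a contradiction.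
\<close>

section \<open>Absolutely continuous functions\<close>

text \<open>The hypothesis equates sets only, with nothing uniform in \<open>t\<close>, so constants
  have to be produced for each time separately. This is harmless because every comparison involves
  two fixed times while \<open>y\<close> tends to infinity. The precision of the comparison matters:
  an error o(y) in \<open>ln Q\<close> would suffice for the formula for \<open>s\<close>, but would
  say nothing about the zero set of the determinant. The bounded error makes the integral of a
  nonnegative excess bounded in \<open>y\<close>; by Fatou's lemma the excess is then bounded along
  a sequence of \<open>y\<close> at almost every time. Where the determinant vanishes, the form of
  \<open>H\<close> is a single square, and a bounded excess says exactly that one rotated component
  is small. The restriction to z = iy pays because every quadratic expression in the solution then
  has a derivative proportional to \<open>Q\<close>. As \<open>H\<close> is merely locally
  integrable, differential equations are kept in integrated form with an explicit density. Boundary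
  values are taken by continuity up to the real axis, where \<open>E\<close> has no zeros because
  det M = 1.\<close>

definition ac :: "real \<Rightarrow> real \<Rightarrow> (real \<Rightarrow> 'a::euclidean_space) \<Rightarrow> (real \<Rightarrow> 'a) \<Rightarrow> bool" where
  "ac a b f g \<longleftrightarrow> g absolutely_integrable_on {a..b} \<and>
     (\<forall>t\<in>{a..b}. f t - f a = integral {a..t} g)"

lemma absolutely_integrable_on_subinterval_real:
  fixes g :: "real \<Rightarrow> 'a::euclidean_space"
  assumes "g absolutely_integrable_on {a..b}" "a \<le> c" "d \<le> b"
  shows "g absolutely_integrable_on {c..d}"
  by (rule set_integrable_subset[OF assms(1)]) (use assms in auto)

lemma absolutely_integrable_mult_continuous:
  fixes f g :: "real \<Rightarrow> 'a::{real_normed_algebra,euclidean_space}"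
  assumes "continuous_on {a..b} f" "g absolutely_integrable_on {a..b}"
  shows "(\<lambda>x. f x * g x) absolutely_integrable_on {a..b}"
proof (rule absolutely_integrable_bounded_measurable_product[where h = "(*)"])
  show "bilinear ((*) :: 'a \<Rightarrow> 'a \<Rightarrow> 'a)"
    by (simp add: bilinear_conv_bounded_bilinear bounded_bilinear_mult)
  show "f \<in> borel_measurable (lebesgue_on {a..b})"
    using assms(1) by (simp add: continuous_imp_measurable_on_sets_lebesgue)
  show "bounded (f ` {a..b})"
    using assms(1) by (simp add: compact_continuous_image compact_imp_bounded)
qed (use assms in auto)

lemma absolutely_integrable_mult_continuous_right:
  fixes f g :: "real \<Rightarrow> 'a::{real_normed_field,euclidean_space}"
  assumes "g absolutely_integrable_on {a..b}" "continuous_on {a..b} f"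
  shows "(\<lambda>x. g x * f x) absolutely_integrable_on {a..b}"
  using absolutely_integrable_mult_continuous[OF assms(2,1)] by (simp add: mult.commute)

lemma ac_diff:
  assumes "ac a b f g" "a \<le> c" "c \<le> d" "d \<le> b"
  shows "f d - f c = integral {c..d} g"
proof -
  have i: "g integrable_on {a..d}"
    using assms absolutely_integrable_on_subinterval_real[of a b g a d] set_lebesgue_integral_eq_integral(1)
    by (auto simp: ac_def)
  have "integral {a..c} g + integral {c..d} g = integral {a..d} g"
    by (rule Henstock_Kurzweil_Integration.integral_combine) (use assms i in auto)
  moreover have "f d - f a = integral {a..d} g" "f c - f a = integral {a..c} g"
    using assms by (auto simp: ac_def)
  ultimately show ?thesis by (simp add: algebra_simps)
qed

lemma ac_abs_integrable: "ac a b f g \<Longrightarrow> g absolutely_integrable_on {a..b}"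
  by (simp add: ac_def)

lemma ac_integrable: "ac a b f g \<Longrightarrow> a \<le> c \<Longrightarrow> d \<le> b \<Longrightarrow> g integrable_on {c..d}"
  by (meson ac_abs_integrable absolutely_integrable_on_subinterval_real set_lebesgue_integral_eq_integral(1))

lemma ac_sub: "ac a b f g \<Longrightarrow> a \<le> c \<Longrightarrow> d \<le> b \<Longrightarrow> ac c d f g"
  using ac_diff[of a b f g c] absolutely_integrable_on_subinterval_real[OF ac_abs_integrable, of a b f g c d]
  by (auto simp: ac_def)

lemma ac_continuous:
  assumes "ac a b f g" shows "continuous_on {a..b} f"
proof -
  have "continuous_on {a..b} (\<lambda>t. f a + integral {a..t} g)"
    by (intro continuous_intros indefinite_integral_continuous_1 ac_integrable[OF assms]) auto
  then show ?thesis
  proof (rule continuous_on_eq)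
    fix t assume "t \<in> {a..b}"
    then have "f t - f a = integral {a..t} g" using assms by (simp add: ac_def)
    then show "f a + integral {a..t} g = f t" by (metis add.commute diff_add_cancel)
  qed
qed

text \<open>A function whose increments are, on short intervals, negligible against those of an
  integral of a fixed \<open>v\<close> is constant; this replaces differentiation almost everywhere.\<close>

lemma negligible_increments_imp_eq:
  fixes \<Psi> :: "real \<Rightarrow> 'a::real_normed_vector" and v :: "real \<Rightarrow> real"
  assumes v: "v integrable_on {a..b}" and ab: "a \<le> b"
    and loc: "\<And>e. e > 0 \<Longrightarrow> \<exists>d>0. \<forall>s t. a \<le> s \<and> s \<le> t \<and> t \<le> b \<and> t - s < d \<longrightarrow>
       norm (\<Psi> t - \<Psi> s) \<le> e * integral {s..t} v"
  shows "\<Psi> b = \<Psi> a"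
proof -
  have "norm (\<Psi> b - \<Psi> a) \<le> e * integral {a..b} v" if e: "e > 0" for e
  proof -
    obtain d where d: "d > 0" and loc': "\<And>s t. a \<le> s \<Longrightarrow> s \<le> t \<Longrightarrow> t \<le> b \<Longrightarrow> t - s < d \<Longrightarrow>
       norm (\<Psi> t - \<Psi> s) \<le> e * integral {s..t} v"
      using loc[OF e] by blast
    obtain n :: nat where n: "n > 0" "(b - a) / n < d"
    proof -
      obtain m where m: "(b - a) / d < real m" using reals_Archimedean2 by blast
      have "0 \<le> (b - a) / d" using ab d by simp
      then have "m > 0" using m by (cases m) auto
      then show ?thesis using that[of m] m d by (simp add: field_simps)
    qed
    define x where "x i = a + (b - a) * (real i / n)" for i :: nat
    have step: "norm (\<Psi> (x i) - \<Psi> a) \<le> e * integral {a..x i} v" if "i \<le> n" for i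
      using that
    proof (induction i)
      case 0 then show ?case by (simp add: x_def)
    next
      case (Suc i)
      have le: "a \<le> x i" using ab by (simp add: x_def)
      have x2: "x i \<le> x (Suc i)" unfolding x_def using ab
        by (intro add_left_mono mult_left_mono divide_right_mono) auto
      have "real (Suc i) / n \<le> 1" using Suc n by simp
      then have x3: "x (Suc i) \<le> b" unfolding x_def
        using mult_left_mono[of "real (Suc i) / n" 1 "b - a"] ab by simp
      have "x (Suc i) - x i = (b - a) / n" unfolding x_def using n by (simp add: field_simps)
      then have x4: "x (Suc i) - x i < d" using n by simp
      have "norm (\<Psi> (x (Suc i)) - \<Psi> a) \<le> norm (\<Psi> (x (Suc i)) - \<Psi> (x i)) + norm (\<Psi> (x i) - \<Psi> a)"
        using norm_triangle_ineq[of "\<Psi> (x (Suc i)) - \<Psi> (x i)" "\<Psi> (x i) - \<Psi> a"] by simp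
      also have "\<dots> \<le> e * integral {x i..x (Suc i)} v + e * integral {a..x i} v"
        by (intro add_mono loc' le x2 x3 x4 Suc.IH) (use Suc in auto)
      also have "\<dots> = e * integral {a..x (Suc i)} v"
        using Henstock_Kurzweil_Integration.integral_combine[of a "x i" "x (Suc i)" v] le x2 x3 v
          integrable_on_subinterval[of v "{a..b}" a "x (Suc i)"]
        by (simp add: algebra_simps flip: distrib_left)
      finally show ?case .
    qed
    have "x n = b" using n by (simp add: x_def)
    then show ?thesis using step[of n] by simp
  qed
  then have *: "norm (\<Psi> b - \<Psi> a) \<le> e * integral {a..b} v" if "e > 0" for e using that by blast
  have "norm (\<Psi> b - \<Psi> a) \<le> 0"
  proof (rule ccontr)
    assume c: "\<not> ?thesis"
    define I where "I = integral {a..b} v"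
    have "norm (\<Psi> b - \<Psi> a) > 0" using c by linarith
    then have I: "I > 0" using *[of 1] unfolding I_def by linarith
    have "norm (\<Psi> b - \<Psi> a) \<le> (norm (\<Psi> b - \<Psi> a) / (2 * I)) * I"
      unfolding I_def using I c I_def by (intro *) auto
    then show False using I c by simp
  qed
  then show ?thesis by simp
qed

text \<open>Apply the preceding criterion to \<open>F\<close> minus the indefinite integral of
  \<open>g\<close>. The product, reciprocal and logarithm rules all pass through this lemma, with
  \<open>v\<close> built from the norms of the densities, so that uniform continuity of the factors
  is all that remains to be used.\<close>

lemma ac_from_increments:
  fixes F :: "real \<Rightarrow> 'a::euclidean_space" and v :: "real \<Rightarrow> real"
  assumes g: "g absolutely_integrable_on {a..b}" and v: "v integrable_on {a..b}"
    and loc: "\<And>e. e > 0 \<Longrightarrow> \<exists>d>0. \<forall>s t. a \<le> s \<and> s \<le> t \<and> t \<le> b \<and> t - s < d \<longrightarrow>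
       norm (F t - F s - integral {s..t} g) \<le> e * integral {s..t} v"
  shows "ac a b F g"
  unfolding ac_def
proof (intro conjI g ballI)
  fix t assume t: "t \<in> {a..b}"
  have gi: "g integrable_on {a..b}" using g set_lebesgue_integral_eq_integral(1) by blast
  define \<Psi> where "\<Psi> t = F t - integral {a..t} g" for t
  have "\<Psi> t = \<Psi> a"
  proof (rule negligible_increments_imp_eq[where v = v])
    show "v integrable_on {a..t}" using v t by (meson atLeastAtMost_iff atLeastatMost_subset_iff integrable_on_subinterval order_refl)
    fix e :: real assume e: "e > 0"
    then obtain d where d: "d > 0" "\<And>s t. a \<le> s \<Longrightarrow> s \<le> t \<Longrightarrow> t \<le> b \<Longrightarrow> t - s < d \<Longrightarrow>
       norm (F t - F s - integral {s..t} g) \<le> e * integral {s..t} v"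
      using loc[OF e] by blast
    have "norm (\<Psi> u - \<Psi> s) \<le> e * integral {s..u} v"
      if "a \<le> s" "s \<le> u" "u \<le> t" "u - s < d" for s u
    proof -
      have "integral {a..s} g + integral {s..u} g = integral {a..u} g"
        by (rule Henstock_Kurzweil_Integration.integral_combine) 
          (use that t gi integrable_on_subinterval[of g "{a..b}" a u] in auto)
      then have "\<Psi> u - \<Psi> s = F u - F s - integral {s..u} g" by (simp add: \<Psi>_def algebra_simps)
      then show ?thesis using d that t by auto
    qed
    then show "\<exists>d>0. \<forall>s u. a \<le> s \<and> s \<le> u \<and> u \<le> t \<and> u - s < d \<longrightarrow>
         norm (\<Psi> u - \<Psi> s) \<le> e * integral {s..u} v" using d by blast
  qed (use t in auto)
  then show "F t - F a = integral {a..t} g" by (simp add: \<Psi>_def algebra_simps)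
qed

lemma ac_linear:
  assumes "bounded_linear L" "ac a b f g"
  shows "ac a b (\<lambda>t. L (f t)) (\<lambda>t. L (g t))"
  unfolding ac_def
proof (intro conjI ballI)
  show "(\<lambda>t. L (g t)) absolutely_integrable_on {a..b}"
    using absolutely_integrable_linear[OF ac_abs_integrable[OF assms(2)] assms(1)] by (simp add: o_def)
  fix t assume t: "t \<in> {a..b}"
  have "g integrable_on {a..t}" using assms(2) t by (auto intro!: ac_integrable)
  then have "integral {a..t} (L \<circ> g) = L (integral {a..t} g)"
    by (rule integral_linear[OF _ assms(1)])
  then show "L (f t) - L (f a) = integral {a..t} (\<lambda>t. L (g t))"
    using assms(2) t by (simp add: ac_def o_def bounded_linear.linear linear_diff[symmetric, OF bounded_linear.linear[OF assms(1)]])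
qed

lemma ac_add:
  assumes "ac a b f g" "ac a b f' g'"
  shows "ac a b (\<lambda>t. f t + f' t) (\<lambda>t. g t + g' t)"
  unfolding ac_def
proof (intro conjI ballI)
  show "(\<lambda>t. g t + g' t) absolutely_integrable_on {a..b}"
    using assms by (auto simp: ac_def)
  fix t assume t: "t \<in> {a..b}"
  have "integral {a..t} (\<lambda>t. g t + g' t) = integral {a..t} g + integral {a..t} g'"
    by (rule Henstock_Kurzweil_Integration.integral_add) (use assms t in \<open>auto intro!: ac_integrable\<close>)
  then show "f t + f' t - (f a + f' a) = integral {a..t} (\<lambda>t. g t + g' t)"
    using ac_diff[OF assms(1), of a t] ac_diff[OF assms(2), of a t] t by (simp add: add_diff_add)
qed

lemma ac_cmult:
  fixes f :: "real \<Rightarrow> 'a::{real_normed_algebra,euclidean_space}"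
  shows "ac a b f g \<Longrightarrow> ac a b (\<lambda>t. k * f t) (\<lambda>t. k * g t)"
  by (rule ac_linear[OF bounded_linear_mult_right])

lemma ac_diff_fun:
  assumes "ac a b f g" "ac a b f' g'"
  shows "ac a b (\<lambda>t. f t - f' t) (\<lambda>t. g t - g' t)"
  using ac_add[OF assms(1) ac_linear[OF bounded_linear_minus[OF bounded_linear_ident] assms(2)]] by simp

lemma ac_cong:
  assumes "ac a b f g" "\<And>t. t \<in> {a..b} \<Longrightarrow> f t = f' t" "\<And>t. t \<in> {a..b} \<Longrightarrow> g t = g' t"
  shows "ac a b f' g'"
  unfolding ac_def
proof (intro conjI ballI)
  show "g' absolutely_integrable_on {a..b}"
    using set_integrable_cong[of lebesgue lebesgue "{a..b}" "{a..b}" g g'] assms by (auto simp: ac_def)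
  fix t assume t: "t \<in> {a..b}"
  have "integral {a..t} g = integral {a..t} g'"
    by (rule integral_cong) (use assms t in auto)
  then show "f' t - f' a = integral {a..t} g'"
    using assms t by (simp add: ac_def)
qed

lemma norm_integral_mult_le:
  fixes h g :: "real \<Rightarrow> 'a::{real_normed_field,euclidean_space}"
  assumes g: "g absolutely_integrable_on {s..t}" and h: "continuous_on {s..t} h"
    and b: "\<And>x. x \<in> {s..t} \<Longrightarrow> norm (h x) \<le> e"
  shows "norm (integral {s..t} (\<lambda>x. g x * h x)) \<le> e * integral {s..t} (\<lambda>x. norm (g x))"
proof -
  have "norm (integral {s..t} (\<lambda>x. g x * h x)) \<le> integral {s..t} (\<lambda>x. e * norm (g x))"
  proof (rule integral_norm_bound_integral)
    show "(\<lambda>x. g x * h x) integrable_on {s..t}"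
      using absolutely_integrable_mult_continuous_right[OF g h] set_lebesgue_integral_eq_integral(1) by blast
    show "(\<lambda>x. e * norm (g x)) integrable_on {s..t}"
      using g unfolding absolutely_integrable_on_def by (intro integrable_on_mult_right) blast
    fix x assume "x \<in> {s..t}"
    then show "norm (g x * h x) \<le> e * norm (g x)"
      using mult_right_mono[OF b[of x], of "norm (g x)"] by (simp add: norm_mult mult.commute)
  qed
  then show ?thesis by simp
qed

lemma uniform_modulus:
  fixes f :: "real \<Rightarrow> 'a::real_normed_vector"
  assumes "continuous_on {a..b} f" "e > 0"
  obtains d where "d > 0" "\<And>x y. x \<in> {a..b} \<Longrightarrow> y \<in> {a..b} \<Longrightarrow> \<bar>x - y\<bar> < d \<Longrightarrow> norm (f x - f y) \<le> e"
proof -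
  have "uniformly_continuous_on {a..b} f"
    using assms compact_uniformly_continuous by blast
  then obtain d where "d > 0" "\<And>x y. x \<in> {a..b} \<Longrightarrow> y \<in> {a..b} \<Longrightarrow> dist y x < d \<Longrightarrow> dist (f y) (f x) < e"
    unfolding uniformly_continuous_on_def using assms(2) by meson
  then show ?thesis using that by (metis dist_norm less_imp_le real_norm_def)
qed

lemma ac_mult:
  fixes f1 f2 :: "real \<Rightarrow> 'a::{real_normed_field,euclidean_space}"
  assumes 1: "ac a b f1 g1" and 2: "ac a b f2 g2"
  shows "ac a b (\<lambda>t. f1 t * f2 t) (\<lambda>t. g1 t * f2 t + g2 t * f1 t)"
proof (rule ac_from_increments[where v = "\<lambda>t. norm (g1 t) + norm (g2 t)"])
  note c1 = ac_continuous[OF 1] and c2 = ac_continuous[OF 2]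
  note a1 = ac_abs_integrable[OF 1] and a2 = ac_abs_integrable[OF 2]
  show "(\<lambda>t. g1 t * f2 t + g2 t * f1 t) absolutely_integrable_on {a..b}"
    by (intro set_integral_add absolutely_integrable_mult_continuous_right a1 a2 c1 c2)
  show "(\<lambda>t. norm (g1 t) + norm (g2 t)) integrable_on {a..b}"
    using a1 a2 by (auto simp: absolutely_integrable_on_def intro!: integrable_add)
  fix e :: real assume e: "e > 0"
  obtain d1 where d1: "d1 > 0" "\<And>x y. x \<in> {a..b} \<Longrightarrow> y \<in> {a..b} \<Longrightarrow> \<bar>x - y\<bar> < d1 \<Longrightarrow> norm (f1 x - f1 y) \<le> e"
    using uniform_modulus[OF c1 e] by blast
  obtain d2 where d2: "d2 > 0" "\<And>x y. x \<in> {a..b} \<Longrightarrow> y \<in> {a..b} \<Longrightarrow> \<bar>x - y\<bar> < d2 \<Longrightarrow> norm (f2 x - f2 y) \<le> e"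
    using uniform_modulus[OF c2 e] by blast
  have "norm (f1 t * f2 t - f1 s * f2 s - integral {s..t} (\<lambda>t. g1 t * f2 t + g2 t * f1 t))
        \<le> e * integral {s..t} (\<lambda>t. norm (g1 t) + norm (g2 t))"
    if st: "a \<le> s" "s \<le> t" "t \<le> b" "t - s < min d1 d2" for s t
  proof -
    note A1 = absolutely_integrable_on_subinterval_real[OF a1 st(1,3)]
    note A2 = absolutely_integrable_on_subinterval_real[OF a2 st(1,3)]
    have C1: "continuous_on {s..t} f1" and C2: "continuous_on {s..t} f2"
      using continuous_on_subset[OF c1] continuous_on_subset[OF c2] st by auto
    have i: "(\<lambda>x. g1 x * h x) integrable_on {s..t}" "(\<lambda>x. g2 x * h x) integrable_on {s..t}"
      if "continuous_on {s..t} h" for h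
      using absolutely_integrable_mult_continuous_right[OF A1 that] absolutely_integrable_mult_continuous_right[OF A2 that]
        set_lebesgue_integral_eq_integral(1) by blast+
    \<comment> \<open>Leibniz rule for increments. Freezing \<open>f2\<close> at the right end and
      \<open>f1\<close> at the left end makes the error a sum of two integrals, each with a factor
      that is small by uniform continuity.\<close>
    have "f1 t * f2 t - f1 s * f2 s = (f1 t - f1 s) * f2 t + (f2 t - f2 s) * f1 s" by (simp add: algebra_simps)
    also have "\<dots> = integral {s..t} g1 * f2 t + integral {s..t} g2 * f1 s"
      using ac_diff[OF 1] ac_diff[OF 2] st by simp
    also have "\<dots> = integral {s..t} (\<lambda>x. g1 x * f2 t) + integral {s..t} (\<lambda>x. g2 x * f1 s)" by simp
    finally have "f1 t * f2 t - f1 s * f2 s - integral {s..t} (\<lambda>t. g1 t * f2 t + g2 t * f1 t)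
       = integral {s..t} (\<lambda>x. g1 x * (f2 t - f2 x)) + integral {s..t} (\<lambda>x. g2 x * (f1 s - f1 x))"
      unfolding right_diff_distrib
        Henstock_Kurzweil_Integration.integral_diff[OF i(1)[OF continuous_on_const] i(1)[OF C2]]
        Henstock_Kurzweil_Integration.integral_diff[OF i(2)[OF continuous_on_const] i(2)[OF C1]]
        Henstock_Kurzweil_Integration.integral_add[OF i(1)[OF C2] i(2)[OF C1]] by (simp only: add_diff_add)
    also have "norm \<dots> \<le> norm (integral {s..t} (\<lambda>x. g1 x * (f2 t - f2 x))) + norm (integral {s..t} (\<lambda>x. g2 x * (f1 s - f1 x)))"
      by (rule norm_triangle_ineq)
    also have "\<dots> \<le> e * integral {s..t} (\<lambda>x. norm (g1 x)) + e * integral {s..t} (\<lambda>x. norm (g2 x))"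
    proof (rule add_mono)
      show "norm (integral {s..t} (\<lambda>x. g1 x * (f2 t - f2 x))) \<le> e * integral {s..t} (\<lambda>x. norm (g1 x))"
        by (rule norm_integral_mult_le[OF A1]) (use st d2 C2 in \<open>auto intro!: continuous_intros\<close>)
      show "norm (integral {s..t} (\<lambda>x. g2 x * (f1 s - f1 x))) \<le> e * integral {s..t} (\<lambda>x. norm (g2 x))"
        by (rule norm_integral_mult_le[OF A2]) (use st d1 C1 in \<open>auto intro!: continuous_intros\<close>)
    qed
    also have "\<dots> = e * integral {s..t} (\<lambda>t. norm (g1 t) + norm (g2 t))"
      using A1 A2 by (subst Henstock_Kurzweil_Integration.integral_add) (auto simp: absolutely_integrable_on_def distrib_left)
    finally show ?thesis .
  qed
  then show "\<exists>d>0. \<forall>s t. a \<le> s \<and> s \<le> t \<and> t \<le> b \<and> t - s < d \<longrightarrow>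
            norm (f1 t * f2 t - f1 s * f2 s - integral {s..t} (\<lambda>t. g1 t * f2 t + g2 t * f1 t))
            \<le> e * integral {s..t} (\<lambda>t. norm (g1 t) + norm (g2 t))"
    using d1 d2 by (intro exI[of _ "min d1 d2"]) auto
qed

text \<open>Both the reciprocal and the logarithm are instances: their difference quotient over
  \<open>{s..t}\<close> is \<open>m s t\<close>, which stays uniformly close to the derivative \<open>h\<close>.\<close>

lemma ac_quotient_rule:
  fixes f h F :: "real \<Rightarrow> 'a::{real_normed_field,euclidean_space}"
  assumes f: "ac a b f g" and h: "continuous_on {a..b} h"
    and m: "\<And>s t. a \<le> s \<Longrightarrow> s \<le> t \<Longrightarrow> t \<le> b \<Longrightarrow> F t - F s = (f t - f s) * m s t"
    and mh: "\<And>e. e > 0 \<Longrightarrow> \<exists>d>0. \<forall>s t x. a \<le> s \<and> s \<le> x \<and> x \<le> t \<and> t \<le> b \<and> t - s < d \<longrightarrow> norm (m s t - h x) \<le> e"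
  shows "ac a b F (\<lambda>t. g t * h t)"
proof (rule ac_from_increments[where v = "\<lambda>t. norm (g t)"])
  note a1 = ac_abs_integrable[OF f]
  show "(\<lambda>t. g t * h t) absolutely_integrable_on {a..b}"
    by (intro absolutely_integrable_mult_continuous_right a1 h)
  show "(\<lambda>t. norm (g t)) integrable_on {a..b}"
    using a1 by (auto simp: absolutely_integrable_on_def)
  fix e :: real assume "e > 0"
  then obtain d where d: "d > 0" "\<And>s t x. a \<le> s \<Longrightarrow> s \<le> x \<Longrightarrow> x \<le> t \<Longrightarrow> t \<le> b \<Longrightarrow> t - s < d \<Longrightarrow> norm (m s t - h x) \<le> e"
    using mh by meson
  have "norm (F t - F s - integral {s..t} (\<lambda>t. g t * h t)) \<le> e * integral {s..t} (\<lambda>t. norm (g t))"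
    if st: "a \<le> s" "s \<le> t" "t \<le> b" "t - s < d" for s t
  proof -
    note A1 = absolutely_integrable_on_subinterval_real[OF a1 st(1,3)]
    have C1: "continuous_on {s..t} h"
      using continuous_on_subset[OF h] st by auto
    have i: "(\<lambda>x. g x * h x) integrable_on {s..t}" if "continuous_on {s..t} h" for h
      using absolutely_integrable_mult_continuous_right[OF A1 that]
        set_lebesgue_integral_eq_integral(1) by blast
    have "F t - F s = integral {s..t} (\<lambda>x. g x * m s t)"
      using m[OF st(1-3)] ac_diff[OF f st(1-3)] by simp
    then have "F t - F s - integral {s..t} (\<lambda>t. g t * h t) = integral {s..t} (\<lambda>x. g x * (m s t - h x))"
      unfolding right_diff_distrib
        Henstock_Kurzweil_Integration.integral_diff[OF i[OF continuous_on_const] i[OF C1]] by simp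
    also have "norm \<dots> \<le> e * integral {s..t} (\<lambda>x. norm (g x))"
      by (rule norm_integral_mult_le[OF A1]) (use st d C1 in \<open>auto intro!: continuous_intros\<close>)
    finally show ?thesis .
  qed
  then show "\<exists>d>0. \<forall>s t. a \<le> s \<and> s \<le> t \<and> t \<le> b \<and> t - s < d \<longrightarrow>
            norm (F t - F s - integral {s..t} (\<lambda>t. g t * h t)) \<le> e * integral {s..t} (\<lambda>t. norm (g t))"
    using d by blast
qed

lemma ac_inverse:
  fixes f :: "real \<Rightarrow> 'a::{real_normed_field,euclidean_space}"
  assumes f: "ac a b f g" and nz: "\<And>t. t \<in> {a..b} \<Longrightarrow> f t \<noteq> 0"
  shows "ac a b (\<lambda>t. inverse (f t)) (\<lambda>t. g t * - (inverse (f t))\<^sup>2)"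
proof (rule ac_quotient_rule[OF f, where m = "\<lambda>s t. - inverse (f s) * inverse (f t)"])
  have c: "continuous_on {a..b} (\<lambda>t. inverse (f t))"
    by (intro continuous_intros ac_continuous[OF f]) (use nz in auto)
  then show "continuous_on {a..b} (\<lambda>t. - (inverse (f t))\<^sup>2)"
    by (intro continuous_on_minus continuous_on_power)
  show "inverse (f t) - inverse (f s) = (f t - f s) * (- inverse (f s) * inverse (f t))"
    if "a \<le> s" "s \<le> t" "t \<le> b" for s t
    using nz[of s] nz[of t] that by (auto simp: field_simps)
  fix e :: real assume e: "e > 0"
  have "bounded ((\<lambda>t. inverse (f t)) ` {a..b})"
    using c by (simp add: compact_continuous_image compact_imp_bounded)
  then obtain B where B: "B > 0" "\<And>t. t \<in> {a..b} \<Longrightarrow> norm (inverse (f t)) \<le> B"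
    unfolding bounded_pos by auto
  have "e / (2 * B) > 0" using e B by simp
  from uniform_modulus[OF c this] obtain d where d: "d > 0"
    "\<And>x y. x \<in> {a..b} \<Longrightarrow> y \<in> {a..b} \<Longrightarrow> \<bar>x - y\<bar> < d \<Longrightarrow> norm (inverse (f x) - inverse (f y)) \<le> e / (2 * B)"
    by blast
  have "norm (- inverse (f s) * inverse (f t) - - (inverse (f x))\<^sup>2) \<le> e"
    if "a \<le> s" "s \<le> x" "x \<le> t" "t \<le> b" "t - s < d" for s t x
  proof -
    have "- inverse (f s) * inverse (f t) - - (inverse (f x))\<^sup>2 =
        (inverse (f x) - inverse (f s)) * inverse (f x) + (inverse (f x) - inverse (f t)) * inverse (f s)"
      by (simp add: algebra_simps power2_eq_square)
    also have "norm \<dots> \<le> norm (inverse (f x) - inverse (f s)) * norm (inverse (f x)) + norm (inverse (f x) - inverse (f t)) * norm (inverse (f s))"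
      by (metis norm_mult norm_triangle_ineq)
    also have "\<dots> \<le> e / (2 * B) * B + e / (2 * B) * B"
      using that B e by (intro add_mono mult_mono d) auto
    also have "\<dots> = e" using B by simp
    finally show ?thesis .
  qed
  then show "\<exists>d>0. \<forall>s t x. a \<le> s \<and> s \<le> x \<and> x \<le> t \<and> t \<le> b \<and> t - s < d \<longrightarrow>
            norm (- inverse (f s) * inverse (f t) - - (inverse (f x))\<^sup>2) \<le> e"
    using d by blast
qed

lemma ac_ln:
  fixes f :: "real \<Rightarrow> real"
  assumes f: "ac a b f g" and pos: "\<And>t. t \<in> {a..b} \<Longrightarrow> f t > 0"
  shows "ac a b (\<lambda>t. ln (f t)) (\<lambda>t. g t * inverse (f t))"
\<comment> \<open>If \<open>f t = f s\<close> any value satisfies the first condition;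
  \<open>inverse (f s)\<close> is the one that also stays close to the derivative.\<close>
proof (rule ac_quotient_rule[OF f, where m = "\<lambda>s t. if f t = f s then inverse (f s) else (ln (f t) - ln (f s)) / (f t - f s)"])
  have c: "continuous_on {a..b} (\<lambda>t. inverse (f t))"
    by (intro continuous_intros ac_continuous[OF f]) (use pos in force)
  then show "continuous_on {a..b} (\<lambda>t. inverse (f t))" .
  show "ln (f t) - ln (f s) = (f t - f s) * (if f t = f s then inverse (f s) else (ln (f t) - ln (f s)) / (f t - f s))"
    for s t by auto
  \<comment> \<open>The inequality \<open>ln x \<le> x - 1\<close> at \<open>u / v\<close> and at
    \<open>v / u\<close> places the difference quotient of \<open>ln\<close> between
    \<open>inverse u\<close> and \<open>inverse v\<close>.\<close>
  have between: "\<bar>(ln u - ln v) / (u - v) - inverse v\<bar> \<le> \<bar>inverse u - inverse v\<bar>" if "u > 0" "v > 0" "u \<noteq> v" for u v :: real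
  proof -
    have 1: "(u - v) * inverse u \<le> ln u - ln v" "ln u - ln v \<le> (u - v) * inverse v"
      using ln_le_minus_one[of "v / u"] ln_le_minus_one[of "u / v"] that by (auto simp: ln_div field_simps)
    show ?thesis
    proof (cases "u > v")
      case True
      then have "inverse u \<le> (ln u - ln v) / (u - v)" "(ln u - ln v) / (u - v) \<le> inverse v"
        using 1 by (auto simp: field_simps)
      then show ?thesis by auto
    next
      case False
      then have *: "u < v" using that by auto
      have "inverse v \<le> (ln u - ln v) / (u - v)" "(ln u - ln v) / (u - v) \<le> inverse u"
        using 1 * by (auto simp: neg_le_divide_eq neg_divide_le_eq mult.commute)
      then show ?thesis by auto
    qed
  qed
  fix e :: real assume e: "e > 0"
  then have "e / 2 > 0" by simp
  from uniform_modulus[OF c this] obtain d where d: "d > 0"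
    "\<And>x y. x \<in> {a..b} \<Longrightarrow> y \<in> {a..b} \<Longrightarrow> \<bar>x - y\<bar> < d \<Longrightarrow> norm (inverse (f x) - inverse (f y)) \<le> e / 2"
    by blast
  have "norm ((if f t = f s then inverse (f s) else (ln (f t) - ln (f s)) / (f t - f s)) - inverse (f x)) \<le> e"
    if "a \<le> s" "s \<le> x" "x \<le> t" "t \<le> b" "t - s < d" for s t x
  proof -
    have "\<bar>(if f t = f s then inverse (f s) else (ln (f t) - ln (f s)) / (f t - f s)) - inverse (f s)\<bar> \<le> e / 2"
      using between[of "f t" "f s"] pos[of t] pos[of s] that d(2)[of t s] e by auto
    moreover have "\<bar>inverse (f s) - inverse (f x)\<bar> \<le> e / 2" using d(2)[of s x] that by auto
    ultimately show ?thesis unfolding real_norm_def by linarith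
  qed
  then show "\<exists>d>0. \<forall>s t x. a \<le> s \<and> s \<le> x \<and> x \<le> t \<and> t \<le> b \<and> t - s < d \<longrightarrow>
       norm ((if f t = f s then inverse (f s) else (ln (f t) - ln (f s)) / (f t - f s)) - inverse (f x)) \<le> e"
    using d by blast
qed

section \<open>Cauchy-Schwarz estimates and pointwise bounds from square integrals\<close>

text \<open>The weight \<open>l = sqrt (b / a)\<close> is optimal and turns the arithmetic mean into
  the geometric one. Cauchy-Schwarz thus follows from a pointwise inequality and monotonicity of the
  integral, for the Lebesgue and for the gauge integral alike.\<close>

lemma le_sqrt_mult_if_le_weighted_mean:
  fixes X a b :: real
  assumes "\<And>l. l > 0 \<Longrightarrow> X \<le> (l * a + b / l) / 2" and "a \<ge> 0" "b \<ge> 0"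
  shows "X \<le> sqrt (a * b)"
proof (cases "a > 0 \<and> b > 0")
  case True
  have "X \<le> (sqrt (b / a) * a + b / sqrt (b / a)) / 2" using assms(1)[of "sqrt (b / a)"] True by simp
  also have "\<dots> = sqrt (a * b)"
    using True by (simp add: real_sqrt_divide real_sqrt_mult field_simps)
  finally show ?thesis .
next
  case False
  have "X \<le> 0"
  proof (rule ccontr)
    assume X: "\<not> X \<le> 0"
    consider "a = 0" | "b = 0" using False assms by fastforce
    then show False
    proof cases
      \<comment> \<open>A large \<open>l\<close> here, and a small \<open>l\<close> in the next
        case, makes the only surviving term smaller than \<open>X\<close>.\<close>
      case 1
      have "X \<le> (b / ((b + 1) / X)) / 2" using assms(1)[of "(b + 1) / X"] X assms 1 by simp
      also have "\<dots> = X * (b / (b + 1)) / 2" by (simp add: field_simps)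
      also have "\<dots> \<le> X * 1 / 2" using X assms by (intro divide_right_mono mult_left_mono) auto
      finally show False using X by simp
    next
      case 2
      have "X \<le> (X / (a + 1) * a) / 2" using assms(1)[of "X / (a + 1)"] X assms 2 by simp
      also have "\<dots> = X * (a / (a + 1)) / 2" by (simp add: field_simps)
      also have "\<dots> \<le> X * 1 / 2" using X assms by (intro divide_right_mono mult_left_mono) auto
      finally show False using X by simp
    qed
  qed
  then show ?thesis using assms by (meson mult_nonneg_nonneg order_trans real_sqrt_ge_zero)
qed

lemma Cauchy_Schwarz_integral:
  fixes f g :: "'a \<Rightarrow> complex"
  assumes [measurable]: "f \<in> borel_measurable M" "g \<in> borel_measurable M"
    and f: "integrable M (\<lambda>x. (cmod (f x))\<^sup>2)" and g: "integrable M (\<lambda>x. (cmod (g x))\<^sup>2)"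
  shows "integrable M (\<lambda>x. f x * g x)"
    and "(\<integral>x. cmod (f x) * cmod (g x) \<partial>M) \<le> sqrt ((\<integral>x. (cmod (f x))\<^sup>2 \<partial>M) * (\<integral>x. (cmod (g x))\<^sup>2 \<partial>M))"
    and "cmod (\<integral>x. f x * g x \<partial>M) \<le> sqrt ((\<integral>x. (cmod (f x))\<^sup>2 \<partial>M) * (\<integral>x. (cmod (g x))\<^sup>2 \<partial>M))"
proof -
  have am: "u * v \<le> (l * u\<^sup>2 + v\<^sup>2 / l) / 2" if "l > 0" for u v l :: real
  proof -
    have "0 \<le> (l * u - v)\<^sup>2 / l" using that by simp
    also have "\<dots> = l * u\<^sup>2 + v\<^sup>2 / l - 2 * (u * v)" using that by (simp add: power2_eq_square field_simps)
    finally show ?thesis by simp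
  qed
  show 1: "integrable M (\<lambda>x. f x * g x)"
  proof (rule Bochner_Integration.integrable_bound)
    show "integrable M (\<lambda>x. (1 * (cmod (f x))\<^sup>2 + (cmod (g x))\<^sup>2 / 1) / 2)" using f g by simp
    show "AE x in M. norm (f x * g x) \<le> norm ((1 * (cmod (f x))\<^sup>2 + (cmod (g x))\<^sup>2 / 1) / 2)"
      using am[of 1] by (simp add: norm_mult)
  qed simp
  show 2: "(\<integral>x. cmod (f x) * cmod (g x) \<partial>M) \<le> sqrt ((\<integral>x. (cmod (f x))\<^sup>2 \<partial>M) * (\<integral>x. (cmod (g x))\<^sup>2 \<partial>M))"
  proof (rule le_sqrt_mult_if_le_weighted_mean)
    fix l :: real assume l: "l > 0"
    have "(\<integral>x. cmod (f x) * cmod (g x) \<partial>M) \<le> (\<integral>x. (l * (cmod (f x))\<^sup>2 + (cmod (g x))\<^sup>2 / l) / 2 \<partial>M)"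
      by (rule integral_mono) (use integrable_norm[OF 1] f g am[OF l] in \<open>auto simp: norm_mult\<close>)
    also have "\<dots> = (l * (\<integral>x. (cmod (f x))\<^sup>2 \<partial>M) + (\<integral>x. (cmod (g x))\<^sup>2 \<partial>M) / l) / 2"
      using f g by simp
    finally show "(\<integral>x. cmod (f x) * cmod (g x) \<partial>M) \<le> (l * (\<integral>x. (cmod (f x))\<^sup>2 \<partial>M) + (\<integral>x. (cmod (g x))\<^sup>2 \<partial>M) / l) / 2" .
  qed auto
  have "cmod (\<integral>x. f x * g x \<partial>M) \<le> (\<integral>x. cmod (f x) * cmod (g x) \<partial>M)"
    using integral_norm_bound[of M "\<lambda>x. f x * g x"] by (simp add: norm_mult)
  with 2 show "cmod (\<integral>x. f x * g x \<partial>M) \<le> sqrt ((\<integral>x. (cmod (f x))\<^sup>2 \<partial>M) * (\<integral>x. (cmod (g x))\<^sup>2 \<partial>M))"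
    by linarith
qed

text \<open>Cauchy-Schwarz against the indicator function of the interval.\<close>

lemma integral_norm_interval_le:
  fixes h :: "real \<Rightarrow> complex"
  assumes h: "continuous_on UNIV h" "integrable lborel (\<lambda>x. (cmod (h x))\<^sup>2)"
    "(\<integral>x. (cmod (h x))\<^sup>2 \<partial>lborel) \<le> C" and r: "r \<ge> 0"
  shows "integral {c..c + r} (\<lambda>x. cmod (h x)) \<le> sqrt (C * r)"
    and "cmod (integral {c..c + r} h) \<le> sqrt (C * r)"
proof -
  have [measurable]: "h \<in> borel_measurable lborel" using borel_measurable_continuous_onI[OF h(1)] by simp
  define g where "g x = complex_of_real (indicator {c..c + r} x)" for x :: real
  have [measurable]: "g \<in> borel_measurable lborel" unfolding g_def by measurable
  have g2: "(cmod (g x))\<^sup>2 = indicator {c..c+r} x" for x by (auto simp: g_def indicator_def)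
  have ig: "integrable lborel (\<lambda>x. (cmod (g x))\<^sup>2)" unfolding g2 using r by (intro integrable_real_indicator) auto
  have "(\<integral>x. cmod (h x) * cmod (g x) \<partial>lborel) \<le> sqrt ((\<integral>x. (cmod (h x))\<^sup>2 \<partial>lborel) * (\<integral>x. (cmod (g x))\<^sup>2 \<partial>lborel))"
    by (rule Cauchy_Schwarz_integral) (use h ig in auto)
  also have "\<dots> \<le> sqrt (C * r)"
  proof -
    have "0 \<le> C" using h(3) by (meson order_trans zero_le_power2 Bochner_Integration.integral_nonneg)
    then show ?thesis unfolding g2 using h r by (intro real_sqrt_le_mono mult_mono) auto
  qed
  finally have 1: "(\<integral>x. cmod (h x) * cmod (g x) \<partial>lborel) \<le> sqrt (C * r)" .
  have "(\<integral>x. cmod (h x) * cmod (g x) \<partial>lborel) = (LINT x:{c..c+r}|lborel. cmod (h x))"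
    unfolding set_lebesgue_integral_def by (rule Bochner_Integration.integral_cong) (auto simp: g_def indicator_def)
  also have "\<dots> = integral {c..c+r} (\<lambda>x. cmod (h x))"
    by (intro set_borel_integral_eq_integral(2) borel_integrable_atLeastAtMost') 
      (auto intro!: continuous_intros continuous_on_subset[OF h(1)])
  finally show 2: "integral {c..c + r} (\<lambda>x. cmod (h x)) \<le> sqrt (C * r)" using 1 by simp
  have "cmod (integral {c..c + r} h) \<le> integral {c..c + r} (\<lambda>x. cmod (h x))"
    by (rule integral_norm_bound_integral)
      (auto intro!: integrable_continuous_real continuous_intros continuous_on_subset[OF h(1)])
  then show "cmod (integral {c..c + r} h) \<le> sqrt (C * r)" using 2 by linarith
qed

text \<open>By Cauchy-Schwarz the mean of \<open>cmod (h x)\<close> over the interval is at most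
  \<open>sqrt (C / r)\<close>, and \<open>h c\<close> differs from the values averaged by at most
  \<open>D\<close>. This converts square integrability into a pointwise bound once the oscillation
  is under control.\<close>

lemma norm_le_if_slowly_varying:
  fixes h :: "real \<Rightarrow> complex"
  assumes h: "continuous_on UNIV h" "integrable lborel (\<lambda>x. (cmod (h x))\<^sup>2)"
    "(\<integral>x. (cmod (h x))\<^sup>2 \<partial>lborel) \<le> C" and r: "r > 0"
    and D: "\<And>x. x \<in> {c..c + r} \<Longrightarrow> cmod (h x - h c) \<le> D"
  shows "cmod (h c) \<le> sqrt (C / r) + D"
proof -
  have "r * cmod (h c) = integral {c..c + r} (\<lambda>x. cmod (h c))" using r by simp
  also have "\<dots> \<le> integral {c..c + r} (\<lambda>x. cmod (h x) + D)"
  proof (rule integral_le)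
    fix x assume "x \<in> {c..c + r}"
    with D[of x] show "cmod (h c) \<le> cmod (h x) + D"
      by (metis add.commute add_le_cancel_left norm_minus_commute norm_triangle_sub order_trans)
  qed (auto intro!: integrable_continuous_real continuous_intros continuous_on_subset[OF h(1)])
  also have "\<dots> = integral {c..c + r} (\<lambda>x. cmod (h x)) + r * D"
    using r by (subst Henstock_Kurzweil_Integration.integral_add)
      (auto intro!: integrable_continuous_real continuous_intros continuous_on_subset[OF h(1)])
  also have "\<dots> \<le> sqrt (C * r) + r * D"
    using integral_norm_interval_le(1)[OF h] r by simp
  finally have "cmod (h c) \<le> (sqrt (C * r) + r * D) / r" using r by (simp add: field_simps)
  also have "\<dots> = sqrt (C * r) / sqrt (r\<^sup>2) + D" using r by (simp add: add_divide_distrib)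
  also have "sqrt (C * r) / sqrt (r\<^sup>2) = sqrt (C / r)"
    using r unfolding real_sqrt_divide[symmetric] by (simp add: power2_eq_square)
  finally show ?thesis .
qed

section \<open>The Hardy space of the half plane\<close>

lemma convex_upper_half: "convex upper_half" "open upper_half"
  unfolding upper_half_def by (simp_all add: convex_halfspace_Im_gt open_halfspace_Im_gt)

text \<open>The derivative is taken only within \<open>S\<close>, so that the closed half plane is
  admissible and the path may run along the real axis.\<close>

lemma primitive_along_line:
  fixes \<Phi> f :: "complex \<Rightarrow> complex"
  assumes \<Phi>: "\<And>z. z \<in> S \<Longrightarrow> (\<Phi> has_field_derivative f z) (at z within S)"
    and sub: "\<And>s. s \<in> {a..b} \<Longrightarrow> w + of_real s * v \<in> S" and "a \<le> b"
  shows "((\<lambda>s. f (w + of_real s * v) * v) has_integral \<Phi> (w + of_real b * v) - \<Phi> (w + of_real a * v)) {a..b}"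
proof (rule fundamental_theorem_of_calculus[OF \<open>a \<le> b\<close>])
  fix s assume s: "s \<in> {a..b}"
  have 1: "((\<lambda>s. w + of_real s * v) has_vector_derivative v) (at s within {a..b})"
    by (auto intro!: derivative_eq_intros simp: has_vector_derivative_def scaleR_conv_of_real)
  have 2: "(\<Phi> has_field_derivative f (w + of_real s * v)) (at (w + of_real s * v) within (\<lambda>s. w + of_real s * v) ` {a..b})"
    by (rule DERIV_subset[OF \<Phi>]) (use sub s in auto)
  have "((\<Phi> \<circ> (\<lambda>s. w + of_real s * v)) has_vector_derivative v * f (w + of_real s * v)) (at s within {a..b})"
    by (rule field_vector_diff_chain_within[OF 1 2])
  then show "((\<lambda>s. \<Phi> (w + of_real s * v)) has_vector_derivative f (w + of_real s * v) * v) (at s within {a..b})"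
    by (simp add: o_def mult.commute)
qed

lemma Cauchy_inequality_deriv:
  assumes "G holomorphic_on S" "open S" "cball z r \<subseteq> S" "r > 0" "\<And>w. w \<in> cball z r \<Longrightarrow> cmod (G w) \<le> B"
    and d: "(G has_field_derivative g) (at z)"
  shows "cmod g \<le> B / r"
proof -
  have "norm ((deriv ^^ 1) G z) \<le> fact 1 * B / r ^ 1"
  proof (rule Cauchy_inequality)
    show "G holomorphic_on ball z r" using assms by (meson ball_subset_cball holomorphic_on_subset order_trans)
    show "continuous_on (cball z r) G" using assms by (meson holomorphic_on_subset holomorphic_on_imp_continuous_on)
    show "norm (G x) \<le> B" if "norm (z - x) = r" for x using assms(5)[of x] that by (simp add: dist_norm)
  qed (use assms in auto)
  then show ?thesis using DERIV_imp_deriv[OF d] by simp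
qed

text \<open>The integral \<open>G w\<close> of \<open>f\<close> over the horizontal segment from
  \<open>w\<close> to \<open>w + r\<close> is bounded by Cauchy-Schwarz on its line, and its
  derivative is \<open>f (w + r) - f w\<close>. Cauchy's inequality on a disc of radius
  \<open>y / 2\<close> then bounds the oscillation of \<open>f\<close> on a segment of length
  \<open>y\<close> by \<open>2 * sqrt (C / y)\<close>, and \<open>norm_le_if_slowly_varying\<close>
  adds one more \<open>sqrt (C / y)\<close>; hence the constant 3.\<close>

lemma hardy_pointwise_bound:
  assumes f: "f holomorphic_on upper_half"
    and C: "\<And>y. y > 0 \<Longrightarrow> integrable lborel (\<lambda>x. (cmod (f (Complex x y)))\<^sup>2)"
      "\<And>y. y > 0 \<Longrightarrow> (\<integral>x. (cmod (f (Complex x y)))\<^sup>2 \<partial>lborel) \<le> C"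
    and z: "Im z > 0"
  shows "cmod (f z) \<le> 3 * sqrt (C / Im z)"
proof -
  obtain \<Phi> where \<Phi>0: "\<And>x. x \<in> upper_half \<Longrightarrow> (\<Phi> has_field_derivative f x) (at x within upper_half)"
    using holomorphic_convex_primitive'[OF convex_upper_half f] by blast
  have \<Phi>: "(\<Phi> has_field_derivative f x) (at x)" if "x \<in> upper_half" for x
    using \<Phi>0[OF that] at_within_open[OF that convex_upper_half(2)] by simp
  have cont: "continuous_on UNIV (\<lambda>x. f (Complex x y))" if "y > 0" for y
    by (rule continuous_on_compose2[OF holomorphic_on_imp_continuous_on[OF f]])
      (use that in \<open>auto simp: upper_half_def Complex_eq intro!: continuous_intros\<close>)
  define y where "y = Im z"
  have y: "y > 0" using z by (simp add: y_def)
  have "cmod (f (Complex (Re z) y)) \<le> sqrt (C / y) + 2 * sqrt (C / y)"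
  proof (rule norm_le_if_slowly_varying[where r = y and h = "\<lambda>x. f (Complex x y)" and c = "Re z"])
    fix x assume x: "x \<in> {Re z..Re z + y}"
    define r where "r = x - Re z"
    have r: "0 \<le> r" "r \<le> y" using x by (auto simp: r_def)
    define G where "G w = \<Phi> (w + of_real r) - \<Phi> w" for w
    have dG: "(G has_field_derivative (f (w + of_real r) - f w)) (at w)" if "w \<in> upper_half" for w
      unfolding G_def using that
      by (auto intro!: derivative_eq_intros DERIV_chain'[where g = \<Phi>, OF _ \<Phi>] \<Phi> simp: upper_half_def)
    have "cmod (f (z + of_real r) - f z) \<le> sqrt (C * y) / (y / 2)"
    proof (rule Cauchy_inequality_deriv[where S = upper_half and G = G])
      show "G holomorphic_on upper_half"
        using dG holomorphic_on_open[OF convex_upper_half(2)] by blast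
      show sub: "cball z (y / 2) \<subseteq> upper_half"
      proof
        fix w assume "w \<in> cball z (y / 2)"
        then have "Im (z - w) \<le> y / 2" using abs_Im_le_cmod[of "z - w"] unfolding mem_cball dist_norm by linarith
        then have "Im w \<ge> y - y / 2" by (simp add: y_def)
        then show "w \<in> upper_half" using y by (simp add: upper_half_def)
      qed
      fix w assume "w \<in> cball z (y / 2)"
      then have w: "w \<in> upper_half" using sub by auto
      define v where "v = Im w"
      have v: "v > 0" using w by (simp add: v_def upper_half_def)
      have *: "Complex s v = \<i> * of_real v + of_real s * 1" for s by (simp add: complex_eq_iff)
      have I: "((\<lambda>s. f (\<i> * of_real v + of_real s * 1) * 1) has_integral \<Phi> (\<i> * of_real v + of_real (Re w + r) * 1) - \<Phi> (\<i> * of_real v + of_real (Re w) * 1)) {Re w..Re w + r}"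
        by (rule primitive_along_line[where S = upper_half, OF \<Phi>0]) (use r v in \<open>auto simp: upper_half_def\<close>)
      have w1: "\<i> * of_real v + of_real (Re w) * 1 = w" by (simp add: complex_eq_iff v_def)
      have w2: "\<i> * of_real v + of_real (Re w + r) * 1 = w + of_real r" by (simp add: complex_eq_iff v_def)
      have "G w = integral {Re w..Re w + r} (\<lambda>s. f (Complex s v))"
        using integral_unique[OF I] unfolding w1 w2 by (simp add: G_def *)
      also have "cmod \<dots> \<le> sqrt (C * r)"
        by (rule integral_norm_interval_le(2)[OF cont[OF v] C(1)[OF v] C(2)[OF v] r(1)])
      also have "\<dots> \<le> sqrt (C * y)"
      proof -
        have "0 \<le> C" using C(2)[of 1] by (meson integral_nonneg order_trans zero_le_power2 zero_less_one Bochner_Integration.integral_nonneg)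
        then show ?thesis using r by (intro real_sqrt_le_mono mult_left_mono) auto
      qed
      finally show "cmod (G w) \<le> sqrt (C * y)" .
    next
      show "(G has_field_derivative (f (z + of_real r) - f z)) (at z)"
        by (rule dG) (use z in \<open>simp add: upper_half_def\<close>)
    qed (use y convex_upper_half in auto)
    moreover have "z + of_real r = Complex x y" "z = Complex (Re z) y" by (simp_all add: complex_eq_iff r_def y_def)
    moreover have "sqrt (C * y) / (y / 2) = 2 * sqrt (C / y)"
    proof -
      have "sqrt (C * y) / y = sqrt (C * y) / sqrt (y\<^sup>2)" using y by simp
      also have "\<dots> = sqrt (C / y)" using y unfolding real_sqrt_divide[symmetric] by (simp add: power2_eq_square)
      finally have *: "sqrt (C * y) / y = sqrt (C / y)" .
      have "sqrt (C * y) / (y / 2) = 2 * (sqrt (C * y) / y)" by simp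
      then show ?thesis unfolding * .
    qed
    ultimately show "cmod (f (Complex x y) - f (Complex (Re z) y)) \<le> 2 * sqrt (C / y)" by simp
  qed (use y C cont in auto)
  then show ?thesis by (simp add: y_def)
qed

text \<open>Fatou's lemma along the lines of height \<open>1 / Suc n\<close>; continuity up to the
  axis supplies the pointwise limit.\<close>

lemma hardy_boundary_integrable:
  assumes f: "continuous_on {z. Im z \<ge> 0} f"
    and C: "\<And>y. y > 0 \<Longrightarrow> integrable lborel (\<lambda>x. (cmod (f (Complex x y)))\<^sup>2)"
      "\<And>y. y > 0 \<Longrightarrow> (\<integral>x. (cmod (f (Complex x y)))\<^sup>2 \<partial>lborel) \<le> C"
  shows "integrable lborel (\<lambda>x. (cmod (f (of_real x)))\<^sup>2)" "(\<integral>x. (cmod (f (of_real x)))\<^sup>2 \<partial>lborel) \<le> C"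
proof -
  have C0: "0 \<le> C" using C(2)[of 1] by (meson order_trans zero_le_power2 zero_less_one Bochner_Integration.integral_nonneg)
  have cr: "continuous_on UNIV (\<lambda>x::real. f (of_real x))"
    by (rule continuous_on_compose2[OF f]) (auto intro!: continuous_intros)
  have [measurable]: "(\<lambda>x::real. f (of_real x)) \<in> borel_measurable lborel"
    using borel_measurable_continuous_onI[OF cr] by simp
  have cy: "continuous_on UNIV (\<lambda>x::real. f (Complex x y))" if "y > 0" for y
    by (rule continuous_on_compose2[OF f]) (use that in \<open>auto simp: Complex_eq intro!: continuous_intros\<close>)
  have lim: "(\<lambda>n. (cmod (f (Complex x (1 / real (Suc n)))))\<^sup>2) \<longlonglongrightarrow> (cmod (f (of_real x)))\<^sup>2" for x
  proof -
    have l0: "(\<lambda>n. 1 / real (Suc n)) \<longlonglongrightarrow> 0"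
      using LIMSEQ_inverse_real_of_nat by (simp add: inverse_eq_divide)
    have l1: "(\<lambda>n. Complex x (1 / real (Suc n))) \<longlonglongrightarrow> Complex x 0"
      by (intro tendsto_Complex tendsto_const l0)
    have "(\<lambda>n. f (Complex x (1 / real (Suc n)))) \<longlonglongrightarrow> f (Complex x 0)"
      by (rule continuous_on_tendsto_compose[OF f l1]) auto
    then show ?thesis by (intro tendsto_power tendsto_norm) (simp add: complex_of_real_def)
  qed
  have "(\<integral>\<^sup>+x. ennreal ((cmod (f (of_real x)))\<^sup>2) \<partial>lborel) =
     (\<integral>\<^sup>+x. liminf (\<lambda>n. ennreal ((cmod (f (Complex x (1 / real (Suc n)))))\<^sup>2)) \<partial>lborel)"
    by (intro nn_integral_cong lim_imp_Liminf[symmetric] tendsto_ennrealI lim) auto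
  also have "\<dots> \<le> liminf (\<lambda>n. \<integral>\<^sup>+x. ennreal ((cmod (f (Complex x (1 / real (Suc n)))))\<^sup>2) \<partial>lborel)"
  proof (rule nn_integral_liminf)
    fix n
    have [measurable]: "(\<lambda>x. f (Complex x (1 / real (Suc n)))) \<in> borel_measurable lborel"
      using borel_measurable_continuous_onI[OF cy[of "1 / real (Suc n)"]] by simp
    show "(\<lambda>x. ennreal ((cmod (f (Complex x (1 / real (Suc n)))))\<^sup>2)) \<in> borel_measurable lborel"
      by measurable
  qed
  also have "\<dots> \<le> liminf (\<lambda>n::nat. ennreal C)"
    by (intro Liminf_mono always_eventually allI)
      (subst nn_integral_eq_integral, use C in \<open>auto intro!: ennreal_leI\<close>)
  also have "\<dots> = ennreal C" by (simp add: Liminf_const)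
  finally have le: "(\<integral>\<^sup>+x. ennreal ((cmod (f (of_real x)))\<^sup>2) \<partial>lborel) \<le> ennreal C" .
  show int: "integrable lborel (\<lambda>x. (cmod (f (of_real x)))\<^sup>2)"
    by (rule integrableI_bounded) (use le in \<open>auto intro: le_less_trans[OF _ ennreal_less_top]\<close>)
  show "(\<integral>x. (cmod (f (of_real x)))\<^sup>2 \<partial>lborel) \<le> C"
    using le nn_integral_eq_integral[OF int] C0 by (simp add: ennreal_le_iff)
qed

section \<open>The Poisson kernel, contour integrals and Poisson's formula\<close>

lemma lborel_integral_arctan_kernel:
  fixes a y :: real
  assumes y: "y > 0"
  shows "integrable lborel (\<lambda>x. 1 / ((x - a)\<^sup>2 + y\<^sup>2))" "(\<integral>x. 1 / ((x - a)\<^sup>2 + y\<^sup>2) \<partial>lborel) = pi / y"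
proof -
  define F where "F x = arctan ((x - a) / y) / y" for x
  have pos: "(x - a)\<^sup>2 + y\<^sup>2 > 0" for x using y by (simp add: add_nonneg_pos)
  have top: "(F \<longlongrightarrow> (pi / 2) / y) at_top"
  proof -
    have "LIM x at_top. (x - a) / y :> at_top"
      unfolding filterlim_at_top eventually_at_top_linorder
    proof
      fix Z
      show "\<exists>N. \<forall>x\<ge>N. Z \<le> (x - a) / y" by (rule exI[of _ "Z * y + a"]) (use y in \<open>auto simp: field_simps\<close>)
    qed
    from filterlim_compose[OF tendsto_arctan_at_top this] show ?thesis
      unfolding F_def by (intro tendsto_intros) (use y in auto)
  qed
  have bot: "(F \<longlongrightarrow> (- (pi / 2)) / y) at_bot"
  proof -
    have "LIM x at_bot. (x - a) / y :> at_bot"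
      unfolding filterlim_at_bot eventually_at_bot_linorder
    proof
      fix Z
      show "\<exists>N. \<forall>x\<le>N. (x - a) / y \<le> Z" by (rule exI[of _ "Z * y + a"]) (use y in \<open>auto simp: field_simps\<close>)
    qed
    from filterlim_compose[OF tendsto_arctan_at_bot this] show ?thesis
      unfolding F_def by (intro tendsto_intros) (use y in auto)
  qed
  have d: "DERIV F x :> 1 / ((x - a)\<^sup>2 + y\<^sup>2)" for x
  proof -
    have "DERIV F x :> (1 / (1 + ((x - a) / y)\<^sup>2)) * (1 / y) / y"
      unfolding F_def using y by (auto intro!: derivative_eq_intros simp: inverse_eq_divide)
    moreover have "(1 / (1 + ((x - a) / y)\<^sup>2)) * (1 / y) / y = 1 / ((x - a)\<^sup>2 + y\<^sup>2)"
    proof -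
      have "1 + ((x - a) / y)\<^sup>2 = ((x - a)\<^sup>2 + y\<^sup>2) / y\<^sup>2" using y by (simp add: power_divide add_divide_distrib)
      then show ?thesis using y by (simp add: power2_eq_square)
    qed
    ultimately show ?thesis by simp
  qed
  have c: "isCont (\<lambda>x. 1 / ((x - a)\<^sup>2 + y\<^sup>2)) x" for x
    using pos[of x] by (intro continuous_intros) auto
  have *: "set_integrable lborel (einterval (-\<infinity>) \<infinity>) (\<lambda>x. 1 / ((x - a)\<^sup>2 + y\<^sup>2))"
      "(LBINT x=-\<infinity>..\<infinity>. 1 / ((x - a)\<^sup>2 + y\<^sup>2)) = (pi / 2) / y - (- (pi / 2)) / y"
    by (rule interval_integral_FTC_nonneg[where F = F];
        use d c top bot pos in \<open>auto simp: ereal_tendsto_simps less_imp_le\<close>)+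
  have e: "einterval (-\<infinity>) \<infinity> = UNIV" by (auto simp: einterval_def)
  show "integrable lborel (\<lambda>x. 1 / ((x - a)\<^sup>2 + y\<^sup>2))"
    using *(1) by (simp add: e set_integrable_def)
  show "(\<integral>x. 1 / ((x - a)\<^sup>2 + y\<^sup>2) \<partial>lborel) = pi / y"
    using *(2) by (simp add: e interval_lebesgue_integral_def set_lebesgue_integral_def field_simps)
qed

lemma cmod_of_real_minus_sq: "(cmod (of_real x - w))\<^sup>2 = (x - Re w)\<^sup>2 + (Im w)\<^sup>2"
  by (simp add: cmod_power2)

lemma tendsto_integral_symmetric_intervals:
  fixes F :: "real \<Rightarrow> complex"
  assumes F: "integrable lborel F"
  shows "(\<lambda>n. integral {- real n..real n} F) \<longlonglongrightarrow> (\<integral>x. F x \<partial>lborel)"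
proof -
  have "(\<lambda>n. LINT x:{- real n..real n}|lborel. F x) \<longlonglongrightarrow> (\<integral>x. F x \<partial>lborel)"
    unfolding set_lebesgue_integral_def
  proof (rule integral_dominated_convergence[where w = "\<lambda>x. norm (F x)"])
    show "AE x in lborel. (\<lambda>n. indicat_real {- real n..real n} x *\<^sub>R F x) \<longlonglongrightarrow> F x"
    proof (intro AE_I2 tendsto_eventually)
      fix x :: real
      obtain N :: nat where N: "\<bar>x\<bar> \<le> N" using real_arch_simple by blast
      show "\<forall>\<^sub>F n in sequentially. indicat_real {- real n..real n} x *\<^sub>R F x = F x"
        using eventually_ge_at_top[of N] by eventually_elim (use N in \<open>auto simp: indicator_def\<close>)
    qed
  qed (use F in \<open>auto simp: indicator_def\<close>)
  moreover have "(LINT x:{- real n..real n}|lborel. F x) = integral {- real n..real n} F" for n :: nat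
    by (rule set_borel_integral_eq_integral)
      (use F in \<open>auto simp: set_integrable_def intro!: integrable_mult_indicator\<close>)
  ultimately show ?thesis by simp
qed

lemma integral_inverse_sqrt:
  assumes "R > 0"
  shows "((\<lambda>s. 1 / sqrt s) has_integral 2 * sqrt R) {0..R}"
proof -
  have "((\<lambda>s. s powr (-1/2)) has_integral (R powr (-1/2 + 1) / (-1/2 + 1))) {0..R}"
    by (rule has_integral_powr_from_0) (use assms in auto)
  moreover have "s powr (-1/2) = 1 / sqrt s" if "s \<ge> 0" for s :: real
    using that by (cases "s = 0") (auto simp: powr_minus_divide powr_half_sqrt)
  ultimately have "((\<lambda>s. 1 / sqrt s) has_integral (R powr (-1/2 + 1) / (-1/2 + 1))) {0..R}"
    using has_integral_eq[of "{0..R}" "\<lambda>s. s powr (-1/2)" "\<lambda>s. 1 / sqrt s"] by auto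
  then show ?thesis
    using assms by (simp add: powr_half_sqrt mult.commute)
qed

text \<open>The rectangle with base \<open>{-R..R}\<close> and height \<open>R\<close>: the singularity of the bound
  at the real axis is integrable along the vertical sides.\<close>

lemma half_plane_integral_tendsto_zero:
  assumes c: "continuous_on {z. Im z \<ge> 0} g" and h: "g holomorphic_on upper_half"
    and b: "\<And>z. Im z > 0 \<Longrightarrow> cmod z \<ge> rad \<Longrightarrow> cmod (g z) \<le> B / (cmod z * sqrt (Im z))"
  shows "(\<lambda>n. integral {- real n..real n} (\<lambda>x. g (of_real x))) \<longlonglongrightarrow> 0"
proof -
  define S where "S = {z. Im z \<ge> 0}"
  have conv: "convex S" unfolding S_def by (simp add: convex_halfspace_Im_ge)
  have int: "x \<in> upper_half" if x: "x \<in> interior S" for x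
  proof -
    obtain e where e: "e > 0" "ball x e \<subseteq> S" using x by (auto simp: mem_interior)
    have "x - \<i> * of_real (e / 2) \<in> ball x e" using e by (simp add: dist_norm norm_mult)
    then have "x - \<i> * of_real (e / 2) \<in> S" using e by blast
    then show ?thesis using e by (simp add: S_def upper_half_def)
  qed
  have fd: "g field_differentiable at x" if "x \<in> interior S - {}" for x
    using h int[of x] that convex_upper_half(2) by (auto simp: holomorphic_on_open field_differentiable_def)
  \<comment> \<open>Continuity up to the boundary suffices for a primitive on the closed half plane,
    so every contour integral becomes a difference of values of \<open>\<Phi>\<close>.\<close>
  obtain \<Phi> where \<Phi>: "\<And>x. x \<in> S \<Longrightarrow> (\<Phi> has_field_derivative g x) (at x within S)"
    using holomorphic_convex_primitive[of S "{}" g, OF conv _ _ fd] c[folded S_def] by auto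
  have B0: "B \<ge> 0"
  proof -
    define \<rho> where "\<rho> = \<bar>rad\<bar> + 1"
    have \<rho>: "\<rho> > 0" "\<rho> \<ge> rad" unfolding \<rho>_def by auto
    have "0 \<le> B / (cmod (\<i> * of_real \<rho>) * sqrt (Im (\<i> * of_real \<rho>)))"
      by (rule order_trans[OF norm_ge_zero b]) (use \<rho> in \<open>auto simp: norm_mult\<close>)
    moreover have "cmod (\<i> * of_real \<rho>) * sqrt (Im (\<i> * of_real \<rho>)) > 0" using \<rho> by (simp add: norm_mult)
    ultimately show ?thesis by (simp add: zero_le_divide_iff)
  qed
  have main: "cmod (integral {-R..R} (\<lambda>x. g (of_real x))) \<le> 6 * B / sqrt R" if R: "R > 0" "R \<ge> rad" for R
  proof -
    have 1: "((\<lambda>s. g (0 + of_real s * 1) * 1) has_integral \<Phi> (0 + of_real R * 1) - \<Phi> (0 + of_real (-R) * 1)) {-R..R}"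
      by (rule primitive_along_line[OF \<Phi>]) (use R in \<open>auto simp: S_def\<close>)
    have v: "cmod (\<Phi> (w + of_real R * \<i>) - \<Phi> w) \<le> 2 * B / sqrt R" if w: "w = of_real x" "\<bar>x\<bar> = R" for w x
    proof -
      have 2: "((\<lambda>s. g (w + of_real s * \<i>) * \<i>) has_integral \<Phi> (w + of_real R * \<i>) - \<Phi> (w + of_real 0 * \<i>)) {0..R}"
        by (rule primitive_along_line[OF \<Phi>]) (use R w in \<open>auto simp: S_def\<close>)
      \<comment> \<open>The bound is infinite at \<open>s = 0\<close>; there the integrand is
        dominated by its own value, which changes nothing in the integral.\<close>
      have 3: "((\<lambda>s. if s = 0 then cmod (g w) else B / R * (1 / sqrt s)) has_integral B / R * (2 * sqrt R)) {0..R}"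
        by (rule has_integral_spike_finite[OF _ _ has_integral_mult_right[OF integral_inverse_sqrt], where S = "{0}"])
          (use R in auto)
      have "cmod (\<Phi> (w + of_real R * \<i>) - \<Phi> (w + of_real 0 * \<i>)) \<le> B / R * (2 * sqrt R)"
        unfolding integral_unique[OF 2, symmetric] integral_unique[OF 3, symmetric]
      proof (rule integral_norm_bound_integral)
        fix s assume s: "s \<in> {0..R}"
        show "norm (g (w + of_real s * \<i>) * \<i>) \<le> (if s = 0 then cmod (g w) else B / R * (1 / sqrt s))"
        proof (cases "s = 0")
          case False
          then have s0: "s > 0" using s by auto
          have m: "cmod (w + of_real s * \<i>) \<ge> R"
            using abs_Re_le_cmod[of "w + of_real s * \<i>"] w by simp
          have "cmod (g (w + of_real s * \<i>)) \<le> B / (cmod (w + of_real s * \<i>) * sqrt (Im (w + of_real s * \<i>)))"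
            by (rule b) (use s0 w m R in auto)
          also have "\<dots> \<le> B / (R * sqrt s)"
            using m s0 R w B0 by (intro divide_left_mono mult_mono mult_pos_pos) auto
          finally show ?thesis using False by (simp add: norm_mult)
        qed (simp add: norm_mult)
      qed (use 2 3 in \<open>auto simp: has_integral_integrable\<close>)
      also have "B / R * (2 * sqrt R) = 2 * B / sqrt R"
        using R by (simp add: field_simps flip: power2_eq_square)
      finally show ?thesis by simp
    qed
    have t: "cmod (\<Phi> (of_real R + of_real R * \<i>) - \<Phi> (of_real (-R) + of_real R * \<i>)) \<le> 2 * B / sqrt R"
    proof -
      have 2: "((\<lambda>s. g (of_real R * \<i> + of_real s * 1) * 1) has_integral \<Phi> (of_real R * \<i> + of_real R * 1) - \<Phi> (of_real R * \<i> + of_real (-R) * 1)) {-R..R}"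
        by (rule primitive_along_line[OF \<Phi>]) (use R in \<open>auto simp: S_def\<close>)
      have 3: "((\<lambda>s. B / (R * sqrt R)) has_integral (R - -R) *\<^sub>R (B / (R * sqrt R))) {-R..R}"
        by (rule has_integral_const_real[of _ "-R" R, THEN has_integral_eq_rhs]) (use R in simp)
      have "cmod (\<Phi> (of_real R * \<i> + of_real R * 1) - \<Phi> (of_real R * \<i> + of_real (-R) * 1)) \<le> (R - -R) *\<^sub>R (B / (R * sqrt R))"
        unfolding integral_unique[OF 2, symmetric] integral_unique[OF 3, symmetric]
      proof (rule integral_norm_bound_integral)
        fix s assume s: "s \<in> {-R..R}"
        have m: "cmod (of_real R * \<i> + of_real s * 1) \<ge> R"
          using abs_Im_le_cmod[of "of_real R * \<i> + of_real s * 1"] R by simp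
        have "cmod (g (of_real R * \<i> + of_real s * 1)) \<le> B / (cmod (of_real R * \<i> + of_real s * 1) * sqrt (Im (of_real R * \<i> + of_real s * 1)))"
          by (rule b) (use m R in auto)
        also have "\<dots> \<le> B / (R * sqrt R)"
          using m R B0 by (intro divide_left_mono mult_mono mult_pos_pos) auto
        finally show "norm (g (of_real R * \<i> + of_real s * 1) * 1) \<le> B / (R * sqrt R)" by simp
      qed (use 2 3 in \<open>auto simp: has_integral_integrable\<close>)
      also have "\<dots> = 2 * B / sqrt R" using R by (simp add: field_simps)
      finally show ?thesis by (simp add: add.commute)
    qed
    have "integral {-R..R} (\<lambda>x. g (of_real x)) = \<Phi> (of_real R) - \<Phi> (of_real (-R))"
      using integral_unique[OF 1] by simp
    \<comment> \<open>The base of the rectangle is replaced by its other three sides, each of which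
      contributes at most \<open>2 * B / sqrt R\<close>.\<close>
    also have "\<dots> = (\<Phi> (of_real R + of_real R * \<i>) - \<Phi> (of_real (-R) + of_real R * \<i>)) 
        - (\<Phi> (of_real R + of_real R * \<i>) - \<Phi> (of_real R)) + (\<Phi> (of_real (-R) + of_real R * \<i>) - \<Phi> (of_real (-R)))"
      by simp
    also have "cmod \<dots> \<le> 2 * B / sqrt R + 2 * B / sqrt R + 2 * B / sqrt R"
      using R by (intro norm_triangle_le norm_triangle_le_diff add_mono t v) auto
    finally show ?thesis by simp
  qed
  show ?thesis
  proof (rule Lim_null_comparison)
    show "\<forall>\<^sub>F n in sequentially. norm (integral {- real n..real n} (\<lambda>x. g (of_real x))) \<le> 6 * B / sqrt (real n)"
    proof -
      obtain N :: nat where N: "rad \<le> N" using real_arch_simple by blast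
      show ?thesis
        using eventually_ge_at_top[of "max N 1"] by eventually_elim (rule main, use N in auto)
    qed
    have "LIM n sequentially. sqrt (real n) :> at_top"
      by (rule filterlim_compose[OF sqrt_at_top filterlim_real_sequentially])
    then show "(\<lambda>n. 6 * B / sqrt (real n)) \<longlonglongrightarrow> 0"
      by (intro real_tendsto_divide_at_top[OF tendsto_const])
  qed
qed

lemma continuous_on_difference_quotient:
  assumes c: "continuous_on {z. Im z \<ge> 0} f" and h: "f holomorphic_on upper_half" and w: "Im w > 0"
  shows "continuous_on {z. Im z \<ge> 0} (\<lambda>z. if z = w then deriv f w else (f z - f w) / (z - w))"
    (is "continuous_on _ ?g")
proof -
  have S: "{z. Im z \<ge> 0} = upper_half \<union> ({z. Im z \<ge> 0} - {w})"
    using w by (auto simp: upper_half_def)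
  have 1: "continuous_on upper_half ?g"
    using pole_lemma_open[OF h convex_upper_half(2)] holomorphic_on_imp_continuous_on by blast
  have "continuous_on ({z. Im z \<ge> 0} - {w}) (\<lambda>z. (f z - f w) / (z - w))"
    by (intro continuous_intros continuous_on_subset[OF c]) auto
  then have 2: "continuous_on ({z. Im z \<ge> 0} - {w}) ?g"
    by (rule continuous_on_eq) auto
  have "continuous_on (upper_half \<union> ({z. Im z \<ge> 0} - {w})) ?g"
  proof (rule continuous_on_Un_local_open[OF _ _ 1 2])
    show "openin (top_of_set (upper_half \<union> ({z. 0 \<le> Im z} - {w}))) upper_half"
      unfolding openin_open using convex_upper_half by (intro exI[of _ upper_half]) auto
    show "openin (top_of_set (upper_half \<union> ({z. 0 \<le> Im z} - {w}))) ({z. 0 \<le> Im z} - {w})"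
      unfolding openin_open using w by (intro exI[of _ "- {w}"]) (auto simp: upper_half_def)
  qed
  then show ?thesis using S by simp
qed

lemma cmod_diff_ge_half:
  assumes "cmod z \<ge> 2 * cmod w" shows "cmod (z - w) \<ge> cmod z / 2"
  using norm_triangle_ineq2[of z w] assms by linarith

text \<open>On the real axis the square of \<open>cmod (of_real x - w)\<close> is
  \<open>(x - w) * (x - cnj w)\<close>. After subtracting \<open>f w\<close> the quotient is
  holomorphic in the half plane, since its singularity at \<open>w\<close> is removable, and decays,
  so that its integral vanishes; the subtracted constant contributes the mass
  \<open>pi / Im w\<close> of the kernel. The bound assumed on \<open>f\<close> covers bounded
  functions such as \<open>\<theta>\<close> as well as functions of the Hardy space.\<close>

lemma Poisson_formula:
  assumes c: "continuous_on {z. Im z \<ge> 0} f" and h: "f holomorphic_on upper_half" and w: "Im w > 0"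
    and b: "\<And>z. Im z > 0 \<Longrightarrow> cmod (f z) \<le> B * (1 + 1 / sqrt (Im z))"
    and i: "integrable lborel (\<lambda>x. f (of_real x) / of_real ((cmod (of_real x - w))\<^sup>2))"
  shows "(\<integral>x. f (of_real x) / of_real ((cmod (of_real x - w))\<^sup>2) \<partial>lborel) = of_real (pi / Im w) * f w"
proof -
  define g where "g z = (if z = w then deriv f w else (f z - f w) / (z - w)) / (z - cnj w)" for z
  have nz: "z - cnj w \<noteq> 0" if "Im z \<ge> 0" for z using that w by (auto simp: complex_eq_iff)
  have "0 \<le> B * (1 + 1 / sqrt (Im \<i>))" by (rule order_trans[OF norm_ge_zero b]) auto
  then have B: "B \<ge> 0" by simp
  have lim: "(\<lambda>n. integral {- real n..real n} (\<lambda>x. g (of_real x))) \<longlonglongrightarrow> 0"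
  proof (rule half_plane_integral_tendsto_zero[where rad = "2 * cmod w + 1" and B = "4 * (2 * B + cmod (f w))"])
    show "continuous_on {z. Im z \<ge> 0} g"
      unfolding g_def
      by (intro continuous_on_divide continuous_on_difference_quotient c h w continuous_intros) (use nz in auto)
    show "g holomorphic_on upper_half"
      unfolding g_def
      by (intro holomorphic_on_divide pole_lemma_open h convex_upper_half holomorphic_intros) (use nz in \<open>auto simp: upper_half_def\<close>)
    fix z assume z: "Im z > 0" "cmod z \<ge> 2 * cmod w + 1"
    define r where "r = cmod z"
    define y where "y = Im z"
    have r: "r \<ge> 1" using z norm_ge_zero[of w] unfolding r_def by linarith
    have y: "y > 0" "y \<le> r" using z abs_Im_le_cmod[of z] by (auto simp: y_def r_def)
    have 1: "cmod (z - w) \<ge> r / 2" "cmod (z - cnj w) \<ge> r / 2"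
      using cmod_diff_ge_half[of w z] cmod_diff_ge_half[of "cnj w" z] z by (auto simp: r_def)
    have q: "sqrt y \<le> sqrt r" "1 \<le> sqrt r" "sqrt y > 0" using y r by auto
    \<comment> \<open>For \<open>y \<le> r\<close> and \<open>r \<ge> 1\<close> both 1 and
      \<open>1 / sqrt y\<close> are at most \<open>sqrt r / sqrt y\<close>. The factor
      \<open>sqrt r\<close> lost in this way is affordable because the denominator decays
      quadratically.\<close>
    have q1: "1 \<le> sqrt r / sqrt y" using q by (simp add: field_simps)
    have q2: "1 / sqrt y \<le> sqrt r / sqrt y" using q by (simp add: field_simps)
    have q3: "sqrt r \<le> r" using q mult_left_mono[of 1 "sqrt r" "sqrt r"] r by simp
    have zw: "z \<noteq> w"
    proof
      assume "z = w"
      then show False using z(2) norm_ge_zero[of w] by simp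
    qed
    have "cmod (g z) = cmod (f z - f w) / (cmod (z - w) * cmod (z - cnj w))"
      using zw by (simp add: g_def norm_divide norm_mult)
    also have "\<dots> \<le> (cmod (f z) + cmod (f w)) / ((r / 2) * (r / 2))"
      using 1 r by (intro frac_le mult_mono norm_triangle_ineq4 mult_pos_pos) auto
    also have "\<dots> \<le> (B * (sqrt r / sqrt y + sqrt r / sqrt y) + cmod (f w) * (sqrt r / sqrt y)) / ((r / 2) * (r / 2))"
    proof (rule divide_right_mono[OF add_mono])
      have "cmod (f z) \<le> B * (1 + 1 / sqrt y)" using b[OF z(1)] by (simp add: y_def)
      also have "\<dots> \<le> B * (sqrt r / sqrt y + sqrt r / sqrt y)" using B q1 q2 by (intro mult_left_mono add_mono) auto
      finally show "cmod (f z) \<le> B * (sqrt r / sqrt y + sqrt r / sqrt y)" .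
      show "cmod (f w) \<le> cmod (f w) * (sqrt r / sqrt y)"
        using mult_left_mono[OF q1, of "cmod (f w)"] by simp
    qed (use r in auto)
    also have "\<dots> = 4 * (2 * B + cmod (f w)) * sqrt r / (r * r * sqrt y)"
      using r q by (simp add: field_simps)
    also have "\<dots> \<le> 4 * (2 * B + cmod (f w)) * r / (r * r * sqrt y)"
      using q3 r q B by (intro divide_right_mono mult_left_mono) auto
    also have "\<dots> = 4 * (2 * B + cmod (f w)) / (r * sqrt y)" using r by simp
    finally show "cmod (g z) \<le> 4 * (2 * B + cmod (f w)) / (cmod z * sqrt (Im z))" by (simp add: r_def y_def)
  qed
  have k: "integrable lborel (\<lambda>x. 1 / (cmod (of_real x - w))\<^sup>2)"
      "(\<integral>x. 1 / (cmod (of_real x - w))\<^sup>2 \<partial>lborel) = pi / Im w"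
    unfolding cmod_of_real_minus_sq using lborel_integral_arctan_kernel[OF w, of "Re w"] by auto
  have kc: "integrable lborel (\<lambda>x. of_real (1 / (cmod (of_real x - w))\<^sup>2) * f w)"
      "(\<integral>x. of_real (1 / (cmod (of_real x - w))\<^sup>2) * f w \<partial>lborel) = of_real (pi / Im w) * f w"
    using k(1) by (auto simp del: of_real_divide simp: k(2))
  have ge: "g (of_real x) = f (of_real x) / of_real ((cmod (of_real x - w))\<^sup>2) - of_real (1 / (cmod (of_real x - w))\<^sup>2) * f w" for x
  proof -
    have P: "complex_of_real ((cmod (of_real x - w))\<^sup>2) = (of_real x - w) * (of_real x - cnj w)"
      by (subst complex_norm_square) simp
    have "of_real x \<noteq> w" using w by auto
    then have "g (of_real x) = (f (of_real x) - f w) / ((of_real x - w) * (of_real x - cnj w))"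
      by (simp add: g_def)
    then show ?thesis unfolding of_real_divide P by (simp add: diff_divide_distrib)
  qed
  have "integrable lborel (\<lambda>x. g (of_real x))" unfolding ge using i kc(1) by (intro Bochner_Integration.integrable_diff)
  from tendsto_integral_symmetric_intervals[OF this] lim
  have "(\<integral>x. g (of_real x) \<partial>lborel) = 0" using LIMSEQ_unique by blast
  then show ?thesis unfolding ge using i kc by (simp add: Bochner_Integration.integral_diff del: of_real_divide)
qed

text \<open>Cauchy's theorem: the pole \<open>cnj w\<close> lies in the lower half plane.\<close>

lemma hardy_conj_Cauchy_zero:
  assumes c: "continuous_on {z. Im z \<ge> 0} f" and h: "f holomorphic_on upper_half" and w: "Im w > 0"
    and b: "\<And>z. Im z > 0 \<Longrightarrow> cmod (f z) \<le> B / sqrt (Im z)"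
    and i: "integrable lborel (\<lambda>x. f (of_real x) / (of_real x - cnj w))"
  shows "(\<integral>x. f (of_real x) / (of_real x - cnj w) \<partial>lborel) = 0"
proof -
  have nz: "z - cnj w \<noteq> 0" if "Im z \<ge> 0" for z using that w by (auto simp: complex_eq_iff)
  have "0 \<le> B / sqrt (Im \<i>)" by (rule order_trans[OF norm_ge_zero b]) auto
  then have B: "B \<ge> 0" by simp
  have "(\<lambda>n. integral {- real n..real n} (\<lambda>x. f (of_real x) / (of_real x - cnj w))) \<longlonglongrightarrow> 0"
  proof (rule half_plane_integral_tendsto_zero[where rad = "2 * cmod w + 1" and B = "2 * B"])
    show "continuous_on {z. Im z \<ge> 0} (\<lambda>z. f z / (z - cnj w))"
      by (intro continuous_on_divide c continuous_intros) (use nz in auto)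
    show "(\<lambda>z. f z / (z - cnj w)) holomorphic_on upper_half"
      by (intro holomorphic_on_divide h holomorphic_intros) (use nz in \<open>auto simp: upper_half_def\<close>)
    fix z assume z: "Im z > 0" "cmod z \<ge> 2 * cmod w + 1"
    have z0: "cmod z > 0" using z norm_ge_zero[of w] by linarith
    have "cmod (z - cnj w) \<ge> cmod z / 2"
      using cmod_diff_ge_half[of "cnj w" z] z by auto
    then have "cmod (f z / (z - cnj w)) \<le> (B / sqrt (Im z)) / (cmod z / 2)"
      unfolding norm_divide using b[OF z(1)] z0 B z by (intro frac_le) auto
    then show "cmod (f z / (z - cnj w)) \<le> 2 * B / (cmod z * sqrt (Im z))" by (simp add: field_simps)
  qed
  then show ?thesis using tendsto_integral_symmetric_intervals[OF i] LIMSEQ_unique by blast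
qed

lemma square_integrable_Cauchy_kernel:
  assumes w: "Im w \<noteq> 0"
  shows "(\<lambda>x. 1 / (complex_of_real x - w)) \<in> borel_measurable lborel"
    and "integrable lborel (\<lambda>x. (cmod (1 / (complex_of_real x - w)))\<^sup>2)"
    and "(\<integral>x. (cmod (1 / (complex_of_real x - w)))\<^sup>2 \<partial>lborel) = pi / \<bar>Im w\<bar>"
proof -
  have "continuous_on UNIV (\<lambda>x. 1 / (complex_of_real x - w))"
    by (intro continuous_intros) (use w in \<open>auto simp: complex_eq_iff\<close>)
  then show "(\<lambda>x. 1 / (complex_of_real x - w)) \<in> borel_measurable lborel"
    using borel_measurable_continuous_onI by simp
  have "(cmod (1 / (complex_of_real x - w)))\<^sup>2 = 1 / ((x - Re w)\<^sup>2 + \<bar>Im w\<bar>\<^sup>2)" for x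
    by (simp add: norm_divide power_divide cmod_of_real_minus_sq)
  then show "integrable lborel (\<lambda>x. (cmod (1 / (complex_of_real x - w)))\<^sup>2)"
    "(\<integral>x. (cmod (1 / (complex_of_real x - w)))\<^sup>2 \<partial>lborel) = pi / \<bar>Im w\<bar>"
    using lborel_integral_arctan_kernel[of "\<bar>Im w\<bar>" "Re w"] w by auto
qed

text \<open>Poisson's formula and Cauchy-Schwarz bound the square of the modulus on the line by the
  Poisson integral of its boundary values. Integrating in \<open>s\<close> and exchanging the
  integrals gives the claim, because the Poisson kernel has mass 1. This is the way back from a norm
  on the axis to membership in the Hardy space.\<close>

lemma line_square_integral_le:
  assumes c: "continuous_on {z. Im z \<ge> 0} f" and h: "f holomorphic_on upper_half" and y: "y > 0"
    and b: "\<And>z. Im z > 0 \<Longrightarrow> cmod (f z) \<le> B * (1 + 1 / sqrt (Im z))"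
    and i: "integrable lborel (\<lambda>x. (cmod (f (of_real x)))\<^sup>2)"
  shows "integrable lborel (\<lambda>x. (cmod (f (Complex x y)))\<^sup>2)"
    "(\<integral>x. (cmod (f (Complex x y)))\<^sup>2 \<partial>lborel) \<le> (\<integral>x. (cmod (f (of_real x)))\<^sup>2 \<partial>lborel)"
proof -
  have cr: "continuous_on UNIV (\<lambda>x::real. f (of_real x))"
    by (rule continuous_on_compose2[OF c]) (auto intro!: continuous_intros)
  have m[measurable]: "(\<lambda>x::real. f (of_real x)) \<in> borel_measurable borel"
    using borel_measurable_continuous_onI[OF cr] by simp
  have cy: "continuous_on UNIV (\<lambda>x::real. f (Complex x y))"
    by (rule continuous_on_compose2[OF c]) (use y in \<open>auto simp: Complex_eq intro!: continuous_intros\<close>)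
  have my[measurable]: "(\<lambda>x::real. f (Complex x y)) \<in> borel_measurable borel"
    using borel_measurable_continuous_onI[OF cy] by simp
  define k where "k s x = (y / pi) * (cmod (f (of_real x)))\<^sup>2 * (1 / ((x - s)\<^sup>2 + y\<^sup>2))" for s x :: real
  have k0: "k s x \<ge> 0" for s x using y by (simp add: k_def)
  have pt: "ennreal ((cmod (f (Complex s y)))\<^sup>2) \<le> (\<integral>\<^sup>+x. ennreal (k s x) \<partial>lborel)" for s
  proof -
    define w where "w = Complex s y"
    have w: "Im w > 0" "Im w \<noteq> 0" "Re w = s" "Im w = y" using y by (auto simp: w_def)
    \<comment> \<open>The kernel is shared between two square integrable factors: \<open>u\<close>
      carries \<open>f\<close>, and the norm of \<open>v\<close> is known. Their product also
      provides the integrability that Poisson's formula asks for.\<close>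
    define u where "u x = f (of_real x) * (1 / (of_real x - w))" for x :: real
    define v where "v x = 1 / (complex_of_real x - cnj w)" for x :: real
    have [measurable]: "u \<in> borel_measurable lborel" "v \<in> borel_measurable lborel"
      using square_integrable_Cauchy_kernel(1)[of w] square_integrable_Cauchy_kernel(1)[of "cnj w"] w m
      unfolding u_def v_def by (auto intro!: borel_measurable_times)
    have u2: "(cmod (u x))\<^sup>2 = (cmod (f (of_real x)))\<^sup>2 * (1 / ((x - s)\<^sup>2 + y\<^sup>2))" for x
      by (simp add: u_def norm_mult norm_divide power_mult_distrib power_divide cmod_of_real_minus_sq w)
    have iu: "integrable lborel (\<lambda>x. (cmod (u x))\<^sup>2)"
    proof (rule Bochner_Integration.integrable_bound[OF integrable_mult_left[OF i, of "1 / y\<^sup>2"]])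
      show "AE x in lborel. norm ((cmod (u x))\<^sup>2) \<le> norm ((cmod (f (of_real x)))\<^sup>2 * (1 / y\<^sup>2))"
        unfolding u2 using y by (auto intro!: mult_left_mono divide_left_mono simp: abs_mult add_nonneg_pos)
    qed simp
    have iv: "integrable lborel (\<lambda>x. (cmod (v x))\<^sup>2)" "(\<integral>x. (cmod (v x))\<^sup>2 \<partial>lborel) = pi / y"
      unfolding v_def using square_integrable_Cauchy_kernel(2,3)[of "cnj w"] w y by auto
    have uv: "u x * v x = f (of_real x) / of_real ((cmod (of_real x - w))\<^sup>2)" for x
      by (subst complex_norm_square) (simp add: u_def v_def)
    have "of_real (pi / y) * f w = (\<integral>x. u x * v x \<partial>lborel)"
      unfolding uv
      by (rule Poisson_formula[OF c h w(1) b, unfolded w, symmetric])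
        (use Cauchy_Schwarz_integral(1)[of u lborel v] iu iv in \<open>auto simp: uv\<close>)
    also have "cmod \<dots> \<le> sqrt ((\<integral>x. (cmod (u x))\<^sup>2 \<partial>lborel) * (pi / y))"
      using Cauchy_Schwarz_integral(3)[of u lborel v] iu iv by auto
    finally have "pi / y * cmod (f w) \<le> sqrt ((\<integral>x. (cmod (u x))\<^sup>2 \<partial>lborel) * (pi / y))"
      using y by (simp add: norm_mult norm_divide)
    then have "(pi / y * cmod (f w))\<^sup>2 \<le> (sqrt ((\<integral>x. (cmod (u x))\<^sup>2 \<partial>lborel) * (pi / y)))\<^sup>2"
      by (rule power_mono) (use y in auto)
    also have "\<dots> = (\<integral>x. (cmod (u x))\<^sup>2 \<partial>lborel) * (pi / y)"
      by (rule real_sqrt_pow2) (use y in auto)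
    finally have "(pi / y)\<^sup>2 * (cmod (f w))\<^sup>2 \<le> (pi / y) * (\<integral>x. (cmod (u x))\<^sup>2 \<partial>lborel)"
      by (simp add: power_mult_distrib mult.commute power_divide)
    then have "(pi / y) * (cmod (f w))\<^sup>2 \<le> (\<integral>x. (cmod (u x))\<^sup>2 \<partial>lborel)"
      using y by (simp add: power2_eq_square field_simps)
    then have "(cmod (f w))\<^sup>2 \<le> (y / pi) * (\<integral>x. (cmod (u x))\<^sup>2 \<partial>lborel)"
      using y by (simp add: field_simps)
    also have "\<dots> = (\<integral>x. k s x \<partial>lborel)"
      unfolding k_def u2 by (simp only: mult.assoc integral_mult_right_zero)
    finally have le: "(cmod (f w))\<^sup>2 \<le> (\<integral>x. k s x \<partial>lborel)" .
    have "integrable lborel (k s)" using integrable_mult_right[OF iu, of "y / pi"] by (simp add: k_def[abs_def] u2 mult.assoc)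
    then have "(\<integral>\<^sup>+x. ennreal (k s x) \<partial>lborel) = ennreal (\<integral>x. k s x \<partial>lborel)"
      by (intro nn_integral_eq_integral) (auto simp: k0)
    then show ?thesis using le by (simp add: w_def ennreal_leI)
  qed
  have "(\<integral>\<^sup>+s. ennreal ((cmod (f (Complex s y)))\<^sup>2) \<partial>lborel) \<le> (\<integral>\<^sup>+s. \<integral>\<^sup>+x. ennreal (k s x) \<partial>lborel \<partial>lborel)"
    by (intro nn_integral_mono pt)
  also have "\<dots> = (\<integral>\<^sup>+x. \<integral>\<^sup>+s. ennreal (k s x) \<partial>lborel \<partial>lborel)"
    by (rule lborel_pair.Fubini'[symmetric]) (unfold k_def, measurable)
  also have "\<dots> = (\<integral>\<^sup>+x. ennreal ((cmod (f (of_real x)))\<^sup>2) \<partial>lborel)"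
  proof (rule nn_integral_cong)
    fix x :: real
    have ks: "k s x = (y / pi) * (cmod (f (of_real x)))\<^sup>2 * (1 / ((s - x)\<^sup>2 + y\<^sup>2))" for s
      by (simp add: k_def power2_commute)
    have "(\<integral>\<^sup>+s. ennreal (k s x) \<partial>lborel) = ennreal (\<integral>s. k s x \<partial>lborel)"
      unfolding ks by (intro nn_integral_eq_integral integrable_mult_right lborel_integral_arctan_kernel[OF y])
        (use y in auto)
    also have "(\<integral>s. k s x \<partial>lborel) = (cmod (f (of_real x)))\<^sup>2"
      unfolding ks using y by (simp only: integral_mult_right_zero lborel_integral_arctan_kernel(2)[OF y]) simp
    finally show "(\<integral>\<^sup>+s. ennreal (k s x) \<partial>lborel) = ennreal ((cmod (f (of_real x)))\<^sup>2)" .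
  qed
  also have "\<dots> = ennreal (\<integral>x. (cmod (f (of_real x)))\<^sup>2 \<partial>lborel)"
    by (intro nn_integral_eq_integral i) auto
  finally have le: "(\<integral>\<^sup>+s. ennreal ((cmod (f (Complex s y)))\<^sup>2) \<partial>lborel) \<le> ennreal (\<integral>x. (cmod (f (of_real x)))\<^sup>2 \<partial>lborel)" .
  show int: "integrable lborel (\<lambda>x. (cmod (f (Complex x y)))\<^sup>2)"
    by (rule integrableI_bounded) (use le in \<open>auto intro: le_less_trans[OF _ ennreal_less_top]\<close>)
  show "(\<integral>x. (cmod (f (Complex x y)))\<^sup>2 \<partial>lborel) \<le> (\<integral>x. (cmod (f (of_real x)))\<^sup>2 \<partial>lborel)"
    using le nn_integral_eq_integral[OF int] by (simp add: ennreal_le_iff)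
qed

section \<open>Phragmen--Lindelof and Paley--Wiener spaces\<close>

text \<open>Locates the frontier of a truncated sector or half plane without computing it: it lies
  in the closed set and off the obvious open subset.\<close>

lemma frontier_closed_subset:
  assumes "closed S" "z \<in> frontier S" "open U" "U \<subseteq> S" shows "z \<in> S" "z \<notin> U"
  using assms interior_maximal[OF assms(4,3)] by (auto simp: frontier_def)

text \<open>The comparison function of the Phragmen--Lindelof argument in a quarter plane:
  \<open>w * csqrt w\<close> is the power \<open>w\<^bsup>3/2\<^esup>\<close>, whose real part grows faster than \<open>\<bar>w\<bar>\<close> there.\<close>

lemma Re_three_halves_power_ge:
  assumes w: "\<bar>Im w\<bar> \<le> Re w"
  shows "Re (w * csqrt w) \<ge> cmod w / 8 * sqrt (cmod w / 2)"
proof -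
  define c where "c = csqrt w"
  define s t where "s = Re c" and "t = Im c"
  have sq: "w = c\<^sup>2" by (simp add: c_def)
  have re: "Re w = s\<^sup>2 - t\<^sup>2" and im: "Im w = 2 * s * t"
    unfolding sq s_def t_def by (simp_all add: power2_eq_square)
  have s0: "s \<ge> 0" unfolding s_def c_def using csqrt_principal[of w] by auto
  have n: "cmod w = s\<^sup>2 + t\<^sup>2"
    unfolding sq by (simp add: norm_power cmod_power2 s_def t_def)
  have t2: "t\<^sup>2 \<le> s\<^sup>2 / 4"
  proof (rule ccontr)
    assume c: "\<not> ?thesis"
    then have "(s / 2)\<^sup>2 < \<bar>t\<bar>\<^sup>2" by (simp add: power_divide)
    then have "s / 2 < \<bar>t\<bar>" by (rule power_less_imp_less_base) simp
    then have "2 * s * \<bar>t\<bar> \<ge> s * s" using s0 mult_left_mono[of "s / 2" "\<bar>t\<bar>" "2 * s"] by simp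
    moreover have "2 * s * \<bar>t\<bar> \<le> s\<^sup>2 - t\<^sup>2" using w s0 by (simp add: re im abs_mult)
    ultimately have "t\<^sup>2 \<le> 0" unfolding power2_eq_square by linarith
    moreover have "s\<^sup>2 / 4 \<ge> 0" by simp
    ultimately show False using c by linarith
  qed
  have "Re (w * csqrt w) = s * (s\<^sup>2 - 3 * t\<^sup>2)"
    unfolding c_def[symmetric] by (simp add: re im s_def[symmetric] t_def[symmetric] algebra_simps power2_eq_square)
  also have "\<dots> \<ge> s * (s\<^sup>2 / 4)" using t2 s0 by (intro mult_left_mono) auto
  finally have 1: "Re (w * csqrt w) \<ge> s * (s\<^sup>2 / 4)" .
  have h: "cmod w / 2 \<le> s\<^sup>2" using t2 n zero_le_power2[of s] by linarith
  then have "sqrt (cmod w / 2) \<le> s" using s0 by (simp add: real_le_lsqrt)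
  then have "(cmod w / 2 / 4) * sqrt (cmod w / 2) \<le> (s\<^sup>2 / 4) * s" using h s0 by (intro mult_mono divide_right_mono) auto
  with 1 show ?thesis by (simp add: mult.commute)
qed

text \<open>The sector has opening angle pi / 2, so growth of order below 2 is admissible. The
  damping factor has order 3/2, strictly between the order 1 of \<open>f\<close> and the critical
  order, and is removed by \<open>\<delta> \<rightarrow> 0\<close>. The shift to
  \<open>z + 1\<close> keeps the square root away from its branch cut at the vertex.\<close>

lemma Phragmen_Lindelof_quarter_plane:
  fixes f :: "complex \<Rightarrow> complex"
  assumes f: "f holomorphic_on UNIV" and B: "B > 0" and k: "k \<ge> 0"
    and g: "\<And>z. \<bar>Im z\<bar> \<le> Re z \<Longrightarrow> cmod (f z) \<le> A * exp (k * cmod z)"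
    and b: "\<And>z. \<bar>Im z\<bar> = Re z \<Longrightarrow> cmod (f z) \<le> B"
    and \<xi>: "\<bar>Im \<xi>\<bar> \<le> Re \<xi>"
  shows "cmod (f \<xi>) \<le> B"
proof -
  define \<phi> where "\<phi> z = (z + 1) * csqrt (z + 1)" for z
  have main: "cmod (f \<xi>) \<le> B * exp (\<delta> * Re (\<phi> \<xi>))" if \<delta>: "\<delta> > 0" for \<delta>
  proof -
    have "0 \<le> A * exp (k * cmod 0)" by (rule order_trans[OF norm_ge_zero g]) auto
    then have A: "A \<ge> 0" by simp
    \<comment> \<open>The last term makes the damping exceed \<open>R * (k + 1)\<close> on the arc,
      which leaves a factor \<open>exp (- R)\<close>; the middle term gives
      \<open>A \<le> B * R \<le> B * exp R\<close>, so that the arc is bounded by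
      \<open>B\<close>.\<close>
    define R where "R = max (max (cmod \<xi>) (A / B)) (2 * (8 * (k + 1) / \<delta>)\<^sup>2)"
    have R: "R \<ge> cmod \<xi>" "R \<ge> A / B" "R \<ge> 2 * (8 * (k + 1) / \<delta>)\<^sup>2" unfolding R_def by auto
    then have R0: "R \<ge> 0" using norm_ge_zero[of \<xi>] by linarith
    define S where "S = {z. \<bar>Im z\<bar> \<le> Re z} \<inter> cball 0 R"
    have clS: "closed S" unfolding S_def
      by (intro closed_Int closed_cball closed_Collect_le continuous_intros)
    have opU: "open ({z. \<bar>Im z\<bar> < Re z} \<inter> ball 0 R)"
      by (intro open_Int open_ball open_Collect_less continuous_intros)
    have US: "{z. \<bar>Im z\<bar> < Re z} \<inter> ball 0 R \<subseteq> S" by (auto simp: S_def)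
    define h where "h z = f z * exp (- of_real \<delta> * \<phi> z)" for z
    have nn: "z + 1 \<notin> \<real>\<^sub>\<le>\<^sub>0" if "z \<in> S" for z
      using that by (auto simp: S_def complex_nonpos_Reals_iff)
    have hol: "h holomorphic_on S"
      unfolding h_def \<phi>_def by (intro holomorphic_intros holomorphic_on_subset[OF f] nn) auto
    have nh: "cmod (h z) = cmod (f z) * exp (- (\<delta> * Re (\<phi> z)))" for z
      by (simp add: h_def norm_mult)
    have re: "Re (\<phi> z) \<ge> cmod z / 8 * sqrt (cmod z / 2)" if z: "\<bar>Im z\<bar> \<le> Re z" for z
    proof -
      have z0: "Re z \<ge> 0" using z by linarith
      have "cmod z \<le> cmod (z + 1)"
        unfolding cmod_def using z0 power_mono[of "Re z" "Re (z + 1)" 2] by (intro real_sqrt_le_mono) simp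
      then have "cmod z / 8 * sqrt (cmod z / 2) \<le> cmod (z + 1) / 8 * sqrt (cmod (z + 1) / 2)"
        by (intro mult_mono) auto
      also have "\<dots> \<le> Re (\<phi> z)" unfolding \<phi>_def by (rule Re_three_halves_power_ge) (use z in auto)
      finally show ?thesis .
    qed
    have "norm (h \<xi>) \<le> B"
    proof (rule maximum_modulus_frontier[where S = S and f = h])
      show "h holomorphic_on interior S" using hol interior_subset holomorphic_on_subset by blast
      show "continuous_on (closure S) h" using hol clS by (simp add: holomorphic_on_imp_continuous_on)
      show "bounded S" unfolding S_def by (intro bounded_Int) auto
      show "\<xi> \<in> S" using \<xi> R by (simp add: S_def)
      fix z assume "z \<in> frontier S"
      from frontier_closed_subset[OF clS this opU US]
      have z: "\<bar>Im z\<bar> \<le> Re z" "cmod z \<le> R" "\<bar>Im z\<bar> = Re z \<or> cmod z = R" by (auto simp: S_def)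
      have re0: "Re (\<phi> z) \<ge> 0" using re[OF z(1)] by (rule order_trans[rotated]) auto
      show "norm (h z) \<le> B"
      proof (cases "\<bar>Im z\<bar> = Re z")
        case True
        have "cmod (h z) \<le> B * 1" unfolding nh using b[OF True] B re0 \<delta> by (intro mult_mono) auto
        then show ?thesis by simp
      next
        case False
        then have zR: "cmod z = R" using z by auto
        have "8 * (k + 1) / \<delta> \<le> sqrt (R / 2)" using R(3) \<delta> k by (intro real_le_rsqrt) auto
        then have "R / 8 * (8 * (k + 1) / \<delta>) \<le> R / 8 * sqrt (R / 2)" using R0 by (intro mult_left_mono) auto
        also have "\<dots> \<le> Re (\<phi> z)" using re[OF z(1)] zR by simp
        finally have "R * (k + 1) \<le> \<delta> * Re (\<phi> z)" using \<delta> by (simp add: field_simps)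
        then have "exp (- (\<delta> * Re (\<phi> z))) \<le> exp (- (R * (k + 1)))" by simp
        then have "cmod (h z) \<le> (A * exp (k * R)) * exp (- (R * (k + 1)))"
          unfolding nh using g[OF z(1)] zR A by (intro mult_mono) auto
        also have "\<dots> = A * exp (- R)" by (simp add: algebra_simps flip: exp_add)
        also have "\<dots> \<le> B"
        proof -
          have "A \<le> B * R" using R(2) B by (simp add: field_simps)
          also have "B * R \<le> B * exp R"
          proof (rule mult_left_mono)
            show "R \<le> exp R" using exp_ge_add_one_self[of R] by linarith
          qed (use B in simp)
          finally show ?thesis by (simp add: exp_minus field_simps)
        qed
        finally show ?thesis .
      qed
    qed
    then have "cmod (f \<xi>) * exp (- (\<delta> * Re (\<phi> \<xi>))) \<le> B" by (simp add: nh)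
    then show ?thesis by (simp add: exp_minus field_simps)
  qed
  have "((\<lambda>\<delta>. B * exp (\<delta> * Re (\<phi> \<xi>))) \<longlongrightarrow> B * exp (0 * Re (\<phi> \<xi>))) (at_right 0)"
    by (intro tendsto_intros)
  then have "cmod (f \<xi>) \<le> B * exp (0 * Re (\<phi> \<xi>))"
    by (rule tendsto_lowerbound) (simp_all add: eventually_mono[OF eventually_at_right_less main])
  then show ?thesis by simp
qed

text \<open>A half plane is too wide for growth of order 1, so it is cut along the imaginary axis,
  where \<open>G\<close> is bounded by the constant \<open>C\<close> of the type estimate. This
  \<open>C\<close> depends on \<open>\<epsilon>\<close> and would not survive the limit; a second
  pass, now for a function known to be bounded, restores \<open>B\<close>.\<close>

lemma Phragmen_Lindelof_half_plane:
  assumes F: "F holomorphic_on UNIV" and a: "a \<ge> 0" and t: "exp_type_le F a" and B: "B > 0"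
    and b: "\<And>x. cmod (F (of_real x)) \<le> B" and z: "Im z \<ge> 0"
  shows "cmod (F z) \<le> B * exp (a * Im z)"
proof -
  have eps: "cmod (F z) \<le> B * exp ((a + \<epsilon>) * Im z)" if e: "\<epsilon> > 0" for \<epsilon>
  proof -
    obtain C where C: "\<And>z. cmod (F z) \<le> C * exp ((a + \<epsilon>) * cmod z)" using t e unfolding exp_type_le_def by blast
    have C0: "C \<ge> 0" using order_trans[OF norm_ge_zero C[of 0]] by simp
    define G where "G z = F z * exp (\<i> * of_real (a + \<epsilon>) * z)" for z
    have hG: "G holomorphic_on UNIV" unfolding G_def by (intro holomorphic_intros F)
    have nG: "cmod (G z) = cmod (F z) * exp (- ((a + \<epsilon>) * Im z))" for z
      by (simp add: G_def norm_mult)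
    define B' where "B' = max B C"
    have B': "B' > 0" "B \<le> B'" "C \<le> B'" using B by (auto simp: B'_def)
    \<comment> \<open>Multiplication by \<open>1 + \<i>\<close> and by \<open>- 1 + \<i>\<close>
      carries the sector onto the first and the second quadrant.\<close>
    have quarter: "cmod (G (u * \<zeta>)) \<le> B'"
      if u: "u = 1 + \<i> \<or> u = - 1 + \<i>" and \<zeta>: "\<bar>Im \<zeta>\<bar> \<le> Re \<zeta>" for u \<zeta>
    proof (rule Phragmen_Lindelof_quarter_plane[where f = "\<lambda>\<zeta>. G (u * \<zeta>)" and k = "4 * (a + \<epsilon>)" and A = C])
      show "(\<lambda>\<zeta>. G (u * \<zeta>)) holomorphic_on UNIV"
        using holomorphic_on_compose_gen[OF _ hG, of "\<lambda>\<zeta>. u * \<zeta>" UNIV] by (auto simp: o_def intro!: holomorphic_intros)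
      have nu: "cmod u \<le> 2"
      proof -
        have "cmod (1 + \<i>) \<le> 2" "cmod (- 1 + \<i>) \<le> 2"
          by (rule order_trans[OF norm_triangle_ineq], simp)+
        then show ?thesis using u by blast
      qed
      fix x :: complex
      show "cmod (G (u * x)) \<le> C * exp (4 * (a + \<epsilon>) * cmod x)"
      proof -
        have "cmod (G (u * x)) \<le> (C * exp ((a + \<epsilon>) * cmod (u * x))) * exp ((a + \<epsilon>) * cmod (u * x))"
        proof -
          have "- Im (u * x) \<le> cmod (u * x)" using abs_Im_le_cmod[of "u * x"] by linarith
          then have "- ((a + \<epsilon>) * Im (u * x)) \<le> (a + \<epsilon>) * cmod (u * x)"
            using a e mult_left_mono[of "- Im (u * x)" "cmod (u * x)" "a + \<epsilon>"] by linarith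
          then show ?thesis unfolding nG using C[of "u * x"] C0 by (intro mult_mono) auto
        qed
        also have "\<dots> = C * exp (2 * (a + \<epsilon>) * cmod (u * x))" by (simp add: algebra_simps flip: exp_add)
        also have "\<dots> \<le> C * exp (2 * (a + \<epsilon>) * (2 * cmod x))"
        proof -
          have "cmod (u * x) \<le> 2 * cmod x" using nu by (simp add: norm_mult mult_right_mono)
          then have "2 * (a + \<epsilon>) * cmod (u * x) \<le> 2 * (a + \<epsilon>) * (2 * cmod x)"
            using a e by (intro mult_left_mono) auto
          then show ?thesis using C0 by (intro mult_left_mono) auto
        qed
        finally show ?thesis by (simp add: algebra_simps)
      qed
      assume x: "\<bar>Im x\<bar> = Re x"
      define v where "v = u * x"
      have "Im v = 0 \<or> (Re v = 0 \<and> Im v \<ge> 0)"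
        using u x by (auto simp: v_def abs_if split: if_splits)
      then show "cmod (G (u * x)) \<le> B'"
      proof
        assume "Im v = 0"
        then have "v = of_real (Re v)" by (simp add: complex_eq_iff)
        then have "cmod (F v) \<le> B" using b[of "Re v"] by simp
        then show ?thesis using \<open>Im v = 0\<close> B' by (simp add: nG flip: v_def)
      next
        assume v: "Re v = 0 \<and> Im v \<ge> 0"
        then have "cmod v = Im v" by (simp add: cmod_def)
        then have "cmod (G v) \<le> (C * exp ((a + \<epsilon>) * Im v)) * exp (- ((a + \<epsilon>) * Im v))"
          unfolding nG using C[of v] by (intro mult_right_mono) auto
        also have "\<dots> = C" by (simp add: exp_minus)
        finally show ?thesis using B' by (simp add: v_def)
      qed
    qed (use B' a e \<zeta> in auto)
    have G_bd: "cmod (G w) \<le> B'" if w: "Im w \<ge> 0" for w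
    proof (cases "Re w \<ge> 0")
      case True
      define \<zeta> where "\<zeta> = Complex ((Re w + Im w) / 2) ((Im w - Re w) / 2)"
      have "w = (1 + \<i>) * \<zeta>" by (simp add: \<zeta>_def complex_eq_iff field_simps)
      moreover have "\<bar>Im \<zeta>\<bar> \<le> Re \<zeta>" using True w by (simp add: \<zeta>_def)
      ultimately show ?thesis using quarter[of "1 + \<i>" \<zeta>] by simp
    next
      case False
      define \<zeta> where "\<zeta> = Complex ((Im w - Re w) / 2) (- (Re w + Im w) / 2)"
      have "w = (-1 + \<i>) * \<zeta>" by (simp add: \<zeta>_def complex_eq_iff field_simps)
      moreover have "\<bar>Im \<zeta>\<bar> \<le> Re \<zeta>" using False w by (simp add: \<zeta>_def)
      ultimately show ?thesis using quarter[of "-1 + \<i>" \<zeta>] by simp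
    qed
    \<comment> \<open>Dividing by \<open>1 - \<i> * of_real \<delta> * z\<close>, which has modulus
      at least 1 in the half plane and grows linearly, makes the large arc harmless once
      \<open>B' \<le> B * (\<delta> * R)\<close>.\<close>
    have main: "cmod (G z) \<le> B * cmod (1 - \<i> * of_real \<delta> * z)" if \<delta>: "\<delta> > 0" for \<delta>
    proof -
      define R where "R = max (cmod z) (B' / (\<delta> * B))"
      have R: "cmod z \<le> R" "B' / (\<delta> * B) \<le> R" by (auto simp: R_def)
      define S where "S = {z. 0 \<le> Im z} \<inter> cball 0 R"
      have clS: "closed S" unfolding S_def
        by (intro closed_Int closed_cball closed_Collect_le continuous_intros)
      have opU: "open ({z. 0 < Im z} \<inter> ball 0 R)"
        by (intro open_Int open_ball open_Collect_less continuous_intros)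
      have US: "{z. 0 < Im z} \<inter> ball 0 R \<subseteq> S" by (auto simp: S_def)
      have n1: "cmod (1 - \<i> * of_real \<delta> * w) \<ge> 1" "cmod (1 - \<i> * of_real \<delta> * w) \<ge> \<delta> * cmod w" if "Im w \<ge> 0" for w
      proof -
        have sq: "(cmod (1 - \<i> * of_real \<delta> * w))\<^sup>2 = (1 + \<delta> * Im w)\<^sup>2 + (\<delta> * Re w)\<^sup>2"
          by (simp add: cmod_power2)
        have "1\<^sup>2 \<le> (1 + \<delta> * Im w)\<^sup>2" using \<delta> that by (intro power_mono) auto
        then have "1\<^sup>2 \<le> (cmod (1 - \<i> * of_real \<delta> * w))\<^sup>2" unfolding sq by (simp add: add_increasing2)
        then show "cmod (1 - \<i> * of_real \<delta> * w) \<ge> 1" by (rule power2_le_imp_le) simp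
        have "(\<delta> * Im w)\<^sup>2 \<le> (1 + \<delta> * Im w)\<^sup>2" using \<delta> that by (intro power_mono) auto
        then have "(\<delta> * cmod w)\<^sup>2 \<le> (cmod (1 - \<i> * of_real \<delta> * w))\<^sup>2"
          unfolding sq unfolding power_mult_distrib cmod_power2[of w] distrib_left by linarith
        then show "cmod (1 - \<i> * of_real \<delta> * w) \<ge> \<delta> * cmod w" by (rule power2_le_imp_le) simp
      qed
      have nz: "1 - \<i> * of_real \<delta> * w \<noteq> 0" if "w \<in> S" for w
        using n1(1)[of w] that by (auto simp: S_def)
      define h where "h w = G w / (1 - \<i> * of_real \<delta> * w)" for w
      have hol: "h holomorphic_on S"
        unfolding h_def by (intro holomorphic_intros holomorphic_on_subset[OF hG] nz) auto
      have "norm (h z) \<le> B"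
      proof (rule maximum_modulus_frontier[where S = S and f = h])
        show "h holomorphic_on interior S" using hol interior_subset holomorphic_on_subset by blast
        show "continuous_on (closure S) h" using hol clS by (simp add: holomorphic_on_imp_continuous_on)
        show "bounded S" unfolding S_def by (intro bounded_Int) auto
        show "z \<in> S" using z R by (simp add: S_def)
        fix w assume "w \<in> frontier S"
        from frontier_closed_subset[OF clS this opU US]
        have w: "Im w \<ge> 0" "Im w = 0 \<or> cmod w = R" by (auto simp: S_def)
        show "norm (h w) \<le> B"
        proof (cases "Im w = 0")
          case True
          then have "w = of_real (Re w)" by (simp add: complex_eq_iff)
          then have "cmod (F w) \<le> B" using b[of "Re w"] by simp
          then have "cmod (G w) \<le> B" using True by (simp add: nG)
          moreover have "B \<le> B * cmod (1 - \<i> * of_real \<delta> * w)" using n1(1)[OF w(1)] B by simp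
          ultimately show ?thesis using n1(1)[OF w(1)] unfolding h_def norm_divide by (subst pos_divide_le_eq) auto
        next
          case False
          then have wR: "cmod w = R" using w by auto
          have "B' \<le> B * (\<delta> * R)" using R(2) B \<delta> by (simp add: field_simps)
          also have "\<dots> \<le> B * cmod (1 - \<i> * of_real \<delta> * w)" using n1(2)[OF w(1)] B wR by (intro mult_left_mono) auto
          finally have "cmod (G w) \<le> B * cmod (1 - \<i> * of_real \<delta> * w)" using G_bd[OF w(1)] by linarith
          then show ?thesis using n1(1)[OF w(1)] unfolding h_def norm_divide by (subst pos_divide_le_eq) auto
        qed
      qed
      then show ?thesis using n1(1)[OF z] unfolding h_def norm_divide by (subst (asm) pos_divide_le_eq) auto
    qed
    have "((\<lambda>\<delta>. B * cmod (1 - \<i> * of_real \<delta> * z)) \<longlongrightarrow> B * cmod (1 - \<i> * of_real 0 * z)) (at_right 0)"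
      by (intro tendsto_intros)
    then have "cmod (G z) \<le> B * cmod (1 - \<i> * of_real 0 * z)"
      by (rule tendsto_lowerbound) (simp_all add: eventually_mono[OF eventually_at_right_less main])
    then have "cmod (F z) * exp (- ((a + \<epsilon>) * Im z)) \<le> B" by (simp add: nG)
    then have "cmod (F z) * exp (- ((a + \<epsilon>) * Im z)) * exp ((a + \<epsilon>) * Im z) \<le> B * exp ((a + \<epsilon>) * Im z)"
      by (rule mult_right_mono) simp
    then show ?thesis unfolding mult.assoc exp_add[symmetric] by simp
  qed
  have "((\<lambda>\<epsilon>. B * exp ((a + \<epsilon>) * Im z)) \<longlongrightarrow> B * exp ((a + 0) * Im z)) (at_right 0)"
    by (intro tendsto_intros)
  then have "cmod (F z) \<le> B * exp ((a + 0) * Im z)"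
    by (rule tendsto_lowerbound) (simp_all add: eventually_mono[OF eventually_at_right_less eps])
  then show ?thesis by simp
qed

section \<open>Paley-Wiener functions and the de Branges space of an exponential\<close>

lemma exp_type_le_shift_average:
  assumes \<Phi>: "\<And>z. (\<Phi> has_field_derivative f z) (at z)" and r: "0 \<le> r" "r \<le> 1"
    and t: "exp_type_le f a" and a: "a \<ge> 0"
  shows "exp_type_le (\<lambda>z. \<Phi> (z + of_real r) - \<Phi> z) a"
  unfolding exp_type_le_def
proof (intro allI impI)
  fix \<epsilon> :: real assume e: "\<epsilon> > 0"
  then obtain C where C: "\<And>z. cmod (f z) \<le> C * exp ((a + \<epsilon>) * cmod z)" using t unfolding exp_type_le_def by blast
  have C0: "C \<ge> 0" using order_trans[OF norm_ge_zero C[of 0]] by simp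
  have "cmod (\<Phi> (z + of_real r) - \<Phi> z) \<le> (C * exp (a + \<epsilon>)) * exp ((a + \<epsilon>) * cmod z)" for z
  proof -
    have "cmod (\<Phi> (z + of_real r) - \<Phi> z) \<le> (C * exp ((a + \<epsilon>) * (cmod z + 1))) * cmod (z + of_real r - z)"
    proof (rule field_differentiable_bound[where S = "closed_segment z (z + of_real r)" and f' = f])
      fix w assume w: "w \<in> closed_segment z (z + of_real r)"
      show "(\<Phi> has_field_derivative f w) (at w within closed_segment z (z + of_real r))"
        using \<Phi> has_field_derivative_at_within by blast
      have "dist w z \<le> dist z (z + of_real r)" using w by (metis dist_in_closed_segment(1) dist_commute)
      then have "cmod w \<le> cmod z + 1" using r norm_triangle_sub[of w z] by (simp add: dist_norm)
      then have "C * exp ((a + \<epsilon>) * cmod w) \<le> C * exp ((a + \<epsilon>) * (cmod z + 1))"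
        using C0 a e by (intro mult_left_mono) (auto intro!: mult_left_mono)
      then show "cmod (f w) \<le> C * exp ((a + \<epsilon>) * (cmod z + 1))" using C[of w] by linarith
    qed auto
    also have "\<dots> \<le> (C * exp ((a + \<epsilon>) * (cmod z + 1))) * 1"
      using C0 r by (intro mult_left_mono) auto
    finally show ?thesis by (simp add: distrib_left exp_add mult_ac)
  qed
  then show "\<exists>C. \<forall>z. cmod (\<Phi> (z + of_real r) - \<Phi> z) \<le> C * exp ((a + \<epsilon>) * cmod z)" by blast
qed

lemma Phragmen_Lindelof_strip:
  assumes F: "F holomorphic_on UNIV" and a: "a \<ge> 0" and t: "exp_type_le F a" and B: "B > 0"
    and b: "\<And>x. cmod (F (of_real x)) \<le> B"
  shows "cmod (F z) \<le> B * exp (a * \<bar>Im z\<bar>)"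
proof (cases "Im z \<ge> 0")
  case True
  then show ?thesis using Phragmen_Lindelof_half_plane[OF F a t B b, of z] by simp
next
  case False
  have h: "(\<lambda>z. F (- z)) holomorphic_on UNIV"
    using holomorphic_on_compose_gen[OF holomorphic_on_minus[OF holomorphic_on_ident] F, of UNIV] by (simp add: o_def)
  have t': "exp_type_le (\<lambda>z. F (- z)) a"
    using t unfolding exp_type_le_def by (metis norm_minus_cancel)
  have "cmod (F (- (- z))) \<le> B * exp (a * Im (- z))"
    by (rule Phragmen_Lindelof_half_plane[OF h a t' B]) (use False b[of "- _"] in auto)
  then show ?thesis using False by simp
qed

text \<open>No pointwise bound for \<open>f\<close> on the axis is available at the start, so
  Phragmen-Lindelof is applied to the integral \<open>G\<close> of \<open>f\<close> over a segment
  of length \<open>r \<le> 1\<close>: it has the same type and is bounded on the axis by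
  Cauchy-Schwarz. Cauchy's inequality for \<open>G\<close> on a unit disc controls the oscillation
  of \<open>f\<close>, and \<open>norm_le_if_slowly_varying\<close> finishes.\<close>

lemma paley_wiener_bounded_on_real:
  assumes f: "f \<in> paley_wiener a" and a: "a \<ge> 0"
  shows "\<exists>B>0. \<forall>x. cmod (f (of_real x)) \<le> B"
proof -
  have h: "f holomorphic_on UNIV" and t: "exp_type_le f a"
    and i: "integrable lborel (\<lambda>x::real. (cmod (f (of_real x)))\<^sup>2)" using f by (auto simp: paley_wiener_def)
  define N where "N = (\<integral>x. (cmod (f (of_real x)))\<^sup>2 \<partial>lborel)"
  obtain \<Phi> where "\<And>z. z \<in> UNIV \<Longrightarrow> (\<Phi> has_field_derivative f z) (at z within UNIV)"
    using holomorphic_convex_primitive'[OF convex_UNIV open_UNIV h] by blast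
  then have \<Phi>: "(\<Phi> has_field_derivative f z) (at z)" for z by simp
  have cr: "continuous_on UNIV (\<lambda>x::real. f (of_real x))"
    by (rule continuous_on_compose2[OF holomorphic_on_imp_continuous_on[OF h]]) (auto intro!: continuous_intros)
  have N0: "N \<ge> 0" unfolding N_def by simp
  define B where "B = sqrt N + 1"
  have B: "B > 0" using N0 by (simp add: B_def add_nonneg_pos)
  have var: "cmod (f (of_real x) - f (of_real x0)) \<le> B * exp a" if x: "x \<in> {x0..x0 + 1}" for x x0
  proof -
    define r where "r = x - x0"
    have r: "0 \<le> r" "r \<le> 1" using x by (auto simp: r_def)
    define G where "G w = \<Phi> (w + of_real r) - \<Phi> w" for w
    have dG: "(G has_field_derivative (f (w + of_real r) - f w)) (at w)" for w
      unfolding G_def by (auto intro!: derivative_eq_intros DERIV_chain'[where g = \<Phi>, OF _ \<Phi>] \<Phi>)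
    have hG: "G holomorphic_on UNIV" using dG holomorphic_on_open[OF open_UNIV] by blast
    have tG: "exp_type_le G a" unfolding G_def by (rule exp_type_le_shift_average[OF \<Phi> r t a])
    have bG: "cmod (G (of_real s)) \<le> B" for s
    proof -
      have "((\<lambda>u. f (0 + of_real u * 1) * 1) has_integral \<Phi> (0 + of_real (s + r) * 1) - \<Phi> (0 + of_real s * 1)) {s..s + r}"
        by (rule primitive_along_line[where S = UNIV]) (use \<Phi> r in auto)
      then have "G (of_real s) = integral {s..s + r} (\<lambda>u. f (of_real u))"
        by (simp add: G_def integral_unique)
      also have "cmod \<dots> \<le> sqrt (N * r)"
        by (rule integral_norm_interval_le(2)[OF cr i]) (use r in \<open>auto simp: N_def\<close>)
      also have "\<dots> \<le> sqrt (N * 1)" using r N0 by (intro real_sqrt_le_mono mult_left_mono) auto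
      finally show ?thesis by (simp add: B_def)
    qed
    have "cmod (f (of_real x0 + of_real r) - f (of_real x0)) \<le> (B * exp a) / 1"
    proof (rule Cauchy_inequality_deriv[OF hG open_UNIV _ _ _ dG])
      fix w assume w: "w \<in> cball (complex_of_real x0) 1"
      have "\<bar>Im w\<bar> \<le> 1" using abs_Im_le_cmod[of "of_real x0 - w"] w by (simp add: dist_norm)
      then have "a * \<bar>Im w\<bar> \<le> a" using a mult_left_mono[of "\<bar>Im w\<bar>" 1 a] by simp
      then have "B * exp (a * \<bar>Im w\<bar>) \<le> B * exp a" using B by simp
      then show "cmod (G w) \<le> B * exp a" using Phragmen_Lindelof_strip[OF hG a tG B bG, of w] by linarith
    qed auto
    then show ?thesis by (simp add: r_def)
  qed
  have "cmod (f (of_real x)) \<le> sqrt (N / 1) + B * exp a" for x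
    by (rule norm_le_if_slowly_varying[OF cr i]) (use var in \<open>auto simp: N_def\<close>)
  moreover have "sqrt (N / 1) + B * exp a > 0" using N0 B by (simp add: add_nonneg_pos)
  ultimately show ?thesis by blast
qed

lemma norm_exp_i: "cmod (exp (- \<i> * of_real a * z)) = exp (a * Im z)"
  by simp

text \<open>The bound on the axis and Phragmen-Lindelof make the quotient bounded in the half plane.
  This is the growth condition under which \<open>line_square_integral_le\<close> transfers the norm
  on the axis to parallel lines.\<close>

lemma paley_wiener_hardy:
  assumes f: "f \<in> paley_wiener a" and a: "a \<ge> 0"
  shows "hardy2_upper (\<lambda>z. f z / exp (- \<i> * of_real a * z))"
proof -
  have h: "f holomorphic_on UNIV" and t: "exp_type_le f a"
    and i: "integrable lborel (\<lambda>x::real. (cmod (f (of_real x)))\<^sup>2)" using f by (auto simp: paley_wiener_def)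
  obtain B where B: "B > 0" "\<And>x. cmod (f (of_real x)) \<le> B" using paley_wiener_bounded_on_real[OF f a] by blast
  define g where "g z = f z / exp (- \<i> * of_real a * z)" for z
  have hg: "g holomorphic_on UNIV" unfolding g_def by (intro holomorphic_intros h) auto
  have bg: "cmod (g z) \<le> B * (1 + 1 / sqrt (Im z))" if z: "Im z > 0" for z
  proof -
    have "cmod (f z) \<le> B * exp (a * Im z)" using Phragmen_Lindelof_half_plane[OF h a t B] z by simp
    then have "cmod (g z) \<le> B" by (simp only: g_def norm_divide norm_exp_i) (simp add: field_simps)
    also have "\<dots> \<le> B * (1 + 1 / sqrt (Im z))" using B z mult_left_mono[of 1 "1 + 1 / sqrt (Im z)" B] by simp
    finally show ?thesis .
  qed
  have gr: "cmod (g (of_real x)) = cmod (f (of_real x))" for x by (simp only: g_def norm_divide norm_exp_i) simp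
  have c: "continuous_on {z. 0 \<le> Im z} g" and hu: "g holomorphic_on upper_half"
    using hg holomorphic_on_imp_continuous_on holomorphic_on_subset by blast+
  have ig: "integrable lborel (\<lambda>x::real. (cmod (g (of_real x)))\<^sup>2)" unfolding gr by (rule i)
  show ?thesis
    unfolding hardy2_upper_def g_def[symmetric]
    using line_square_integral_le[OF c hu _ bg ig] hu by blast
qed

lemma holomorphic_cnj_cnj_UNIV:
  assumes "f holomorphic_on UNIV" shows "(\<lambda>z. cnj (f (cnj z))) holomorphic_on UNIV"
proof -
  have "cnj \<circ> f \<circ> cnj holomorphic_on UNIV"
    by (rule holomorphic_on_compose_cnj_cnj) (use assms in \<open>auto simp: surj_def intro: complex_cnj_cnj[symmetric] holomorphic_on_subset\<close>)
  then show ?thesis by (simp add: o_def)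
qed

lemma paley_wiener_cnj:
  assumes f: "f \<in> paley_wiener a"
  shows "(\<lambda>z. cnj (f (cnj z))) \<in> paley_wiener a"
proof -
  have "exp_type_le (\<lambda>z. cnj (f (cnj z))) a"
    using f unfolding paley_wiener_def exp_type_le_def by auto (metis complex_mod_cnj)
  then show ?thesis using f holomorphic_cnj_cnj_UNIV[of f] by (auto simp: paley_wiener_def)
qed

text \<open>Multiplying by \<open>(z - c)\<^sup>2 - \<rho>\<^sup>2\<close>, which vanishes where the circle meets the
  real axis, turns the singular bound on the circle into a bounded one.\<close>

lemma bound_across_real_axis:
  assumes F: "F holomorphic_on UNIV" and r: "\<rho> > 0"
    and b: "\<And>z. cmod (z - of_real c) = \<rho> \<Longrightarrow> Im z \<noteq> 0 \<Longrightarrow> cmod (F z) \<le> M / sqrt \<bar>Im z\<bar>"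
    and z: "cmod (z - of_real c) \<le> \<rho> / 2"
  shows "cmod (F z) \<le> 8 / 3 * M / sqrt \<rho>"
proof -
  define h where "h w = F w * ((w - of_real c)\<^sup>2 - (of_real \<rho>)\<^sup>2)" for w
  have hol: "h holomorphic_on UNIV" unfolding h_def by (intro holomorphic_intros F)
  have M: "M \<ge> 0"
  proof -
    have "0 \<le> M / sqrt \<bar>Im (of_real c + \<i> * of_real \<rho>)\<bar>"
      by (rule order_trans[OF norm_ge_zero b]) (use r in \<open>auto simp: norm_mult\<close>)
    then show ?thesis using r by (simp add: zero_le_divide_iff)
  qed
  have "norm (h z) \<le> 2 * \<rho> * M * sqrt \<rho>"
  proof (rule maximum_modulus_frontier[where S = "cball (of_real c) \<rho>" and f = h])
    show "h holomorphic_on interior (cball (of_real c) \<rho>)" using hol holomorphic_on_subset by blast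
    show "continuous_on (closure (cball (of_real c) \<rho>)) h"
      using hol holomorphic_on_imp_continuous_on continuous_on_subset by blast
    show "z \<in> cball (of_real c) \<rho>" using z r by (simp add: dist_norm norm_minus_commute)
    fix w assume "w \<in> frontier (cball (complex_of_real c) \<rho>)"
    then have w: "cmod (w - of_real c) = \<rho>" using r by (simp add: dist_norm norm_minus_commute)
    define v where "v = w - of_real c"
    have v: "cmod v = \<rho>" "Im v = Im w" using w by (auto simp: v_def)
    \<comment> \<open>On the circle the square of \<open>\<rho>\<close> is \<open>v * cnj v\<close>,
      so the multiplier is \<open>v * (v - cnj v)\<close>, of modulus
      \<open>2 * \<rho> * \<bar>Im w\<bar>\<close>; this absorbs the singularity.\<close>
    have "v\<^sup>2 - (of_real \<rho>)\<^sup>2 = v * (v - cnj v)"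
      using v by (metis complex_norm_square mult.commute of_real_power power2_eq_square right_diff_distrib)
    moreover have "v - cnj v = of_real (2 * Im v) * \<i>" by (simp add: complex_eq_iff)
    ultimately have k: "cmod (v\<^sup>2 - (of_real \<rho>)\<^sup>2) = \<rho> * (2 * \<bar>Im w\<bar>)" using v by (simp add: norm_mult)
    show "norm (h w) \<le> 2 * \<rho> * M * sqrt \<rho>"
    proof (cases "Im w = 0")
      case True
      then show ?thesis using k M r by (simp add: h_def norm_mult v_def[symmetric])
    next
      case False
      have "norm (h w) = cmod (F w) * (\<rho> * (2 * \<bar>Im w\<bar>))"
        using k by (simp add: h_def norm_mult v_def[symmetric])
      also have "\<dots> \<le> (M / sqrt \<bar>Im w\<bar>) * (\<rho> * (2 * \<bar>Im w\<bar>))"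
        using b[OF w False] r by (intro mult_right_mono) auto
      also have "\<dots> = 2 * \<rho> * M * sqrt \<bar>Im w\<bar>"
        using False by (simp add: field_simps flip: power2_eq_square)
      also have "\<dots> \<le> 2 * \<rho> * M * sqrt \<rho>"
        using abs_Im_le_cmod[of v] v M r by (intro mult_left_mono) auto
      finally show ?thesis .
    qed
  qed auto
  moreover have "cmod ((z - of_real c)\<^sup>2 - (of_real \<rho>)\<^sup>2) \<ge> 3 / 4 * \<rho>\<^sup>2"
  proof -
    have "cmod ((z - of_real c)\<^sup>2) \<le> (\<rho> / 2)\<^sup>2" unfolding norm_power using z by (intro power_mono) auto
    moreover have "cmod ((complex_of_real \<rho>)\<^sup>2) = \<rho>\<^sup>2" by (simp add: norm_power)
    ultimately show ?thesis
      using norm_triangle_ineq2[of "(of_real \<rho>)\<^sup>2" "(z - of_real c)\<^sup>2"] unfolding norm_minus_commute[of "(of_real \<rho>)\<^sup>2"] by (simp add: power_divide)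
  qed
  ultimately have "cmod (F z) * (3 / 4 * \<rho>\<^sup>2) \<le> 2 * \<rho> * M * sqrt \<rho>"
    unfolding h_def norm_mult by (meson mult_left_mono norm_ge_zero order_trans)
  then have "cmod (F z) \<le> 2 * \<rho> * M * sqrt \<rho> / (3 / 4 * \<rho>\<^sup>2)" using r by (subst pos_le_divide_eq) auto
  also have "\<dots> = 8 / 3 * M * (sqrt \<rho> / \<rho>)" using r by (simp add: power2_eq_square field_simps)
  also have "sqrt \<rho> / \<rho> = 1 / sqrt \<rho>" using r by (simp add: field_simps)
  finally show ?thesis by simp
qed

text \<open>Makes the Paley-Wiener space a de Branges space with explicit kernel, which is the model
  for all comparisons. For the inclusion into the Paley-Wiener space, the two Hardy conditions bound
  \<open>f\<close> off the axis with a singularity at the axis, which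
  \<open>bound_across_real_axis\<close> removes.\<close>

lemma de_branges_exp_eq_paley_wiener:
  assumes a: "a > 0"
  shows "de_branges_space (\<lambda>z. exp (- \<i> * of_real a * z)) = paley_wiener a"
proof (intro set_eqI iffI)
  fix f assume f: "f \<in> paley_wiener a"
  then show "f \<in> de_branges_space (\<lambda>z. exp (- \<i> * of_real a * z))"
    using paley_wiener_hardy[OF f] paley_wiener_hardy[OF paley_wiener_cnj[OF f]] a
    by (auto simp: de_branges_space_def paley_wiener_def)
next
  fix f assume f: "f \<in> de_branges_space (\<lambda>z. exp (- \<i> * of_real a * z))"
  define E where "E z = exp (- \<i> * of_real a * z)" for z
  have hf: "f holomorphic_on UNIV" and h1: "hardy2_upper (\<lambda>z. f z / E z)" and h2: "hardy2_upper (\<lambda>z. cnj (f (cnj z)) / E z)"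
    using f by (auto simp: de_branges_space_def E_def)
  obtain C1 where C1: "\<And>y. y > 0 \<Longrightarrow> integrable lborel (\<lambda>x. (cmod (f (Complex x y) / E (Complex x y)))\<^sup>2)"
      "\<And>y. y > 0 \<Longrightarrow> (\<integral>x. (cmod (f (Complex x y) / E (Complex x y)))\<^sup>2 \<partial>lborel) \<le> C1"
    using h1 unfolding hardy2_upper_def by blast
  obtain C2 where C2: "\<And>y. y > 0 \<Longrightarrow> integrable lborel (\<lambda>x. (cmod (cnj (f (cnj (Complex x y))) / E (Complex x y)))\<^sup>2)"
      "\<And>y. y > 0 \<Longrightarrow> (\<integral>x. (cmod (cnj (f (cnj (Complex x y))) / E (Complex x y)))\<^sup>2 \<partial>lborel) \<le> C2"
    using h2 unfolding hardy2_upper_def by blast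
  define C where "C = max C1 C2"
  have E: "cmod (E z) = exp (a * Im z)" "E z \<noteq> 0" for z by (simp_all add: E_def)
  have bd: "cmod (f z) \<le> 3 * sqrt C * exp (a * \<bar>Im z\<bar>) / sqrt \<bar>Im z\<bar>" if z: "Im z \<noteq> 0" for z
  proof (cases "Im z > 0")
    case True
    have "cmod (f z / E z) \<le> 3 * sqrt (C1 / Im z)"
      by (rule hardy_pointwise_bound[where f = "\<lambda>z. f z / E z", OF _ C1 True]) (use h1 in \<open>auto simp: hardy2_upper_def\<close>)
    also have "\<dots> \<le> 3 * sqrt (C / Im z)" using True by (auto simp: C_def intro!: divide_right_mono)
    finally have "cmod (f z) \<le> 3 * sqrt (C / Im z) * exp (a * Im z)"
      by (simp add: norm_divide E pos_divide_le_eq)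
    then show ?thesis using True by (simp add: real_sqrt_divide mult.commute)
  next
    case False
    then have z': "Im (cnj z) > 0" using z by simp
    have "cmod (cnj (f (cnj (cnj z))) / E (cnj z)) \<le> 3 * sqrt (C2 / Im (cnj z))"
      by (rule hardy_pointwise_bound[where f = "\<lambda>z. cnj (f (cnj z)) / E z", OF _ C2 z']) (use h2 in \<open>auto simp: hardy2_upper_def\<close>)
    also have "\<dots> \<le> 3 * sqrt (C / Im (cnj z))" using z' by (intro mult_left_mono real_sqrt_le_mono divide_right_mono) (auto simp: C_def)
    finally have "cmod (f z) \<le> 3 * sqrt (C / Im (cnj z)) * exp (a * Im (cnj z))"
      by (simp add: norm_divide E pos_divide_le_eq)
    moreover have "\<bar>Im z\<bar> = Im (cnj z)" using z' by simp
    ultimately show ?thesis unfolding real_sqrt_divide by (simp only: times_divide_eq_left times_divide_eq_right)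
  qed
  \<comment> \<open>Circles of radius 2 about real points surround the strip
    \<open>\<bar>Im z\<bar> \<le> 1\<close> at half their radius; on them the exponential factor is
    at most \<open>exp (2 * a)\<close>.\<close>
  define D where "D = 3 * sqrt C * exp (2 * a)"
  have C0: "C \<ge> 0"
  proof -
    have "0 \<le> (\<integral>x. (cmod (f (Complex x 1) / E (Complex x 1)))\<^sup>2 \<partial>lborel)" by (rule Bochner_Integration.integral_nonneg) simp
    also have "\<dots> \<le> C1" by (rule C1(2)) simp
    finally show ?thesis by (simp add: C_def le_max_iff_disj)
  qed
  have D: "3 * sqrt C * exp a \<le> D" "D \<ge> 0" using a C0 by (auto simp: D_def intro!: mult_left_mono)
  have near: "cmod (f z) \<le> 8 / 3 * D" if z: "\<bar>Im z\<bar> \<le> 1" for z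
  proof -
    have "cmod (f z) \<le> 8 / 3 * D / sqrt 2"
    proof (rule bound_across_real_axis[OF hf, where c = "Re z"])
      fix w assume w: "cmod (w - of_real (Re z)) = 2" "Im w \<noteq> 0"
      have "\<bar>Im w\<bar> \<le> 2" using abs_Im_le_cmod[of "w - of_real (Re z)"] w by simp
      then have "exp (a * \<bar>Im w\<bar>) \<le> exp (2 * a)" using a by simp
      then have "3 * sqrt C * exp (a * \<bar>Im w\<bar>) / sqrt \<bar>Im w\<bar> \<le> D / sqrt \<bar>Im w\<bar>"
        unfolding D_def using C0 by (intro divide_right_mono mult_left_mono) auto
      then show "cmod (f w) \<le> D / sqrt \<bar>Im w\<bar>" using bd[OF w(2)] by linarith
    next
      have "z - of_real (Re z) = \<i> * of_real (Im z)" by (simp add: complex_eq_iff)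
      then show "cmod (z - of_real (Re z)) \<le> 2 / 2" using z by (simp add: norm_mult)
    qed auto
    also have "\<dots> \<le> 8 / 3 * D / 1" using D(2) by (intro divide_left_mono) auto
    finally show ?thesis by simp
  qed
  have all: "cmod (f z) \<le> 8 / 3 * D * exp (a * cmod z)" for z
  proof (cases "\<bar>Im z\<bar> \<le> 1")
    case True
    have "8 / 3 * D * 1 \<le> 8 / 3 * D * exp (a * cmod z)" using D a by (intro mult_left_mono) auto
    then show ?thesis using near[OF True] by linarith
  next
    case False
    then have "cmod (f z) \<le> 3 * sqrt C * exp (a * \<bar>Im z\<bar>) / sqrt \<bar>Im z\<bar>" by (intro bd) auto
    also have "\<dots> \<le> 3 * sqrt C * exp (a * \<bar>Im z\<bar>) / 1" using False C0 by (intro divide_left_mono) auto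
    also have "\<dots> \<le> (8 / 3 * D) * exp (a * cmod z)"
    proof -
      have "3 * sqrt C * 1 \<le> 3 * sqrt C * exp (2 * a)" using a C0 by (intro mult_left_mono) auto
      then have "3 * sqrt C \<le> 8 / 3 * D" using D by (simp add: D_def)
      moreover have "exp (a * \<bar>Im z\<bar>) \<le> exp (a * cmod z)" using abs_Im_le_cmod[of z] a by simp
      ultimately have "(3 * sqrt C) * exp (a * \<bar>Im z\<bar>) \<le> (8 / 3 * D) * exp (a * cmod z)"
        by (rule mult_mono) (use D in auto)
      then show ?thesis by simp
    qed
    finally show ?thesis .
  qed
  have "exp_type_le f a"
    unfolding exp_type_le_def
  proof (intro allI impI)
    fix \<epsilon> :: real assume e: "\<epsilon> > 0"
    have "cmod (f z) \<le> 8 / 3 * D * exp ((a + \<epsilon>) * cmod z)" for z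
    proof -
      have "exp (a * cmod z) \<le> exp ((a + \<epsilon>) * cmod z)" using e by (simp add: mult_right_mono)
      then have "8 / 3 * D * exp (a * cmod z) \<le> 8 / 3 * D * exp ((a + \<epsilon>) * cmod z)" using D by (intro mult_left_mono) auto
      then show ?thesis using all[of z] by linarith
    qed
    then show "\<exists>C. \<forall>z. cmod (f z) \<le> C * exp ((a + \<epsilon>) * cmod z)" by blast
  qed
  moreover have "integrable lborel (\<lambda>x. (cmod (f (of_real x) / E (of_real x)))\<^sup>2)"
  proof (rule hardy_boundary_integrable(1)[where f = "\<lambda>z. f z / E z", OF _ C1])
    show "continuous_on {z. 0 \<le> Im z} (\<lambda>z. f z / E z)"
      unfolding E_def using holomorphic_on_imp_continuous_on[OF hf]
      by (intro continuous_intros) (auto intro: continuous_on_subset)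
  qed
  ultimately show "f \<in> paley_wiener a" using hf E by (simp add: paley_wiener_def norm_divide)
qed

section \<open>Reproducing kernels of de Branges spaces\<close>

text \<open>The Hermite-Biehler condition is complemented by the absence of real zeros, so that
  quotients by \<open>E\<close> are continuous up to the axis. The functions \<open>E\<close> of a
  canonical system satisfy this because the transfer matrix is invertible.\<close>

locale de_branges =
  fixes E :: "complex \<Rightarrow> complex"
  assumes entire: "E holomorphic_on UNIV"
    and HB: "Im z > 0 \<Longrightarrow> cmod (E (cnj z)) < cmod (E z)"
    and real_nonzero: "E (of_real x) \<noteq> 0"
begin

text \<open>The inner function of the space: bounded by 1 in the half plane and unimodular on the
  axis.\<close>

definition \<theta> :: "complex \<Rightarrow> complex" where "\<theta> z = cnj (E (cnj z)) / E z"

text \<open>The reproducing kernel on the diagonal, multiplied by \<open>4 * pi\<close>.\<close>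

definition K :: "complex \<Rightarrow> real" where
  "K w = ((cmod (E w))\<^sup>2 - (cmod (E (cnj w)))\<^sup>2) / Im w"

definition sqnorm :: "(complex \<Rightarrow> complex) \<Rightarrow> real" where
  "sqnorm F = (\<integral>x. (cmod (F (of_real x) / E (of_real x)))\<^sup>2 \<partial>lborel)"

lemma nonzero: "Im z \<ge> 0 \<Longrightarrow> E z \<noteq> 0"
proof (cases "Im z = 0")
  case True
  then have "z = of_real (Re z)" by (simp add: complex_eq_iff)
  then show ?thesis using real_nonzero[of "Re z"] by simp
next
  case False
  moreover assume "Im z \<ge> 0"
  ultimately show ?thesis using HB[of z] by (metis less_eq_real_def norm_ge_zero norm_zero not_less)
qed

lemma K_pos: "Im w > 0 \<Longrightarrow> K w > 0"
  unfolding K_def using HB[of w] by (intro divide_pos_pos) (auto simp: power_strict_mono)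

lemma K_le: "Im w > 0 \<Longrightarrow> K w \<le> (cmod (E w))\<^sup>2 / Im w"
  unfolding K_def by (intro divide_right_mono) auto

lemma K_eq: "Im w > 0 \<Longrightarrow> K w = (cmod (E w))\<^sup>2 * (1 - (cmod (\<theta> w))\<^sup>2) / Im w"
  using nonzero[of w] by (simp add: K_def \<theta>_def norm_divide power_divide right_diff_distrib)

lemma continuous_E: "continuous_on S E"
  using holomorphic_on_imp_continuous_on[OF entire] continuous_on_subset by blast

lemma quotient_continuous:
  assumes "F holomorphic_on UNIV" shows "continuous_on {z. Im z \<ge> 0} (\<lambda>z. F z / E z)"
  using holomorphic_on_imp_continuous_on[OF assms]
  by (intro continuous_intros continuous_E) (auto intro: continuous_on_subset dest: nonzero)

lemma quotient_holomorphic: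
  assumes "F holomorphic_on UNIV" shows "(\<lambda>z. F z / E z) holomorphic_on upper_half"
  by (intro holomorphic_intros holomorphic_on_subset[OF assms] holomorphic_on_subset[OF entire])
    (auto simp: upper_half_def nonzero)

lemma \<theta>_holomorphic: "continuous_on {z. Im z \<ge> 0} \<theta>" "\<theta> holomorphic_on upper_half"
  unfolding \<theta>_def using quotient_continuous quotient_holomorphic holomorphic_cnj_cnj_UNIV[OF entire] by blast+

lemma \<theta>_le_1: "Im z > 0 \<Longrightarrow> cmod (\<theta> z) \<le> 1"
  using HB[of z] nonzero[of z] by (simp add: \<theta>_def norm_divide)

lemma \<theta>_real: "cmod (\<theta> (of_real x)) = 1"
  using real_nonzero[of x] by (simp add: \<theta>_def norm_divide)

lemma real_measurable:
  assumes "F holomorphic_on UNIV" shows "(\<lambda>x. F (of_real x) / E (of_real x)) \<in> borel_measurable borel"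
proof -
  have "continuous_on UNIV (\<lambda>x::real. F (of_real x) / E (of_real x))"
    by (rule continuous_on_compose2[OF quotient_continuous[OF assms]]) (auto intro!: continuous_intros)
  then show ?thesis by (rule borel_measurable_continuous_onI)
qed

lemma \<theta>_measurable: "(\<lambda>x::real. \<theta> (of_real x)) \<in> borel_measurable borel"
  unfolding \<theta>_def using real_measurable[OF holomorphic_cnj_cnj_UNIV[OF entire]] by simp

lemma space_hardy:
  assumes "F \<in> de_branges_space E"
  shows "F holomorphic_on UNIV"
    and "\<exists>B. \<forall>z. Im z > 0 \<longrightarrow> cmod (F z / E z) \<le> B / sqrt (Im z)"
    and "integrable lborel (\<lambda>x. (cmod (F (of_real x) / E (of_real x)))\<^sup>2)"
proof -
  show F: "F holomorphic_on UNIV" using assms by (simp add: de_branges_space_def)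
  obtain C where C: "\<And>y. y > 0 \<Longrightarrow> integrable lborel (\<lambda>x. (cmod (F (Complex x y) / E (Complex x y)))\<^sup>2)"
      "\<And>y. y > 0 \<Longrightarrow> (\<integral>x. (cmod (F (Complex x y) / E (Complex x y)))\<^sup>2 \<partial>lborel) \<le> C"
    using assms unfolding de_branges_space_def hardy2_upper_def by blast
  have "cmod (F z / E z) \<le> (3 * sqrt C) / sqrt (Im z)" if "Im z > 0" for z
    using hardy_pointwise_bound[where f = "\<lambda>z. F z / E z", OF quotient_holomorphic[OF F] C that]
    by (simp add: real_sqrt_divide)
  then show "\<exists>B. \<forall>z. Im z > 0 \<longrightarrow> cmod (F z / E z) \<le> B / sqrt (Im z)" by blast
  show "integrable lborel (\<lambda>x. (cmod (F (of_real x) / E (of_real x)))\<^sup>2)"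
    by (rule hardy_boundary_integrable(1)[where f = "\<lambda>z. F z / E z", OF quotient_continuous[OF F] C])
qed

lemma space_cnj: "F \<in> de_branges_space E \<Longrightarrow> (\<lambda>z. cnj (F (cnj z))) \<in> de_branges_space E"
  using holomorphic_cnj_cnj_UNIV[of F] by (simp add: de_branges_space_def)

lemma sqnorm_cnj: "sqnorm (\<lambda>z. cnj (F (cnj z))) = sqnorm F"
  by (simp add: sqnorm_def norm_divide)

text \<open>Since \<open>\<theta>\<close> is unimodular on the axis, expanding the square leaves a
  constant and a term linear in \<open>\<theta>\<close>. Poisson's formula evaluates both, and the
  cross term removes twice the square of \<open>cmod (\<theta> w)\<close>.\<close>

lemma theta_kernel_integral:
  assumes w: "Im w > 0"
  shows "integrable lborel (\<lambda>x. (cmod ((1 - cnj (\<theta> w) * \<theta> (of_real x)) / (of_real x - w)))\<^sup>2)"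
    and "(\<integral>x. (cmod ((1 - cnj (\<theta> w) * \<theta> (of_real x)) / (of_real x - w)))\<^sup>2 \<partial>lborel)
       = pi / Im w * (1 - (cmod (\<theta> w))\<^sup>2)"
proof -
  have w0: "Im w \<noteq> 0" using w by simp
  define k where "k x = 1 / (cmod (of_real x - w))\<^sup>2" for x :: real
  have k: "integrable lborel k" "(\<integral>x. k x \<partial>lborel) = pi / Im w"
    using square_integrable_Cauchy_kernel(2,3)[OF w0] w by (auto simp: k_def[abs_def] norm_divide power_divide)
  have k0: "k x \<ge> 0" for x by (simp add: k_def)
  have tk: "\<theta> (of_real x) / of_real ((cmod (of_real x - w))\<^sup>2) = \<theta> (of_real x) * of_real (k x)" for x
    by (simp add: k_def)
  have itk: "integrable lborel (\<lambda>x. \<theta> (of_real x) * of_real (k x))"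
  proof (rule Bochner_Integration.integrable_bound[OF k(1)])
    have "(\<lambda>x. complex_of_real (k x)) \<in> borel_measurable lborel" using k(1) by auto
    then show "(\<lambda>x. \<theta> (of_real x) * of_real (k x)) \<in> borel_measurable lborel" using \<theta>_measurable by auto
  qed (simp add: norm_mult \<theta>_real k0)
  have "(\<integral>x. \<theta> (of_real x) / of_real ((cmod (of_real x - w))\<^sup>2) \<partial>lborel) = of_real (pi / Im w) * \<theta> w"
  proof (rule Poisson_formula[OF \<theta>_holomorphic w, where B = 1])
    show "integrable lborel (\<lambda>x. \<theta> (of_real x) / of_real ((cmod (of_real x - w))\<^sup>2))" unfolding tk by (rule itk)
    fix z assume z: "Im z > 0"
    show "cmod (\<theta> z) \<le> 1 * (1 + 1 / sqrt (Im z))" using \<theta>_le_1[OF z] z by (simp add: add_increasing2)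
  qed
  then have ptk: "(\<integral>x. \<theta> (of_real x) * of_real (k x) \<partial>lborel) = of_real (pi / Im w) * \<theta> w" unfolding tk .
  have eq: "(cmod ((1 - cnj (\<theta> w) * \<theta> (of_real x)) / (of_real x - w)))\<^sup>2 =
      (1 + (cmod (\<theta> w))\<^sup>2) * k x - 2 * Re (cnj (\<theta> w) * (\<theta> (of_real x) * of_real (k x)))" for x
  proof -
    define t where "t = cnj (\<theta> w) * \<theta> (of_real x)"
    have "(cmod (1 - t))\<^sup>2 = 1 + (cmod t)\<^sup>2 - 2 * Re t"
      unfolding cmod_power2 by (simp add: power2_eq_square algebra_simps)
    moreover have "cmod t = cmod (\<theta> w)" by (simp add: t_def norm_mult \<theta>_real)
    ultimately have "(cmod ((1 - t) / (of_real x - w)))\<^sup>2 = (1 + (cmod (\<theta> w))\<^sup>2 - 2 * Re t) * k x"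
      by (simp add: norm_divide power_divide k_def)
    moreover have "cnj (\<theta> w) * (\<theta> (of_real x) * of_real (k x)) = t * of_real (k x)" by (simp add: t_def)
    moreover have "Re (t * of_real (k x)) = Re t * k x" by simp
    ultimately show ?thesis unfolding t_def[symmetric] by (simp only: left_diff_distrib mult.assoc)
  qed
  have i2: "integrable lborel (\<lambda>x. cnj (\<theta> w) * (\<theta> (of_real x) * of_real (k x)))" using itk by simp
  show "integrable lborel (\<lambda>x. (cmod ((1 - cnj (\<theta> w) * \<theta> (of_real x)) / (of_real x - w)))\<^sup>2)"
    unfolding eq using k(1) integrable_Re[OF i2] by (intro Bochner_Integration.integrable_diff integrable_mult_right) auto
  have "(\<integral>x. (cmod ((1 - cnj (\<theta> w) * \<theta> (of_real x)) / (of_real x - w)))\<^sup>2 \<partial>lborel)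
     = (1 + (cmod (\<theta> w))\<^sup>2) * (pi / Im w) - 2 * Re (cnj (\<theta> w) * (of_real (pi / Im w) * \<theta> w))"
  proof -
    have "(\<integral>x. Re (cnj (\<theta> w) * (\<theta> (of_real x) * of_real (k x))) \<partial>lborel) = Re (\<integral>x. cnj (\<theta> w) * (\<theta> (of_real x) * of_real (k x)) \<partial>lborel)"
      by (rule integral_Re[OF i2])
    also have "(\<integral>x. cnj (\<theta> w) * (\<theta> (of_real x) * of_real (k x)) \<partial>lborel) = cnj (\<theta> w) * (of_real (pi / Im w) * \<theta> w)"
      using ptk by (simp only: integral_mult_right_zero)
    finally show ?thesis unfolding eq
      using k integrable_Re[OF i2]
      by (subst Bochner_Integration.integral_diff) (simp_all only: integrable_mult_right integral_mult_right_zero)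
  qed
  also have "cnj (\<theta> w) * (of_real (pi / Im w) * \<theta> w) = of_real (pi / Im w * (cmod (\<theta> w))\<^sup>2)"
    by (simp only: of_real_mult complex_norm_square) (simp only: mult_ac)
  also have "(1 + (cmod (\<theta> w))\<^sup>2) * (pi / Im w) - 2 * Re (complex_of_real (pi / Im w * (cmod (\<theta> w))\<^sup>2))
     = pi / Im w * (1 - (cmod (\<theta> w))\<^sup>2)" unfolding Re_complex_of_real by (simp only: algebra_simps)
  finally show "(\<integral>x. (cmod ((1 - cnj (\<theta> w) * \<theta> (of_real x)) / (of_real x - w)))\<^sup>2 \<partial>lborel)
     = pi / Im w * (1 - (cmod (\<theta> w))\<^sup>2)" .
qed

text \<open>The reproducing formula expresses \<open>2 * pi * \<i> * f w\<close> as the integral of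
  \<open>f\<close> against \<open>m\<close>. The first part of \<open>m\<close> is the Cauchy
  kernel; the second integrates to zero because on the axis \<open>f * cnj \<theta>\<close> is the
  conjugate of \<open>g\<close>, a Hardy function. Adding this vanishing term lowers the norm of the
  kernel, which yields the sharp constant \<open>K w\<close> in place of the bound from
  \<open>K_le\<close>.\<close>

lemma evaluation_bound:
  assumes F: "F \<in> de_branges_space E" and w: "Im w > 0"
  shows "(cmod (F w))\<^sup>2 \<le> sqnorm F * K w / (4 * pi)"
proof -
  have w0: "Im w \<noteq> 0" "Im (cnj w) \<noteq> 0" using w by auto
  note F1 = space_hardy[OF F] and F2 = space_hardy[OF space_cnj[OF F]]
  define f where "f z = F z / E z" for z
  define g where "g z = cnj (F (cnj z)) / E z" for z
  define kw where "kw x = 1 / (complex_of_real x - w)" for x :: real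
  define kc where "kc x = 1 / (complex_of_real x - cnj w)" for x :: real
  obtain B1 where B1: "\<And>z. Im z > 0 \<Longrightarrow> cmod (f z) \<le> B1 / sqrt (Im z)" using F1(2) unfolding f_def by blast
  obtain B2 where B2: "\<And>z. Im z > 0 \<Longrightarrow> cmod (g z) \<le> B2 / sqrt (Im z)" using F2(2) unfolding g_def by blast
  note cf = quotient_continuous[OF F1(1), folded f_def] quotient_holomorphic[OF F1(1), folded f_def]
  note cg = quotient_continuous[OF F2(1), folded g_def] quotient_holomorphic[OF F2(1), folded g_def]
  have [measurable]: "(\<lambda>x. f (of_real x)) \<in> borel_measurable lborel" "(\<lambda>x. g (of_real x)) \<in> borel_measurable lborel"
    using real_measurable[OF F1(1)] real_measurable[OF F2(1)] by (auto simp: f_def g_def)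
  have mk[measurable]: "kw \<in> borel_measurable lborel" "kc \<in> borel_measurable lborel"
    using square_integrable_Cauchy_kernel(1)[OF w0(1)] square_integrable_Cauchy_kernel(1)[OF w0(2)] by (auto simp: kw_def[abs_def] kc_def[abs_def])
  have f2: "integrable lborel (\<lambda>x. (cmod (f (of_real x)))\<^sup>2)" and g2: "integrable lborel (\<lambda>x. (cmod (g (of_real x)))\<^sup>2)"
    using F1(3) F2(3) by (auto simp: f_def g_def)
  have k2: "integrable lborel (\<lambda>x. (cmod (kw x))\<^sup>2)" "integrable lborel (\<lambda>x. (cmod (kc x))\<^sup>2)"
    using square_integrable_Cauchy_kernel(2)[OF w0(1)] square_integrable_Cauchy_kernel(2)[OF w0(2)] by (auto simp: kw_def kc_def)
  have ifw: "integrable lborel (\<lambda>x. f (of_real x) * kw x)" and ifc: "integrable lborel (\<lambda>x. f (of_real x) * kc x)"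
    and igc: "integrable lborel (\<lambda>x. g (of_real x) * kc x)"
    by (rule Cauchy_Schwarz_integral(1); use f2 g2 k2 in auto)+
  have Z1: "(\<integral>x. f (of_real x) * kc x \<partial>lborel) = 0"
    using hardy_conj_Cauchy_zero[OF cf w B1] ifc by (simp add: kc_def)
  have Z2: "(\<integral>x. g (of_real x) * kc x \<partial>lborel) = 0"
    using hardy_conj_Cauchy_zero[OF cg w B2] igc by (simp add: kc_def)
  have P: "complex_of_real ((cmod (of_real x - w))\<^sup>2) = (of_real x - w) * (of_real x - cnj w)" for x
    by (subst complex_norm_square) simp
  have nzr: "of_real x - w \<noteq> 0" "of_real x - cnj w \<noteq> 0" for x using w by (auto simp: complex_eq_iff)
  have wc: "w - cnj w \<noteq> 0" using w by (auto simp: complex_eq_iff)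
  \<comment> \<open>Partial fractions: the Poisson kernel is a difference of two Cauchy kernels, and
    the one with its pole below the axis contributes nothing.\<close>
  have kk: "f (of_real x) / of_real ((cmod (of_real x - w))\<^sup>2) = (f (of_real x) * kw x - f (of_real x) * kc x) / (w - cnj w)" for x
  proof -
    have "kw x - kc x = (w - cnj w) / ((of_real x - w) * (of_real x - cnj w))"
      unfolding kw_def kc_def using nzr[of x] by (simp add: diff_frac_eq)
    then show ?thesis unfolding P right_diff_distrib[symmetric] using wc by simp
  qed
  have "(\<integral>x. f (of_real x) / of_real ((cmod (of_real x - w))\<^sup>2) \<partial>lborel) = of_real (pi / Im w) * f w"
  proof (rule Poisson_formula[OF cf w])
    show "integrable lborel (\<lambda>x. f (of_real x) / of_real ((cmod (of_real x - w))\<^sup>2))"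
      unfolding kk using ifw ifc by auto
    fix z assume z: "Im z > 0"
    have "0 \<le> B1 / sqrt (Im \<i>)" by (rule order_trans[OF norm_ge_zero B1]) auto
    then have "B1 \<ge> 0" by simp
    then have "B1 / sqrt (Im z) \<le> B1 * (1 + 1 / sqrt (Im z))" by (simp add: distrib_left)
    then show "cmod (f z) \<le> B1 * (1 + 1 / sqrt (Im z))" using B1[OF z] by linarith
  qed
  then have "(\<integral>x. f (of_real x) * kw x \<partial>lborel) / (w - cnj w) = of_real (pi / Im w) * f w"
    unfolding kk using ifw ifc Z1 by simp
  moreover have "w - cnj w = 2 * \<i> * of_real (Im w)" by (simp add: complex_eq_iff)
  ultimately have fw: "(\<integral>x. f (of_real x) * kw x \<partial>lborel) = 2 * pi * \<i> * f w"
    using w by (simp add: field_simps)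
  \<comment> \<open>The second Hardy condition of the space enters here, after conjugation.\<close>
  have "(\<integral>x. cnj (g (of_real x) * kc x) \<partial>lborel) = 0" using Z2 integral_bounded_linear[OF bounded_linear_cnj igc] by simp
  moreover have gk: "cnj (g (of_real x) * kc x) = f (of_real x) * cnj (\<theta> (of_real x)) * kw x" for x
    using real_nonzero[of x] by (simp add: g_def kc_def kw_def f_def \<theta>_def)
  ultimately have Z3: "(\<integral>x. f (of_real x) * cnj (\<theta> (of_real x)) * kw x \<partial>lborel) = 0" by simp
  have i3: "integrable lborel (\<lambda>x. f (of_real x) * cnj (\<theta> (of_real x)) * kw x)"
    using integrable_cnj[OF igc] unfolding gk .
  define m where "m x = (1 - \<theta> w * cnj (\<theta> (of_real x))) * kw x" for x
  have "2 * pi * \<i> * f w = (\<integral>x. f (of_real x) * kw x \<partial>lborel) - \<theta> w * (\<integral>x. f (of_real x) * cnj (\<theta> (of_real x)) * kw x \<partial>lborel)"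
    using fw Z3 by simp
  also have "\<dots> = (\<integral>x. f (of_real x) * kw x - \<theta> w * (f (of_real x) * cnj (\<theta> (of_real x)) * kw x) \<partial>lborel)"
    using ifw i3 by simp
  also have "\<dots> = (\<integral>x. f (of_real x) * m x \<partial>lborel)"
    by (simp add: m_def algebra_simps)
  finally have e: "2 * pi * \<i> * f w = (\<integral>x. f (of_real x) * m x \<partial>lborel)" .
  have [measurable]: "(\<lambda>x::real. cnj (\<theta> (of_real x))) \<in> borel_measurable borel"
    by (rule measurable_compose[OF \<theta>_measurable borel_measurable_continuous_onI]) (intro continuous_intros)
  have [measurable]: "m \<in> borel_measurable lborel"
    unfolding m_def[abs_def] using mk by (auto intro!: borel_measurable_times borel_measurable_diff)
  have m2: "(cmod (m x))\<^sup>2 = (cmod ((1 - cnj (\<theta> w) * \<theta> (of_real x)) / (of_real x - w)))\<^sup>2" for x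
  proof -
    have "cmod (1 - \<theta> w * cnj (\<theta> (of_real x))) = cmod (cnj (1 - \<theta> w * cnj (\<theta> (of_real x))))" by (simp only: complex_mod_cnj)
    then show ?thesis by (simp add: m_def kw_def norm_mult norm_divide)
  qed
  have "cmod (2 * pi * \<i> * f w) \<le> sqrt ((\<integral>x. (cmod (f (of_real x)))\<^sup>2 \<partial>lborel) * (\<integral>x. (cmod (m x))\<^sup>2 \<partial>lborel))"
    unfolding e by (rule Cauchy_Schwarz_integral(3)) (use f2 theta_kernel_integral(1)[OF w] in \<open>auto simp: m2\<close>)
  also have "(\<integral>x. (cmod (m x))\<^sup>2 \<partial>lborel) = pi / Im w * (1 - (cmod (\<theta> w))\<^sup>2)"
    unfolding m2 by (rule theta_kernel_integral(2)[OF w])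
  finally have "2 * pi * cmod (f w) \<le> sqrt (sqnorm F * (pi / Im w * (1 - (cmod (\<theta> w))\<^sup>2)))"
    unfolding sqnorm_def f_def[symmetric] by (simp add: norm_mult)
  then have "(2 * pi * cmod (f w))\<^sup>2 \<le> (sqrt (sqnorm F * (pi / Im w * (1 - (cmod (\<theta> w))\<^sup>2))))\<^sup>2"
    by (rule power_mono) simp
  also have "\<dots> = sqnorm F * (pi / Im w * (1 - (cmod (\<theta> w))\<^sup>2))"
  proof (rule real_sqrt_pow2)
    have "1 - (cmod (\<theta> w))\<^sup>2 \<ge> 0" using \<theta>_le_1[OF w] by (simp add: power_le_one)
    then show "0 \<le> sqnorm F * (pi / Im w * (1 - (cmod (\<theta> w))\<^sup>2))" using w by (auto simp: sqnorm_def)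
  qed
  finally have "4 * pi\<^sup>2 * (cmod (f w))\<^sup>2 \<le> sqnorm F * (pi / Im w * (1 - (cmod (\<theta> w))\<^sup>2))"
    by (simp add: power_mult_distrib)
  then have "4 * pi\<^sup>2 * (cmod (f w))\<^sup>2 * (cmod (E w))\<^sup>2 \<le> sqnorm F * (pi / Im w * (1 - (cmod (\<theta> w))\<^sup>2)) * (cmod (E w))\<^sup>2"
    by (rule mult_right_mono) simp
  moreover have "cmod (F w) = cmod (f w) * cmod (E w)" using nonzero[of w] w by (simp add: f_def norm_divide)
  moreover have "sqnorm F * (pi / Im w * (1 - (cmod (\<theta> w))\<^sup>2)) * (cmod (E w))\<^sup>2 = pi * (sqnorm F * K w)"
    unfolding K_eq[OF w] by (simp add: mult_ac)
  ultimately have "4 * pi\<^sup>2 * (cmod (F w))\<^sup>2 \<le> pi * (sqnorm F * K w)"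
    by (simp add: power_mult_distrib mult.assoc)
  then have "4 * pi * (cmod (F w))\<^sup>2 \<le> sqnorm F * K w"
    by (simp add: power2_eq_square)
  then show ?thesis by (simp add: field_simps)
qed

section \<open>The kernel functions and their norms\<close>

text \<open>It vanishes at \<open>z = cnj w\<close>. The value subtracted in \<open>kernel\<close>
  below is therefore zero and only gives the quotient the shape of a removable singularity.\<close>

definition kernel_num :: "complex \<Rightarrow> complex \<Rightarrow> complex" where
  "kernel_num w z = cnj (E w) * E z - E (cnj w) * cnj (E (cnj z))"

text \<open>Up to a constant factor this is the reproducing kernel; the singularity at
  \<open>z = cnj w\<close> is removable.\<close>

definition kernel :: "complex \<Rightarrow> complex \<Rightarrow> complex" where
  "kernel w z = (if z = cnj w then deriv (kernel_num w) (cnj w)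
     else (kernel_num w z - kernel_num w (cnj w)) / (z - cnj w))"

lemma kernel_holomorphic: "kernel w holomorphic_on UNIV"
proof -
  have "kernel_num w holomorphic_on UNIV"
    unfolding kernel_num_def by (intro holomorphic_intros entire holomorphic_cnj_cnj_UNIV)
  then show ?thesis unfolding kernel_def by (rule pole_lemma_open) simp
qed

lemma kernel_eq: "z \<noteq> cnj w \<Longrightarrow> kernel w z = kernel_num w z / (z - cnj w)"
  by (simp add: kernel_def kernel_num_def)

lemma kernel_self: "Im w > 0 \<Longrightarrow> cmod (kernel w w) = K w / 2"
proof -
  assume w: "Im w > 0"
  then have "w \<noteq> cnj w" by (auto simp: complex_eq_iff)
  then have "kernel w w = (cnj (E w) * E w - E (cnj w) * cnj (E (cnj w))) / (w - cnj w)"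
    by (simp add: kernel_eq kernel_num_def)
  also have "cnj (E w) * E w - E (cnj w) * cnj (E (cnj w)) = of_real ((cmod (E w))\<^sup>2 - (cmod (E (cnj w)))\<^sup>2)"
    by (simp only: of_real_diff complex_norm_square) (simp only: mult_ac)
  also have "w - cnj w = of_real (2 * Im w) * \<i>" by (simp add: complex_eq_iff)
  finally have e: "cmod (kernel w w) = \<bar>(cmod (E w))\<^sup>2 - (cmod (E (cnj w)))\<^sup>2\<bar> / (2 * \<bar>Im w\<bar>)"
    by (simp only: norm_divide norm_mult norm_of_real) (simp add: abs_mult)
  have "(cmod (E (cnj w)))\<^sup>2 < (cmod (E w))\<^sup>2" using HB[OF w] by (simp add: power_strict_mono)
  then show ?thesis using w unfolding e by (simp add: K_def)
qed

lemma kernel_quotient: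
  assumes w: "Im w > 0" and z: "Im z \<ge> 0"
  shows "kernel w z / E z = cnj (E w) * (1 - cnj (\<theta> w) * \<theta> z) / (z - cnj w)"
proof -
  have "z \<noteq> cnj w" using w z by auto
  moreover have "E z \<noteq> 0" "E w \<noteq> 0" using nonzero w z by auto
  ultimately show ?thesis by (simp add: kernel_eq kernel_num_def \<theta>_def field_simps)
qed

lemma kernel_sqnorm:
  assumes w: "Im w > 0"
  shows "integrable lborel (\<lambda>x. (cmod (kernel w (of_real x) / E (of_real x)))\<^sup>2)"
    and "sqnorm (kernel w) = pi * K w"
proof -
  have "cmod (of_real x - cnj w) = cmod (of_real x - w)" for x
    by (metis complex_cnj_complex_of_real complex_cnj_diff complex_mod_cnj)
  then have e: "(cmod (kernel w (of_real x) / E (of_real x)))\<^sup>2 =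
     (cmod (E w))\<^sup>2 * (cmod ((1 - cnj (\<theta> w) * \<theta> (of_real x)) / (of_real x - w)))\<^sup>2" for x
    by (simp add: kernel_quotient[OF w] norm_mult norm_divide power_mult_distrib power_divide)
  show "integrable lborel (\<lambda>x. (cmod (kernel w (of_real x) / E (of_real x)))\<^sup>2)"
    unfolding e by (intro integrable_mult_right theta_kernel_integral[OF w])
  have "sqnorm (kernel w) = (cmod (E w))\<^sup>2 * (pi / Im w * (1 - (cmod (\<theta> w))\<^sup>2))"
    unfolding sqnorm_def e integral_mult_right_zero theta_kernel_integral(2)[OF w] ..
  then show "sqnorm (kernel w) = pi * K w" using w by (simp add: K_eq)
qed

text \<open>After reflection the removable singularity sits at \<open>w\<close>, inside the half
  plane where the bound is wanted. A disc about \<open>w\<close> is handled by compactness and its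
  complement by the explicit formula.\<close>

lemma kernel_cnj_bounded:
  assumes w: "Im w > 0"
  shows "\<exists>B\<ge>0. \<forall>z. Im z > 0 \<longrightarrow> cmod (cnj (kernel w (cnj z)) / E z) \<le> B"
proof -
  define g where "g z = cnj (kernel w (cnj z)) / E z" for z
  define y where "y = Im w"
  have y: "y > 0" using w by (simp add: y_def)
  have sub: "cball w (y / 2) \<subseteq> {z. Im z \<ge> 0}"
  proof
    fix v assume "v \<in> cball w (y / 2)"
    then have "Im (w - v) \<le> y / 2" using abs_Im_le_cmod[of "w - v"] unfolding mem_cball dist_norm by linarith
    then show "v \<in> {z. Im z \<ge> 0}" using y by (simp add: y_def)
  qed
  have "continuous_on (cball w (y / 2)) g"
    using quotient_continuous[OF holomorphic_cnj_cnj_UNIV[OF kernel_holomorphic[of w]]] sub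
    unfolding g_def by (rule continuous_on_subset)
  then have "bounded (g ` cball w (y / 2))" by (simp add: compact_continuous_image compact_imp_bounded)
  then obtain B1 where B1: "\<And>v. v \<in> cball w (y / 2) \<Longrightarrow> cmod (g v) \<le> B1" unfolding bounded_iff by blast
  have far: "cmod (g z) \<le> 2 * cmod (E w) / (y / 2)" if z: "Im z > 0" "z \<notin> cball w (y / 2)" for z
  proof -
    have zw: "cmod (z - w) \<ge> y / 2" "z \<noteq> w" using z y by (auto simp: dist_norm norm_minus_commute)
    have nz: "E z \<noteq> 0" using nonzero z by simp
    have "kernel w (cnj z) = kernel_num w (cnj z) / (cnj z - cnj w)" using zw by (intro kernel_eq) auto
    then have "g z = (E w * \<theta> z - cnj (E (cnj w))) / (z - w)"
      using nz by (simp add: g_def kernel_num_def \<theta>_def field_simps)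
    then have "cmod (g z) = cmod (E w * \<theta> z - cnj (E (cnj w))) / cmod (z - w)" by (simp add: norm_divide)
    also have "\<dots> \<le> (cmod (E w) * 1 + cmod (E w)) / (y / 2)"
    proof (rule frac_le)
      have "cmod (E w * \<theta> z - cnj (E (cnj w))) \<le> cmod (E w * \<theta> z) + cmod (cnj (E (cnj w)))" by (rule norm_triangle_ineq4)
      also have "\<dots> \<le> cmod (E w) * 1 + cmod (E w)"
        unfolding norm_mult complex_mod_cnj using \<theta>_le_1[OF z(1)] HB[OF w] by (intro add_mono mult_left_mono) auto
      finally show "cmod (E w * \<theta> z - cnj (E (cnj w))) \<le> cmod (E w) * 1 + cmod (E w)" .
    qed (use zw y in auto)
    finally show ?thesis by simp
  qed
  show ?thesis
    unfolding g_def[symmetric]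
  proof (intro exI[of _ "max B1 (2 * cmod (E w) / (y / 2))"] conjI allI impI)
    show "0 \<le> max B1 (2 * cmod (E w) / (y / 2))" using y by (simp add: le_max_iff_disj)
    fix z assume z: "Im z > 0"
    show "cmod (g z) \<le> max B1 (2 * cmod (E w) / (y / 2))"
      using B1[of z] far[OF z] by (cases "z \<in> cball w (y / 2)") (auto simp: le_max_iff_disj)
  qed
qed

lemma kernel_bounded:
  assumes w: "Im w > 0"
  shows "\<exists>B\<ge>0. \<forall>z. Im z > 0 \<longrightarrow> cmod (kernel w z / E z) \<le> B"
proof (intro exI[of _ "cmod (E w) * 2 / Im w"] conjI allI impI)
  fix z assume z: "Im z > 0"
  have t: "cmod (\<theta> w) * cmod (\<theta> z) \<le> 1 * 1" using \<theta>_le_1[OF w] \<theta>_le_1[OF z] by (intro mult_mono) auto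
  have "cmod (1 - cnj (\<theta> w) * \<theta> z) \<le> 2"
    using norm_triangle_ineq4[of 1 "cnj (\<theta> w) * \<theta> z"] t by (simp add: norm_mult)
  moreover have "cmod (z - cnj w) \<ge> Im w" using abs_Im_le_cmod[of "z - cnj w"] w z by simp
  ultimately have "cmod (E w) * cmod (1 - cnj (\<theta> w) * \<theta> z) / cmod (z - cnj w) \<le> cmod (E w) * 2 / Im w"
    using w by (intro frac_le mult_left_mono) auto
  then show "cmod (kernel w z / E z) \<le> cmod (E w) * 2 / Im w"
    using z w by (simp add: kernel_quotient norm_mult norm_divide)
qed (use w in auto)

lemma line_norm_le_sqnorm:
  assumes F: "F holomorphic_on UNIV" and b: "\<And>z. Im z > 0 \<Longrightarrow> cmod (F z / E z) \<le> B" and B: "B \<ge> 0"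
    and i: "integrable lborel (\<lambda>x. (cmod (F (of_real x) / E (of_real x)))\<^sup>2)" and y: "y > 0"
  shows "integrable lborel (\<lambda>x. (cmod (F (Complex x y) / E (Complex x y)))\<^sup>2)"
    and "(\<integral>x. (cmod (F (Complex x y) / E (Complex x y)))\<^sup>2 \<partial>lborel) \<le> sqnorm F"
proof -
  have b': "cmod (F z / E z) \<le> B * (1 + 1 / sqrt (Im z))" if z: "Im z > 0" for z
  proof -
    have "B * 1 \<le> B * (1 + 1 / sqrt (Im z))" using B z by (intro mult_left_mono) auto
    then show ?thesis using b[OF z] by linarith
  qed
  from line_square_integral_le[where f = "\<lambda>z. F z / E z", OF quotient_continuous[OF F] quotient_holomorphic[OF F] y b' i]
  show "integrable lborel (\<lambda>x. (cmod (F (Complex x y) / E (Complex x y)))\<^sup>2)"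
    "(\<integral>x. (cmod (F (Complex x y) / E (Complex x y)))\<^sup>2 \<partial>lborel) \<le> sqnorm F" by (auto simp: sqnorm_def)
qed

lemma kernel_line_norm:
  assumes w: "Im w > 0" and y: "y > 0"
  shows "integrable lborel (\<lambda>x. (cmod (kernel w (Complex x y) / E (Complex x y)))\<^sup>2)"
    and "(\<integral>x. (cmod (kernel w (Complex x y) / E (Complex x y)))\<^sup>2 \<partial>lborel) \<le> pi * K w"
    and "integrable lborel (\<lambda>x. (cmod (cnj (kernel w (cnj (Complex x y))) / E (Complex x y)))\<^sup>2)"
    and "(\<integral>x. (cmod (cnj (kernel w (cnj (Complex x y))) / E (Complex x y)))\<^sup>2 \<partial>lborel) \<le> pi * K w"
proof -
  obtain B where "B \<ge> 0" "\<And>z. Im z > 0 \<Longrightarrow> cmod (kernel w z / E z) \<le> B" using kernel_bounded[OF w] by blast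
  from line_norm_le_sqnorm[OF kernel_holomorphic this(2,1) kernel_sqnorm(1)[OF w] y]
  show "integrable lborel (\<lambda>x. (cmod (kernel w (Complex x y) / E (Complex x y)))\<^sup>2)"
    "(\<integral>x. (cmod (kernel w (Complex x y) / E (Complex x y)))\<^sup>2 \<partial>lborel) \<le> pi * K w"
    unfolding kernel_sqnorm(2)[OF w] by auto
  obtain B where "B \<ge> 0" "\<And>z. Im z > 0 \<Longrightarrow> cmod (cnj (kernel w (cnj z)) / E z) \<le> B" using kernel_cnj_bounded[OF w] by blast
  moreover have "integrable lborel (\<lambda>x. (cmod (cnj (kernel w (cnj (of_real x))) / E (of_real x)))\<^sup>2)"
    using kernel_sqnorm(1)[OF w] by (simp add: norm_divide)
  ultimately show "integrable lborel (\<lambda>x. (cmod (cnj (kernel w (cnj (Complex x y))) / E (Complex x y)))\<^sup>2)"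
    "(\<integral>x. (cmod (cnj (kernel w (cnj (Complex x y))) / E (Complex x y)))\<^sup>2 \<partial>lborel) \<le> pi * K w"
    using line_norm_le_sqnorm[OF holomorphic_cnj_cnj_UNIV[OF kernel_holomorphic[of w]] _ _ _ y, of B]
    unfolding sqnorm_cnj kernel_sqnorm(2)[OF w] by auto
qed

lemma kernel_in_space:
  assumes w: "Im w > 0" shows "kernel w \<in> de_branges_space E"
  using kernel_line_norm[OF w] kernel_holomorphic quotient_holomorphic[OF kernel_holomorphic[of w]]
    quotient_holomorphic[OF holomorphic_cnj_cnj_UNIV[OF kernel_holomorphic[of w]]]
  unfolding de_branges_space_def hardy2_upper_def by blast

end

section \<open>Comparison of kernels under inclusion of spaces\<close>

lemma sum_powers_third: "(\<Sum>k<n. (1 / 3 :: real) ^ k) \<le> 3 / 2"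
  by (subst sum_gp_strict) (auto simp: field_simps)

text \<open>The form of completeness required for the gliding hump. Cauchy-Schwarz for the sum, with
  weights of total mass at most 3/2, bounds the partial sums by the square of 3/2, and Fatou's lemma
  passes to the limit.\<close>

lemma hardy2_upper_series:
  fixes h :: "nat \<Rightarrow> complex \<Rightarrow> complex" and d :: "nat \<Rightarrow> complex"
  assumes L: "L holomorphic_on upper_half" and h: "\<And>k. h k holomorphic_on upper_half"
    and lim: "\<And>z. Im z > 0 \<Longrightarrow> (\<lambda>n. \<Sum>k<n. d k * h k z) \<longlonglongrightarrow> L z"
    and d: "\<And>k. cmod (d k) \<le> (1 / 3) ^ k"
    and i: "\<And>k y. y > 0 \<Longrightarrow> integrable lborel (\<lambda>x. (cmod (h k (Complex x y)))\<^sup>2)"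
    and b: "\<And>k y. y > 0 \<Longrightarrow> (\<integral>x. (cmod (h k (Complex x y)))\<^sup>2 \<partial>lborel) \<le> 1"
  shows "hardy2_upper L"
  unfolding hardy2_upper_def
proof (intro conjI L exI[of _ "9 / 4 :: real"] allI impI)
  fix y :: real assume y: "y > 0"
  have cont: "continuous_on UNIV (\<lambda>x. g (Complex x y))" if "g holomorphic_on upper_half" for g :: "complex \<Rightarrow> complex"
    by (rule continuous_on_compose2[OF holomorphic_on_imp_continuous_on[OF that]])
      (use y in \<open>auto simp: upper_half_def Complex_eq intro!: continuous_intros\<close>)
  have [measurable]: "(\<lambda>x. L (Complex x y)) \<in> borel_measurable borel" "\<And>k. (\<lambda>x. h k (Complex x y)) \<in> borel_measurable borel"
    using cont[OF L] cont[OF h] borel_measurable_continuous_onI by blast+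
  define S where "S n x = (\<Sum>k<n. d k * h k (Complex x y))" for n x
  have [measurable]: "S n \<in> borel_measurable borel" for n unfolding S_def by measurable
  have Sn: "(\<integral>\<^sup>+x. ennreal ((cmod (S n x))\<^sup>2) \<partial>lborel) \<le> ennreal (9 / 4)" for n
  proof -
    have pt: "(cmod (S n x))\<^sup>2 \<le> 3 / 2 * (\<Sum>k<n. (1 / 3) ^ k * (cmod (h k (Complex x y)))\<^sup>2)" for x
    proof -
      \<comment> \<open>Half of the geometric weight goes to each factor of Cauchy-Schwarz.\<close>
      define c where "c k = sqrt ((1 / 3 :: real) ^ k)" for k
      have c2: "c k * c k = (1 / 3) ^ k" for k unfolding c_def by (simp flip: power2_eq_square)
      have "cmod (S n x) \<le> (\<Sum>k<n. cmod (d k * h k (Complex x y)))" unfolding S_def by (rule norm_sum)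
      also have "\<dots> \<le> (\<Sum>k<n. c k * (c k * cmod (h k (Complex x y))))"
        unfolding mult.assoc[symmetric] c2 norm_mult using d by (intro sum_mono mult_right_mono) auto
      finally have "(cmod (S n x))\<^sup>2 \<le> (\<Sum>k<n. c k * (c k * cmod (h k (Complex x y))))\<^sup>2" by (rule power_mono) simp
      also have "\<dots> \<le> (\<Sum>k<n. (c k)\<^sup>2) * (\<Sum>k<n. (c k * cmod (h k (Complex x y)))\<^sup>2)"
        by (rule Cauchy_Schwarz_ineq_sum)
      also have "(\<Sum>k<n. (c k)\<^sup>2) = (\<Sum>k<n. (1 / 3) ^ k)" by (simp add: power2_eq_square c2)
      also have "(\<Sum>k<n. (c k * cmod (h k (Complex x y)))\<^sup>2) = (\<Sum>k<n. (1 / 3) ^ k * (cmod (h k (Complex x y)))\<^sup>2)"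
        by (intro sum.cong refl) (simp add: power_mult_distrib power2_eq_square[of "c _"] c2)
      also have "(\<Sum>k<n. (1 / 3) ^ k) * (\<Sum>k<n. (1 / 3) ^ k * (cmod (h k (Complex x y)))\<^sup>2)
         \<le> 3 / 2 * (\<Sum>k<n. (1 / 3) ^ k * (cmod (h k (Complex x y)))\<^sup>2)"
        by (intro mult_right_mono sum_powers_third sum_nonneg) auto
      finally show ?thesis .
    qed
    have "(\<integral>\<^sup>+x. ennreal ((cmod (S n x))\<^sup>2) \<partial>lborel) \<le> (\<integral>\<^sup>+x. ennreal (3 / 2 * (\<Sum>k<n. (1 / 3) ^ k * (cmod (h k (Complex x y)))\<^sup>2)) \<partial>lborel)"
      by (intro nn_integral_mono ennreal_leI pt)
    also have "\<dots> = ennreal (\<integral>x. 3 / 2 * (\<Sum>k<n. (1 / 3) ^ k * (cmod (h k (Complex x y)))\<^sup>2) \<partial>lborel)"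
      using i[OF y] by (intro nn_integral_eq_integral) (auto intro!: sum_nonneg)
    also have "(\<integral>x. 3 / 2 * (\<Sum>k<n. (1 / 3) ^ k * (cmod (h k (Complex x y)))\<^sup>2) \<partial>lborel)
       = 3 / 2 * (\<Sum>k<n. (1 / 3) ^ k * (\<integral>x. (cmod (h k (Complex x y)))\<^sup>2 \<partial>lborel))"
      using i[OF y] by (simp add: Bochner_Integration.integral_sum)
    also have "\<dots> \<le> 3 / 2 * (\<Sum>k<n. (1 / 3) ^ k * 1)"
      by (intro mult_left_mono sum_mono b y) auto
    also have "\<dots> \<le> 3 / 2 * (3 / 2)" using sum_powers_third[of n] by (intro mult_left_mono) auto
    finally show ?thesis by (simp add: ennreal_leI)
  qed
  have lim': "(\<lambda>n. (cmod (S n x))\<^sup>2) \<longlonglongrightarrow> (cmod (L (Complex x y)))\<^sup>2" for x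
    unfolding S_def by (intro tendsto_intros lim) (use y in simp)
  have "(\<integral>\<^sup>+x. ennreal ((cmod (L (Complex x y)))\<^sup>2) \<partial>lborel) = (\<integral>\<^sup>+x. liminf (\<lambda>n. ennreal ((cmod (S n x))\<^sup>2)) \<partial>lborel)"
    by (intro nn_integral_cong lim_imp_Liminf[symmetric] tendsto_ennrealI lim') auto
  also have "\<dots> \<le> liminf (\<lambda>n. \<integral>\<^sup>+x. ennreal ((cmod (S n x))\<^sup>2) \<partial>lborel)"
    by (rule nn_integral_liminf) measurable
  also have "\<dots> \<le> liminf (\<lambda>n::nat. ennreal (9 / 4))" by (intro Liminf_mono always_eventually allI Sn)
  also have "\<dots> = ennreal (9 / 4)" by (simp add: Liminf_const)
  finally have le: "(\<integral>\<^sup>+x. ennreal ((cmod (L (Complex x y)))\<^sup>2) \<partial>lborel) \<le> ennreal (9 / 4)" .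
  show int: "integrable lborel (\<lambda>x. (cmod (L (Complex x y)))\<^sup>2)"
    by (rule integrableI_bounded) (use le in \<open>auto intro: le_less_trans[OF _ ennreal_less_top]\<close>)
  show "(\<integral>x. (cmod (L (Complex x y)))\<^sup>2 \<partial>lborel) \<le> 9 / 4"
    using le nn_integral_eq_integral[OF int] by (simp add: ennreal_le_iff)
qed

context de_branges
begin

text \<open>The unit vector on which evaluation at \<open>w\<close> attains its norm.\<close>

definition unit_kernel :: "complex \<Rightarrow> complex \<Rightarrow> complex" where
  "unit_kernel w z = kernel w z / of_real (sqrt (pi * K w))"

lemma unit_kernel_facts:
  assumes w: "Im w > 0"
  shows "unit_kernel w holomorphic_on UNIV"
    and "cmod (unit_kernel w w) = sqrt (K w / (4 * pi))"
    and "\<And>z. Im z > 0 \<Longrightarrow> cmod (unit_kernel w z) \<le> sqrt (K z / (4 * pi))"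
    and "\<And>z. Im z > 0 \<Longrightarrow> cmod (unit_kernel w (cnj z)) \<le> sqrt (K z / (4 * pi))"
    and "\<And>y. y > 0 \<Longrightarrow> integrable lborel (\<lambda>x. (cmod (unit_kernel w (Complex x y) / E (Complex x y)))\<^sup>2)"
    and "\<And>y. y > 0 \<Longrightarrow> (\<integral>x. (cmod (unit_kernel w (Complex x y) / E (Complex x y)))\<^sup>2 \<partial>lborel) \<le> 1"
    and "\<And>y. y > 0 \<Longrightarrow> integrable lborel (\<lambda>x. (cmod (cnj (unit_kernel w (cnj (Complex x y))) / E (Complex x y)))\<^sup>2)"
    and "\<And>y. y > 0 \<Longrightarrow> (\<integral>x. (cmod (cnj (unit_kernel w (cnj (Complex x y))) / E (Complex x y)))\<^sup>2 \<partial>lborel) \<le> 1"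
proof -
  define N where "N = pi * K w"
  have N: "N > 0" using K_pos[OF w] by (simp add: N_def)
  show "unit_kernel w holomorphic_on UNIV"
    unfolding unit_kernel_def by (intro holomorphic_intros kernel_holomorphic) (use N in \<open>auto simp: N_def\<close>)
  have n: "cmod (unit_kernel w z) = cmod (kernel w z) / sqrt N" for z
    using N by (simp add: unit_kernel_def norm_divide N_def)
  have "cmod (unit_kernel w w) = sqrt ((K w / 2)\<^sup>2 / N)"
    unfolding n kernel_self[OF w] using K_pos[OF w] by (simp add: real_sqrt_divide)
  also have "(K w / 2)\<^sup>2 / N = K w / (4 * pi)" using K_pos[OF w] by (simp add: N_def power2_eq_square)
  finally show "cmod (unit_kernel w w) = sqrt (K w / (4 * pi))" .
  have e: "cmod F / sqrt N \<le> sqrt (K z / (4 * pi))" if "(cmod F)\<^sup>2 \<le> N * K z / (4 * pi)" for F z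
  proof -
    have "cmod F \<le> sqrt (N * (K z / (4 * pi)))" using that by (intro real_le_rsqrt) simp
    then show ?thesis using N by (simp only: real_sqrt_mult) (simp add: field_simps)
  qed
  show "cmod (unit_kernel w z) \<le> sqrt (K z / (4 * pi))" if "Im z > 0" for z
    unfolding n by (rule e) (use evaluation_bound[OF kernel_in_space[OF w] that] kernel_sqnorm(2)[OF w] in \<open>simp add: N_def\<close>)
  show "cmod (unit_kernel w (cnj z)) \<le> sqrt (K z / (4 * pi))" if "Im z > 0" for z
    unfolding n by (rule e) (use evaluation_bound[OF space_cnj[OF kernel_in_space[OF w]] that] kernel_sqnorm(2)[OF w] sqnorm_cnj in \<open>simp add: N_def\<close>)
  have sq: "(cmod (unit_kernel w z / e))\<^sup>2 = (cmod (kernel w z / e))\<^sup>2 / N"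
    "(cmod (cnj (unit_kernel w z) / e))\<^sup>2 = (cmod (cnj (kernel w z) / e))\<^sup>2 / N" for z e
    using N by (simp_all add: norm_divide n power_divide power_mult_distrib)
  fix y :: real assume y: "y > 0"
  note k = kernel_line_norm[OF w y, folded N_def]
  show "integrable lborel (\<lambda>x. (cmod (unit_kernel w (Complex x y) / E (Complex x y)))\<^sup>2)"
    "integrable lborel (\<lambda>x. (cmod (cnj (unit_kernel w (cnj (Complex x y))) / E (Complex x y)))\<^sup>2)"
    unfolding sq using k(1,3) by simp_all
  show "(\<integral>x. (cmod (unit_kernel w (Complex x y) / E (Complex x y)))\<^sup>2 \<partial>lborel) \<le> 1"
    "(\<integral>x. (cmod (cnj (unit_kernel w (cnj (Complex x y))) / E (Complex x y)))\<^sup>2 \<partial>lborel) \<le> 1"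
    unfolding sq integral_divide_zero using k(2,4) N by simp_all
qed

text \<open>Uniform in \<open>w\<close>: evaluation bounds every unit vector of the space by
  \<open>cmod (E z) / sqrt (Im z)\<close>, and \<open>bound_across_real_axis\<close> removes the
  singularity. This yields locally uniform convergence of series of unit kernels.\<close>

lemma unit_kernel_locally_bounded:
  "\<exists>M\<ge>0. \<forall>w z. Im w > 0 \<longrightarrow> cmod z \<le> R \<longrightarrow> cmod (unit_kernel w z) \<le> M"
proof -
  define \<rho> where "\<rho> = 2 * max R 1"
  have \<rho>: "\<rho> > 0" "R \<le> \<rho> / 2" by (auto simp: \<rho>_def)
  have "bounded (E ` cball 0 \<rho>)"
    using continuous_E by (simp add: compact_continuous_image compact_imp_bounded)
  then obtain M where M0: "M > 0" "\<forall>z\<in>cball 0 \<rho>. cmod (E z) \<le> M"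
    unfolding bounded_pos by auto
  then have M: "M \<ge> 0" "\<And>z. cmod z \<le> \<rho> \<Longrightarrow> cmod (E z) \<le> M" by auto
  have up: "sqrt (K z / (4 * pi)) \<le> M / sqrt (Im z)" if z: "Im z > 0" "cmod z \<le> \<rho>" for z
  proof -
    have "K z / (4 * pi) \<le> K z / 1" using K_pos[OF z(1)] pi_ge_two by (intro divide_left_mono) auto
    also have "\<dots> \<le> (cmod (E z))\<^sup>2 / Im z" using K_le[OF z(1)] by simp
    also have "\<dots> \<le> M\<^sup>2 / Im z" using M(2)[OF z(2)] z by (intro divide_right_mono power_mono) auto
    finally have "sqrt (K z / (4 * pi)) \<le> sqrt (M\<^sup>2 / Im z)" by (rule real_sqrt_le_mono)
    then show ?thesis using M by (simp add: real_sqrt_divide)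
  qed
  have "cmod (unit_kernel w z) \<le> 8 / 3 * M / sqrt \<rho>" if w: "Im w > 0" and z: "cmod z \<le> R" for w z
  proof (rule bound_across_real_axis[OF unit_kernel_facts(1)[OF w] \<rho>(1), where c = 0])
    fix v assume v: "cmod (v - of_real 0) = \<rho>" "Im v \<noteq> 0"
    show "cmod (unit_kernel w v) \<le> M / sqrt \<bar>Im v\<bar>"
    proof (cases "Im v > 0")
      case True
      then show ?thesis using unit_kernel_facts(3)[OF w, of v] up[of v] v by simp
    next
      case False
      then have "Im (cnj v) > 0" using v by simp
      then show ?thesis using unit_kernel_facts(4)[OF w, of "cnj v"] up[of "cnj v"] v by simp
    qed
  qed (use z \<rho> in simp)
  moreover have "8 / 3 * M / sqrt \<rho> \<ge> 0" using M \<rho> by simp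
  ultimately show ?thesis by blast
qed

text \<open>Since the evaluations are bounded on both spaces, an inclusion of the underlying
  sets compares the kernels. This is a uniform boundedness argument, carried out along an explicit
  gliding hump: the sign in front of each summand is chosen so that the earlier terms do not cancel it.\<close>

theorem kernel_comparison:
  assumes E2: "de_branges E2" and sub: "de_branges_space E \<subseteq> de_branges_space E2"
  shows "\<exists>C>0. \<forall>w. Im w > 0 \<longrightarrow> K w \<le> C * de_branges.K E2 w"
proof (rule ccontr)
  interpret e2: de_branges E2 by (rule E2)
  assume "\<not> ?thesis"
  then have "\<exists>w. Im w > 0 \<and> K w > C * e2.K w" if "C > 0" for C using that by (auto simp: not_le)
  \<comment> \<open>The factor \<open>9 ^ n\<close> compensates the square of the weight
    \<open>(1 / 3) ^ n\<close> of the n-th summand; \<open>Suc n\<close> is what finally exceeds a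
    fixed norm.\<close>
  then have "\<forall>n::nat. \<exists>w. Im w > 0 \<and> K w > (real (Suc n) * 9 ^ n) * e2.K w" by auto
  then obtain w where w: "\<And>n::nat. Im (w n) > 0" "\<And>n. K (w n) > (real (Suc n) * 9 ^ n) * e2.K (w n)" by metis
  define G where "G n = unit_kernel (w n)" for n
  define c where "c n = (1 / 3 :: complex) ^ n" for n
  \<comment> \<open>The partial sums are defined recursively because the sign of a summand depends
    on the sum before it.\<close>
  define X where "X = rec_nat (\<lambda>z::complex. 0::complex) (\<lambda>n F z.
     if cmod (F (w n) + c n * G n (w n)) \<ge> cmod (c n * G n (w n)) then F z + c n * G n z else F z - c n * G n z)"
  define s where "s n = (if cmod (X n (w n) + c n * G n (w n)) \<ge> cmod (c n * G n (w n)) then 1 else -1 :: complex)" for n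
  have X0: "X 0 z = 0" for z by (simp add: X_def)
  have XS: "X (Suc n) z = X n z + s n * c n * G n z" for n z by (simp add: X_def s_def)
  have X_sum: "X n z = (\<Sum>k<n. (s k * c k) * G k z)" for n z
    by (induction n) (simp_all add: X0 XS)
  have hump: "cmod (X (Suc n) (w n)) \<ge> cmod (c n * G n (w n))" for n
  proof (cases "cmod (X n (w n) + c n * G n (w n)) \<ge> cmod (c n * G n (w n))")
    case True
    then show ?thesis by (simp add: XS s_def)
  next
    case False
    define a b where "a = X n (w n)" and "b = c n * G n (w n)"
    \<comment> \<open>Of \<open>a + b\<close> and \<open>a - b\<close>, at least one has modulus at
      least \<open>cmod b\<close>.\<close>
    have "2 * cmod b = cmod ((a + b) - (a - b))" by (simp add: norm_mult flip: mult_2)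
    also have "\<dots> \<le> cmod (a + b) + cmod (a - b)" by (rule norm_triangle_ineq4)
    finally have "cmod (a - b) \<ge> cmod b" using False unfolding a_def[symmetric] b_def[symmetric] by linarith
    then show ?thesis using False by (simp add: XS s_def a_def b_def)
  qed
  have sc: "cmod (s k * c k) = (1 / 3) ^ k" for k by (simp add: s_def c_def norm_mult norm_power)
  \<comment> \<open>Real coefficients let the reflected series be summed with the same
    weights.\<close>
  have cs: "cnj (s k * c k) = s k * c k" for k by (simp add: s_def c_def)
  have smb: "summable (\<lambda>k. (1 / 3 :: real) ^ k * M)" for M by (intro summable_mult2 summable_geometric) auto
  define x where "x z = (\<Sum>k. (s k * c k) * G k z)" for z
  have unif: "uniform_limit (cball 0 R) X x sequentially" for R
  proof -
    obtain M where M: "\<And>k z. cmod z \<le> R \<Longrightarrow> cmod (G k z) \<le> M"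
      using unit_kernel_locally_bounded[of R] w(1) unfolding G_def by blast
    have "uniform_limit (cball 0 R) (\<lambda>n z. \<Sum>k<n. (s k * c k) * G k z) (\<lambda>z. \<Sum>k. (s k * c k) * G k z) sequentially"
    proof (rule Weierstrass_m_test[where M = "\<lambda>k. (1 / 3) ^ k * M"])
      fix k z assume "z \<in> cball (0::complex) R"
      then show "norm (s k * c k * G k z) \<le> (1 / 3) ^ k * M"
        unfolding norm_mult[of "s k * c k"] sc using M[of z k] by (intro mult_left_mono) auto
    qed (rule smb)
    then show ?thesis unfolding X_sum[abs_def] x_def .
  qed
  have lim: "(\<lambda>n. X n z) \<longlonglongrightarrow> x z" for z
    by (rule tendsto_uniform_limitI[OF unif[of "cmod z"]]) simp
  have hX: "X n holomorphic_on UNIV" for n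
    unfolding X_sum[abs_def] G_def by (intro holomorphic_intros unit_kernel_facts w)
  have hx: "x holomorphic_on UNIV"
  proof (rule holomorphic_uniform_sequence[OF open_UNIV hX])
    fix z :: complex
    have "cball z 1 \<subseteq> cball 0 (cmod z + 1)"
      by (auto simp: dist_norm) (metis add.commute norm_minus_commute norm_triangle_sub order_trans add_left_mono)
    then show "\<exists>d>0. cball z d \<subseteq> UNIV \<and> uniform_limit (cball z d) X x sequentially"
      using uniform_limit_on_subset[OF unif] by (intro exI[of _ 1]) auto
  qed
  have xE: "x \<in> de_branges_space E"
    unfolding de_branges_space_def mem_Collect_eq
  proof (intro conjI hx)
    show "hardy2_upper (\<lambda>z. x z / E z)"
    proof (rule hardy2_upper_series[where h = "\<lambda>k z. G k z / E z" and d = "\<lambda>k. s k * c k"])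
      show "(\<lambda>z. x z / E z) holomorphic_on upper_half" by (rule quotient_holomorphic[OF hx])
      show "(\<lambda>z. G k z / E z) holomorphic_on upper_half" for k
        unfolding G_def by (rule quotient_holomorphic[OF unit_kernel_facts(1)[OF w(1)]])
      show "(\<lambda>n. \<Sum>k<n. s k * c k * (G k z / E z)) \<longlonglongrightarrow> x z / E z" if "Im z > 0" for z
        using tendsto_divide[OF lim[of z] tendsto_const[of "E z"]] nonzero[of z] that
        by (simp add: X_sum sum_divide_distrib)
    qed (use unit_kernel_facts(5,6)[OF w(1)] sc in \<open>simp_all add: G_def\<close>)
    show "hardy2_upper (\<lambda>z. cnj (x (cnj z)) / E z)"
    proof (rule hardy2_upper_series[where h = "\<lambda>k z. cnj (G k (cnj z)) / E z" and d = "\<lambda>k. s k * c k"])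
      show "(\<lambda>z. cnj (x (cnj z)) / E z) holomorphic_on upper_half"
        by (rule quotient_holomorphic[OF holomorphic_cnj_cnj_UNIV[OF hx]])
      show "(\<lambda>z. cnj (G k (cnj z)) / E z) holomorphic_on upper_half" for k
        unfolding G_def by (rule quotient_holomorphic[OF holomorphic_cnj_cnj_UNIV[OF unit_kernel_facts(1)[OF w(1)]]])
      show "(\<lambda>n. \<Sum>k<n. s k * c k * (cnj (G k (cnj z)) / E z)) \<longlonglongrightarrow> cnj (x (cnj z)) / E z" if "Im z > 0" for z
      proof -
        have "cnj (X n (cnj z)) / E z = (\<Sum>k<n. s k * c k * (cnj (G k (cnj z)) / E z))" for n
          unfolding X_sum cnj_sum complex_cnj_mult[of "s _ * c _"] cs by (simp add: sum_divide_distrib)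
        then show ?thesis
          using tendsto_divide[OF tendsto_cnj[OF lim[of "cnj z"]] tendsto_const[of "E z"]] nonzero[of z] that by simp
      qed
    qed (use unit_kernel_facts(7,8)[OF w(1)] sc in \<open>simp_all add: G_def\<close>)
  qed
  have bound: "K (w n) \<le> 4 * 9 ^ n * (e2.sqnorm x * e2.K (w n))" for n
  proof -
    define q where "q = sqrt (K (w n) / (4 * pi))"
    have q: "q \<ge> 0" "q\<^sup>2 = K (w n) / (4 * pi)" using K_pos[OF w(1)[of n]] by (auto simp: q_def)
    have Gq: "cmod (G k (w n)) \<le> q" for k unfolding G_def q_def by (rule unit_kernel_facts(3)[OF w(1) w(1)])
    have cG: "cmod (c n * G n (w n)) = (1 / 3) ^ n * q"
      using unit_kernel_facts(2)[OF w(1)[of n]] by (simp add: norm_mult c_def norm_power G_def q_def)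
    \<comment> \<open>No unit vector exceeds \<open>q\<close> at \<open>w n\<close>, while
      \<open>G n\<close> attains it. The terms after the n-th therefore add up to at most half of
      the hump, so at least the other half survives in the limit.\<close>
    have tail: "cmod (X (Suc n + j) (w n) - X (Suc n) (w n)) \<le> q * ((1 / 3) ^ n / 2 - (1 / 3) ^ (n + j) / 2)" for j
    proof (induction j)
      case 0 then show ?case by simp
    next
      case (Suc j)
      have "X (Suc n + Suc j) (w n) - X (Suc n) (w n) = (X (Suc n + j) (w n) - X (Suc n) (w n)) + s (Suc n + j) * c (Suc n + j) * G (Suc n + j) (w n)"
        by (simp add: XS)
      also have "cmod \<dots> \<le> q * ((1 / 3) ^ n / 2 - (1 / 3) ^ (n + j) / 2) + (1 / 3) ^ (Suc n + j) * q"
        by (rule norm_triangle_le[OF add_mono[OF Suc.IH]])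
          (unfold norm_mult[of "s _ * c _"] sc, intro mult_left_mono Gq, simp)
      also have "\<dots> = q * ((1 / 3) ^ n / 2 - (1 / 3) ^ (n + Suc j) / 2)" by (simp add: field_simps)
      finally show ?case .
    qed
    have "(\<lambda>j. X (j + Suc n) (w n) - X (Suc n) (w n)) \<longlonglongrightarrow> x (w n) - X (Suc n) (w n)"
      by (intro tendsto_diff tendsto_const LIMSEQ_ignore_initial_segment lim)
    then have "cmod (x (w n) - X (Suc n) (w n)) \<le> q * ((1 / 3) ^ n / 2)"
    proof (rule tendsto_upperbound[OF tendsto_norm], intro always_eventually allI)
      fix j
      have "q * ((1 / 3) ^ n / 2 - (1 / 3) ^ (n + j) / 2) \<le> q * ((1 / 3) ^ n / 2)" using q by (intro mult_left_mono) auto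
      then show "cmod (X (j + Suc n) (w n) - X (Suc n) (w n)) \<le> q * ((1 / 3) ^ n / 2)"
        using tail[of j] by (simp add: add.commute)
    qed simp
    moreover have "cmod (X (Suc n) (w n)) \<ge> (1 / 3) ^ n * q" using hump[of n] cG by simp
    moreover have "cmod (X (Suc n) (w n)) \<le> cmod (x (w n)) + cmod (x (w n) - X (Suc n) (w n))"
      by (metis norm_minus_commute norm_triangle_sub)
    ultimately have "cmod (x (w n)) \<ge> q * (1 / 3) ^ n / 2" by (simp add: mult.commute)
    then have "(q * (1 / 3) ^ n / 2)\<^sup>2 \<le> (cmod (x (w n)))\<^sup>2" using q by (intro power_mono) auto
    also have "\<dots> \<le> e2.sqnorm x * e2.K (w n) / (4 * pi)"
      by (rule e2.evaluation_bound[OF _ w(1)]) (use xE sub in auto)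
    finally have "q\<^sup>2 * (1 / 9) ^ n / 4 \<le> e2.sqnorm x * e2.K (w n) / (4 * pi)"
      by (simp add: power_divide power_mult_distrib power2_eq_square flip: power_mult_distrib)
    then have "K (w n) * (1 / 9) ^ n / 4 \<le> e2.sqnorm x * e2.K (w n)"
      unfolding q(2) by (simp add: field_simps)
    then show ?thesis by (simp add: power_divide field_simps)
  qed
  obtain n :: nat where n: "4 * e2.sqnorm x < real n" using reals_Archimedean2 by blast
  have k2: "e2.K (w n) > 0" using e2.K_pos w by blast
  have "(real (Suc n) * 9 ^ n) * e2.K (w n) < 4 * 9 ^ n * (e2.sqnorm x * e2.K (w n))"
    using w(2)[of n] bound[of n] by linarith
  then have "real (Suc n) * (9 ^ n * e2.K (w n)) < (4 * e2.sqnorm x) * (9 ^ n * e2.K (w n))"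
    by (simp add: mult_ac)
  then have "real (Suc n) < 4 * e2.sqnorm x" using k2 by (simp add: mult_less_cancel_right_pos)
  then show False using n by simp
qed

end

section \<open>Canonical systems\<close>

text \<open>One column \<open>(a, c)\<close> of the transfer matrix, with the system solved for the
  derivatives; \<open>p\<close>, \<open>q\<close>, \<open>r\<close> are the entries of the
  Hamiltonian.\<close>

definition sol :: "(real \<Rightarrow> real) \<Rightarrow> (real \<Rightarrow> real) \<Rightarrow> (real \<Rightarrow> real) \<Rightarrow> complex \<Rightarrow> real \<Rightarrow>
    (real \<Rightarrow> complex) \<Rightarrow> (real \<Rightarrow> complex) \<Rightarrow> bool" where
  "sol p q r z T a c \<longleftrightarrow>
     ac 0 T a (\<lambda>t. - z * (of_real (q t) * a t + of_real (r t) * c t)) \<and>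
     ac 0 T c (\<lambda>t. z * (of_real (p t) * a t + of_real (q t) * c t))"

text \<open>A symplectic form: for the first column it is a quarter of the difference of squares in
  the Hermite-Biehler inequality.\<close>

definition area :: "complex \<Rightarrow> complex \<Rightarrow> real" where
  "area a c = Im (cnj a * c)"

definition qform :: "real \<Rightarrow> real \<Rightarrow> real \<Rightarrow> complex \<Rightarrow> complex \<Rightarrow> real" where
  "qform p q r a c = p * (cmod a)\<^sup>2 + 2 * q * Re (cnj a * c) + r * (cmod c)\<^sup>2"

lemma cmod_mult_self: "cmod a * cmod a = Re a * Re a + Im a * Im a"
  using cmod_power2[of a] by (simp add: power2_eq_square)

lemma sol_D: "sol p q r z T a c \<Longrightarrow> ac 0 T a (\<lambda>t. - z * (of_real (q t) * a t + of_real (r t) * c t))"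
  "sol p q r z T a c \<Longrightarrow> ac 0 T c (\<lambda>t. z * (of_real (p t) * a t + of_real (q t) * c t))"
  by (auto simp: sol_def)

lemma sol_product:
  assumes "sol p q r z T a c"
  shows "ac 0 T (\<lambda>t. cnj (a t) * c t) (\<lambda>t. cnj (- z * (of_real (q t) * a t + of_real (r t) * c t)) * c t +
     z * (of_real (p t) * a t + of_real (q t) * c t) * cnj (a t))"
  using ac_mult[OF ac_linear[OF bounded_linear_cnj sol_D(1)[OF assms]] sol_D(2)[OF assms]] by simp

lemma sol_area:
  assumes "sol p q r z T a c"
  shows "ac 0 T (\<lambda>t. area (a t) (c t)) (\<lambda>t. Im z * qform (p t) (q t) (r t) (a t) (c t))"
  using ac_linear[OF bounded_linear_Im sol_product[OF assms]]
  by (rule ac_cong) (auto simp: area_def qform_def cmod_mult_self algebra_simps power2_eq_square)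

lemma sol_Re_product:
  assumes "sol p q r (\<i> * of_real y) T a c"
  shows "ac 0 T (\<lambda>t. Re (cnj (a t) * c t)) (\<lambda>t. - 2 * y * q t * area (a t) (c t))"
  using ac_linear[OF bounded_linear_Re sol_product[OF assms]]
  by (rule ac_cong) (auto simp: area_def algebra_simps)

lemma sol_norm_sq:
  assumes "sol p q r (\<i> * of_real y) T a c"
  shows "ac 0 T (\<lambda>t. (cmod (a t))\<^sup>2) (\<lambda>t. 2 * y * r t * area (a t) (c t))"
    and "ac 0 T (\<lambda>t. (cmod (c t))\<^sup>2) (\<lambda>t. 2 * y * p t * area (a t) (c t))"
proof -
  note a = sol_D(1)[OF assms] and c = sol_D(2)[OF assms]
  show "ac 0 T (\<lambda>t. (cmod (a t))\<^sup>2) (\<lambda>t. 2 * y * r t * area (a t) (c t))"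
    using ac_linear[OF bounded_linear_Re ac_mult[OF ac_linear[OF bounded_linear_cnj a] a]]
    by (rule ac_cong) (auto simp: area_def cmod_mult_self algebra_simps power2_eq_square)
  show "ac 0 T (\<lambda>t. (cmod (c t))\<^sup>2) (\<lambda>t. 2 * y * p t * area (a t) (c t))"
    using ac_linear[OF bounded_linear_Re ac_mult[OF ac_linear[OF bounded_linear_cnj c] c]]
    by (rule ac_cong) (auto simp: area_def cmod_mult_self algebra_simps power2_eq_square)
qed

text \<open>On the imaginary axis all quadratic quantities have derivatives proportional to the
  area. The coefficient here is the trace of the adjugate of the fixed matrix times
  \<open>H\<close>, hence linear in \<open>H\<close>.\<close>

lemma sol_qform_const:
  assumes "sol p q r (\<i> * of_real y) T a c"
  shows "ac 0 T (\<lambda>t. qform P1 P2 P3 (a t) (c t))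
     (\<lambda>t. y * (P1 * r t - 2 * P2 * q t + P3 * p t) * (2 * area (a t) (c t)))"
proof -
  have "ac 0 T (\<lambda>t. P1 * (cmod (a t))\<^sup>2 + (2 * P2) * Re (cnj (a t) * c t) + P3 * (cmod (c t))\<^sup>2)
     (\<lambda>t. P1 * (2 * y * r t * area (a t) (c t)) + (2 * P2) * (- 2 * y * q t * area (a t) (c t)) + P3 * (2 * y * p t * area (a t) (c t)))"
    by (intro ac_add ac_cmult sol_norm_sq[OF assms] sol_Re_product[OF assms])
  then show ?thesis by (rule ac_cong) (auto simp: qform_def algebra_simps)
qed

lemma cmod_sq_area: "(cmod a)\<^sup>2 * (cmod c)\<^sup>2 = (Re (cnj a * c))\<^sup>2 + (area a c)\<^sup>2"
  unfolding area_def cmod_power2[symmetric] norm_mult by (simp add: power_mult_distrib)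

lemma area_le: "area a c \<le> cmod a * cmod c"
  unfolding area_def using abs_Im_le_cmod[of "cnj a * c"] by (simp add: norm_mult)

text \<open>The squares of \<open>Re (cnj a * c)\<close> and of the area add up to the square of
  \<open>cmod a * cmod c\<close>. Cauchy-Schwarz in the plane for \<open>(\<bar>q\<bar>, d)\<close>,
  where the squares of \<open>q\<close> and \<open>d\<close> add up to \<open>p * r\<close>, is
  followed by the arithmetic-geometric mean inequality.\<close>

lemma qform_ge_area:
  assumes "p \<ge> 0" "r \<ge> 0" "q\<^sup>2 \<le> p * r"
  shows "2 * sqrt (p * r - q\<^sup>2) * \<bar>area a c\<bar> \<le> qform p q r a c"
proof -
  define R where "R = Re (cnj a * c)"
  define S where "S = area a c"
  define d where "d = sqrt (p * r - q\<^sup>2)"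
  have d: "d \<ge> 0" "d\<^sup>2 = p * r - q\<^sup>2" using assms by (auto simp: d_def)
  have n: "(cmod a * cmod c)\<^sup>2 = R\<^sup>2 + S\<^sup>2" using cmod_sq_area[of a c] by (simp add: R_def S_def power_mult_distrib)
  have "(\<bar>q\<bar> * \<bar>R\<bar> + d * \<bar>S\<bar>)\<^sup>2 \<le> (q\<^sup>2 + d\<^sup>2) * (R\<^sup>2 + S\<^sup>2)"
  proof -
    have "0 \<le> (\<bar>q\<bar> * \<bar>S\<bar> - d * \<bar>R\<bar>)\<^sup>2" by simp
    also have "\<dots> = (q\<^sup>2 + d\<^sup>2) * (R\<^sup>2 + S\<^sup>2) - (\<bar>q\<bar> * \<bar>R\<bar> + d * \<bar>S\<bar>)\<^sup>2"
    proof -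
      have "(q\<^sup>2 + d\<^sup>2) * (R\<^sup>2 + S\<^sup>2) = (\<bar>q\<bar>\<^sup>2 + d\<^sup>2) * (\<bar>R\<bar>\<^sup>2 + \<bar>S\<bar>\<^sup>2)" by simp
      then show ?thesis by (simp only: power2_eq_square algebra_simps)
    qed
    finally show ?thesis by simp
  qed
  also have "\<dots> = (sqrt p * sqrt r * (cmod a * cmod c))\<^sup>2"
    using d n assms by (simp add: power_mult_distrib)
  finally have "\<bar>q\<bar> * \<bar>R\<bar> + d * \<bar>S\<bar> \<le> sqrt p * sqrt r * (cmod a * cmod c)"
    by (rule power2_le_imp_le) (use assms in auto)
  moreover have "2 * (sqrt p * sqrt r * (cmod a * cmod c)) \<le> p * (cmod a)\<^sup>2 + r * (cmod c)\<^sup>2"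
  proof -
    have "0 \<le> (sqrt p * cmod a - sqrt r * cmod c)\<^sup>2" by simp
    also have "\<dots> = (sqrt p)\<^sup>2 * (cmod a)\<^sup>2 + (sqrt r)\<^sup>2 * (cmod c)\<^sup>2 - 2 * (sqrt p * sqrt r * (cmod a * cmod c))"
      by (simp only: power2_diff power_mult_distrib) (simp only: mult_ac)
    finally show ?thesis using assms by simp
  qed
  moreover have "2 * q * R \<ge> - (2 * (\<bar>q\<bar> * \<bar>R\<bar>))"
    using abs_ge_minus_self[of "q * R"] unfolding abs_mult by linarith
  ultimately show ?thesis unfolding qform_def R_def[symmetric] S_def[symmetric] d_def[symmetric] by (simp add: algebra_simps)
qed

lemma qform_nonneg: "p \<ge> 0 \<Longrightarrow> r \<ge> 0 \<Longrightarrow> q\<^sup>2 \<le> p * r \<Longrightarrow> qform p q r a c \<ge> 0"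
  using qform_ge_area[of p r q a c] by (rule order_trans[rotated]) auto

text \<open>The difference of the two sides is the determinant times the square of the other
  component. It lets a vanishing form annihilate the right-hand side of the system.\<close>

lemma qform_column_bound:
  assumes "p \<ge> 0" "r \<ge> 0" "q\<^sup>2 \<le> p * r"
  shows "(cmod (of_real p * a + of_real q * c))\<^sup>2 \<le> p * qform p q r a c"
    and "(cmod (of_real q * a + of_real r * c))\<^sup>2 \<le> r * qform p q r a c"
proof -
  have "p * qform p q r a c - (cmod (of_real p * a + of_real q * c))\<^sup>2 = (p * r - q\<^sup>2) * (cmod c)\<^sup>2"
    by (simp add: qform_def cmod_mult_self power2_eq_square algebra_simps)
  moreover have "(p * r - q\<^sup>2) * (cmod c)\<^sup>2 \<ge> 0" using assms by simp
  ultimately show "(cmod (of_real p * a + of_real q * c))\<^sup>2 \<le> p * qform p q r a c" by linarith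
  have "r * qform p q r a c - (cmod (of_real q * a + of_real r * c))\<^sup>2 = (p * r - q\<^sup>2) * (cmod a)\<^sup>2"
    by (simp add: qform_def cmod_mult_self power2_eq_square algebra_simps)
  moreover have "(p * r - q\<^sup>2) * (cmod a)\<^sup>2 \<ge> 0" using assms by simp
  ultimately show "(cmod (of_real q * a + of_real r * c))\<^sup>2 \<le> r * qform p q r a c" by linarith
qed

text \<open>For \<open>z = w\<close> the Wronskian is constant, which gives determinant 1; for
  different parameters it is the source of the variation of constants formula.\<close>

lemma sol_wronskian:
  assumes ac: "sol p q r z T a c" and AC: "sol p q r w T A C"
  shows "ac 0 T (\<lambda>t. A t * c t - C t * a t) (\<lambda>t. (z - w) * ((of_real (p t) * A t + of_real (q t) * C t) * a t +
      (of_real (q t) * A t + of_real (r t) * C t) * c t))"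
proof -
  note 1 = ac_mult[OF sol_D(1)[OF AC] sol_D(2)[OF ac]] and 2 = ac_mult[OF sol_D(2)[OF AC] sol_D(1)[OF ac]]
  show ?thesis using ac_diff_fun[OF 1 2] by (rule ac_cong) (auto simp: algebra_simps)
qed

lemma sol_cnj:
  assumes "sol p q r z T a c"
  shows "sol p q r (cnj z) T (\<lambda>t. cnj (a t)) (\<lambda>t. cnj (c t))"
  unfolding sol_def using ac_linear[OF bounded_linear_cnj sol_D(1)[OF assms]] ac_linear[OF bounded_linear_cnj sol_D(2)[OF assms]]
  by (simp add: algebra_simps)

section \<open>The first column as an entire function of the spectral parameter\<close>

text \<open>Positivity is demanded at every time. A Hamiltonian has it almost everywhere and is
  replaced by zero on the exceptional set before the locale is instantiated.\<close>

locale canonical_system =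
  fixes p q r :: "real \<Rightarrow> real" and A B C D :: "real \<Rightarrow> complex \<Rightarrow> complex"
  assumes p_int: "p absolutely_integrable_on {0..T}"
    and q_int: "q absolutely_integrable_on {0..T}"
    and r_int: "r absolutely_integrable_on {0..T}"
    and p_nonneg: "p t \<ge> 0" and r_nonneg: "r t \<ge> 0" and psd: "(q t)\<^sup>2 \<le> p t * r t"
    and AC: "0 \<le> T \<Longrightarrow> sol p q r z T (\<lambda>t. A t z) (\<lambda>t. C t z)"
    and BD: "0 \<le> T \<Longrightarrow> sol p q r z T (\<lambda>t. B t z) (\<lambda>t. D t z)"
    and init: "A 0 z = 1" "B 0 z = 0" "C 0 z = 0" "D 0 z = 1"
begin

lemma det_one:
  assumes t: "0 \<le> t" shows "A t z * D t z - C t z * B t z = 1"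
proof -
  have "(A t z * D t z - C t z * B t z) - (A 0 z * D 0 z - C 0 z * B 0 z) = integral {0..t} (\<lambda>t. 0)"
    using ac_diff[OF sol_wronskian[OF BD AC, of t z z], of 0 t] t by simp
  then show ?thesis by (simp add: init)
qed

text \<open>The bilinear form of the Hamiltonian, without conjugation: the density of the Wronskian
  of two columns.\<close>

definition J :: "(real \<Rightarrow> complex) \<Rightarrow> (real \<Rightarrow> complex) \<Rightarrow> (real \<Rightarrow> complex) \<Rightarrow> (real \<Rightarrow> complex) \<Rightarrow> real \<Rightarrow> complex" where
  "J b d a c s = (of_real (p s) * b s + of_real (q s) * d s) * a s + (of_real (q s) * b s + of_real (r s) * d s) * c s"

definition k :: "real \<Rightarrow> real" where "k s = p s + 2 * \<bar>q s\<bar> + r s"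

lemma k_nonneg: "k s \<ge> 0"
  using p_nonneg[of s] r_nonneg[of s] by (simp add: k_def)

lemma coefficient_integrable:
  assumes "a \<ge> 0"
  shows "p integrable_on {a..b}" "q integrable_on {a..b}" "r integrable_on {a..b}" "(\<lambda>s. \<bar>q s\<bar>) integrable_on {a..b}"
  using absolutely_integrable_on_subinterval_real[OF p_int[of b] assms order_refl]
    absolutely_integrable_on_subinterval_real[OF q_int[of b] assms order_refl]
    absolutely_integrable_on_subinterval_real[OF r_int[of b] assms order_refl]
  by (auto simp: absolutely_integrable_on_def)

lemma k_integrable: "a \<ge> 0 \<Longrightarrow> k integrable_on {a..b}"
  unfolding k_def[abs_def] by (intro integrable_add integrable_on_mult_right coefficient_integrable)

lemma of_real_coefficient_integrable:
  "(\<lambda>s. complex_of_real (p s)) absolutely_integrable_on {0..T}"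
  "(\<lambda>s. complex_of_real (q s)) absolutely_integrable_on {0..T}"
  "(\<lambda>s. complex_of_real (r s)) absolutely_integrable_on {0..T}"
  using absolutely_integrable_linear[OF p_int[of T] bounded_linear_of_real]
    absolutely_integrable_linear[OF q_int[of T] bounded_linear_of_real]
    absolutely_integrable_linear[OF r_int[of T] bounded_linear_of_real] by (simp_all add: o_def)

lemma J_integrable:
  assumes "continuous_on {0..t} b" "continuous_on {0..t} d" "continuous_on {0..t} a" "continuous_on {0..t} c" "s \<le> t"
  shows "J b d a c integrable_on {0..s}"
proof -
  have "J b d a c absolutely_integrable_on {0..t}"
    unfolding J_def[abs_def]
    by (intro set_integral_add absolutely_integrable_mult_continuous_right of_real_coefficient_integrable assms)
  then show ?thesis
    using assms(5) absolutely_integrable_on_subinterval_real[of 0 t _ 0 s] set_lebesgue_integral_eq_integral(1) by blast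
qed

lemma J_norm_le:
  assumes "cmod (b s) \<le> M" "cmod (d s) \<le> M"
  shows "cmod (J b d a c s) \<le> k s * (M * (cmod (a s) + cmod (c s)))"
proof -
  have M: "M \<ge> 0" using assms(1) norm_ge_zero order_trans by blast
  have 1: "cmod (of_real (p s) * b s + of_real (q s) * d s) \<le> p s * M + \<bar>q s\<bar> * M"
    using assms p_nonneg[of s] by (intro norm_triangle_le add_mono) (auto simp: norm_mult intro!: mult_left_mono)
  have 2: "cmod (of_real (q s) * b s + of_real (r s) * d s) \<le> \<bar>q s\<bar> * M + r s * M"
    using assms r_nonneg[of s] by (intro norm_triangle_le add_mono) (auto simp: norm_mult intro!: mult_left_mono)
  have "cmod (J b d a c s) \<le> (p s * M + \<bar>q s\<bar> * M) * cmod (a s) + (\<bar>q s\<bar> * M + r s * M) * cmod (c s)"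
    unfolding J_def by (intro norm_triangle_le add_mono) (auto simp: norm_mult intro!: mult_right_mono 1 2)
  also have "\<dots> \<le> k s * M * cmod (a s) + k s * M * cmod (c s)"
    using M p_nonneg[of s] r_nonneg[of s]
    by (intro add_mono mult_right_mono) (auto simp: k_def distrib_right)
  finally show ?thesis by (simp add: algebra_simps)
qed

lemma J_integral_le:
  assumes c: "continuous_on {0..t} b" "continuous_on {0..t} d" "continuous_on {0..t} a" "continuous_on {0..t} c"
    and s: "0 \<le> s" "s \<le> t"
    and M: "\<And>x. x \<in> {0..t} \<Longrightarrow> cmod (b x) \<le> M" "\<And>x. x \<in> {0..t} \<Longrightarrow> cmod (d x) \<le> M"
    and m: "\<And>x. x \<in> {0..t} \<Longrightarrow> cmod (a x) + cmod (c x) \<le> m"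
  shows "cmod (integral {0..s} (J b d a c)) \<le> integral {0..t} k * (M * m)"
proof -
  have M0: "M \<ge> 0" "m \<ge> 0" using M(1)[of 0] m[of 0] s norm_ge_zero[of "b 0"] norm_ge_zero[of "a 0"] norm_ge_zero[of "c 0"] 
    by (smt (verit) atLeastAtMost_iff)+
  have "cmod (integral {0..s} (J b d a c)) \<le> integral {0..s} (\<lambda>x. k x * (M * m))"
  proof (rule integral_norm_bound_integral)
    show "J b d a c integrable_on {0..s}" by (rule J_integrable[OF c s(2)])
    show "(\<lambda>x. k x * (M * m)) integrable_on {0..s}" by (intro integrable_on_mult_left k_integrable) simp
    fix x assume x: "x \<in> {0..s}"
    have "cmod (J b d a c x) \<le> k x * (M * (cmod (a x) + cmod (c x)))" by (rule J_norm_le) (use M x s in auto)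
    also have "\<dots> \<le> k x * (M * m)" using m[of x] x s M0 k_nonneg by (intro mult_left_mono) auto
    finally show "cmod (J b d a c x) \<le> k x * (M * m)" .
  qed
  also have "\<dots> = integral {0..s} k * (M * m)" by simp
  also have "\<dots> \<le> integral {0..t} k * (M * m)"
    using M0 s k_nonneg by (intro mult_right_mono integral_subset_le k_integrable) auto
  finally show ?thesis .
qed

lemma J_diff:
  "J b d a c s - J b d a' c' s = J b d (\<lambda>s. a s - a' s) (\<lambda>s. c s - c' s) s"
  by (simp add: J_def algebra_simps)

lemma continuous_entries:
  assumes "0 \<le> t"
  shows "continuous_on {0..t} (\<lambda>s. A s z)" "continuous_on {0..t} (\<lambda>s. C s z)"
    "continuous_on {0..t} (\<lambda>s. B s z)" "continuous_on {0..t} (\<lambda>s. D s z)"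
  using ac_continuous[OF sol_D(1)[OF AC[OF assms]]] ac_continuous[OF sol_D(2)[OF AC[OF assms]]]
    ac_continuous[OF sol_D(1)[OF BD[OF assms]]] ac_continuous[OF sol_D(2)[OF BD[OF assms]]] by auto

text \<open>The Wronskians with the two columns at \<open>w\<close> determine \<open>(a, c)\<close>,
  since these columns have determinant 1. For \<open>z = w\<close> the formula is the uniqueness
  statement.\<close>

lemma variation_of_constants:
  assumes sl: "sol p q r z t a c" and i: "a 0 = 1" "c 0 = 0" and s: "0 \<le> s" "s \<le> t"
  shows "a s = A s w + (z - w) * (B s w * integral {0..s} (J (\<lambda>s. A s w) (\<lambda>s. C s w) a c)
            - A s w * integral {0..s} (J (\<lambda>s. B s w) (\<lambda>s. D s w) a c))"
    and "c s = C s w + (z - w) * (D s w * integral {0..s} (J (\<lambda>s. A s w) (\<lambda>s. C s w) a c)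
            - C s w * integral {0..s} (J (\<lambda>s. B s w) (\<lambda>s. D s w) a c))"
proof -
  have t: "0 \<le> t" using s by simp
  define I1 where "I1 = integral {0..s} (J (\<lambda>s. B s w) (\<lambda>s. D s w) a c)"
  define I2 where "I2 = integral {0..s} (J (\<lambda>s. A s w) (\<lambda>s. C s w) a c)"
  have "B s w * c s - D s w * a s + 1 = (z - w) * I1"
    using ac_diff[OF sol_wronskian[OF sl BD[OF t, of w]], of 0 s] s
    by (simp add: I1_def J_def[abs_def] init i)
  then have 1: "B s w * c s - D s w * a s = - 1 + (z - w) * I1" by (simp add: algebra_simps)
  have 2: "A s w * c s - C s w * a s = (z - w) * I2"
    using ac_diff[OF sol_wronskian[OF sl AC[OF t, of w]], of 0 s] s
    by (simp add: I2_def J_def[abs_def] init i)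
  have d: "A s w * D s w - C s w * B s w = 1" using det_one s by simp
  have "a s = (A s w * D s w - C s w * B s w) * a s" using d by simp
  also have "\<dots> = - A s w * (B s w * c s - D s w * a s) + B s w * (A s w * c s - C s w * a s)" by (simp add: algebra_simps)
  finally show "a s = A s w + (z - w) * (B s w * I2 - A s w * I1)" unfolding 1 2 by (simp add: algebra_simps)
  have "c s = (A s w * D s w - C s w * B s w) * c s" using d by simp
  also have "\<dots> = - C s w * (B s w * c s - D s w * a s) + D s w * (A s w * c s - C s w * a s)" by (simp add: algebra_simps)
  finally show "c s = C s w + (z - w) * (D s w * I2 - C s w * I1)" unfolding 1 2 by (simp add: algebra_simps)
qed

lemma sol_unique:
  assumes "sol p q r z t a c" "a 0 = 1" "c 0 = 0" "0 \<le> t"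
  shows "a t = A t z" "c t = C t z"
  using variation_of_constants[OF assms(1-3), of t z] assms(4) by simp_all

lemma entries_cnj:
  assumes "0 \<le> t" shows "A t (cnj z) = cnj (A t z)" "C t (cnj z) = cnj (C t z)"
  using sol_unique[OF sol_cnj[OF AC[OF assms, of z]] _ _ assms] init by simp_all

text \<open>Variation of constants writes the difference quotient in \<open>z\<close> through
  \<open>I1 z\<close> and \<open>I2 z\<close>, so differentiability reduces to continuity of these
  integrals at \<open>w\<close>. That follows from uniform convergence of the solutions on
  \<open>{0..t}\<close> as \<open>z\<close> tends to \<open>w\<close>.\<close>

lemma entries_derivative:
  fixes w :: complex
  assumes t: "0 \<le> t"
  defines "I1 \<equiv> \<lambda>z. integral {0..t} (J (\<lambda>s. B s w) (\<lambda>s. D s w) (\<lambda>s. A s z) (\<lambda>s. C s z))"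
    and "I2 \<equiv> \<lambda>z. integral {0..t} (J (\<lambda>s. A s w) (\<lambda>s. C s w) (\<lambda>s. A s z) (\<lambda>s. C s z))"
  shows "(A t has_field_derivative (B t w * I2 w - A t w * I1 w)) (at w)"
    and "(C t has_field_derivative (D t w * I2 w - C t w * I1 w)) (at w)"
proof -
  note cw = continuous_entries[OF t, of w]
  have "\<exists>M. \<forall>s\<in>{0..t}. cmod (A s w) \<le> M \<and> cmod (C s w) \<le> M \<and> cmod (B s w) \<le> M \<and> cmod (D s w) \<le> M"
  proof -
    have "continuous_on {0..t} (\<lambda>s. cmod (A s w) + cmod (C s w) + cmod (B s w) + cmod (D s w))"
      by (intro continuous_intros cw)
    then have "bounded ((\<lambda>s. cmod (A s w) + cmod (C s w) + cmod (B s w) + cmod (D s w)) ` {0..t})"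
      by (simp add: compact_continuous_image compact_imp_bounded)
    then obtain M where M0: "\<forall>s\<in>{0..t}. cmod (A s w) + cmod (C s w) + cmod (B s w) + cmod (D s w) \<le> M"
      unfolding bounded_iff by auto
    then have M: "cmod (A s w) + cmod (C s w) + cmod (B s w) + cmod (D s w) \<le> M" if "s \<in> {0..t}" for s
      using that by blast
    have "cmod (A s w) \<le> M \<and> cmod (C s w) \<le> M \<and> cmod (B s w) \<le> M \<and> cmod (D s w) \<le> M" if "s \<in> {0..t}" for s
      using M[OF that] norm_ge_zero[of "A s w"] norm_ge_zero[of "B s w"] norm_ge_zero[of "C s w"] norm_ge_zero[of "D s w"]
      by linarith
    then show ?thesis by blast
  qed
  then obtain M where M: "\<And>s. s \<in> {0..t} \<Longrightarrow> cmod (A s w) \<le> M" "\<And>s. s \<in> {0..t} \<Longrightarrow> cmod (C s w) \<le> M"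
     "\<And>s. s \<in> {0..t} \<Longrightarrow> cmod (B s w) \<le> M" "\<And>s. s \<in> {0..t} \<Longrightarrow> cmod (D s w) \<le> M" by blast
  have M0: "M \<ge> 0" using M(1)[of 0] t norm_ge_zero[of "A 0 w"] by (meson atLeastAtMost_iff order_refl order_trans)
  define h where "h = integral {0..t} k"
  have h0: "h \<ge> 0" unfolding h_def using k_nonneg by (intro integral_nonneg k_integrable) auto
  define \<kappa> where "\<kappa> = 4 * M * h * M + 1"
  have \<kappa>0: "\<kappa> > 0" using M0 h0 by (simp add: \<kappa>_def add_nonneg_pos)
  define g where "g z s = cmod (A s z - A s w) + cmod (C s z - C s w)" for z s
  have g_bound: "g z s \<le> cmod (z - w) * (4 * \<kappa> * M)" if z: "cmod (z - w) * \<kappa> \<le> 1 / 2" and s: "s \<in> {0..t}" for z s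
  proof -
    note cz = continuous_entries[OF t, of z]
    have "continuous_on {0..t} (g z)" unfolding g_def by (intro continuous_intros cz cw)
    moreover have "{0..t} \<noteq> {}" using t by simp
    ultimately obtain x where x: "x \<in> {0..t}" "\<And>s. s \<in> {0..t} \<Longrightarrow> g z s \<le> g z x"
      using continuous_attains_sup[of "{0..t}" "g z"] by blast
    \<comment> \<open>The a priori bound contains the unknown maximum \<open>g z x\<close>; the
      resulting inequality bounds it by a constant plus at most half of itself once
      \<open>cmod (z - w) * \<kappa> \<le> 1 / 2\<close>, so it can be absorbed.\<close>
    define m where "m = 2 * M + g z x"
    have mz: "cmod (A s z) + cmod (C s z) \<le> m" if "s \<in> {0..t}" for s
      using x(2)[OF that] M(1,2)[OF that] norm_triangle_sub[of "A s z" "A s w"] norm_triangle_sub[of "C s z" "C s w"]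
      unfolding m_def g_def by linarith
    have I: "cmod (integral {0..x} (J (\<lambda>s. B s w) (\<lambda>s. D s w) (\<lambda>s. A s z) (\<lambda>s. C s z))) \<le> h * (M * m)"
      "cmod (integral {0..x} (J (\<lambda>s. A s w) (\<lambda>s. C s w) (\<lambda>s. A s z) (\<lambda>s. C s z))) \<le> h * (M * m)"
      unfolding h_def using x(1) by (auto intro!: J_integral_le cw cz M mz)
    have m0: "m \<ge> 0" using M0 by (simp add: m_def g_def)
    note v = variation_of_constants[OF AC[OF t, of z], of x w, unfolded init]
    have v1: "cmod (A x z - A x w) \<le> cmod (z - w) * (M * (h * (M * m)) + M * (h * (M * m)))"
    proof -
      have "A x z - A x w = (z - w) * (B x w * integral {0..x} (J (\<lambda>s. A s w) (\<lambda>s. C s w) (\<lambda>s. A s z) (\<lambda>s. C s z))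
            - A x w * integral {0..x} (J (\<lambda>s. B s w) (\<lambda>s. D s w) (\<lambda>s. A s z) (\<lambda>s. C s z)))"
        using v(1) x(1) by simp
      also have "cmod \<dots> \<le> cmod (z - w) * (M * (h * (M * m)) + M * (h * (M * m)))"
        unfolding norm_mult[of "z - w"] using M0 h0 m0
        by (intro mult_left_mono order_trans[OF norm_triangle_ineq4] add_mono) (auto simp: norm_mult intro!: mult_mono M I x)
      finally show ?thesis .
    qed
    have v2: "cmod (C x z - C x w) \<le> cmod (z - w) * (M * (h * (M * m)) + M * (h * (M * m)))"
    proof -
      have "C x z - C x w = (z - w) * (D x w * integral {0..x} (J (\<lambda>s. A s w) (\<lambda>s. C s w) (\<lambda>s. A s z) (\<lambda>s. C s z))
            - C x w * integral {0..x} (J (\<lambda>s. B s w) (\<lambda>s. D s w) (\<lambda>s. A s z) (\<lambda>s. C s z)))"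
        using v(2) x(1) by simp
      also have "cmod \<dots> \<le> cmod (z - w) * (M * (h * (M * m)) + M * (h * (M * m)))"
        unfolding norm_mult[of "z - w"] using M0 h0 m0
        by (intro mult_left_mono order_trans[OF norm_triangle_ineq4] add_mono) (auto simp: norm_mult intro!: mult_mono M I x)
      finally show ?thesis .
    qed
    have "g z x \<le> cmod (z - w) * (4 * M * h * M) * m" using v1 v2 unfolding g_def by (simp add: algebra_simps)
    also have "\<dots> \<le> cmod (z - w) * \<kappa> * m" using m0 by (intro mult_right_mono mult_left_mono) (auto simp: \<kappa>_def)
    also have "\<dots> = cmod (z - w) * \<kappa> * (2 * M) + cmod (z - w) * \<kappa> * g z x" by (simp add: m_def algebra_simps)
    also have "\<dots> \<le> cmod (z - w) * \<kappa> * (2 * M) + 1 / 2 * g z x"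
      using z by (intro add_left_mono mult_right_mono) (auto simp: g_def)
    finally have "g z x \<le> cmod (z - w) * (4 * \<kappa> * M)" by (simp add: algebra_simps)
    then show ?thesis using x(2)[OF s] by linarith
  qed
  have ev: "\<forall>\<^sub>F z in at w. cmod (z - w) * \<kappa> \<le> 1 / 2"
  proof -
    have "((\<lambda>z. cmod (z - w) * \<kappa>) \<longlongrightarrow> cmod (w - w) * \<kappa>) (at w)" by (intro tendsto_intros)
    then have "\<forall>\<^sub>F z in at w. cmod (z - w) * \<kappa> < 1 / 2" by (rule order_tendstoD) simp
    then show ?thesis by eventually_elim simp
  qed
  have lim: "((\<lambda>z. integral {0..t} (J b d (\<lambda>s. A s z) (\<lambda>s. C s z))) \<longlongrightarrow> integral {0..t} (J b d (\<lambda>s. A s w) (\<lambda>s. C s w))) (at w)"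
    if b: "continuous_on {0..t} b" "continuous_on {0..t} d" "\<And>x. x \<in> {0..t} \<Longrightarrow> cmod (b x) \<le> M" "\<And>x. x \<in> {0..t} \<Longrightarrow> cmod (d x) \<le> M" for b d
  proof -
    have "((\<lambda>z. integral {0..t} (J b d (\<lambda>s. A s z) (\<lambda>s. C s z)) - integral {0..t} (J b d (\<lambda>s. A s w) (\<lambda>s. C s w))) \<longlongrightarrow> 0) (at w)"
    proof (rule Lim_null_comparison)
      show "\<forall>\<^sub>F z in at w. norm (integral {0..t} (J b d (\<lambda>s. A s z) (\<lambda>s. C s z)) - integral {0..t} (J b d (\<lambda>s. A s w) (\<lambda>s. C s w)))
         \<le> h * (M * (cmod (z - w) * (4 * \<kappa> * M)))"
        using ev
      proof eventually_elim
        case (elim z)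
        note cz = continuous_entries[OF t, of z]
        have "integral {0..t} (J b d (\<lambda>s. A s z) (\<lambda>s. C s z)) - integral {0..t} (J b d (\<lambda>s. A s w) (\<lambda>s. C s w))
           = integral {0..t} (J b d (\<lambda>s. A s z - A s w) (\<lambda>s. C s z - C s w))"
          by (subst Henstock_Kurzweil_Integration.integral_diff[symmetric]) (auto intro!: J_integrable b cz cw simp: J_diff)
        also have "cmod \<dots> \<le> h * (M * (cmod (z - w) * (4 * \<kappa> * M)))"
          unfolding h_def using t g_bound[OF elim] by (intro J_integral_le b continuous_intros cz cw) (auto simp: g_def)
        finally show ?case .
      qed
      have "((\<lambda>z. h * (M * (cmod (z - w) * (4 * \<kappa> * M)))) \<longlongrightarrow> h * (M * (cmod (w - w) * (4 * \<kappa> * M)))) (at w)"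
        by (intro tendsto_intros)
      then show "((\<lambda>z. h * (M * (cmod (z - w) * (4 * \<kappa> * M)))) \<longlongrightarrow> 0) (at w)" by simp
    qed
    then show ?thesis by (simp add: LIM_zero_iff)
  qed
  have I1: "(I1 \<longlongrightarrow> I1 w) (at w)" unfolding I1_def by (rule lim) (use cw M in auto)
  have I2: "(I2 \<longlongrightarrow> I2 w) (at w)" unfolding I2_def by (rule lim) (use cw M in auto)
  have v1: "A t z = A t w + (z - w) * (B t w * I2 z - A t w * I1 z)" for z
    unfolding I1_def I2_def by (rule variation_of_constants(1)[OF AC[OF t] init(1,3) t order_refl])
  have v2: "C t z = C t w + (z - w) * (D t w * I2 z - C t w * I1 z)" for z
    unfolding I1_def I2_def by (rule variation_of_constants(2)[OF AC[OF t] init(1,3) t order_refl])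
  have quot: "X = (f z - f w) / (z - w)" if "f z = f w + (z - w) * X" "z \<noteq> w" for f :: "complex \<Rightarrow> complex" and z X
    using that by simp
  have "((\<lambda>z. B t w * I2 z - A t w * I1 z) \<longlongrightarrow> B t w * I2 w - A t w * I1 w) (at w)"
    by (intro tendsto_intros I1 I2)
  moreover have "\<forall>\<^sub>F z in at w. B t w * I2 z - A t w * I1 z = (A t z - A t w) / (z - w)"
    unfolding eventually_at_filter by (intro always_eventually allI impI quot[where f = "A t", OF v1])
  ultimately show "(A t has_field_derivative (B t w * I2 w - A t w * I1 w)) (at w)"
    unfolding has_field_derivative_iff by (rule Lim_transform_eventually)
  have "((\<lambda>z. D t w * I2 z - C t w * I1 z) \<longlongrightarrow> D t w * I2 w - C t w * I1 w) (at w)"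
    by (intro tendsto_intros I1 I2)
  moreover have "\<forall>\<^sub>F z in at w. D t w * I2 z - C t w * I1 z = (C t z - C t w) / (z - w)"
    unfolding eventually_at_filter by (intro always_eventually allI impI quot[where f = "C t", OF v2])
  ultimately show "(C t has_field_derivative (D t w * I2 w - C t w * I1 w)) (at w)"
    unfolding has_field_derivative_iff by (rule Lim_transform_eventually)
qed

lemma entries_holomorphic:
  assumes "0 \<le> t" shows "A t holomorphic_on UNIV" "C t holomorphic_on UNIV"
  using entries_derivative[OF assms] by (auto simp: holomorphic_on_open)

end

section \<open>Monotonicity of the area, growth exponents and the upper bound for the type\<close>

lemma integral_le_sqrt_integral_mult:
  fixes f g h :: "real \<Rightarrow> real"
  assumes i: "f integrable_on S" "g integrable_on S" "h integrable_on S"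
    and n: "\<And>x. x \<in> S \<Longrightarrow> f x \<ge> 0" "\<And>x. x \<in> S \<Longrightarrow> g x \<ge> 0"
    and s: "\<And>x. x \<in> S \<Longrightarrow> (h x)\<^sup>2 \<le> f x * g x"
  shows "integral S h \<le> sqrt (integral S f * integral S g)"
proof (rule le_sqrt_mult_if_le_weighted_mean)
  fix l :: real assume l: "l > 0"
  have "integral S h \<le> integral S (\<lambda>x. (l * f x + g x / l) / 2)"
  proof (rule integral_le)
    show "(\<lambda>x. (l * f x + g x / l) / 2) integrable_on S"
      using i by (intro integrable_on_divide integrable_add integrable_on_mult_right)
    fix x assume x: "x \<in> S"
    have "(2 * h x)\<^sup>2 \<le> (l * f x + g x / l)\<^sup>2"
    proof -
      have "(2 * h x)\<^sup>2 \<le> 4 * (f x * g x)" using s[OF x] by (simp add: power_mult_distrib)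
      also have "\<dots> = (l * f x + g x / l)\<^sup>2 - (l * f x - g x / l)\<^sup>2"
        using l by (simp add: power2_eq_square field_simps)
      finally show ?thesis using zero_le_power2[of "l * f x - g x / l"] by linarith
    qed
    then have "2 * h x \<le> l * f x + g x / l" by (rule power2_le_imp_le) (use n[OF x] l in auto)
    then show "h x \<le> (l * f x + g x / l) / 2" by simp
  qed (rule i)
  also have "\<dots> = (l * integral S f + integral S g / l) / 2"
    using i by (simp add: Henstock_Kurzweil_Integration.integral_add integrable_on_mult_right integrable_on_divide)
  finally show "integral S h \<le> (l * integral S f + integral S g / l) / 2" .
qed (use i n in \<open>auto intro!: integral_nonneg\<close>)

context canonical_system
begin

definition d :: "real \<Rightarrow> real" where "d s = sqrt (p s * r s - (q s)\<^sup>2)"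

lemma d_nonneg: "d s \<ge> 0" using psd[of s] by (simp add: d_def)

lemma d_le: "d s \<le> p s + r s"
proof -
  have sq: "p s * r s - (q s)\<^sup>2 \<le> (p s + r s)\<^sup>2"
    using mult_nonneg_nonneg[OF p_nonneg[of s] r_nonneg[of s]] zero_le_power2[of "p s"] zero_le_power2[of "q s"] zero_le_power2[of "r s"]
    unfolding power2_sum by linarith
  show ?thesis unfolding d_def
    by (rule real_le_lsqrt) (simp_all only: sq add_nonneg_nonneg p_nonneg r_nonneg psd diff_ge_0_iff_ge)
qed

lemma d_abs_integrable: "d absolutely_integrable_on {0..T}"
proof (rule measurable_bounded_by_integrable_imp_absolutely_integrable)
  have [measurable]: "p \<in> borel_measurable (lebesgue_on {0..T})" "q \<in> borel_measurable (lebesgue_on {0..T})"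
    "r \<in> borel_measurable (lebesgue_on {0..T})"
    using p_int[of T] q_int[of T] r_int[of T] by (simp_all add: absolutely_integrable_measurable)
  show "d \<in> borel_measurable (lebesgue_on {0..T})" unfolding d_def by measurable
  show "(\<lambda>s. p s + r s) integrable_on {0..T}" by (intro integrable_add coefficient_integrable) simp_all
  show "norm (d s) \<le> p s + r s" for s using d_le d_nonneg by simp
qed simp

lemma d_integrable: "a \<ge> 0 \<Longrightarrow> d integrable_on {a..b}"
  using absolutely_integrable_on_subinterval_real[OF d_abs_integrable[of b], of a b] set_lebesgue_integral_eq_integral(1)
  by blast

lemma area_increment:
  assumes "0 \<le> s" "s \<le> t"
  shows "area (A t z) (C t z) - area (A s z) (C s z) = integral {s..t} (\<lambda>x. Im z * qform (p x) (q x) (r x) (A x z) (C x z))"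
    and "(\<lambda>x. Im z * qform (p x) (q x) (r x) (A x z) (C x z)) integrable_on {s..t}"
  using ac_diff[OF sol_area[OF AC[of t z]], of s t] ac_integrable[OF sol_area[OF AC[of t z]], of s t] assms by auto

lemma qform_coeff_nonneg: "qform (p x) (q x) (r x) a c \<ge> 0"
  by (rule qform_nonneg[OF p_nonneg r_nonneg psd])

lemma area_mono:
  assumes "0 \<le> s" "s \<le> t" "Im z \<ge> 0"
  shows "area (A s z) (C s z) \<le> area (A t z) (C t z)"
proof -
  have "0 \<le> integral {s..t} (\<lambda>x. Im z * qform (p x) (q x) (r x) (A x z) (C x z))"
    using assms qform_coeff_nonneg by (intro integral_nonneg area_increment) auto
  then show ?thesis using area_increment(1)[OF assms(1,2), of z] by linarith
qed

lemma area_0: "area (A 0 z) (C 0 z) = 0" by (simp add: init area_def)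

lemma area_nonneg: "0 \<le> t \<Longrightarrow> Im z \<ge> 0 \<Longrightarrow> area (A t z) (C t z) \<ge> 0"
  using area_mono[of 0 t z] by (simp add: area_0)

lemma integral_abs_q_le:
  assumes "0 \<le> a" shows "integral {a..b} (\<lambda>s. \<bar>q s\<bar>) \<le> sqrt (integral {a..b} p * integral {a..b} r)"
  by (rule integral_le_sqrt_integral_mult) (use coefficient_integrable[OF assms] p_nonneg r_nonneg psd in auto)

text \<open>Vanishing area means vanishing energy. The column bounds and Cauchy-Schwarz then make
  the column at \<open>w\<close> constant, equal to \<open>(1, 0)\<close>, so the energy is
  \<open>p\<close> itself and has integral zero. Hence \<open>q\<close> integrates to zero too, and
  \<open>(1, 0)\<close> solves the system for every \<open>z\<close>.\<close>

lemma area_zero_imp_trivial: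
  assumes t: "0 \<le> t" and w: "Im w > 0" and z0: "area (A t w) (C t w) = 0"
  shows "A t z = 1" "C t z = 0"
proof -
  define F where "F x = qform (p x) (q x) (r x) (A x w) (C x w)" for x
  have Fi: "F integrable_on {0..t}"
  proof -
    have "(\<lambda>x. Im w * F x) integrable_on {0..t}" unfolding F_def by (rule area_increment(2)) (use t in auto)
    then have "(\<lambda>x. (1 / Im w) * (Im w * F x)) integrable_on {0..t}" by (rule integrable_on_mult_right)
    then show ?thesis using w by simp
  qed
  have F0: "F x \<ge> 0" for x unfolding F_def by (rule qform_coeff_nonneg)
  have "Im w * integral {0..t} F = 0"
    using area_increment(1)[OF order_refl t, of w] z0 by (simp add: area_0 F_def[abs_def])
  then have IF: "integral {0..t} F = 0" using w by simp
  have IFs: "integral {0..s} F = 0" if "s \<in> {0..t}" for s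
  proof (rule antisym)
    have Fs: "F integrable_on {0..s}" using integrable_on_subinterval[OF Fi, of 0 s] that by simp
    have "integral {0..s} F \<le> integral {0..t} F"
      by (rule integral_subset_le[OF _ Fs Fi]) (use that F0 in simp_all)
    then show "integral {0..s} F \<le> 0" by (simp add: IF)
    show "0 \<le> integral {0..s} F" by (rule integral_nonneg[OF Fs]) (rule F0)
  qed
  have zero: "integral {0..s} G = 0" if s: "s \<in> {0..t}" and G: "G absolutely_integrable_on {0..t}"
    and b: "\<And>x. (cmod (G x))\<^sup>2 \<le> m x * F x" and m: "m integrable_on {0..t}" "\<And>x. m x \<ge> 0" for s m and G :: "real \<Rightarrow> complex"
  proof -
    have Gs: "G absolutely_integrable_on {0..s}" using absolutely_integrable_on_subinterval_real[OF G] s by auto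
    have ms: "m integrable_on {0..s}" "F integrable_on {0..s}" using integrable_on_subinterval[OF m(1), of 0 s] integrable_on_subinterval[OF Fi, of 0 s] s by simp_all
    have "cmod (integral {0..s} G) \<le> integral {0..s} (\<lambda>x. cmod (G x))"
      using Gs by (intro integral_norm_bound_integral) (auto simp: absolutely_integrable_on_def)
    also have "\<dots> \<le> sqrt (integral {0..s} m * integral {0..s} F)"
      by (rule integral_le_sqrt_integral_mult) (use Gs ms b m F0 in \<open>auto simp: absolutely_integrable_on_def\<close>)
    finally show ?thesis using IFs[OF s] by simp
  qed
  note cw = continuous_entries[OF t, of w]
  have A1: "A s w = 1" and C0: "C s w = 0" if s: "s \<in> {0..t}" for s
  proof -
    have "integral {0..s} (\<lambda>x. of_real (p x) * A x w + of_real (q x) * C x w) = 0"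
      by (rule zero[OF s, where m = p])
        (auto intro!: set_integral_add absolutely_integrable_mult_continuous_right of_real_coefficient_integrable cw
          coefficient_integrable p_nonneg simp: F_def qform_column_bound p_nonneg r_nonneg psd)
    moreover have "C s w - C 0 w = integral {0..s} (\<lambda>x. w * (of_real (p x) * A x w + of_real (q x) * C x w))"
      using ac_diff[OF sol_D(2)[OF AC[OF t, of w]], of 0 s] s by auto
    ultimately show "C s w = 0" by (simp add: init)
    have "integral {0..s} (\<lambda>x. of_real (q x) * A x w + of_real (r x) * C x w) = 0"
      by (rule zero[OF s, where m = r])
        (auto intro!: set_integral_add absolutely_integrable_mult_continuous_right of_real_coefficient_integrable cw
          coefficient_integrable r_nonneg simp: F_def qform_column_bound p_nonneg r_nonneg psd)
    moreover have "A s w - A 0 w = integral {0..s} (\<lambda>x. - w * (of_real (q x) * A x w + of_real (r x) * C x w))"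
      using ac_diff[OF sol_D(1)[OF AC[OF t, of w]], of 0 s] s by auto
    ultimately show "A s w = 1" by (simp add: init)
  qed
  have Ip: "integral {0..s} p = 0" if s: "s \<in> {0..t}" for s
  proof -
    have "integral {0..s} p = integral {0..s} F"
      by (rule integral_cong) (use s A1 C0 in \<open>auto simp: F_def qform_def\<close>)
    then show ?thesis using IFs[OF s] by simp
  qed
  have Iq: "integral {0..s} q = 0" if s: "s \<in> {0..t}" for s
  proof -
    have "norm (integral {0..s} q) \<le> integral {0..s} (\<lambda>s. \<bar>q s\<bar>)"
      by (intro integral_norm_bound_integral coefficient_integrable) auto
    also have "\<dots> \<le> 0" using integral_abs_q_le[of 0 s] Ip[OF s] by simp
    finally show ?thesis by simp
  qed
  have of: "integral {0..s} (\<lambda>x. complex_of_real (f x)) = of_real (integral {0..s} f)" if "f integrable_on {0..s}" for f :: "real \<Rightarrow> real" and s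
    using integral_linear[OF that bounded_linear_of_real] by (simp add: o_def)
  have "sol p q r z t (\<lambda>_. 1) (\<lambda>_. 0)"
    unfolding sol_def ac_def
  proof (intro conjI ballI)
    show "(\<lambda>x. - z * (of_real (q x) * 1 + of_real (r x) * 0)) absolutely_integrable_on {0..t}"
      "(\<lambda>x. z * (of_real (p x) * 1 + of_real (q x) * 0)) absolutely_integrable_on {0..t}"
      unfolding mult_zero_right add_0_right mult_1_right
      by (intro set_integrable_mult_right of_real_coefficient_integrable)+
    fix s assume s: "s \<in> {0..t}"
    show "(1::complex) - 1 = integral {0..s} (\<lambda>x. - z * (of_real (q x) * 1 + of_real (r x) * 0))"
      "(0::complex) - 0 = integral {0..s} (\<lambda>x. z * (of_real (p x) * 1 + of_real (q x) * 0))"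
      using Ip[OF s] Iq[OF s] coefficient_integrable[of 0 s] by (simp_all add: of)
  qed
  from sol_unique[OF this _ _ t] show "A t z = 1" "C t z = 0" by simp_all
qed

definition N :: "real \<Rightarrow> real \<Rightarrow> real" where
  "N t y = (cmod (A t (\<i> * of_real y)))\<^sup>2 + (cmod (C t (\<i> * of_real y)))\<^sup>2"

text \<open>\<open>N\<close> is quadratic in the entries, whence the 2; \<open>W\<close> below is
  then the exponential type of the first column along the positive imaginary axis.\<close>

definition growth :: "real \<Rightarrow> real \<Rightarrow> bool" where
  "growth t \<kappa> \<longleftrightarrow> (\<exists>M. \<forall>y\<ge>1. N t y \<le> M * exp (2 * y * \<kappa>))"

definition W :: "real \<Rightarrow> real" where "W t = Inf {\<kappa>. growth t \<kappa>}"

text \<open>The square of the modulus of \<open>A\<close> starts at 1 and has density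
  \<open>2 * y * r\<close> times the area, which is nonnegative.\<close>

lemma N_ge_1: "0 \<le> t \<Longrightarrow> y \<ge> 0 \<Longrightarrow> N t y \<ge> 1"
proof -
  assume t: "0 \<le> t" and y: "y \<ge> 0"
  define z where "z = \<i> * complex_of_real y"
  note s = sol_norm_sq(1)[OF AC[OF t, of "\<i> * of_real y"]]
  have "(cmod (A t z))\<^sup>2 - (cmod (A 0 z))\<^sup>2 = integral {0..t} (\<lambda>x. 2 * y * r x * area (A x z) (C x z))"
    using ac_diff[OF s, of 0 t] t by (simp add: z_def)
  also have "\<dots> \<ge> 0"
    using ac_integrable[OF s, of 0 t] y r_nonneg area_nonneg[of _ z]
    by (intro integral_nonneg) (auto simp: z_def)
  finally show ?thesis by (simp add: N_def z_def init add_increasing2)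
qed

lemma growth_nonneg:
  assumes "0 \<le> t" "growth t \<kappa>" shows "\<kappa> \<ge> 0"
proof (rule ccontr)
  assume c: "\<not> ?thesis"
  obtain M where M: "\<And>y. y \<ge> 1 \<Longrightarrow> N t y \<le> M * exp (2 * y * \<kappa>)" using assms by (auto simp: growth_def)
  define y where "y = max 1 ((M + 1) / (- 2 * \<kappa>))"
  have y: "y \<ge> 1" "y * (- 2 * \<kappa>) \<ge> M + 1" using c by (auto simp: y_def field_simps max_def)
  have "1 \<le> M * exp (2 * y * \<kappa>)" using M[OF y(1)] N_ge_1[OF assms(1), of y] y by linarith
  then have "exp (- (2 * y * \<kappa>)) \<le> M" by (simp add: exp_minus field_simps)
  moreover have "exp (- (2 * y * \<kappa>)) \<ge> 1 + - (2 * y * \<kappa>)" by (rule exp_ge_add_one_self)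
  ultimately show False using y(2) by (simp add: algebra_simps)
qed

lemma growth_0: "growth 0 0" by (auto simp: growth_def N_def init intro: exI[of _ 1])

text \<open>On \<open>{s..t}\<close> the solution is measured in the fixed norm given by the matrix
  \<open>\<integral>H + \<delta> I\<close>; its logarithm then grows at a rate that is linear in \<open>H\<close>.\<close>

lemma growth_step:
  assumes st: "0 \<le> s" "s \<le> t" and \<delta>: "\<delta> > 0" and g: "growth s \<kappa>"
  defines "P \<equiv> integral {s..t} p" and "Qq \<equiv> integral {s..t} q" and "R \<equiv> integral {s..t} r"
  shows "growth t (\<kappa> + sqrt (P * R - Qq\<^sup>2 + \<delta> * (P + R) + \<delta>\<^sup>2))"
proof -
  note ci = coefficient_integrable[OF st(1), of t]
  have P0: "P \<ge> 0" "R \<ge> 0" unfolding P_def R_def using p_nonneg r_nonneg by (auto intro!: integral_nonneg ci)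
  have Q: "Qq\<^sup>2 \<le> P * R"
  proof -
    have "norm Qq \<le> integral {s..t} (\<lambda>s. \<bar>q s\<bar>)"
      unfolding Qq_def by (intro integral_norm_bound_integral ci) auto
    also have "\<dots> \<le> sqrt (P * R)" unfolding P_def R_def by (rule integral_abs_q_le[OF st(1)])
    finally have "(norm Qq)\<^sup>2 \<le> (sqrt (P * R))\<^sup>2" by (rule power_mono) simp
    then show ?thesis using P0 by simp
  qed
  \<comment> \<open>Adding \<open>\<delta>\<close> to the diagonal makes the matrix positive
    definite; \<open>D\<close> is its determinant.\<close>
  define P1 P3 D where "P1 = P + \<delta>" and "P3 = R + \<delta>" and "D = P1 * P3 - Qq\<^sup>2"
  have D_eq: "D = P * R - Qq\<^sup>2 + \<delta> * (P + R) + \<delta>\<^sup>2" by (simp add: D_def P1_def P3_def power2_eq_square algebra_simps)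
  have D0: "D > 0" unfolding D_eq using Q P0 \<delta> by (intro add_nonneg_pos add_nonneg_nonneg) auto
  define K where "K = sqrt D"
  have K: "K > 0" "K\<^sup>2 = D" using D0 by (auto simp: K_def)
  have pos: "P1 > 0" "P3 > 0" using P0 \<delta> by (auto simp: P1_def P3_def)
  have psdP: "Qq\<^sup>2 \<le> P1 * P3" using D0 by (simp add: D_def)
  define tr where "tr = P1 + P3"
  \<comment> \<open>Determinant over trace, a lower bound for the smaller eigenvalue.\<close>
  define lam where "lam = D / tr"
  have tr0: "tr > 0" using pos by (simp add: tr_def)
  have lam0: "lam > 0" using D0 tr0 by (simp add: lam_def)
  have lower: "lam * ((cmod a)\<^sup>2 + (cmod c)\<^sup>2) \<le> qform P1 Qq P3 a c" for a c
  proof -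
    have "D \<le> P1 * tr" "D \<le> P3 * tr" using pos by (auto simp: D_def tr_def algebra_simps)
    then have 1: "0 \<le> P1 - lam" "0 \<le> P3 - lam" using tr0 by (auto simp: lam_def field_simps)
    have "(P1 - lam) * (P3 - lam) - Qq\<^sup>2 = D - lam * tr + lam\<^sup>2" by (simp add: D_def tr_def power2_eq_square algebra_simps)
    also have "\<dots> = lam\<^sup>2" using tr0 by (simp add: lam_def)
    finally have "Qq\<^sup>2 \<le> (P1 - lam) * (P3 - lam)" using zero_le_power2[of lam] by linarith
    from qform_nonneg[OF 1 this, of a c] show ?thesis by (simp add: qform_def algebra_simps)
  qed
  have upper: "qform P1 Qq P3 a c \<le> 2 * tr * ((cmod a)\<^sup>2 + (cmod c)\<^sup>2)" for a c
  proof -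
    have 1: "2 * Qq * Re (cnj a * c) \<le> qform P1 0 P3 a c"
    proof -
      have "qform P1 (- Qq) P3 a c \<ge> 0" by (rule qform_nonneg) (use pos psdP in auto)
      then show ?thesis by (simp add: qform_def)
    qed
    have "qform P1 Qq P3 a c \<le> 2 * qform P1 0 P3 a c" using 1 by (simp add: qform_def)
    also have "qform P1 0 P3 a c \<le> tr * ((cmod a)\<^sup>2 + (cmod c)\<^sup>2)"
      using pos by (simp add: qform_def tr_def algebra_simps)
    finally show ?thesis by simp
  qed
  have grow: "qform P1 Qq P3 (A t (\<i> * of_real y)) (C t (\<i> * of_real y)) \<le>
      qform P1 Qq P3 (A s (\<i> * of_real y)) (C s (\<i> * of_real y)) * exp (2 * y * K)" if y: "y \<ge> 1" for y
  proof -
    define z where "z = \<i> * complex_of_real y"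
    define n where "n x = qform P1 Qq P3 (A x z) (C x z)" for x
    have n0: "n x > 0" if "x \<ge> 0" for x
    proof -
      have "0 < lam * N x y" using lam0 N_ge_1[OF that, of y] y by (intro mult_pos_pos) auto
      also have "\<dots> \<le> n x" unfolding n_def N_def z_def by (rule lower)
      finally show ?thesis .
    qed
    \<comment> \<open>The trace of the adjugate of the weight times \<open>H\<close>. As the weight
      is the integral of \<open>H\<close> up to \<open>\<delta>\<close>, its integral is at most
      \<open>2 * D\<close>, twice the determinant of the weight; this is what dictates the choice of
      norm.\<close>
    define \<tau> where "\<tau> x = P1 * r x - 2 * Qq * q x + P3 * p x" for x
    have t: "0 \<le> t" using st by simp
    have acn: "ac 0 t n (\<lambda>x. y * \<tau> x * (2 * area (A x z) (C x z)))"
      unfolding n_def \<tau>_def z_def by (rule sol_qform_const[OF AC[OF t]])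
    have acl: "ac s t (\<lambda>x. ln (n x)) (\<lambda>x. y * \<tau> x * (2 * area (A x z) (C x z)) * inverse (n x))"
      by (rule ac_ln[OF ac_sub[OF acn]]) (use st n0 in auto)
    have \<tau>0: "\<tau> x \<ge> 0" for x
    proof -
      have "(2 * \<bar>Qq * q x\<bar>)\<^sup>2 \<le> (P1 * r x + P3 * p x)\<^sup>2"
      proof -
        have "(Qq * q x)\<^sup>2 \<le> (P1 * P3) * (p x * r x)"
          unfolding power_mult_distrib using psdP psd[of x] pos by (intro mult_mono) auto
        moreover have "4 * ((P1 * P3) * (p x * r x)) = (P1 * r x + P3 * p x)\<^sup>2 - (P1 * r x - P3 * p x)\<^sup>2"
          by (simp add: power2_eq_square algebra_simps)
        moreover have "(2 * \<bar>Qq * q x\<bar>)\<^sup>2 = 4 * (Qq * q x)\<^sup>2" by (simp add: power_mult_distrib)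
        ultimately show ?thesis using zero_le_power2[of "P1 * r x - P3 * p x"] by linarith
      qed
      then have "2 * \<bar>Qq * q x\<bar> \<le> P1 * r x + P3 * p x"
        by (rule power2_le_imp_le) (use pos p_nonneg[of x] r_nonneg[of x] in auto)
      then show ?thesis using abs_ge_self[of "Qq * q x"] unfolding \<tau>_def by linarith
    qed
    have \<tau>i: "\<tau> integrable_on {s..t}"
      unfolding \<tau>_def by (intro integrable_add integrable_diff integrable_on_mult_right ci)
    have "ln (n t) - ln (n s) = integral {s..t} (\<lambda>x. y * \<tau> x * (2 * area (A x z) (C x z)) * inverse (n x))"
      by (rule ac_diff[OF acl]) (use st in auto)
    also have "\<dots> \<le> integral {s..t} (\<lambda>x. y / K * \<tau> x)"
    proof (rule integral_le)
      show "(\<lambda>x. y * \<tau> x * (2 * area (A x z) (C x z)) * inverse (n x)) integrable_on {s..t}"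
        by (rule ac_integrable[OF acl]) auto
      show "(\<lambda>x. y / K * \<tau> x) integrable_on {s..t}" by (intro integrable_on_mult_right \<tau>i)
      fix x assume x: "x \<in> {s..t}"
      have "K * (2 * area (A x z) (C x z)) \<le> n x"
      proof -
        have "2 * K * \<bar>area (A x z) (C x z)\<bar> \<le> n x"
          unfolding n_def K_def D_def by (rule qform_ge_area) (use pos psdP in auto)
        moreover have "K * (2 * area (A x z) (C x z)) \<le> 2 * K * \<bar>area (A x z) (C x z)\<bar>"
          using K mult_left_mono[OF abs_ge_self, of "2 * K" "area (A x z) (C x z)"] by simp
        ultimately show ?thesis by linarith
      qed
      then have "2 * area (A x z) (C x z) * inverse (n x) \<le> 1 / K"
        using K n0[of x] x st by (simp add: field_simps)
      then have "(y * \<tau> x) * (2 * area (A x z) (C x z) * inverse (n x)) \<le> (y * \<tau> x) * (1 / K)"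
        using \<tau>0[of x] y by (intro mult_left_mono) auto
      then show "y * \<tau> x * (2 * area (A x z) (C x z)) * inverse (n x) \<le> y / K * \<tau> x" by (simp add: mult_ac)
    qed
    also have "\<dots> = y / K * (P1 * R - 2 * Qq * Qq + P3 * P)"
      unfolding \<tau>_def using ci
      by (simp add: Henstock_Kurzweil_Integration.integral_add Henstock_Kurzweil_Integration.integral_diff
          integrable_on_mult_right integrable_diff P_def Qq_def R_def)
    also have "\<dots> \<le> y / K * (2 * D)"
      using y K \<delta> P0 by (intro mult_left_mono) (auto simp: D_eq P1_def P3_def power2_eq_square algebra_simps)
    also have "\<dots> = 2 * y * K" using K by (simp add: field_simps power2_eq_square)
    finally have "ln (n t) \<le> ln (n s) + 2 * y * K" by simp
    then have "exp (ln (n t)) \<le> exp (ln (n s) + 2 * y * K)" by simp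
    then show ?thesis using n0[of s] n0[of t] st by (simp add: exp_add n_def z_def)
  qed
  obtain M where M: "\<And>y. y \<ge> 1 \<Longrightarrow> N s y \<le> M * exp (2 * y * \<kappa>)" using g by (auto simp: growth_def)
  have "N t y \<le> (2 * tr * M / lam) * exp (2 * y * (\<kappa> + K))" if y: "y \<ge> 1" for y
  proof -
    have "lam * N t y \<le> qform P1 Qq P3 (A t (\<i> * of_real y)) (C t (\<i> * of_real y))" unfolding N_def by (rule lower)
    also have "\<dots> \<le> qform P1 Qq P3 (A s (\<i> * of_real y)) (C s (\<i> * of_real y)) * exp (2 * y * K)" by (rule grow[OF y])
    also have "\<dots> \<le> (2 * tr * N s y) * exp (2 * y * K)" unfolding N_def by (intro mult_right_mono upper) simp
    also have "\<dots> \<le> (2 * tr * (M * exp (2 * y * \<kappa>))) * exp (2 * y * K)"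
      using tr0 M[OF y] by (intro mult_right_mono mult_left_mono) auto
    also have "\<dots> = 2 * tr * M * exp (2 * y * (\<kappa> + K))" by (simp add: distrib_left exp_add)
    finally show ?thesis using lam0 by (simp add: field_simps)
  qed
  then show ?thesis unfolding growth_def K_def D_eq by blast
qed

lemma W_le: "0 \<le> t \<Longrightarrow> growth t \<kappa> \<Longrightarrow> W t \<le> \<kappa>"
  unfolding W_def using growth_nonneg by (intro cInf_lower) (auto intro!: bdd_belowI[of _ 0])

text \<open>The multiplicative constants of \<open>growth_step\<close> may blow up as
  \<open>\<delta> \<rightarrow> 0\<close>, but the infimum over exponents does not see them, so the
  limit can be taken.\<close>

lemma W_step:
  assumes st: "0 \<le> s" "s \<le> t"
  defines "P \<equiv> integral {s..t} p" and "Qq \<equiv> integral {s..t} q" and "R \<equiv> integral {s..t} r"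
  shows "W t - W s \<le> sqrt (P * R - Qq\<^sup>2)"
proof -
  have ne: "{\<kappa>. growth s \<kappa>} \<noteq> {}" using growth_step[of 0 s 1 0] growth_0 st by auto
  have "W t - W s \<le> sqrt (P * R - Qq\<^sup>2 + \<delta> * (P + R) + \<delta>\<^sup>2)" if "\<delta> > 0" for \<delta>
  proof -
    have "W t - sqrt (P * R - Qq\<^sup>2 + \<delta> * (P + R) + \<delta>\<^sup>2) \<le> W s"
      unfolding W_def[of s]
    proof (rule cInf_greatest[OF ne])
      fix \<kappa> assume "\<kappa> \<in> {\<kappa>. growth s \<kappa>}"
      then have "growth t (\<kappa> + sqrt (P * R - Qq\<^sup>2 + \<delta> * (P + R) + \<delta>\<^sup>2))"
        unfolding P_def Qq_def R_def using growth_step[OF st that] by simp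
      from W_le[OF _ this] show "W t - sqrt (P * R - Qq\<^sup>2 + \<delta> * (P + R) + \<delta>\<^sup>2) \<le> \<kappa>" using st by simp
    qed
    then show ?thesis by simp
  qed
  moreover have "((\<lambda>\<delta>. sqrt (P * R - Qq\<^sup>2 + \<delta> * (P + R) + \<delta>\<^sup>2)) \<longlongrightarrow> sqrt (P * R - Qq\<^sup>2 + 0 * (P + R) + 0\<^sup>2)) (at_right 0)"
    by (intro tendsto_intros)
  ultimately have "W t - W s \<le> sqrt (P * R - Qq\<^sup>2 + 0 * (P + R) + 0\<^sup>2)"
    by (intro tendsto_lowerbound[where F = "at_right 0"]) (auto simp: eventually_mono[OF eventually_at_right_less])
  then show ?thesis by simp
qed

text \<open>The square root of the determinant is not Lipschitz at singular matrices. The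
  arithmetic-geometric mean inequality with weight \<open>l\<close> replaces the square root of the
  error by terms linear in \<open>e\<close> and \<open>k\<close>, which can be summed over a
  division.\<close>

lemma sqrt_det_perturbation:
  fixes P Q R P' Q' R' e k l :: real
  assumes e: "\<bar>P - P'\<bar> + \<bar>Q - Q'\<bar> + \<bar>R - R'\<bar> = e" and k: "P + 2 * \<bar>Q\<bar> + R \<le> k" and l: "l > 0"
    and n: "P \<ge> 0" "R' \<ge> 0" "Q'\<^sup>2 \<le> P' * R'"
  shows "sqrt (P * R - Q\<^sup>2) \<le> sqrt (P' * R' - Q'\<^sup>2) + (e / l + l * (k + 2 * e)) / 2"
proof -
  have e0: "e \<ge> 0" using e by linarith
  have b: "\<bar>P - P'\<bar> \<le> e" "\<bar>Q - Q'\<bar> \<le> e" "\<bar>R - R'\<bar> \<le> e" using e by linarith+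
  have k0: "k + 2 * e \<ge> P + R' + (\<bar>Q\<bar> + \<bar>Q'\<bar>)" using b k e0 e by linarith
  have k1: "k + 2 * e \<ge> 0" using k0 n by linarith
  have "(P * R - Q\<^sup>2) - (P' * R' - Q'\<^sup>2) = P * (R - R') + (P - P') * R' - (Q - Q') * (Q + Q')"
    by (simp add: power2_eq_square algebra_simps)
  also have "\<dots> \<le> P * \<bar>R - R'\<bar> + \<bar>P - P'\<bar> * R' + \<bar>Q - Q'\<bar> * (\<bar>Q\<bar> + \<bar>Q'\<bar>)"
  proof -
    have "P * (R - R') \<le> P * \<bar>R - R'\<bar>" using n by (intro mult_left_mono) auto
    moreover have "(P - P') * R' \<le> \<bar>P - P'\<bar> * R'" using n by (intro mult_right_mono) auto
    moreover have "- ((Q - Q') * (Q + Q')) \<le> \<bar>Q - Q'\<bar> * (\<bar>Q\<bar> + \<bar>Q'\<bar>)"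
    proof -
      have "- ((Q - Q') * (Q + Q')) \<le> \<bar>Q - Q'\<bar> * \<bar>Q + Q'\<bar>" unfolding abs_mult[symmetric] by (rule abs_ge_minus_self)
      also have "\<dots> \<le> \<bar>Q - Q'\<bar> * (\<bar>Q\<bar> + \<bar>Q'\<bar>)" by (intro mult_left_mono abs_triangle_ineq) simp
      finally show ?thesis .
    qed
    ultimately show ?thesis by linarith
  qed
  also have "\<dots> \<le> e * P + e * R' + e * (\<bar>Q\<bar> + \<bar>Q'\<bar>)"
    using b n by (intro add_mono) (auto simp: mult.commute[of P] intro!: mult_right_mono)
  also have "\<dots> = e * (P + R' + (\<bar>Q\<bar> + \<bar>Q'\<bar>))" by (simp add: algebra_simps)
  also have "\<dots> \<le> e * (k + 2 * e)" using k0 e0 by (intro mult_left_mono) auto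
  finally have 1: "P * R - Q\<^sup>2 \<le> (P' * R' - Q'\<^sup>2) + e * (k + 2 * e)" by simp
  have "sqrt (P * R - Q\<^sup>2) \<le> sqrt ((P' * R' - Q'\<^sup>2) + e * (k + 2 * e))" using 1 by simp
  also have "\<dots> \<le> sqrt (P' * R' - Q'\<^sup>2) + sqrt (e * (k + 2 * e))"
    using n e0 k1 by (intro sqrt_add_le_add_sqrt) auto
  also have "sqrt (e * (k + 2 * e)) \<le> (e / l + l * (k + 2 * e)) / 2"
  proof -
    have "sqrt ((e / l) * (l * (k + 2 * e))) \<le> (e / l + l * (k + 2 * e)) / 2"
      using e0 l k1 by (intro arith_geo_mean_sqrt) auto
    then show ?thesis using l by simp
  qed
  finally show ?thesis by simp
qed

text \<open>Summing the increments of \<open>W\<close> over a fine tagged division of a Henstock gauge gives the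
  upper half of the Krein--de Branges formula for the exponential type.\<close>

theorem W_le_integral:
  assumes t: "0 \<le> t" shows "W t \<le> integral {0..t} d"
proof -
  define h where "h = integral {0..t} k"
  note ci = coefficient_integrable[OF order_refl, of t]
  have main: "W t \<le> integral {0..t} d + e + (3 * e / l + l * (h + 6 * e)) / 2" if e: "e > 0" and l: "l > 0" for e l
  proof -
    obtain g1 where g1: "gauge g1" "\<And>D. D tagged_partial_division_of cbox 0 t \<Longrightarrow> g1 fine D \<Longrightarrow>
      (\<Sum>(x,K)\<in>D. norm (measure lborel K *\<^sub>R p x - integral K p)) < e"
      using Henstock_lemma[of p 0 t e] ci e by auto
    obtain g2 where g2: "gauge g2" "\<And>D. D tagged_partial_division_of cbox 0 t \<Longrightarrow> g2 fine D \<Longrightarrow>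
      (\<Sum>(x,K)\<in>D. norm (measure lborel K *\<^sub>R q x - integral K q)) < e"
      using Henstock_lemma[of q 0 t e] ci e by auto
    obtain g3 where g3: "gauge g3" "\<And>D. D tagged_partial_division_of cbox 0 t \<Longrightarrow> g3 fine D \<Longrightarrow>
      (\<Sum>(x,K)\<in>D. norm (measure lborel K *\<^sub>R r x - integral K r)) < e"
      using Henstock_lemma[of r 0 t e] ci e by auto
    obtain g4 where g4: "gauge g4" "\<And>D. D tagged_partial_division_of cbox 0 t \<Longrightarrow> g4 fine D \<Longrightarrow>
      (\<Sum>(x,K)\<in>D. norm (measure lborel K *\<^sub>R d x - integral K d)) < e"
      using Henstock_lemma[of d 0 t e] d_integrable e by auto
    \<comment> \<open>One gauge controls the Riemann sums of the three entries and of
      \<open>d\<close> simultaneously.\<close>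
    define g where "g x = (g1 x \<inter> g2 x) \<inter> (g3 x \<inter> g4 x)" for x
    have "gauge g" unfolding g_def by (intro gauge_Int g1 g2 g3 g4)
    then obtain D where D: "D tagged_division_of {0..t}" "g fine D" using fine_division_exists_real by blast
    have fines: "g1 fine D" "g2 fine D" "g3 fine D" "g4 fine D"
      using D(2) unfolding g_def by (auto simp: fine_Int)
    have pd: "D tagged_partial_division_of cbox 0 t" using D(1) by (simp add: tagged_division_of_def)
    define e1 where "e1 x K = norm (measure lborel K *\<^sub>R p x - integral K p)" for x K
    define e2 where "e2 x K = norm (measure lborel K *\<^sub>R q x - integral K q)" for x K
    define e3 where "e3 x K = norm (measure lborel K *\<^sub>R r x - integral K r)" for x K
    define e4 where "e4 x K = norm (measure lborel K *\<^sub>R d x - integral K d)" for x K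
    have se: "(\<Sum>(x,K)\<in>D. e1 x K) < e" "(\<Sum>(x,K)\<in>D. e2 x K) < e" "(\<Sum>(x,K)\<in>D. e3 x K) < e" "(\<Sum>(x,K)\<in>D. e4 x K) < e"
      unfolding e1_def e2_def e3_def e4_def using g1 g2 g3 g4 pd fines by auto
    have elem: "W (Sup K) - W (Inf K) \<le> (integral {0..Sup K} d - integral {0..Inf K} d) + e4 x K
         + ((e1 x K + e2 x K + e3 x K) / l + l * ((integral {0..Sup K} k - integral {0..Inf K} k) + 2 * (e1 x K + e2 x K + e3 x K))) / 2"
      if xK: "(x, K) \<in> D" for x K
    proof -
      obtain a b where ab: "K = {a..b}" using tagged_division_ofD(4)[OF D(1) xK] by auto
      have "x \<in> K" "K \<subseteq> {0..t}" using tagged_division_ofD(2,3)[OF D(1) xK] by auto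
      then have o: "a \<le> b" "0 \<le> a" "b \<le> t" using ab by auto
      have si: "Sup K = b" "Inf K = a" using ab o by auto
      have cK: "measure lborel K = b - a" using ab o by simp
      have split: "integral {0..b} f - integral {0..a} f = integral {a..b} f" if "f integrable_on {0..b}" for f :: "real \<Rightarrow> real"
        using Henstock_Kurzweil_Integration.integral_combine[of 0 a b f] o that by simp
      define P Q R where "P = integral {a..b} p" and "Q = integral {a..b} q" and "R = integral {a..b} r"
      have "W b - W a \<le> sqrt (P * R - Q\<^sup>2)" unfolding P_def Q_def R_def by (rule W_step) (use o in auto)
      also have "\<dots> \<le> sqrt (((b - a) * p x) * ((b - a) * r x) - ((b - a) * q x)\<^sup>2)
         + ((e1 x K + e2 x K + e3 x K) / l + l * (integral {a..b} k + 2 * (e1 x K + e2 x K + e3 x K))) / 2"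
      proof (rule sqrt_det_perturbation[OF _ _ l])
        show "\<bar>P - (b - a) * p x\<bar> + \<bar>Q - (b - a) * q x\<bar> + \<bar>R - (b - a) * r x\<bar> = e1 x K + e2 x K + e3 x K"
          unfolding e1_def e2_def e3_def cK using ab by (simp add: P_def Q_def R_def abs_minus_commute)
        have "norm Q \<le> integral {a..b} (\<lambda>s. \<bar>q s\<bar>)"
          unfolding Q_def by (intro integral_norm_bound_integral coefficient_integrable) (use o in auto)
        moreover have "integral {a..b} k = P + 2 * integral {a..b} (\<lambda>s. \<bar>q s\<bar>) + R"
          unfolding k_def P_def R_def using coefficient_integrable[OF o(2), of b]
          by (simp add: Henstock_Kurzweil_Integration.integral_add integrable_on_mult_right integrable_add)
        ultimately show "P + 2 * \<bar>Q\<bar> + R \<le> integral {a..b} k" by simp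
        show "P \<ge> 0" unfolding P_def using p_nonneg by (intro integral_nonneg coefficient_integrable o) auto
        show "0 \<le> (b - a) * r x" using o r_nonneg by simp
        have "((b - a) * q x)\<^sup>2 = (b - a)\<^sup>2 * (q x)\<^sup>2" by (simp add: power_mult_distrib)
        also have "\<dots> \<le> (b - a)\<^sup>2 * (p x * r x)" using psd by (intro mult_left_mono) auto
        finally show "((b - a) * q x)\<^sup>2 \<le> (b - a) * p x * ((b - a) * r x)" by (simp add: power2_eq_square mult_ac)
      qed
      also have "sqrt (((b - a) * p x) * ((b - a) * r x) - ((b - a) * q x)\<^sup>2) = (b - a) * d x"
      proof -
        have "((b - a) * p x) * ((b - a) * r x) - ((b - a) * q x)\<^sup>2 = (b - a)\<^sup>2 * (p x * r x - (q x)\<^sup>2)"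
          by (simp add: power2_eq_square algebra_simps)
        then show ?thesis using o by (simp add: real_sqrt_mult d_def)
      qed
      also have "(b - a) * d x \<le> integral {a..b} d + e4 x K"
        unfolding e4_def cK using ab abs_ge_self[of "(b - a) * d x - integral {a..b} d"] by simp
      finally show ?thesis
        unfolding si using split[OF d_integrable] split[OF k_integrable] by simp
    qed
    have add1: "(\<Sum>(x,K)\<in>D. f (Sup K) - f (Inf K)) = f t - f 0" for f :: "real \<Rightarrow> real"
      by (rule additive_tagged_division_1[OF t D(1)])
    have "W t - W 0 = (\<Sum>(x,K)\<in>D. W (Sup K) - W (Inf K))" by (simp add: add1)
    also have "\<dots> \<le> (\<Sum>(x,K)\<in>D. (integral {0..Sup K} d - integral {0..Inf K} d) + e4 x K
         + ((e1 x K + e2 x K + e3 x K) / l + l * ((integral {0..Sup K} k - integral {0..Inf K} k) + 2 * (e1 x K + e2 x K + e3 x K))) / 2)"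
      by (intro sum_mono) (use elem in auto)
    also have "\<dots> = (\<Sum>(x,K)\<in>D. (integral {0..Sup K} d - integral {0..Inf K} d)) + (\<Sum>(x,K)\<in>D. e4 x K)
       + (((\<Sum>(x,K)\<in>D. e1 x K) + (\<Sum>(x,K)\<in>D. e2 x K) + (\<Sum>(x,K)\<in>D. e3 x K)) / l
       + l * ((\<Sum>(x,K)\<in>D. (integral {0..Sup K} k - integral {0..Inf K} k)) + 2 * ((\<Sum>(x,K)\<in>D. e1 x K) + (\<Sum>(x,K)\<in>D. e2 x K) + (\<Sum>(x,K)\<in>D. e3 x K)))) / 2"
      unfolding case_prod_beta sum.distrib sum_divide_distrib[symmetric] sum_distrib_left[symmetric] ..
    also have "\<dots> = integral {0..t} d + (\<Sum>(x,K)\<in>D. e4 x K)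
       + (((\<Sum>(x,K)\<in>D. e1 x K) + (\<Sum>(x,K)\<in>D. e2 x K) + (\<Sum>(x,K)\<in>D. e3 x K)) / l
       + l * (h + 2 * ((\<Sum>(x,K)\<in>D. e1 x K) + (\<Sum>(x,K)\<in>D. e2 x K) + (\<Sum>(x,K)\<in>D. e3 x K)))) / 2"
      unfolding add1[of "\<lambda>s. integral {0..s} d"] add1[of "\<lambda>s. integral {0..s} k"] by (simp add: h_def)
    also have "\<dots> \<le> integral {0..t} d + e + (3 * e / l + l * (h + 6 * e)) / 2"
    proof -
      have s3: "(\<Sum>(x,K)\<in>D. e1 x K) + (\<Sum>(x,K)\<in>D. e2 x K) + (\<Sum>(x,K)\<in>D. e3 x K) \<le> 3 * e" using se by linarith
      show ?thesis
        using se(4) s3 l by (intro add_mono divide_right_mono mult_left_mono) auto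
    qed
    finally show ?thesis using W_le[OF order_refl growth_0] growth_0
      using cInf_greatest[of "{\<kappa>. growth 0 \<kappa>}" 0] growth_nonneg[of 0] unfolding W_def[of 0] by fastforce
  qed
  have "((\<lambda>e. integral {0..t} d + e + (3 * sqrt e + sqrt e * (h + 6 * e)) / 2) \<longlongrightarrow>
     integral {0..t} d + 0 + (3 * sqrt 0 + sqrt 0 * (h + 6 * 0)) / 2) (at_right 0)"
    by (intro tendsto_intros) auto
  moreover have "W t \<le> integral {0..t} d + e + (3 * sqrt e + sqrt e * (h + 6 * e)) / 2" if e: "e > 0" for e
  proof -
    \<comment> \<open>With \<open>l = sqrt e\<close> both error terms are of order
      \<open>sqrt e\<close>.\<close>
    have "3 * e / sqrt e = 3 * sqrt e" using e by (metis less_imp_le real_div_sqrt times_divide_eq_right)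
    then show ?thesis using main[OF e, of "sqrt e"] e by simp
  qed
  ultimately have "W t \<le> integral {0..t} d + 0 + (3 * sqrt 0 + sqrt 0 * (h + 6 * 0)) / 2"
    by (intro tendsto_lowerbound[where F = "at_right 0"]) (auto simp: eventually_mono[OF eventually_at_right_less])
  then show ?thesis by simp
qed

end

lemma de_branges_exp:
  assumes a: "a > 0" shows "de_branges (\<lambda>z. exp (- \<i> * of_real a * z))"
proof
  show "(\<lambda>z. exp (- \<i> * of_real a * z)) holomorphic_on UNIV" by (intro holomorphic_intros)
  fix z :: complex assume "Im z > 0"
  then have "a * Im (cnj z) < a * Im z" using a by (intro mult_strict_left_mono) auto
  then show "cmod (exp (- \<i> * of_real a * cnj z)) < cmod (exp (- \<i> * of_real a * z))" unfolding norm_exp_i by simp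
qed simp

text \<open>The kernel at \<open>\<i>\<close> of the model space: its numerator at
  \<open>\<i> * of_real y\<close> is the difference of the exponentials of
  \<open>a * (1 + y)\<close> and of its negative. It attains the full type along the imaginary
  axis.\<close>

lemma exp_space_growth:
  assumes a: "a > 0"
  shows "\<exists>f\<in>paley_wiener a. \<exists>c>0. \<forall>y\<ge>1. c * exp (a * y) / (1 + y) \<le> cmod (f (\<i> * of_real y))"
proof -
  interpret e: de_branges "\<lambda>z. exp (- \<i> * of_real a * z)" by (rule de_branges_exp[OF a])
  have "e.kernel \<i> \<in> paley_wiener a"
    using e.kernel_in_space[of \<i>] de_branges_exp_eq_paley_wiener[OF a] by simp
  moreover have "(exp a - 1) * exp (a * y) / (1 + y) \<le> cmod (e.kernel \<i> (\<i> * of_real y))" if y: "y \<ge> 1" for y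
  proof -
    have ne: "\<i> * of_real y \<noteq> cnj \<i>" using y by (simp add: complex_eq_iff)
    have ey: "exp (- \<i> * of_real a * (\<i> * of_real x)) = complex_of_real (exp (a * x))" for x
    proof -
      have "- \<i> * of_real a * (\<i> * of_real x) = complex_of_real (a * x)" by (simp add: complex_eq_iff)
      then show ?thesis by (metis exp_of_real)
    qed
    have "e.kernel_num \<i> (\<i> * of_real y) = of_real (exp (a * 1)) * of_real (exp (a * y)) - of_real (exp (a * - 1)) * of_real (exp (a * - y))"
      unfolding e.kernel_num_def using ey[of 1] ey[of y] ey[of "-1"] ey[of "- y"] by (simp del: exp_of_real of_real_exp)
    also have "\<dots> = of_real (exp a * exp (a * y) - exp (- a) * exp (- (a * y)))" by simp
    finally have "cmod (e.kernel \<i> (\<i> * of_real y)) = \<bar>exp a * exp (a * y) - exp (- a) * exp (- (a * y))\<bar> / cmod (\<i> * of_real y - cnj \<i>)"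
      using e.kernel_eq[OF ne] by (simp only: norm_divide norm_of_real)
    moreover have "\<i> * of_real y - cnj \<i> = \<i> * of_real (1 + y)" by (simp add: complex_eq_iff)
    ultimately have "cmod (e.kernel \<i> (\<i> * of_real y)) = \<bar>exp a * exp (a * y) - exp (- a) * exp (- (a * y))\<bar> / (1 + y)"
      using y by (simp only: norm_mult norm_ii norm_of_real)
    moreover have "(exp a - 1) * exp (a * y) \<le> exp a * exp (a * y) - exp (- a) * exp (- (a * y))"
    proof -
      have "exp (- a) * exp (- (a * y)) \<le> 1 * 1" using a y by (intro mult_mono) auto
      also have "\<dots> \<le> exp (a * y)" using a y by simp
      finally show ?thesis by (simp add: algebra_simps)
    qed
    ultimately show ?thesis using y by (simp add: divide_right_mono order_trans[OF _ abs_ge_self])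
  qed
  moreover have "exp a - 1 > 0" using a by simp
  ultimately show ?thesis by blast
qed

section \<open>Exponential type\<close>

text \<open>\<open>\<sigma>\<close> is an arbitrary choice of the widths of the Paley-Wiener spaces;
  monotonicity and continuity only come out with \<open>\<sigma>_eq\<close>.\<close>

locale pw_system = canonical_system +
  fixes \<sigma> :: "real \<Rightarrow> real"
  assumes \<sigma>_pos: "t > 0 \<Longrightarrow> \<sigma> t > 0"
    and PW: "t > 0 \<Longrightarrow> de_branges_space (\<lambda>z. A t z - \<i> * C t z) = paley_wiener (\<sigma> t)"
begin

lemma norm_E_sq: "(cmod (A t z - \<i> * C t z))\<^sup>2 = (cmod (A t z))\<^sup>2 + (cmod (C t z))\<^sup>2 + 2 * area (A t z) (C t z)"
  unfolding cmod_power2 area_def by (simp add: power2_eq_square algebra_simps)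

lemma norm_E_cnj_sq:
  assumes "0 \<le> t"
  shows "(cmod (A t (cnj z) - \<i> * C t (cnj z)))\<^sup>2 = (cmod (A t z))\<^sup>2 + (cmod (C t z))\<^sup>2 - 2 * area (A t z) (C t z)"
  unfolding cmod_power2 area_def entries_cnj[OF assms] by (simp add: power2_eq_square algebra_simps)

text \<open>The function of \<open>exp_space_growth\<close> belongs to the space, so the Hardy bound
  limits it at \<open>\<i> * of_real y\<close> by \<open>cmod (E z)\<close> and hence by the growth
  of \<open>N\<close>. An exponent below \<open>\<sigma> t\<close> would make an exponential at most
  linear in \<open>y\<close>.\<close>

lemma \<sigma>_le_growth:
  assumes t: "t > 0" and g: "growth t \<kappa>" shows "\<sigma> t \<le> \<kappa>"
proof (rule ccontr)
  assume "\<not> ?thesis"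
  then have k: "\<sigma> t - \<kappa> > 0" by simp
  obtain f c where f: "f \<in> paley_wiener (\<sigma> t)" and c: "c > 0"
    and fc: "\<And>y. y \<ge> 1 \<Longrightarrow> c * exp (\<sigma> t * y) / (1 + y) \<le> cmod (f (\<i> * of_real y))"
    using exp_space_growth[OF \<sigma>_pos[OF t]] by blast
  define E where "E z = A t z - \<i> * C t z" for z
  have hf: "hardy2_upper (\<lambda>z. f z / E z)" using f PW[OF t] by (auto simp: de_branges_space_def E_def)
  then obtain B where B: "\<And>y. y > 0 \<Longrightarrow> integrable lborel (\<lambda>x. (cmod (f (Complex x y) / E (Complex x y)))\<^sup>2)"
      "\<And>y. y > 0 \<Longrightarrow> (\<integral>x. (cmod (f (Complex x y) / E (Complex x y)))\<^sup>2 \<partial>lborel) \<le> B"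
    unfolding hardy2_upper_def by blast
  obtain M where M: "\<And>y. y \<ge> 1 \<Longrightarrow> N t y \<le> M * exp (2 * y * \<kappa>)" using g by (auto simp: growth_def)
  have B0: "B \<ge> 0" using B(2)[of 1] by (meson order_trans zero_le_power2 zero_less_one Bochner_Integration.integral_nonneg)
  have bound: "exp (2 * (\<sigma> t - \<kappa>) * y) \<le> (72 * B * M / c\<^sup>2) * y" if y: "y \<ge> 1" for y
  proof -
    define z where "z = \<i> * complex_of_real y"
    have z: "Im z = y" "Im z > 0" using y by (auto simp: z_def)
    have ar: "area (A t z) (C t z) \<ge> 0" using area_nonneg[of t z] t z by simp
    have E1: "(cmod (E z))\<^sup>2 \<le> 2 * N t y"
    proof -
      have "0 \<le> (cmod (A t z + \<i> * C t z))\<^sup>2" by simp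
      also have "\<dots> = (cmod (A t z))\<^sup>2 + (cmod (C t z))\<^sup>2 - 2 * area (A t z) (C t z)"
        unfolding cmod_power2 area_def by (simp add: power2_eq_square algebra_simps)
      finally show ?thesis unfolding E_def norm_E_sq N_def z_def[symmetric] by simp
    qed
    have "E z \<noteq> 0"
    proof
      assume "E z = 0"
      then have "(cmod (A t z))\<^sup>2 + (cmod (C t z))\<^sup>2 + 2 * area (A t z) (C t z) = 0"
        unfolding norm_E_sq[symmetric] by (simp add: E_def)
      moreover have "N t y \<ge> 1" using N_ge_1 t y by simp
      ultimately show False using ar unfolding N_def z_def[symmetric] by linarith
    qed
    moreover have "cmod (f z / E z) \<le> 3 * sqrt (B / Im z)"
      by (rule hardy_pointwise_bound[where f = "\<lambda>z. f z / E z", OF _ B z(2)]) (use hf in \<open>auto simp: hardy2_upper_def\<close>)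
    ultimately have "cmod (f z) \<le> 3 * sqrt (B / y) * cmod (E z)"
      using z by (simp add: norm_divide pos_divide_le_eq)
    then have "c * exp (\<sigma> t * y) / (1 + y) \<le> 3 * sqrt (B / y) * cmod (E z)"
      using fc[OF y] unfolding z_def by linarith
    then have "(c * exp (\<sigma> t * y) / (1 + y))\<^sup>2 \<le> (3 * sqrt (B / y) * cmod (E z))\<^sup>2"
      by (rule power_mono) (use c y in auto)
    also have "\<dots> = 9 * (B / y) * (cmod (E z))\<^sup>2" using B0 y by (simp add: power_mult_distrib)
    also have "\<dots> \<le> 9 * (B / y) * (2 * (M * exp (2 * y * \<kappa>)))"
      using B0 y E1 M[OF y] by (intro mult_left_mono) auto
    finally have "c\<^sup>2 * (exp (\<sigma> t * y))\<^sup>2 / (1 + y)\<^sup>2 \<le> 18 * B * M * exp (2 * y * \<kappa>) / y"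
      by (simp add: power_divide power_mult_distrib)
    then have "c\<^sup>2 * (exp (\<sigma> t * y))\<^sup>2 \<le> 18 * B * M * exp (2 * y * \<kappa>) / y * (1 + y)\<^sup>2"
      using y by (subst (asm) pos_divide_le_eq) auto
    also have "\<dots> \<le> 18 * B * M * exp (2 * y * \<kappa>) / y * (2 * y)\<^sup>2"
    proof (intro mult_left_mono power_mono)
      have "1 \<le> M * exp (2 * y * \<kappa>)" using M[OF y] N_ge_1[of t y] t y by simp
      then show "0 \<le> 18 * B * M * exp (2 * y * \<kappa>) / y"
        using B0 y mult_nonneg_nonneg[of "18 * B" "M * exp (2 * y * \<kappa>)"] by (simp add: mult.assoc)
    qed (use y in auto)
    also have "\<dots> = 72 * B * M * exp (2 * y * \<kappa>) * y" using y by (simp add: power2_eq_square)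
    finally have "c\<^sup>2 * (exp (\<sigma> t * y))\<^sup>2 \<le> 72 * B * M * exp (2 * y * \<kappa>) * y" .
    moreover have "(exp (\<sigma> t * y))\<^sup>2 = exp (2 * (\<sigma> t - \<kappa>) * y) * exp (2 * y * \<kappa>)"
      by (simp add: power2_eq_square algebra_simps flip: exp_add)
    ultimately have "(c\<^sup>2 * exp (2 * (\<sigma> t - \<kappa>) * y)) * exp (2 * y * \<kappa>) \<le> (72 * B * M * y) * exp (2 * y * \<kappa>)"
      by (simp add: mult_ac)
    then have "c\<^sup>2 * exp (2 * (\<sigma> t - \<kappa>) * y) \<le> 72 * B * M * y" by (simp only: mult_le_cancel_right_pos exp_gt_zero)
    then show ?thesis using c by (simp add: field_simps)
  qed
  define b where "b = \<sigma> t - \<kappa>"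
  define L where "L = 72 * B * M / c\<^sup>2"
  have "b > 0" using k by (simp add: b_def)
  define y where "y = max 1 ((L + 1) / b\<^sup>2)"
  have y: "y \<ge> 1" "y * b\<^sup>2 \<ge> L + 1" using \<open>b > 0\<close> by (auto simp: y_def field_simps max_def)
  have "b * y \<le> exp (b * y)" using exp_ge_add_one_self[of "b * y"] by linarith
  then have "(b * y)\<^sup>2 \<le> (exp (b * y))\<^sup>2" using \<open>b > 0\<close> y by (intro power_mono) auto
  also have "\<dots> = exp (2 * b * y)" by (simp add: power2_eq_square flip: exp_add)
  also have "\<dots> \<le> L * y" using bound[OF y(1)] by (simp add: b_def L_def)
  finally have "(y * b\<^sup>2) * y \<le> L * y" by (simp add: power2_eq_square mult_ac)
  then have "y * b\<^sup>2 \<le> L" by (rule mult_right_le_imp_le) (use y in linarith)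
  then show False using y by linarith
qed

lemma \<sigma>_le_integral: "t > 0 \<Longrightarrow> \<sigma> t \<le> integral {0..t} d"
proof -
  assume t: "t > 0"
  have "\<sigma> t \<le> W t"
    unfolding W_def using \<sigma>_le_growth[OF t] growth_step[of 0 t 1 0] growth_0 t by (intro cInf_greatest) auto
  then show ?thesis using W_le_integral[of t] t by linarith
qed

text \<open>Otherwise the first column would be constant up to time \<open>t\<close>, so its growth
  exponent would be 0, against \<open>\<sigma> t > 0\<close>.\<close>

lemma area_pos: "t > 0 \<Longrightarrow> Im z > 0 \<Longrightarrow> area (A t z) (C t z) > 0"
proof (rule ccontr)
  assume t: "t > 0" and z: "Im z > 0" and "\<not> area (A t z) (C t z) > 0"
  then have "area (A t z) (C t z) = 0" using area_nonneg[of t z] by auto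
  then have "A t w = 1" "C t w = 0" for w using area_zero_imp_trivial[OF _ z, of t w] t by auto
  then have "growth t 0" unfolding growth_def N_def by (intro exI[of _ 1]) auto
  then show False using \<sigma>_le_growth[OF t] \<sigma>_pos[OF t] by fastforce
qed

lemma de_branges_E: assumes t: "t > 0" shows "de_branges (\<lambda>z. A t z - \<i> * C t z)"
proof
  show "(\<lambda>z. A t z - \<i> * C t z) holomorphic_on UNIV"
    using t by (intro holomorphic_intros entries_holomorphic) auto
  fix z :: complex assume z: "Im z > 0"
  have "(cmod (A t (cnj z) - \<i> * C t (cnj z)))\<^sup>2 < (cmod (A t z - \<i> * C t z))\<^sup>2"
    using norm_E_sq[of t z] norm_E_cnj_sq[of t z] area_pos[OF t z] t by simp
  then show "cmod (A t (cnj z) - \<i> * C t (cnj z)) < cmod (A t z - \<i> * C t z)"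
    by (rule power_less_imp_less_base) simp
next
  fix x :: real
  have t': "0 \<le> t" using t by simp
  \<comment> \<open>On the axis both entries are real, so a zero of \<open>E\<close> would be a
    common zero of the first column and contradict determinant 1.\<close>
  have r: "Im (A t (of_real x)) = 0" "Im (C t (of_real x)) = 0"
    using entries_cnj[OF t', of "of_real x"] by (auto simp: complex_eq_iff)
  show "A t (of_real x) - \<i> * C t (of_real x) \<noteq> 0"
  proof
    assume "A t (of_real x) - \<i> * C t (of_real x) = 0"
    then have "A t (of_real x) = 0" "C t (of_real x) = 0" using r by (auto simp: complex_eq_iff)
    then show False using det_one[OF t', of "of_real x"] by simp
  qed
qed

definition Q :: "real \<Rightarrow> real \<Rightarrow> real" where "Q t y = area (A t (\<i> * of_real y)) (C t (\<i> * of_real y))"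

lemma Q_pos: "t > 0 \<Longrightarrow> y > 0 \<Longrightarrow> Q t y > 0"
  unfolding Q_def by (rule area_pos) auto

text \<open>At \<open>\<i> * of_real y\<close> the two diagonal kernels are
  \<open>4 * Q t y / y\<close> and a difference of exponentials over \<open>y\<close>. The factors
  \<open>1 / y\<close> cancel, so the comparison loses only a constant.\<close>

lemma Q_bounds:
  assumes t: "t > 0"
  shows "\<exists>c>0. \<forall>y\<ge>1. c * exp (2 * y * \<sigma> t) \<le> Q t y"
    and "\<exists>c>0. \<forall>y\<ge>1. Q t y \<le> c * exp (2 * y * \<sigma> t)"
proof -
  define a where "a = \<sigma> t"
  have a: "a > 0" using \<sigma>_pos[OF t] by (simp add: a_def)
  interpret e: de_branges "\<lambda>z. exp (- \<i> * of_real a * z)" by (rule de_branges_exp[OF a])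
  interpret E: de_branges "\<lambda>z. A t z - \<i> * C t z" by (rule de_branges_E[OF t])
  have eq: "de_branges_space (\<lambda>z. A t z - \<i> * C t z) = de_branges_space (\<lambda>z. exp (- \<i> * of_real a * z))"
    unfolding PW[OF t] de_branges_exp_eq_paley_wiener[OF a] by (simp add: a_def)
  have ek: "e.K (\<i> * of_real y) = (exp (2 * y * a) - exp (- (2 * y * a))) / y" for y
    unfolding e.K_def norm_exp_i by (simp add: power2_eq_square algebra_simps flip: exp_add)
  have Ek: "E.K (\<i> * of_real y) = 4 * Q t y / y" for y
    using norm_E_sq[of t "\<i> * of_real y"] norm_E_cnj_sq[of t "\<i> * of_real y"] t by (simp add: E.K_def Q_def)
  obtain C1 where C1: "C1 > 0" "\<And>w. Im w > 0 \<Longrightarrow> E.K w \<le> C1 * e.K w"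
    using E.kernel_comparison[OF e.de_branges_axioms] eq by auto
  obtain C2 where C2: "C2 > 0" "\<And>w. Im w > 0 \<Longrightarrow> e.K w \<le> C2 * E.K w"
    using e.kernel_comparison[OF E.de_branges_axioms] eq by auto
  have 1: "Q t y \<le> C1 * exp (2 * y * a)" if y: "y \<ge> 1" for y
  proof -
    have "4 * Q t y / y \<le> C1 * ((exp (2 * y * a) - exp (- (2 * y * a))) / y)"
      using C1(2)[of "\<i> * of_real y"] y unfolding ek Ek by simp
    then have "4 * Q t y \<le> C1 * (exp (2 * y * a) - exp (- (2 * y * a)))" using y by (simp add: divide_le_cancel)
    also have "\<dots> \<le> C1 * exp (2 * y * a)" using C1 by (intro mult_left_mono) auto
    finally show ?thesis using Q_pos[OF t, of y] y by linarith
  qed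
  define \<beta> where "\<beta> = (1 - exp (- 4 * a)) / (4 * C2)"
  have \<beta>: "\<beta> > 0" using a C2 by (simp add: \<beta>_def)
  have 2: "\<beta> * exp (2 * y * a) \<le> Q t y" if y: "y \<ge> 1" for y
  proof -
    have "(exp (2 * y * a) - exp (- (2 * y * a))) / y \<le> C2 * (4 * Q t y / y)"
      using C2(2)[of "\<i> * of_real y"] y unfolding ek Ek by simp
    then have *: "exp (2 * y * a) - exp (- (2 * y * a)) \<le> 4 * C2 * Q t y" using y by (simp add: divide_le_cancel mult_ac)
    \<comment> \<open>For \<open>y \<ge> 1\<close> the decaying exponential is a fixed fraction,
      less than 1, of the growing one.\<close>
    have "- (2 * y * a) \<le> - 4 * a + 2 * y * a" using y a by (simp add: algebra_simps)
    then have "exp (- (2 * y * a)) \<le> exp (- 4 * a) * exp (2 * y * a)" unfolding exp_add[symmetric] by simp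
    then have "(1 - exp (- 4 * a)) * exp (2 * y * a) \<le> exp (2 * y * a) - exp (- (2 * y * a))" by (simp add: left_diff_distrib)
    with * have "(1 - exp (- 4 * a)) * exp (2 * y * a) \<le> Q t y * (4 * C2)" by (simp add: mult_ac)
    then show ?thesis using C2(1) unfolding \<beta>_def times_divide_eq_left by (subst pos_divide_le_eq) auto
  qed
  show "\<exists>c>0. \<forall>y\<ge>1. c * exp (2 * y * \<sigma> t) \<le> Q t y" using \<beta> 2 unfolding a_def by blast
  show "\<exists>c>0. \<forall>y\<ge>1. Q t y \<le> c * exp (2 * y * \<sigma> t)" using C1 1 unfolding a_def by blast
qed

definition rate :: "real \<Rightarrow> real \<Rightarrow> real" where
  "rate y x = y * qform (p x) (q x) (r x) (A x (\<i> * of_real y)) (C x (\<i> * of_real y)) / Q x y"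

lemma ln_Q_increment:
  assumes "0 < s" "s \<le> t" "y > 0"
  shows "rate y absolutely_integrable_on {s..t}" "ln (Q t y) - ln (Q s y) = integral {s..t} (rate y)"
proof -
  have t: "0 \<le> t" using assms by simp
  have "ac 0 t (\<lambda>x. Q x y) (\<lambda>x. y * qform (p x) (q x) (r x) (A x (\<i> * of_real y)) (C x (\<i> * of_real y)))"
    using sol_area[OF AC[OF t, of "\<i> * of_real y"]] by (simp add: Q_def)
  then have "ac s t (\<lambda>x. Q x y) (\<lambda>x. y * qform (p x) (q x) (r x) (A x (\<i> * of_real y)) (C x (\<i> * of_real y)))"
    by (rule ac_sub) (use assms in auto)
  from ac_ln[OF this] have "ac s t (\<lambda>x. ln (Q x y)) (rate y)"
    using assms Q_pos by (auto simp: rate_def[abs_def] divide_inverse)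
  from ac_abs_integrable[OF this] ac_diff[OF this order_refl assms(2) order_refl]
  show "rate y absolutely_integrable_on {s..t}" "ln (Q t y) - ln (Q s y) = integral {s..t} (rate y)" .
qed

lemma rate_ge:
  assumes "x > 0" "y > 0" shows "rate y x \<ge> 2 * y * d x" "rate y x \<ge> 0"
proof -
  define q0 where "q0 = Q x y"
  have q0: "q0 > 0" using Q_pos assms by (simp add: q0_def)
  have "2 * d x * q0 \<le> qform (p x) (q x) (r x) (A x (\<i> * of_real y)) (C x (\<i> * of_real y))"
    using qform_ge_area[OF p_nonneg[of x] r_nonneg[of x] psd[of x], of "A x (\<i> * of_real y)" "C x (\<i> * of_real y)"] q0
    by (simp add: d_def q0_def Q_def)
  then have "y * (2 * d x * q0) \<le> y * qform (p x) (q x) (r x) (A x (\<i> * of_real y)) (C x (\<i> * of_real y))"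
    using assms by (intro mult_left_mono) auto
  then show "rate y x \<ge> 2 * y * d x"
    unfolding rate_def q0_def[symmetric] using q0 by (subst pos_le_divide_eq) (auto simp: mult_ac)
  then show "rate y x \<ge> 0" using d_nonneg[of x] assms by (auto intro: order_trans[rotated])
qed

lemma ln_Q_upper:
  assumes "0 < s" "s \<le> t"
  shows "\<exists>K. \<forall>y\<ge>1. ln (Q t y) - ln (Q s y) \<le> 2 * y * (\<sigma> t - \<sigma> s) + K"
proof -
  obtain c where c: "c > 0" "\<And>y. y \<ge> 1 \<Longrightarrow> c * exp (2 * y * \<sigma> s) \<le> Q s y" using Q_bounds(1)[of s] assms by auto
  obtain C' where C: "C' > 0" "\<And>y. y \<ge> 1 \<Longrightarrow> Q t y \<le> C' * exp (2 * y * \<sigma> t)" using Q_bounds(2)[of t] assms by auto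
  have "ln (Q t y) - ln (Q s y) \<le> 2 * y * (\<sigma> t - \<sigma> s) + (ln C' - ln c)" if y: "y \<ge> 1" for y
  proof -
    have "ln (Q t y) \<le> ln (C' * exp (2 * y * \<sigma> t))" using C(2)[OF y] Q_pos[of t y] assms y by simp
    moreover have "ln (c * exp (2 * y * \<sigma> s)) \<le> ln (Q s y)" using c(2)[OF y] c(1) Q_pos[of s y] assms y by simp
    ultimately show ?thesis using c C by (simp add: ln_mult algebra_simps)
  qed
  then show ?thesis by blast
qed

text \<open>An inequality that holds for all large \<open>y\<close> up to a bounded error holds for
  the coefficients of \<open>y\<close>.\<close>

lemma \<sigma>_increment_ge:
  assumes "0 < s" "s \<le> t" shows "integral {s..t} d \<le> \<sigma> t - \<sigma> s"
proof -
  define D where "D = \<sigma> t - \<sigma> s - integral {s..t} d"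
  obtain K where K: "\<And>y. y \<ge> 1 \<Longrightarrow> ln (Q t y) - ln (Q s y) \<le> 2 * y * (\<sigma> t - \<sigma> s) + K" using ln_Q_upper[OF assms] by blast
  have ineq: "0 \<le> 2 * y * D + K" if y: "y \<ge> 1" for y
  proof -
    have "integral {s..t} (\<lambda>x. 2 * y * d x) \<le> integral {s..t} (rate y)"
      using ln_Q_increment(1)[of s t y] assms y rate_ge[of _ y] d_integrable[of s t]
      by (intro integral_le integrable_on_mult_right) (auto simp: absolutely_integrable_on_def)
    then have "2 * y * integral {s..t} d \<le> ln (Q t y) - ln (Q s y)"
      using ln_Q_increment(2)[of s t y] assms y by simp
    then show ?thesis using K[OF y] by (simp add: D_def algebra_simps)
  qed
  have "D \<ge> 0"
  proof (rule ccontr)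
    assume "\<not> ?thesis"
    then have D: "D < 0" by simp
    define y where "y = max 1 ((\<bar>K\<bar> + 1) / (- 2 * D))"
    have y: "y \<ge> 1" "y * (- 2 * D) \<ge> \<bar>K\<bar> + 1" using D by (auto simp: y_def field_simps max_def)
    have "2 * y * D = - (y * (- 2 * D))" by simp
    then show False using ineq[OF y(1)] y(2) by linarith
  qed
  then show ?thesis by (simp add: D_def)
qed

text \<open>The increments are controlled only from a positive time on, since \<open>Q\<close>
  vanishes at time 0; the initial time is sent to 0 and \<open>\<sigma>\<close> there is bounded
  below by 0.\<close>

theorem \<sigma>_eq:
  assumes t: "t > 0" shows "\<sigma> t = integral {0..t} d"
proof (rule antisym[OF \<sigma>_le_integral[OF t]])
  have c: "continuous_on {0..t} (\<lambda>s. integral {0..s} d)"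
    by (rule indefinite_integral_continuous_1[OF d_integrable]) simp
  define s where "s n = t / real (Suc n)" for n
  have s: "s n > 0" "s n \<le> t" for n using t by (auto simp: s_def field_simps)
  have "s \<longlonglongrightarrow> 0" unfolding s_def using LIMSEQ_Suc[OF lim_const_over_n[of t]] by simp
  then have "(\<lambda>n. integral {0..s n} d) \<longlonglongrightarrow> integral {0..0} d"
    by (rule continuous_on_tendsto_compose[OF c]) (use s t in \<open>auto simp: less_imp_le\<close>)
  then have "(\<lambda>n. \<sigma> t + integral {0..s n} d) \<longlonglongrightarrow> \<sigma> t + 0" by (intro tendsto_intros) simp
  moreover have "integral {0..t} d \<le> \<sigma> t + integral {0..s n} d" for n
  proof -
    have "integral {0..t} d = integral {0..s n} d + integral {s n..t} d"
      using Henstock_Kurzweil_Integration.integral_combine[of 0 "s n" t d] s[of n] d_integrable[of 0 t] by simp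
    also have "integral {s n..t} d \<le> \<sigma> t - \<sigma> (s n)" by (rule \<sigma>_increment_ge[OF s])
    finally show ?thesis using \<sigma>_pos[OF s(1)[of n]] by linarith
  qed
  ultimately have "integral {0..t} d \<le> \<sigma> t + 0" by (intro LIMSEQ_le_const) auto
  then show "integral {0..t} d \<le> \<sigma> t" by simp
qed

text \<open>By \<open>\<sigma>_eq\<close> the term linear in \<open>y\<close> is exactly the one
  coming from \<open>d\<close>, so that what remains is bounded in \<open>y\<close>.\<close>

lemma integral_rate_excess:
  assumes "0 < s" "s \<le> t"
  shows "\<exists>K. \<forall>y\<ge>1. integral {s..t} (rate y) \<le> 2 * y * integral {s..t} d + K"
proof -
  have "\<sigma> t - \<sigma> s = integral {s..t} d"
    using \<sigma>_eq[of s] \<sigma>_eq[of t] assms Henstock_Kurzweil_Integration.integral_combine[of 0 s t d] d_integrable[of 0 t] by simp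
  moreover obtain K where "\<And>y. y \<ge> 1 \<Longrightarrow> ln (Q t y) - ln (Q s y) \<le> 2 * y * (\<sigma> t - \<sigma> s) + K" using ln_Q_upper[OF assms] by blast
  ultimately show ?thesis using ln_Q_increment(2)[OF assms] by (intro exI[of _ K]) fastforce
qed

end

section \<open>Nonvanishing determinant\<close>

text \<open>If the first component of the solution is as small at \<open>t0\<close> as the hypothesis says, then
  \<open>a / c\<close> is of order \<open>1 / y\<close> there, and its Riccati equation keeps it of that order
  backwards in time, which leaves no room for the entry \<open>r\<close>.\<close>

lemma small_component_imp_small_entry:
  fixes p q r :: "real \<Rightarrow> real"
  assumes i: "p integrable_on {s0..t0}" "q integrable_on {s0..t0}" "r integrable_on {s0..t0}"
    and pa: "p absolutely_integrable_on {s0..t0}"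
    and n: "\<And>x. p x \<ge> 0" "\<And>x. r x \<ge> 0" "\<And>x. (q x)\<^sup>2 \<le> p x * r x"
    and sl: "sol p q r (\<i> * of_real y) t0 a c" and y: "y > 0" and s0: "0 \<le> s0" "s0 \<le> t0"
    and pos: "\<And>x. x \<in> {s0..t0} \<Longrightarrow> area (a x) (c x) > 0"
    and L: "L > 0" and b: "y * (cmod (a t0))\<^sup>2 \<le> L * area (a t0) (c t0)"
    and ip: "integral {s0..t0} p \<le> 1 / (2 * L)"
  shows "integral {s0..t0} r \<le> 89 * L / y\<^sup>2"
proof -
  define I where "I = {s0..t0}"
  have t0I: "t0 \<in> I" "s0 \<in> I" using s0 by (auto simp: I_def)
  have cnz: "c x \<noteq> 0" and anz: "a x \<noteq> 0" if "x \<in> I" for x using pos[of x] that by (auto simp: area_def I_def)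
  define ph where "ph x = a x * inverse (c x)" for x
  define r0 q0 where "r0 x = Re (ph x)" and "q0 x = - Im (ph x)" for x
  \<comment> \<open>The form of \<open>H\<close> at the real vector \<open>(r0, 1)\<close>, hence
    nonnegative. Real and imaginary part of the Riccati equation read
    \<open>r0' = - 2 * y * q0 * (p * r0 + q)\<close> and
    \<open>q0' = y * (w - p * q0 * q0)\<close>.\<close>
  define w where "w x = p x * (r0 x)\<^sup>2 + 2 * q x * r0 x + r x" for x
  have aa: "ac s0 t0 a (\<lambda>t. - (\<i> * of_real y) * (of_real (q t) * a t + of_real (r t) * c t))"
    and acc: "ac s0 t0 c (\<lambda>t. \<i> * of_real y * (of_real (p t) * a t + of_real (q t) * c t))"
    using sol_D[OF sl] s0 by (auto intro: ac_sub)
  have ph: "ac s0 t0 ph (\<lambda>t. - (\<i> * of_real y) * (of_real (p t) * (ph t)\<^sup>2 + 2 * of_real (q t) * ph t + of_real (r t)))"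
  proof (rule ac_cong[OF ac_mult[OF aa ac_inverse[OF acc]]])
    fix t assume t: "t \<in> {s0..t0}"
    show "c t \<noteq> 0" by (rule cnz) (use t in \<open>simp add: I_def\<close>)
    then have "c t * inverse (c t) = 1" by simp
    then have "(of_real (q t) * a t + of_real (r t) * c t) * inverse (c t) = of_real (q t) * ph t + of_real (r t)"
      and "(of_real (p t) * a t + of_real (q t) * c t) * inverse (c t) = of_real (p t) * ph t + of_real (q t)"
      by (simp_all add: ph_def distrib_right mult.assoc)
    then show "- (\<i> * of_real y) * (of_real (q t) * a t + of_real (r t) * c t) * inverse (c t) +
       \<i> * of_real y * (of_real (p t) * a t + of_real (q t) * c t) * - (inverse (c t))\<^sup>2 * a t =
       - (\<i> * of_real y) * (of_real (p t) * (ph t)\<^sup>2 + 2 * of_real (q t) * ph t + of_real (r t))"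
    proof -
      assume e: "(of_real (q t) * a t + of_real (r t) * c t) * inverse (c t) = of_real (q t) * ph t + of_real (r t)"
        "(of_real (p t) * a t + of_real (q t) * c t) * inverse (c t) = of_real (p t) * ph t + of_real (q t)"
      have "- (\<i> * of_real y) * (of_real (q t) * a t + of_real (r t) * c t) * inverse (c t) +
         \<i> * of_real y * (of_real (p t) * a t + of_real (q t) * c t) * - (inverse (c t))\<^sup>2 * a t =
         - (\<i> * of_real y) * ((of_real (q t) * a t + of_real (r t) * c t) * inverse (c t)) -
         (\<i> * of_real y) * ((of_real (p t) * a t + of_real (q t) * c t) * inverse (c t)) * ph t"
        by (simp add: ph_def power2_eq_square mult_ac)
      then show ?thesis unfolding e by (simp add: power2_eq_square algebra_simps)
    qed
  qed (auto simp: ph_def)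
  have acr: "ac s0 t0 r0 (\<lambda>t. - 2 * y * q0 t * (p t * r0 t + q t))"
    using ac_linear[OF bounded_linear_Re ph]
    by (rule ac_cong) (auto simp: r0_def q0_def power2_eq_square algebra_simps)
  have acq: "ac s0 t0 q0 (\<lambda>t. y * (w t - p t * (q0 t)\<^sup>2))"
    using ac_linear[OF bounded_linear_minus[OF bounded_linear_Im] ph]
    by (rule ac_cong) (auto simp: r0_def q0_def w_def power2_eq_square algebra_simps)
  have w0: "w x \<ge> 0" for x
  proof -
    have "w x = qform (p x) (q x) (r x) (of_real (r0 x)) 1" by (simp add: w_def qform_def)
    then show ?thesis using qform_nonneg[OF n(1,2,3)] by simp
  qed
  have col: "(p x * r0 x + q x)\<^sup>2 \<le> p x * w x" for x
  proof -
    have "p x * w x - (p x * r0 x + q x)\<^sup>2 = p x * r x - (q x)\<^sup>2" by (simp add: w_def power2_eq_square algebra_simps)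
    then show ?thesis using n(3)[of x] by linarith
  qed
  have q0_eq: "q0 x = area (a x) (c x) / (cmod (c x))\<^sup>2" for x
  proof -
    have "q0 x = - Im (a x / c x)" by (simp add: q0_def ph_def divide_inverse)
    also have "\<dots> = (Re (a x) * Im (c x) - Im (a x) * Re (c x)) / (cmod (c x))\<^sup>2"
      unfolding Im_divide cmod_power2 minus_divide_left by simp
    finally show ?thesis by (simp add: area_def)
  qed
  have q0p: "q0 x > 0" if "x \<in> I" for x using pos[of x] cnz[OF that] that unfolding q0_eq I_def by simp
  define A0 where "A0 = area (a t0) (c t0)"
  have A0: "A0 > 0" using pos[of t0] t0I by (simp add: A0_def I_def)
  have Aac: "A0 \<le> cmod (a t0) * cmod (c t0)" unfolding A0_def by (rule area_le)
  \<comment> \<open>The hypothesis together with \<open>area \<le> cmod a * cmod c\<close> says that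
    \<open>q0 t0\<close> is at most \<open>L / y\<close>.\<close>
  have iq: "inverse (q0 t0) \<ge> y / L"
  proof -
    have "A0 * A0 \<le> (cmod (a t0))\<^sup>2 * (cmod (c t0))\<^sup>2"
      using mult_mono[OF Aac Aac] A0 by (simp add: power2_eq_square mult_ac)
    then have "y * (A0 * A0) \<le> (y * (cmod (a t0))\<^sup>2) * (cmod (c t0))\<^sup>2" using y by (simp add: mult.assoc)
    also have "\<dots> \<le> (L * A0) * (cmod (c t0))\<^sup>2" using b by (intro mult_right_mono) (auto simp: A0_def)
    finally have "(y * A0) * A0 \<le> (L * (cmod (c t0))\<^sup>2) * A0" by (simp add: mult_ac)
    then have "y * A0 \<le> L * (cmod (c t0))\<^sup>2" by (rule mult_right_le_imp_le[OF _ A0])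
    then have "y / L \<le> (cmod (c t0))\<^sup>2 / A0" using L A0 by (simp add: field_simps)
    then show ?thesis by (simp add: q0_eq A0_def)
  qed
  have pI: "p integrable_on {x..t0}" if "x \<in> I" for x
    using integrable_on_subinterval[OF i(1), of x t0] that by (auto simp: I_def)
  have px: "integral {x..t0} p \<le> 1 / (2 * L)" if "x \<in> I" for x
    by (rule order_trans[OF integral_subset_le ip]) (use that pI i n in \<open>auto simp: I_def\<close>)
  \<comment> \<open>The derivative of \<open>inverse q0\<close> is at most \<open>y * p\<close>.
    Going back from \<open>t0\<close> it can therefore drop by at most \<open>y / (2 * L)\<close>,
    half of its value bound at \<open>t0\<close>.\<close>
  have q0le: "q0 x \<le> 2 * L / y" if x: "x \<in> I" for x
  proof -
    have acx: "ac x t0 (\<lambda>t. inverse (q0 t)) (\<lambda>t. y * (w t - p t * (q0 t)\<^sup>2) * - (inverse (q0 t))\<^sup>2)"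
    proof (rule ac_inverse[OF ac_sub[OF acq]])
      fix s assume "s \<in> {x..t0}"
      then show "q0 s \<noteq> 0" using q0p[of s] x by (auto simp: I_def)
    qed (use x in \<open>auto simp: I_def\<close>)
    have "inverse (q0 t0) - inverse (q0 x) = integral {x..t0} (\<lambda>t. y * (w t - p t * (q0 t)\<^sup>2) * - (inverse (q0 t))\<^sup>2)"
      by (rule ac_diff[OF acx]) (use x in \<open>auto simp: I_def\<close>)
    also have "\<dots> \<le> integral {x..t0} (\<lambda>t. y * p t)"
    proof (rule integral_le)
      show "(\<lambda>t. y * (w t - p t * (q0 t)\<^sup>2) * - (inverse (q0 t))\<^sup>2) integrable_on {x..t0}" by (rule ac_integrable[OF acx]) auto
      show "(\<lambda>t. y * p t) integrable_on {x..t0}" by (intro integrable_on_mult_right pI x)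
      fix t assume "t \<in> {x..t0}"
      then have q: "q0 t > 0" using q0p[of t] x by (auto simp: I_def)
      have "y * (w t - p t * (q0 t)\<^sup>2) * - (inverse (q0 t))\<^sup>2 = y * p t * (q0 t * inverse (q0 t))\<^sup>2 - y * w t * (inverse (q0 t))\<^sup>2"
        by (simp add: power_mult_distrib algebra_simps)
      also have "\<dots> \<le> y * p t" using q y w0[of t] by simp
      finally show "y * (w t - p t * (q0 t)\<^sup>2) * - (inverse (q0 t))\<^sup>2 \<le> y * p t" .
    qed
    also have "\<dots> = y * integral {x..t0} p" by simp
    also have "\<dots> \<le> y * (1 / (2 * L))" by (rule mult_left_mono[OF px[OF x]]) (use y in simp)
    finally have "inverse (q0 x) \<ge> y / (2 * L)" using iq by (simp add: field_simps)
    then have "inverse (inverse (q0 x)) \<le> inverse (y / (2 * L))" using y L by (intro le_imp_inverse_le) auto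
    then show ?thesis using L by (simp add: field_simps)
  qed
  have cq: "continuous_on {s0..t0} q0" by (rule ac_continuous[OF acq])
  have pq: "(\<lambda>t. p t * (q0 t)\<^sup>2) integrable_on {s0..t0}"
    using absolutely_integrable_mult_continuous_right[OF pa continuous_on_power[OF cq, of 2]] set_lebesgue_integral_eq_integral(1) by blast
  have wi: "w integrable_on {s0..t0}"
  proof -
    have "(\<lambda>t. 1 / y * (y * (w t - p t * (q0 t)\<^sup>2)) + p t * (q0 t)\<^sup>2) integrable_on {s0..t0}"
      by (intro integrable_add integrable_on_mult_right ac_integrable[OF acq] pq) auto
    then show ?thesis using y by simp
  qed
  \<comment> \<open>Integrate the equation for \<open>q0\<close>: the boundary terms and the
    integral of \<open>p * q0 * q0\<close> each give \<open>2 * L / y\<close>.\<close>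
  have wI: "integral {s0..t0} w \<le> 4 * L / y\<^sup>2"
  proof -
    have "q0 t0 - q0 s0 = integral {s0..t0} (\<lambda>t. y * (w t - p t * (q0 t)\<^sup>2))"
      by (rule ac_diff[OF acq]) (use s0 in auto)
    also have "\<dots> = y * (integral {s0..t0} w - integral {s0..t0} (\<lambda>t. p t * (q0 t)\<^sup>2))"
      using wi pq by (simp add: Henstock_Kurzweil_Integration.integral_diff)
    finally have "y * integral {s0..t0} w = q0 t0 - q0 s0 + y * integral {s0..t0} (\<lambda>t. p t * (q0 t)\<^sup>2)"
      by (simp add: algebra_simps)
    also have "\<dots> \<le> 2 * L / y + y * integral {s0..t0} (\<lambda>t. p t * (2 * L / y)\<^sup>2)"
    proof -
      have "q0 t0 - q0 s0 \<le> 2 * L / y" using q0le[OF t0I(1)] q0p[OF t0I(2)] by linarith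
      moreover have "integral {s0..t0} (\<lambda>t. p t * (q0 t)\<^sup>2) \<le> integral {s0..t0} (\<lambda>t. p t * (2 * L / y)\<^sup>2)"
      proof (rule integral_le[OF pq])
        show "(\<lambda>t. p t * (2 * L / y)\<^sup>2) integrable_on {s0..t0}" by (intro integrable_on_mult_left i)
        fix t assume t: "t \<in> {s0..t0}"
        have "(q0 t)\<^sup>2 \<le> (2 * L / y)\<^sup>2" using q0le[of t] q0p[of t] t by (intro power_mono) (auto simp: I_def)
        then show "p t * (q0 t)\<^sup>2 \<le> p t * (2 * L / y)\<^sup>2" using n by (intro mult_left_mono)
      qed
      ultimately show ?thesis using y by (intro add_mono mult_left_mono) auto
    qed
    also have "\<dots> = 2 * L / y + y * (integral {s0..t0} p * (2 * L / y)\<^sup>2)" by simp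
    also have "\<dots> \<le> 2 * L / y + y * (1 / (2 * L) * (2 * L / y)\<^sup>2)"
      using ip y by (intro add_left_mono mult_left_mono mult_right_mono) auto
    also have "\<dots> = 4 * L / y" using y L by (simp add: power2_eq_square field_simps)
    finally show ?thesis using y by (simp add: power2_eq_square field_simps)
  qed
  define m where "m t = \<bar>p t * r0 t + q t\<bar>" for t
  have mi: "m integrable_on {s0..t0}"
  proof -
    have cr: "continuous_on {s0..t0} r0" by (rule ac_continuous[OF acr])
    have "(\<lambda>t. p t * r0 t) absolutely_integrable_on {s0..t0}" by (rule absolutely_integrable_mult_continuous_right[OF pa cr])
    then have fi: "(\<lambda>t. p t * r0 t + q t) integrable_on {s0..t0}"
      using i(2) set_lebesgue_integral_eq_integral(1) by (intro integrable_add) auto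
    have bd: "\<bar>p t * r0 t + q t\<bar> \<le> p t + w t" for t
    proof -
      have "(p t * r0 t + q t)\<^sup>2 \<le> (p t + w t)\<^sup>2"
      proof -
        have "p t * w t \<le> (p t + w t)\<^sup>2"
          using mult_nonneg_nonneg[OF n(1)[of t] w0[of t]] zero_le_power2[of "p t"] zero_le_power2[of "w t"]
          unfolding power2_sum by linarith
        then show ?thesis using col[of t] by linarith
      qed
      then have "\<bar>p t * r0 t + q t\<bar>\<^sup>2 \<le> (p t + w t)\<^sup>2" by simp
      then show ?thesis by (rule power2_le_imp_le) (use n(1)[of t] w0[of t] in simp)
    qed
    have "(\<lambda>t. p t * r0 t + q t) absolutely_integrable_on {s0..t0}"
      by (rule absolutely_integrable_integrable_bound[OF _ fi integrable_add[OF i(1) wi]]) (simp add: bd)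
    then show ?thesis unfolding m_def by (auto simp: absolutely_integrable_on_def)
  qed
  \<comment> \<open>Cauchy-Schwarz with \<open>col\<close>, the column bound for the vector
    \<open>(r0, 1)\<close>.\<close>
  have mI: "integral {s0..t0} m \<le> 2 / y"
  proof -
    have "integral {s0..t0} m \<le> sqrt (integral {s0..t0} p * integral {s0..t0} w)"
      by (rule integral_le_sqrt_integral_mult) (use i wi mi n w0 col in \<open>auto simp: m_def\<close>)
    also have "\<dots> \<le> sqrt (1 / (2 * L) * (4 * L / y\<^sup>2))"
      using ip wI L w0 by (intro real_sqrt_le_mono mult_mono) (auto intro!: integral_nonneg wi)
    also have "\<dots> = sqrt (2 / y\<^sup>2)" using L by simp
    also have "\<dots> \<le> sqrt (2\<^sup>2 / y\<^sup>2)" by (intro real_sqrt_le_mono divide_right_mono) auto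
    also have "\<dots> = 2 / y" using y by (simp add: real_sqrt_divide)
    finally show ?thesis .
  qed
  have r0t: "\<bar>r0 t0\<bar> \<le> L / y"
  proof -
    have ca: "cmod (a t0) > 0" "cmod (c t0) > 0" using anz cnz t0I by auto
    have "\<bar>r0 t0\<bar> \<le> cmod (a t0) / cmod (c t0)"
      unfolding r0_def ph_def using abs_Re_le_cmod[of "a t0 * inverse (c t0)"] by (simp add: norm_mult norm_inverse divide_inverse)
    also have "\<dots> = (cmod (a t0))\<^sup>2 / (cmod (a t0) * cmod (c t0))" using ca by (simp add: power2_eq_square)
    also have "\<dots> \<le> (cmod (a t0))\<^sup>2 / A0" using Aac A0 ca by (intro divide_left_mono mult_pos_pos) auto
    also have "\<dots> \<le> L / y" using b A0 y by (simp add: field_simps A0_def)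
    finally show ?thesis .
  qed
  \<comment> \<open>At \<open>t0\<close> the real part is at most \<open>L / y\<close>; going
    backwards adds at most \<open>4 * L\<close> times the integral of \<open>m\<close>, that is
    \<open>8 * L / y\<close>.\<close>
  have r0le: "\<bar>r0 x\<bar> \<le> 9 * L / y" if x: "x \<in> I" for x
  proof -
    have sub: "{x..t0} \<subseteq> {s0..t0}" using x by (auto simp: I_def)
    have mx: "m integrable_on {x..t0}" by (rule integrable_on_subinterval[OF mi sub])
    have acx: "ac x t0 r0 (\<lambda>t. - 2 * y * q0 t * (p t * r0 t + q t))" by (rule ac_sub[OF acr]) (use x in \<open>auto simp: I_def\<close>)
    have "r0 t0 - r0 x = integral {x..t0} (\<lambda>t. - 2 * y * q0 t * (p t * r0 t + q t))"
      by (rule ac_diff[OF acx]) (use x in \<open>auto simp: I_def\<close>)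
    also have "norm \<dots> \<le> integral {x..t0} (\<lambda>t. 4 * L * m t)"
    proof (rule integral_norm_bound_integral)
      show "(\<lambda>t. - 2 * y * q0 t * (p t * r0 t + q t)) integrable_on {x..t0}" by (rule ac_integrable[OF acx]) auto
      show "(\<lambda>t. 4 * L * m t) integrable_on {x..t0}" by (intro integrable_on_mult_right mx)
      fix t assume "t \<in> {x..t0}"
      then have t: "t \<in> I" using sub by (auto simp: I_def)
      have "2 * y * q0 t \<le> 2 * y * (2 * L / y)" using q0le[OF t] y by (intro mult_left_mono) auto
      also have "\<dots> = 4 * L" using y by simp
      finally have "2 * y * q0 t * m t \<le> 4 * L * m t" by (intro mult_right_mono) (auto simp: m_def)
      moreover have "norm (- 2 * y * q0 t * (p t * r0 t + q t)) = 2 * y * q0 t * m t"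
        using y q0p[OF t] by (simp add: m_def abs_mult)
      ultimately show "norm (- 2 * y * q0 t * (p t * r0 t + q t)) \<le> 4 * L * m t" by simp
    qed
    also have "\<dots> = 4 * L * integral {x..t0} m" by simp
    also have "\<dots> \<le> 4 * L * integral {s0..t0} m"
      using L by (intro mult_left_mono integral_subset_le sub mx mi) (auto simp: m_def)
    also have "\<dots> \<le> 4 * L * (2 / y)" using mI L by (intro mult_left_mono) auto
    finally have "\<bar>r0 t0 - r0 x\<bar> \<le> 8 * L / y" by simp
    then have "\<bar>r0 x\<bar> \<le> L / y + 8 * L / y" using r0t by linarith
    then show ?thesis by (simp add: add_divide_distrib[symmetric])
  qed
  have "integral {s0..t0} r \<le> integral {s0..t0} (\<lambda>t. 2 * (w t + p t * (9 * L / y)\<^sup>2))"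
  proof (rule integral_le[OF i(3)])
    show "(\<lambda>t. 2 * (w t + p t * (9 * L / y)\<^sup>2)) integrable_on {s0..t0}"
      by (intro integrable_on_mult_right integrable_add integrable_on_mult_left i wi)
    fix t assume t: "t \<in> {s0..t0}"
    \<comment> \<open>Testing the form at \<open>(2 * r0, 1)\<close> bounds \<open>r\<close> by
      \<open>w\<close> and \<open>p\<close> without the mixed term. The constant 89 of the
      conclusion is 8 from \<open>w\<close> plus 81 from the square of 9.\<close>
    have "qform (p t) (q t) (r t) (of_real (2 * r0 t)) 1 \<ge> 0" by (rule qform_nonneg[OF n])
    then have "r t \<le> 2 * (w t + p t * (r0 t)\<^sup>2)" by (simp add: qform_def w_def power2_eq_square algebra_simps)
    also have "p t * (r0 t)\<^sup>2 \<le> p t * (9 * L / y)\<^sup>2"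
    proof (intro mult_left_mono n)
      have "\<bar>r0 t\<bar>\<^sup>2 \<le> (9 * L / y)\<^sup>2" using r0le[of t] t by (intro power_mono) (auto simp: I_def)
      then show "(r0 t)\<^sup>2 \<le> (9 * L / y)\<^sup>2" by simp
    qed
    finally show "r t \<le> 2 * (w t + p t * (9 * L / y)\<^sup>2)" by simp
  qed
  also have "\<dots> = 2 * (integral {s0..t0} w + integral {s0..t0} p * (9 * L / y)\<^sup>2)"
    using wi i by (simp add: Henstock_Kurzweil_Integration.integral_add integrable_on_mult_left)
  also have "\<dots> \<le> 2 * (4 * L / y\<^sup>2 + 1 / (2 * L) * (9 * L / y)\<^sup>2)"
    using wI ip by (intro mult_left_mono add_mono mult_right_mono) auto
  also have "\<dots> = 89 * L / y\<^sup>2" using L y by (simp add: power2_eq_square field_simps)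
  finally show ?thesis .
qed

text \<open>The interval depends only on \<open>p\<close> and \<open>L\<close>, through the
  requirement that the integral of \<open>p\<close> over it be small. The same \<open>s0\<close>
  therefore serves all \<open>y k\<close>, and the bound of order 1 over the square of
  \<open>y k\<close> tends to 0.\<close>

lemma small_component_imp_zero_entry:
  fixes p q r :: "real \<Rightarrow> real" and y :: "nat \<Rightarrow> real"
  assumes i: "p absolutely_integrable_on {0..t0}" "q absolutely_integrable_on {0..t0}" "r absolutely_integrable_on {0..t0}"
    and n: "\<And>x. p x \<ge> 0" "\<And>x. r x \<ge> 0" "\<And>x. (q x)\<^sup>2 \<le> p x * r x"
    and sl: "\<And>k. sol p q r (\<i> * of_real (y k)) t0 (a k) (c k)"
    and y: "\<And>k. y k > 0" "filterlim y at_top sequentially" and t0: "0 < t0"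
    and pos: "\<And>k x. 0 < x \<Longrightarrow> x \<le> t0 \<Longrightarrow> area (a k x) (c k x) > 0"
    and L: "L > 0" and b: "\<And>k. y k * (cmod (a k t0))\<^sup>2 \<le> L * area (a k t0) (c k t0)"
  shows "\<exists>s0. 0 < s0 \<and> s0 < t0 \<and> integral {s0..t0} r = 0"
proof -
  have pi: "p integrable_on {0..t0}" using i set_lebesgue_integral_eq_integral(1) by blast
  have "continuous_on {0..t0} (\<lambda>s. integral {0..s} p)" by (rule indefinite_integral_continuous_1[OF pi])
  from uniform_modulus[OF this, of "1 / (2 * L)"] L obtain e where e: "e > 0"
    "\<And>s s'. s \<in> {0..t0} \<Longrightarrow> s' \<in> {0..t0} \<Longrightarrow> \<bar>s - s'\<bar> < e \<Longrightarrow> norm (integral {0..s} p - integral {0..s'} p) \<le> 1 / (2 * L)" by auto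
  define s0 where "s0 = max (t0 / 2) (t0 - e / 2)"
  have s0: "0 < s0" "s0 < t0" "t0 - s0 < e" using t0 e by (auto simp: s0_def max_def field_simps)
  have ip: "integral {s0..t0} p \<le> 1 / (2 * L)"
  proof -
    have "integral {0..s0} p + integral {s0..t0} p = integral {0..t0} p"
      by (rule Henstock_Kurzweil_Integration.integral_combine) (use s0 pi in auto)
    moreover have "norm (integral {0..t0} p - integral {0..s0} p) \<le> 1 / (2 * L)" by (rule e(2)) (use s0 in auto)
    ultimately show ?thesis by simp
  qed
  have sub: "f absolutely_integrable_on {s0..t0}" if "f absolutely_integrable_on {0..t0}" for f :: "real \<Rightarrow> real"
    by (rule absolutely_integrable_on_subinterval_real[OF that]) (use s0 in auto)
  have si: "f integrable_on {s0..t0}" if "f absolutely_integrable_on {0..t0}" for f :: "real \<Rightarrow> real"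
    using sub[OF that] set_lebesgue_integral_eq_integral(1) by blast
  have bd: "integral {s0..t0} r \<le> 89 * L / (y k)\<^sup>2" for k
    by (rule small_component_imp_small_entry[OF si[OF i(1)] si[OF i(2)] si[OF i(3)] sub[OF i(1)] n sl y(1) _ _ _ L b ip])
      (use s0 pos in auto)
  have "(\<lambda>k. 89 * L / (y k)\<^sup>2) \<longlonglongrightarrow> 0"
    by (rule real_tendsto_divide_at_top[OF tendsto_const filterlim_pow_at_top[OF _ y(2)]]) simp
  then have "integral {s0..t0} r \<le> 0" by (rule LIMSEQ_le_const) (use bd in auto)
  moreover have "integral {s0..t0} r \<ge> 0" using n by (intro integral_nonneg si i) auto
  ultimately show ?thesis using s0 by (intro exI[of _ s0]) auto
qed

section \<open>Rotations and the exclusion of a small component\<close>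

text \<open>A rotation commutes with the symplectic matrix, so the rotated column solves the system
  of the conjugated Hamiltonian, with the same determinant and the same area.\<close>

lemma sol_rotate:
  fixes u v :: real
  assumes "sol p q r z T a c" and uv: "u\<^sup>2 + v\<^sup>2 = 1"
  shows "sol (\<lambda>t. p t * u\<^sup>2 + 2 * q t * u * v + r t * v\<^sup>2)
     (\<lambda>t. (r t - p t) * u * v + q t * (u\<^sup>2 - v\<^sup>2))
     (\<lambda>t. p t * v\<^sup>2 - 2 * q t * u * v + r t * u\<^sup>2) z T
     (\<lambda>t. of_real u * a t + of_real v * c t) (\<lambda>t. - of_real v * a t + of_real u * c t)"
proof -
  define cu cv where "cu = complex_of_real u" and "cv = complex_of_real v"
  have uv': "cv * cv = 1 - cu * cu"
  proof -
    have "complex_of_real (u\<^sup>2 + v\<^sup>2) = 1" using uv by simp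
    then show ?thesis by (simp add: cu_def cv_def power2_eq_square algebra_simps)
  qed
  note a = sol_D(1)[OF assms(1)] and c = sol_D(2)[OF assms(1)]
  have 1: "cu * (- z * (Q * a + R * c)) + cv * (z * (P * a + Q * c)) =
     - z * (((R - P) * cu * cv + Q * (cu * cu - cv * cv)) * (cu * a + cv * c) + (P * (cv * cv) - 2 * Q * cu * cv + R * (cu * cu)) * (- cv * a + cu * c))"
    for P Q R a c :: complex
  proof -
    have "((R - P) * cu * cv + Q * (cu * cu - cv * cv)) * (cu * a + cv * c) + (P * (cv * cv) - 2 * Q * cu * cv + R * (cu * cu)) * (- cv * a + cu * c)
      = (cu * (Q * a + R * c) - cv * (P * a + Q * c)) * (cu * cu + cv * cv)" by (simp add: algebra_simps)
    then show ?thesis by (simp add: uv' algebra_simps)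
  qed
  have 2: "- cv * (- z * (Q * a + R * c)) + cu * (z * (P * a + Q * c)) =
     z * ((P * (cu * cu) + 2 * Q * cu * cv + R * (cv * cv)) * (cu * a + cv * c) + ((R - P) * cu * cv + Q * (cu * cu - cv * cv)) * (- cv * a + cu * c))"
    for P Q R a c :: complex
  proof -
    have "(P * (cu * cu) + 2 * Q * cu * cv + R * (cv * cv)) * (cu * a + cv * c) + ((R - P) * cu * cv + Q * (cu * cu - cv * cv)) * (- cv * a + cu * c)
      = (cv * (Q * a + R * c) + cu * (P * a + Q * c)) * (cu * cu + cv * cv)" by (simp add: algebra_simps)
    then show ?thesis by (simp add: uv' algebra_simps)
  qed
  have "ac 0 T (\<lambda>t. cu * a t + cv * c t) (\<lambda>t. cu * (- z * (of_real (q t) * a t + of_real (r t) * c t)) + cv * (z * (of_real (p t) * a t + of_real (q t) * c t)))"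
    by (intro ac_add ac_cmult a c)
  moreover have "ac 0 T (\<lambda>t. - cv * a t + cu * c t) (\<lambda>t. - cv * (- z * (of_real (q t) * a t + of_real (r t) * c t)) + cu * (z * (of_real (p t) * a t + of_real (q t) * c t)))"
    by (intro ac_add ac_cmult a c)
  ultimately show ?thesis
    unfolding sol_def 1 2 by (simp add: cu_def cv_def power2_eq_square)
qed

lemma area_rotate:
  fixes u v :: real
  assumes "u\<^sup>2 + v\<^sup>2 = 1"
  shows "area (of_real u * a + of_real v * c) (- of_real v * a + of_real u * c) = area a c"
proof -
  have "area (of_real u * a + of_real v * c) (- of_real v * a + of_real u * c) = (u\<^sup>2 + v\<^sup>2) * area a c"
    by (simp add: area_def power2_eq_square algebra_simps)
  then show ?thesis using assms by simp
qed

context pw_system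
begin

lemma no_small_component:
  fixes u v :: real and y :: "nat \<Rightarrow> real"
  assumes uv: "u\<^sup>2 + v\<^sup>2 = 1" and t0: "t0 > 0" and y: "\<And>k. y k \<ge> 1" "filterlim y at_top sequentially" and L: "L > 0"
    and b: "\<And>k. y k * (cmod (of_real u * A t0 (\<i> * of_real (y k)) + of_real v * C t0 (\<i> * of_real (y k))))\<^sup>2 \<le> L * Q t0 (y k)"
  shows False
proof -
  define p' where "p' t = p t * u\<^sup>2 + 2 * q t * u * v + r t * v\<^sup>2" for t
  define q' where "q' t = (r t - p t) * u * v + q t * (u\<^sup>2 - v\<^sup>2)" for t
  define r' where "r' t = p t * v\<^sup>2 - 2 * q t * u * v + r t * u\<^sup>2" for t
  define a where "a k t = of_real u * A t (\<i> * of_real (y k)) + of_real v * C t (\<i> * of_real (y k))" for k t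
  define c where "c k t = - of_real v * A t (\<i> * of_real (y k)) + of_real u * C t (\<i> * of_real (y k))" for k t
  have sl: "sol p' q' r' (\<i> * of_real (y k)) T (a k) (c k)" if "0 \<le> T" for k T
    unfolding p'_def q'_def r'_def a_def c_def by (rule sol_rotate[OF AC[OF that] uv])
  have ar: "area (a k x) (c k x) = Q x (y k)" for k x unfolding a_def c_def Q_def by (rule area_rotate[OF uv])
  have int: "p' absolutely_integrable_on {0..T}" "q' absolutely_integrable_on {0..T}" "r' absolutely_integrable_on {0..T}" for T
  proof -
    have *: "(\<lambda>t. k1 * p t + k2 * q t + k3 * r t) absolutely_integrable_on {0..T}" for k1 k2 k3
      by (intro set_integral_add set_integrable_mult_right p_int q_int r_int)
    show "p' absolutely_integrable_on {0..T}" using *[of "u\<^sup>2" "2 * u * v" "v\<^sup>2"] by (simp add: p'_def[abs_def] mult_ac)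
    show "r' absolutely_integrable_on {0..T}" using *[of "v\<^sup>2" "- 2 * u * v" "u\<^sup>2"] by (simp add: r'_def[abs_def] mult_ac)
    have "(r t - p t) * u * v + q t * (u\<^sup>2 - v\<^sup>2) = (- u * v) * p t + (u\<^sup>2 - v\<^sup>2) * q t + (u * v) * r t" for t
      by (simp add: algebra_simps)
    then show "q' absolutely_integrable_on {0..T}" using *[of "- u * v" "u\<^sup>2 - v\<^sup>2" "u * v"] by (simp only: q'_def[abs_def])
  qed
  have det: "p' t * r' t - (q' t)\<^sup>2 = p t * r t - (q t)\<^sup>2" for t
  proof -
    have "p' t * r' t - (q' t)\<^sup>2 = (p t * r t - (q t)\<^sup>2) * (u\<^sup>2 + v\<^sup>2)\<^sup>2"
      by (simp add: p'_def q'_def r'_def power2_eq_square algebra_simps)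
    then show ?thesis using uv by simp
  qed
  have n: "p' t \<ge> 0" "r' t \<ge> 0" "(q' t)\<^sup>2 \<le> p' t * r' t" for t
  proof -
    have "qform (p t) (q t) (r t) (of_real u) (of_real v) \<ge> 0" "qform (p t) (q t) (r t) (of_real (- v)) (of_real u) \<ge> 0"
      by (rule qform_coeff_nonneg)+
    then show "p' t \<ge> 0" "r' t \<ge> 0" by (simp_all add: qform_def p'_def r'_def mult_ac)
    show "(q' t)\<^sup>2 \<le> p' t * r' t" using det[of t] psd[of t] by linarith
  qed
  have hk: "f integrable_on {x..x'}" if "f absolutely_integrable_on {0..x'}" "0 \<le> x" for f :: "real \<Rightarrow> real" and x x'
    using absolutely_integrable_on_subinterval_real[OF that(1,2), of x'] set_lebesgue_integral_eq_integral(1) by blast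
  have zero_entry: "\<exists>s0. 0 < s0 \<and> s0 < t \<and> integral {s0..t} r' = 0"
    if t: "0 < t" and L': "L' > 0" and b': "\<And>k. y k * (cmod (a k t))\<^sup>2 \<le> L' * Q t (y k)" for t L'
  proof (rule small_component_imp_zero_entry[OF int n _ _ y(2) t _ L'])
    show "sol p' q' r' (\<i> * of_real (y k)) t (a k) (c k)" for k by (rule sl) (use t in simp)
    show y0: "y k > 0" for k using y(1)[of k] by linarith
    show "area (a k x) (c k x) > 0" if "0 < x" "x \<le> t" for k x unfolding ar by (rule Q_pos[OF that(1) y0])
    show "y k * (cmod (a k t))\<^sup>2 \<le> L' * area (a k t) (c k t)" for k unfolding ar by (rule b')
  qed
  \<comment> \<open>The points from which \<open>r'\<close> integrates to zero up to
    \<open>t0\<close>. The set is closed, so its infimum is the left end of the maximal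
    interval.\<close>
  define Z where "Z = {x \<in> {0..t0}. integral {0..x} r' = integral {0..t0} r'}"
  have ri: "r' integrable_on {0..t0}" by (rule hk[OF int(3)]) simp
  have "closed Z" unfolding Z_def
    by (rule continuous_closed_preimage_constant[OF indefinite_integral_continuous_1[OF ri]]) simp
  moreover have "Z \<noteq> {}" using t0 by (auto simp: Z_def)
  moreover have bdd: "bdd_below Z" by (auto simp: Z_def intro!: bdd_belowI[of _ 0])
  ultimately have "Inf Z \<in> Z" by (intro closed_contains_Inf)
  define x where "x = Inf Z"
  have x: "0 \<le> x" "x \<le> t0" "integral {0..x} r' = integral {0..t0} r'" using \<open>Inf Z \<in> Z\<close> by (auto simp: Z_def x_def)
  have xr: "integral {x..t0} r' = 0"
    using Henstock_Kurzweil_Integration.integral_combine[of 0 x t0 r'] x ri by simp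
  have xq: "integral {x..t0} (\<lambda>s. \<bar>q' s\<bar>) = 0"
  proof (rule antisym)
    have qi: "(\<lambda>s. \<bar>q' s\<bar>) integrable_on {x..t0}"
      using absolutely_integrable_on_subinterval_real[OF int(2)[of t0] x(1) order_refl] by (auto simp: absolutely_integrable_on_def)
    then have "integral {x..t0} (\<lambda>s. \<bar>q' s\<bar>) \<le> sqrt (integral {x..t0} p' * integral {x..t0} r')"
      by (intro integral_le_sqrt_integral_mult) (use n x in \<open>auto intro!: hk int\<close>)
    then show "integral {x..t0} (\<lambda>s. \<bar>q' s\<bar>) \<le> 0" using xr by simp
    show "0 \<le> integral {x..t0} (\<lambda>s. \<bar>q' s\<bar>)" by (rule integral_nonneg[OF qi]) simp
  qed
  \<comment> \<open>The determinant is invariant, so \<open>d\<close> is dominated by the geometric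
    mean of \<open>p'\<close> and \<open>r'\<close> and inherits the vanishing integral.\<close>
  have xd: "integral {x..t0} d = 0"
  proof (rule antisym)
    have "(d s)\<^sup>2 \<le> p' s * r' s" for s
    proof -
      have "(d s)\<^sup>2 = p' s * r' s - (q' s)\<^sup>2" using psd[of s] det[of s] by (simp add: d_def)
      then show ?thesis by simp
    qed
    then have "integral {x..t0} d \<le> sqrt (integral {x..t0} p' * integral {x..t0} r')"
      by (intro integral_le_sqrt_integral_mult) (use n x in \<open>auto intro!: hk int d_integrable\<close>)
    then show "integral {x..t0} d \<le> 0" using xr by simp
    show "0 \<le> integral {x..t0} d" using x d_nonneg by (intro integral_nonneg d_integrable) auto
  qed
  show False
  proof (cases "x = 0")
    case True
    then show False using \<sigma>_eq[OF t0] \<sigma>_pos[OF t0] xd by simp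
  next
    case False
    then have x0: "x > 0" using x by simp
    \<comment> \<open>Only \<open>q'\<close> and \<open>r'\<close> enter the equation for
      \<open>a\<close>, and both integrate to zero in absolute value here.\<close>
    have const: "a k t0 = a k x" for k
    proof -
      have aa: "ac x t0 (a k) (\<lambda>t. - (\<i> * of_real (y k)) * (of_real (q' t) * a k t + of_real (r' t) * c k t))"
        by (rule ac_sub[OF sol_D(1)[OF sl[of t0]]]) (use t0 x in auto)
      have cc: "ac x t0 (c k) (\<lambda>t. \<i> * of_real (y k) * (of_real (p' t) * a k t + of_real (q' t) * c k t))"
        by (rule ac_sub[OF sol_D(2)[OF sl[of t0]]]) (use t0 x in auto)
      have "continuous_on {x..t0} (\<lambda>t. cmod (a k t) + cmod (c k t))"
        by (intro continuous_intros ac_continuous[OF aa] ac_continuous[OF cc])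
      then have "bounded ((\<lambda>t. cmod (a k t) + cmod (c k t)) ` {x..t0})" by (simp add: compact_continuous_image compact_imp_bounded)
      then obtain M where M: "\<forall>t\<in>{x..t0}. cmod (a k t) + cmod (c k t) \<le> M" unfolding bounded_iff by auto
      have qi: "(\<lambda>s. \<bar>q' s\<bar>) integrable_on {x..t0}"
        using absolutely_integrable_on_subinterval_real[OF int(2)[of t0] x(1) order_refl] by (auto simp: absolutely_integrable_on_def)
      have rx: "r' integrable_on {x..t0}" by (rule hk[OF int(3) x(1)])
      have "a k t0 - a k x = integral {x..t0} (\<lambda>t. - (\<i> * of_real (y k)) * (of_real (q' t) * a k t + of_real (r' t) * c k t))"
        by (rule ac_diff[OF aa]) (use x in auto)
      also have "cmod \<dots> \<le> integral {x..t0} (\<lambda>t. \<bar>y k\<bar> * (M * (\<bar>q' t\<bar> + r' t)))"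
      proof (rule integral_norm_bound_integral)
        show "(\<lambda>t. - (\<i> * of_real (y k)) * (of_real (q' t) * a k t + of_real (r' t) * c k t)) integrable_on {x..t0}"
          by (rule ac_integrable[OF aa]) auto
        show "(\<lambda>t. \<bar>y k\<bar> * (M * (\<bar>q' t\<bar> + r' t))) integrable_on {x..t0}"
          by (intro integrable_on_mult_right integrable_add qi rx)
        fix t assume t: "t \<in> {x..t0}"
        have Mt: "cmod (a k t) \<le> M" "cmod (c k t) \<le> M"
          using bspec[OF M t] norm_ge_zero[of "a k t"] norm_ge_zero[of "c k t"] by linarith+
        have "cmod (of_real (q' t) * a k t + of_real (r' t) * c k t) \<le> \<bar>q' t\<bar> * M + r' t * M"
          using Mt n(2)[of t] by (intro norm_triangle_le add_mono) (auto simp: norm_mult intro!: mult_left_mono)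
        then have "\<bar>y k\<bar> * cmod (of_real (q' t) * a k t + of_real (r' t) * c k t) \<le> \<bar>y k\<bar> * (M * (\<bar>q' t\<bar> + r' t))"
          by (intro mult_left_mono) (auto simp: algebra_simps)
        then show "norm (- (\<i> * of_real (y k)) * (of_real (q' t) * a k t + of_real (r' t) * c k t)) \<le> \<bar>y k\<bar> * (M * (\<bar>q' t\<bar> + r' t))"
          by (simp add: norm_mult)
      qed
      also have "\<dots> = \<bar>y k\<bar> * (M * (integral {x..t0} (\<lambda>t. \<bar>q' t\<bar>) + integral {x..t0} r'))"
        using Henstock_Kurzweil_Integration.integral_add[OF qi rx] by simp
      finally show ?thesis using xq xr by simp
    qed
    obtain K where K: "\<And>y. y \<ge> 1 \<Longrightarrow> integral {x..t0} (rate y) \<le> 2 * y * integral {x..t0} d + K"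
      using integral_rate_excess[OF x0 x(2)] by blast
    \<comment> \<open>As \<open>d\<close> integrates to zero on this interval, the excess estimate
      bounds the whole increment of \<open>ln Q\<close> independently of \<open>k\<close>. Smallness
      at \<open>t0\<close> thus passes to \<open>x\<close> with the constant
      \<open>L * exp K\<close>.\<close>
    have Qx: "Q t0 (y k) \<le> exp K * Q x (y k)" for k
    proof -
      have y0: "y k > 0" using y(1)[of k] by linarith
      have "ln (Q t0 (y k)) - ln (Q x (y k)) \<le> K"
        using ln_Q_increment(2)[OF x0 x(2) y0] K[OF y(1)[of k]] xd by simp
      then have "exp (ln (Q t0 (y k))) \<le> exp (K + ln (Q x (y k)))" by simp
      then show ?thesis using Q_pos[OF t0 y0] Q_pos[OF x0 y0] by (simp add: exp_add)
    qed
    have "y k * (cmod (a k x))\<^sup>2 \<le> (L * exp K) * Q x (y k)" for k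
    proof -
      have "y k * (cmod (a k x))\<^sup>2 \<le> L * Q t0 (y k)" using b[of k] const[of k] by (simp add: a_def)
      also have "\<dots> \<le> L * (exp K * Q x (y k))" using Qx L by (intro mult_left_mono) auto
      finally show ?thesis by simp
    qed
    then obtain s0 where s0: "0 < s0" "s0 < x" "integral {s0..x} r' = 0" using zero_entry[OF x0, of "L * exp K"] L by auto
    have "r' integrable_on {0..x}" by (rule hk[OF int(3)]) simp
    then have "integral {0..s0} r' = integral {0..x} r'"
      using Henstock_Kurzweil_Integration.integral_combine[of 0 s0 x r'] s0 by simp
    then have "s0 \<in> Z" using s0 x by (simp add: Z_def)
    then have "x \<le> s0" unfolding x_def by (rule cInf_lower[OF _ bdd])
    then show False using s0 by simp
  qed
qed

text \<open>The nonnegative excesses at integer frequencies have bounded integrals, so by Fatou's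
  lemma their lower limit is finite almost everywhere. At a zero of \<open>d\<close> this bounds the
  rate along a sequence of frequencies, which \<open>no_small_component\<close> excludes.\<close>

lemma det_nonzero_AE_interval:
  assumes st: "0 < s" "s \<le> t"
  shows "AE x in lebesgue_on {s..t}. p x + r x > 0 \<longrightarrow> d x \<noteq> 0"
proof -
  define h where "h k x = rate (real (Suc k)) x - 2 * real (Suc k) * d x" for k x
  obtain K where K: "\<And>y. y \<ge> 1 \<Longrightarrow> integral {s..t} (rate y) \<le> 2 * y * integral {s..t} d + K"
    using integral_rate_excess[OF st] by blast
  have ri: "rate (real (Suc k)) absolutely_integrable_on {s..t}" for k by (rule ln_Q_increment(1)[OF st]) simp
  have di: "d absolutely_integrable_on {s..t}"
    by (rule absolutely_integrable_on_subinterval_real[OF d_abs_integrable[of t]]) (use st in auto)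
  have hi: "h k absolutely_integrable_on {s..t}" for k
    unfolding h_def by (intro set_integral_diff ri set_integrable_mult_right di)
  have h0: "h k x \<ge> 0" if "x \<in> {s..t}" for k x unfolding h_def using rate_ge(1)[of x "real (Suc k)"] that st by simp
  have [measurable]: "h k \<in> borel_measurable (lebesgue_on {s..t})" for k
    using hi[of k] by (simp add: absolutely_integrable_measurable)
  have "(\<integral>\<^sup>+x. ennreal (h k x) \<partial>lebesgue_on {s..t}) \<le> ennreal K" for k
  proof -
    have "integrable (lebesgue_on {s..t}) (h k)"
      using hi[of k] by (simp add: set_integrable_def integrable_restrict_space)
    then have "(\<integral>\<^sup>+x. ennreal (h k x) \<partial>lebesgue_on {s..t}) = ennreal (integral\<^sup>L (lebesgue_on {s..t}) (h k))"
      by (intro nn_integral_eq_integral) (use h0 in \<open>auto simp: AE_restrict_space_iff\<close>)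
    also have "integral\<^sup>L (lebesgue_on {s..t}) (h k) = integral {s..t} (h k)"
      by (rule lebesgue_integral_eq_integral) (use \<open>integrable (lebesgue_on {s..t}) (h k)\<close> in auto)
    also have "\<dots> = integral {s..t} (rate (real (Suc k))) - 2 * real (Suc k) * integral {s..t} d"
      unfolding h_def using ri[of k] di
      by (subst Henstock_Kurzweil_Integration.integral_diff) (auto simp: absolutely_integrable_on_def)
    also have "\<dots> \<le> K" using K[of "real (Suc k)"] by simp
    finally show ?thesis by (simp add: ennreal_leI)
  qed
  then have "liminf (\<lambda>k. \<integral>\<^sup>+x. ennreal (h k x) \<partial>lebesgue_on {s..t}) \<le> liminf (\<lambda>k::nat. ennreal K)"
    by (intro Liminf_mono always_eventually allI)
  moreover have "(\<integral>\<^sup>+x. liminf (\<lambda>k. ennreal (h k x)) \<partial>lebesgue_on {s..t}) \<le> liminf (\<lambda>k. \<integral>\<^sup>+x. ennreal (h k x) \<partial>lebesgue_on {s..t})"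
    by (rule nn_integral_liminf) measurable
  ultimately have "(\<integral>\<^sup>+x. liminf (\<lambda>k. ennreal (h k x)) \<partial>lebesgue_on {s..t}) \<le> ennreal K"
    by (simp add: Liminf_const)
  then have "(\<integral>\<^sup>+x. liminf (\<lambda>k. ennreal (h k x)) \<partial>lebesgue_on {s..t}) \<noteq> \<infinity>" by (auto simp: top_unique)
  then have "AE x in lebesgue_on {s..t}. liminf (\<lambda>k. ennreal (h k x)) \<noteq> \<infinity>"
    by (intro nn_integral_noteq_infinite) auto
  moreover have "AE x in lebesgue_on {s..t}. x \<in> {s..t}" by (rule AE_I2) simp
  ultimately show ?thesis
  proof eventually_elim
    case (elim x)
    show ?case
    proof (intro impI notI)
      assume pr: "p x + r x > 0" and dx: "d x = 0"
      have x0: "x > 0" using elim st by auto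
      obtain m :: real where m: "liminf (\<lambda>k. ennreal (h k x)) = ennreal m" "m \<ge> 0"
        using elim(1) by (cases "liminf (\<lambda>k. ennreal (h k x))") auto
      define L where "L = m + 1"
      have "\<not> (\<forall>\<^sub>F k in sequentially. ennreal L \<le> ennreal (h k x))"
      proof
        assume "\<forall>\<^sub>F k in sequentially. ennreal L \<le> ennreal (h k x)"
        then have "ennreal L \<le> liminf (\<lambda>k. ennreal (h k x))" by (rule Liminf_bounded)
        then show False using m by (simp add: L_def ennreal_le_iff)
      qed
      then have "\<exists>\<^sub>F k in sequentially. \<not> ennreal L \<le> ennreal (h k x)" by (simp add: not_eventually)
      then have "\<exists>\<^sub>F k in sequentially. h k x < L"
        by (rule frequently_elim1) (metis ennreal_leI not_le)
      \<comment> \<open>A finite lower limit gives infinitely many frequencies below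
        \<open>L\<close>; their increasing enumeration is the sequence tending to infinity.\<close>
      then have "infinite {k. h k x < L}" by (simp add: frequently_cofinite flip: cofinite_eq_sequentially)
      then obtain f :: "nat \<Rightarrow> nat" where f: "strict_mono f" "\<And>k. h (f k) x < L" using infinite_enumerate[of "{k. h k x < L}"] by auto
      \<comment> \<open>At a zero of the determinant the matrix is its trace \<open>H\<close> times
        the projection onto the unit vector \<open>(u, v)\<close>. The sign of \<open>q x\<close> is
        put into \<open>v\<close>, and the form becomes a single square.\<close>
      define H where "H = p x + r x"
      define u where "u = sqrt (p x / H)"
      define v where "v = (if q x \<ge> 0 then 1 else -1) * sqrt (r x / H)"
      have H: "H > 0" using pr by (simp add: H_def)
      have u2: "u\<^sup>2 = p x / H" using H p_nonneg[of x] by (simp add: u_def)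
      have v2: "v\<^sup>2 = r x / H" using H r_nonneg[of x] by (simp add: v_def power_mult_distrib)
      have uv: "u\<^sup>2 + v\<^sup>2 = 1" unfolding u2 v2 using H by (simp add: H_def add_divide_distrib[symmetric])
      have q2: "(q x)\<^sup>2 = p x * r x" using dx psd[of x] by (simp add: d_def)
      have quv: "H * (u * v) = q x"
      proof -
        have "sqrt (p x / H) * sqrt (r x / H) = sqrt ((q x)\<^sup>2) / H"
          using H unfolding q2 real_sqrt_mult real_sqrt_divide by simp
        then have "u * v = (if q x \<ge> 0 then 1 else -1) * (\<bar>q x\<bar> / H)" by (simp add: u_def v_def mult_ac)
        then show ?thesis using H by auto
      qed
      have qf: "qform (p x) (q x) (r x) a c = H * (cmod (of_real u * a + of_real v * c))\<^sup>2" for a c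
      proof -
        have "(cmod (of_real u * a + of_real v * c))\<^sup>2 = u\<^sup>2 * (cmod a)\<^sup>2 + 2 * (u * v) * Re (cnj a * c) + v\<^sup>2 * (cmod c)\<^sup>2"
          unfolding cmod_power2 by (simp add: power2_eq_square algebra_simps)
        then have "H * (cmod (of_real u * a + of_real v * c))\<^sup>2 = (H * u\<^sup>2) * (cmod a)\<^sup>2 + 2 * (H * (u * v)) * Re (cnj a * c) + (H * v\<^sup>2) * (cmod c)\<^sup>2"
          by (simp add: algebra_simps)
        then show ?thesis unfolding quv u2 v2 using H by (simp add: qform_def)
      qed
      define y where "y k = real (Suc (f k))" for k
      have y1: "y k \<ge> 1" for k by (simp add: y_def)
      have yl: "filterlim y at_top sequentially"
        unfolding y_def by (intro filterlim_compose[OF filterlim_real_sequentially] filterlim_compose[OF filterlim_Suc] filterlim_subseq f)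
      have "y k * (cmod (of_real u * A x (\<i> * of_real (y k)) + of_real v * C x (\<i> * of_real (y k))))\<^sup>2 \<le> (L / H) * Q x (y k)" for k
      proof -
        have Qp: "Q x (y k) > 0" using Q_pos[OF x0] y1[of k] by simp
        have "rate (y k) x \<le> L" using f(2)[of k] dx by (simp add: h_def y_def)
        then have "y k * (H * (cmod (of_real u * A x (\<i> * of_real (y k)) + of_real v * C x (\<i> * of_real (y k))))\<^sup>2) \<le> L * Q x (y k)"
          using Qp unfolding rate_def qf by (simp add: pos_divide_le_eq)
        then have "H * (y k * (cmod (of_real u * A x (\<i> * of_real (y k)) + of_real v * C x (\<i> * of_real (y k))))\<^sup>2) \<le> L * Q x (y k)"
          by (simp only: mult_ac)
        then show ?thesis using H unfolding times_divide_eq_left by (subst pos_le_divide_eq) (auto simp: mult.commute[of _ H])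
      qed
      moreover have "L / H > 0" using m H by (simp add: L_def)
      ultimately show False using no_small_component[OF uv x0 y1 yl] by blast
    qed
  qed
qed

lemma det_nonzero_AE: "AE x in lborel. x > 0 \<longrightarrow> p x + r x > 0 \<longrightarrow> d x \<noteq> 0"
proof -
  have "AE x in lborel. x \<in> {1 / real (Suc n)..real (Suc n)} \<longrightarrow> p x + r x > 0 \<longrightarrow> d x \<noteq> 0" for n
  proof -
    have "1 / real (Suc n) \<le> real (Suc n)" by (simp add: field_simps)
    then have "AE x in lebesgue_on {1 / real (Suc n)..real (Suc n)}. p x + r x > 0 \<longrightarrow> d x \<noteq> 0"
      by (intro det_nonzero_AE_interval) auto
    then have "AE x in lebesgue. x \<in> {1 / real (Suc n)..real (Suc n)} \<longrightarrow> p x + r x > 0 \<longrightarrow> d x \<noteq> 0"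
      by (simp add: AE_restrict_space_iff)
    then show ?thesis by (simp add: AE_completion_iff)
  qed
  then have "AE x in lborel. \<forall>n. x \<in> {1 / real (Suc n)..real (Suc n)} \<longrightarrow> p x + r x > 0 \<longrightarrow> d x \<noteq> 0"
    by (intro AE_all_countable[THEN iffD2] allI)
  then show ?thesis
  proof eventually_elim
    case (elim x)
    show ?case
    proof
      assume x: "x > 0"
      obtain n1 where n1: "x \<le> real n1" using real_arch_simple by blast
      obtain n2 where n2: "1 / x \<le> real n2" using real_arch_simple by blast
      define n where "n = max n1 n2"
      have "x \<le> real (Suc n)" using n1 by (simp add: n_def)
      moreover have "1 / x \<le> real (Suc n)" using n2 by (simp add: n_def)
      then have "1 / real (Suc n) \<le> x" using x by (simp add: field_simps)
      ultimately show "p x + r x > 0 \<longrightarrow> d x \<noteq> 0" using elim by (auto dest: spec[of _ n])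
    qed
  qed
qed

end

section \<open>Matrix form\<close>

no_notation fps_nth (infixl \<open>$\<close> 75)

lemma psd_entries:
  fixes P :: "real^2^2"
  assumes psd: "\<And>v. 0 \<le> v \<bullet> (P *v v)" and sym: "P $ 2 $ 1 = P $ 1 $ 2"
  shows "P $ 1 $ 1 \<ge> 0" "P $ 2 $ 2 \<ge> 0" "(P $ 1 $ 2)\<^sup>2 \<le> P $ 1 $ 1 * P $ 2 $ 2"
proof -
  define p q r where "p = P $ 1 $ 1" and "q = P $ 1 $ 2" and "r = P $ 2 $ 2"
  have form: "0 \<le> p * x\<^sup>2 + 2 * q * x * y + r * y\<^sup>2" for x y
  proof -
    have "(vector [x, y] :: real^2) \<bullet> (P *v vector [x, y]) = p * x\<^sup>2 + 2 * q * x * y + r * y\<^sup>2"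
      by (simp add: inner_vec_def matrix_vector_mult_def sum_2 p_def q_def r_def sym power2_eq_square algebra_simps)
    then show ?thesis using psd[of "vector [x, y]"] by simp
  qed
  have p0: "p \<ge> 0" using form[of 1 0] by simp
  have r0: "r \<ge> 0" using form[of 0 1] by simp
  have "q\<^sup>2 \<le> p * r"
  proof (cases "p = 0")
    case True
    have "q = 0"
    proof (rule ccontr)
      assume "q \<noteq> 0"
      \<comment> \<open>For \<open>p = 0\<close> the form at \<open>(x, 1)\<close> is affine in
        \<open>x\<close>, and this \<open>x\<close> gives it the value -1.\<close>
      then show False using form[of "- (r + 1) / (2 * q)" 1] True by (simp add: field_simps)
    qed
    then show ?thesis using True by simp
  next
    case False
    then have "p > 0" using p0 by simp
    have "p * (- q)\<^sup>2 + 2 * q * (- q) * p + r * p\<^sup>2 = p * (p * r - q\<^sup>2)" by (simp add: power2_eq_square algebra_simps)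
    then have "0 \<le> p * (p * r - q\<^sup>2)" using form[of "- q" p] by simp
    then show ?thesis using \<open>p > 0\<close> by (simp add: zero_le_mult_iff)
  qed
  with p0 r0 show "P $ 1 $ 1 \<ge> 0" "P $ 2 $ 2 \<ge> 0" "(P $ 1 $ 2)\<^sup>2 \<le> P $ 1 $ 1 * P $ 2 $ 2"
    by (auto simp: p_def q_def r_def)
qed

lemma set_integrable_lborel_imp_absolutely_integrable:
  fixes f :: "real \<Rightarrow> 'a::euclidean_space"
  assumes "set_integrable lborel S f"
  shows "f absolutely_integrable_on S" "(LINT x:S|lborel. f x) = integral S f"
proof -
  have m: "(\<lambda>x. indicat_real S x *\<^sub>R f x) \<in> borel_measurable lborel"
    using assms unfolding set_integrable_def by auto
  show ai: "f absolutely_integrable_on S"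
    using assms unfolding set_integrable_def integrable_completion[OF m] .
  have "(LINT x:S|lborel. f x) = (LINT x:S|lebesgue. f x)"
    unfolding set_lebesgue_integral_def by (rule integral_completion[OF m, symmetric])
  then show "(LINT x:S|lborel. f x) = integral S f"
    using set_lebesgue_integral_eq_integral(2)[OF ai] by simp
qed

lemma vec2_integral_nth:
  fixes F :: "real \<Rightarrow> complex^2^2"
  assumes "set_integrable lborel S F"
  shows "set_integrable lborel S (\<lambda>s. F s $ i $ j)"
    "(LINT s:S|lborel. F s) $ i $ j = (LINT s:S|lborel. F s $ i $ j)"
proof -
  have bl: "bounded_linear (\<lambda>X :: complex^2^2. X $ i $ j)"
    by (intro bounded_linear_compose[OF bounded_linear_vec_nth] bounded_linear_vec_nth)
  have e: "indicat_real S x *\<^sub>R F x $ i $ j = (indicat_real S x *\<^sub>R F x) $ i $ j" for x by simp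
  show "set_integrable lborel S (\<lambda>s. F s $ i $ j)"
    using integrable_bounded_linear[OF bl assms[unfolded set_integrable_def]] unfolding set_integrable_def e .
  show "(LINT s:S|lborel. F s) $ i $ j = (LINT s:S|lborel. F s $ i $ j)"
    using integral_bounded_linear[OF bl assms[unfolded set_integrable_def]] unfolding set_lebesgue_integral_def e by simp
qed

text \<open>Multiplication by \<open>Omega_c\<close> exchanges the rows, with a sign in the second.
  So the first row of \<open>H\<close> drives the second row of \<open>M\<close>, and the second row
  of \<open>H\<close> drives the first with a minus sign.\<close>

lemma transfer_matrix_entries:
  assumes tm: "transfer_matrix H M" and t: "t \<ge> 0"
  shows "(\<lambda>s. of_real (H s $ i $ 1) * M s z $ 1 $ j + of_real (H s $ i $ 2) * M s z $ 2 $ j) absolutely_integrable_on {0..t}"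
    and "M t z $ 2 $ j - mat 1 $ 2 $ j = z * integral {0..t} (\<lambda>s. of_real (H s $ 1 $ 1) * M s z $ 1 $ j + of_real (H s $ 1 $ 2) * M s z $ 2 $ j)"
    and "M t z $ 1 $ j - mat 1 $ 1 $ j = - z * integral {0..t} (\<lambda>s. of_real (H s $ 2 $ 1) * M s z $ 1 $ j + of_real (H s $ 2 $ 2) * M s z $ 2 $ j)"
proof -
  have si: "set_integrable lborel {0..t} (\<lambda>s. cmat_of (H s) ** M s z)"
    and eq: "Omega_c ** (M t z - mat 1) = cscale z (LINT s:{0..t}|lborel. cmat_of (H s) ** M s z)"
    using tm t by (auto simp: transfer_matrix_def)
  have entry: "(cmat_of (H s) ** M s z) $ i $ j = of_real (H s $ i $ 1) * M s z $ 1 $ j + of_real (H s $ i $ 2) * M s z $ 2 $ j" for s i j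
    by (simp add: matrix_matrix_mult_def cmat_of_def sum_2)
  note I = vec2_integral_nth[OF si, unfolded entry]
  note J = set_integrable_lborel_imp_absolutely_integrable[OF I(1)]
  show "(\<lambda>s. of_real (H s $ i $ 1) * M s z $ 1 $ j + of_real (H s $ i $ 2) * M s z $ 2 $ j) absolutely_integrable_on {0..t}"
    by (rule J(1))
  have o: "(Omega_c ** (M t z - mat 1)) $ 1 $ j = M t z $ 2 $ j - mat 1 $ 2 $ j"
    "(Omega_c ** (M t z - mat 1)) $ 2 $ j = - (M t z $ 1 $ j - mat 1 $ 1 $ j)"
    by (simp_all add: matrix_matrix_mult_def Omega_c_def sum_2)
  have c: "cscale z (LINT s:{0..t}|lborel. cmat_of (H s) ** M s z) $ i $ j =
     z * integral {0..t} (\<lambda>s. of_real (H s $ i $ 1) * M s z $ 1 $ j + of_real (H s $ i $ 2) * M s z $ 2 $ j)" for i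
    unfolding J(2)[symmetric] I(2)[symmetric] by (simp add: cscale_def)
  show "M t z $ 2 $ j - mat 1 $ 2 $ j = z * integral {0..t} (\<lambda>s. of_real (H s $ 1 $ 1) * M s z $ 1 $ j + of_real (H s $ 1 $ 2) * M s z $ 2 $ j)"
    unfolding o(1)[symmetric] c[symmetric] eq ..
  have "M t z $ 1 $ j - mat 1 $ 1 $ j = - ((Omega_c ** (M t z - mat 1)) $ 2 $ j)" unfolding o(2) by simp
  then show "M t z $ 1 $ j - mat 1 $ 1 $ j = - z * integral {0..t} (\<lambda>s. of_real (H s $ 2 $ 1) * M s z $ 1 $ j + of_real (H s $ 2 $ 2) * M s z $ 2 $ j)"
    unfolding eq c by simp
qed

theorem mainTheorem3:
  fixes H :: "real \<Rightarrow> real^2^2" and M :: "real \<Rightarrow> complex \<Rightarrow> complex^2^2"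
  assumes "hamiltonian H" and "transfer_matrix H M" and "PW_type H M"
  shows "(AE t in lborel. t \<ge> 0 \<longrightarrow> det (H t) \<noteq> 0) \<and>
    ((\<integral>\<^sup>+ t. ennreal (sqrt (det (H t))) * indicator {0..} t \<partial>lborel) = \<infinity>) \<and>
    (\<forall>t>0. de_branges_space (E_of M t) =
               paley_wiener (set_lebesgue_integral lborel {0..t} (\<lambda>\<tau>. sqrt (det (H \<tau>)))))"
proof -
  have sym: "H t $ 2 $ 1 = H t $ 1 $ 2" if "t \<ge> 0" for t
  proof -
    have "transpose (H t) = H t" using assms(1) that by (simp add: hamiltonian_def)
    from arg_cong[OF this, of "\<lambda>P. P $ 1 $ 2"] show ?thesis by (simp add: transpose_def)
  qed
  have Hint: "set_integrable lborel {0..T} (\<lambda>t. H t $ i $ j)" for T i j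
    using assms(1) by (cases "T \<ge> 0") (auto simp: hamiltonian_def set_integrable_def)
  define good where "good t \<longleftrightarrow> t \<ge> 0 \<and> (\<forall>v. 0 \<le> v \<bullet> (H t *v v)) \<and> H t \<noteq> 0" for t
  have "AE t in lborel. t \<ge> 0 \<longrightarrow> good t" using assms(1) by (auto simp: hamiltonian_def good_def)
  from AE_E[OF this] obtain N where N: "{t \<in> space lborel. \<not> (t \<ge> 0 \<longrightarrow> good t)} \<subseteq> N" "emeasure lborel N = 0" "N \<in> sets lborel"
    by blast
  have negN: "negligible N"
    using N(2,3) by (auto simp: negligible_iff_null_sets intro!: null_sets_completionI)
  have goodN: "good t" if "t \<ge> 0" "t \<notin> N" for t using N(1) that by auto
  \<comment> \<open>The value 0 off the good set gives positivity at every time and alters the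
    coefficients for nonnegative times only on the null set \<open>N\<close>, which no integral
    sees.\<close>
  define p where "p t = (if good t then H t $ 1 $ 1 else 0)" for t
  define q where "q t = (if good t then H t $ 1 $ 2 else 0)" for t
  define r where "r t = (if good t then H t $ 2 $ 2 else 0)" for t
  have g: "H t $ 1 $ 1 \<ge> 0" "H t $ 2 $ 2 \<ge> 0" "(H t $ 1 $ 2)\<^sup>2 \<le> H t $ 1 $ 1 * H t $ 2 $ 2" if "good t" for t
    using psd_entries[of "H t"] sym[of t] that by (auto simp: good_def)
  have Hai: "(\<lambda>t. H t $ i $ j) absolutely_integrable_on {0..T}" for T i j
    by (rule set_integrable_lborel_imp_absolutely_integrable(1)[OF Hint])
  have spike: "f absolutely_integrable_on {0..T}"
    if "g absolutely_integrable_on {0..T}" "\<And>t. t \<ge> 0 \<Longrightarrow> t \<notin> N \<Longrightarrow> f t = g t" for f g :: "real \<Rightarrow> 'x::euclidean_space" and T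
    by (rule absolutely_integrable_spike[OF that(1) negN]) (use that(2) in auto)
  have ispike: "integral {0..T} f = integral {0..T} g"
    if "\<And>t. t \<ge> 0 \<Longrightarrow> t \<notin> N \<Longrightarrow> f t = g t" for f g :: "real \<Rightarrow> 'x::euclidean_space" and T
    by (rule integral_spike[OF negN]) (use that in auto)
  have M0: "M 0 z $ i $ j = mat 1 $ i $ j" for z i j
  proof -
    have "M 0 z $ 1 $ j = mat 1 $ 1 $ j" "M 0 z $ 2 $ j = mat 1 $ 2 $ j"
      using transfer_matrix_entries(2,3)[OF assms(2), of 0 z j] by simp_all
    then show ?thesis using exhaust_2[of i] by auto
  qed
  have sl: "sol p q r z T (\<lambda>t. M t z $ 1 $ j) (\<lambda>t. M t z $ 2 $ j)" if T: "0 \<le> T" for z T j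
    unfolding sol_def ac_def
  proof (intro conjI ballI)
    have 1: "of_real (q t) * M t z $ 1 $ j + of_real (r t) * M t z $ 2 $ j = of_real (H t $ 2 $ 1) * M t z $ 1 $ j + of_real (H t $ 2 $ 2) * M t z $ 2 $ j"
      and 2: "of_real (p t) * M t z $ 1 $ j + of_real (q t) * M t z $ 2 $ j = of_real (H t $ 1 $ 1) * M t z $ 1 $ j + of_real (H t $ 1 $ 2) * M t z $ 2 $ j"
      if "t \<ge> 0" "t \<notin> N" for t
      using goodN[OF that] sym[OF that(1)] by (simp_all add: p_def q_def r_def)
    show "(\<lambda>t. - z * (of_real (q t) * M t z $ 1 $ j + of_real (r t) * M t z $ 2 $ j)) absolutely_integrable_on {0..T}"
      "(\<lambda>t. z * (of_real (p t) * M t z $ 1 $ j + of_real (q t) * M t z $ 2 $ j)) absolutely_integrable_on {0..T}"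
      by (intro set_integrable_mult_right spike[OF transfer_matrix_entries(1)[OF assms(2) T] 1]
            spike[OF transfer_matrix_entries(1)[OF assms(2) T] 2]; assumption)+
    fix t assume "t \<in> {0..T}"
    then have t: "t \<ge> 0" by simp
    have i1: "integral {0..t} (\<lambda>t. of_real (q t) * M t z $ 1 $ j + of_real (r t) * M t z $ 2 $ j) =
      integral {0..t} (\<lambda>t. of_real (H t $ 2 $ 1) * M t z $ 1 $ j + of_real (H t $ 2 $ 2) * M t z $ 2 $ j)"
      by (rule ispike[OF 1])
    have i2: "integral {0..t} (\<lambda>t. of_real (p t) * M t z $ 1 $ j + of_real (q t) * M t z $ 2 $ j) =
      integral {0..t} (\<lambda>t. of_real (H t $ 1 $ 1) * M t z $ 1 $ j + of_real (H t $ 1 $ 2) * M t z $ 2 $ j)"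
      by (rule ispike[OF 2])
    show "M t z $ 1 $ j - M 0 z $ 1 $ j = integral {0..t} (\<lambda>t. - z * (of_real (q t) * M t z $ 1 $ j + of_real (r t) * M t z $ 2 $ j))"
      using transfer_matrix_entries(3)[OF assms(2) t, of z j] i1 by (simp add: M0)
    show "M t z $ 2 $ j - M 0 z $ 2 $ j = integral {0..t} (\<lambda>t. z * (of_real (p t) * M t z $ 1 $ j + of_real (q t) * M t z $ 2 $ j))"
      using transfer_matrix_entries(2)[OF assms(2) t, of z j] i2 by (simp add: M0)
  qed
  obtain \<sigma> where \<sigma>: "\<And>t. t > 0 \<Longrightarrow> \<sigma> t > 0" "\<And>t. t > 0 \<Longrightarrow> de_branges_space (E_of M t) = paley_wiener (\<sigma> t)"
    "filterlim \<sigma> at_top at_top" using assms(3) by (auto simp: PW_type_def)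
  interpret pw_system p q r "\<lambda>t z. M t z $ 1 $ 1" "\<lambda>t z. M t z $ 1 $ 2" "\<lambda>t z. M t z $ 2 $ 1" "\<lambda>t z. M t z $ 2 $ 2" \<sigma>
  proof
    show "p absolutely_integrable_on {0..T}" "q absolutely_integrable_on {0..T}" "r absolutely_integrable_on {0..T}" for T
      by (rule spike[OF Hai], use goodN in \<open>simp add: p_def q_def r_def\<close>)+
    show "p t \<ge> 0" "r t \<ge> 0" "(q t)\<^sup>2 \<le> p t * r t" for t using g by (auto simp: p_def q_def r_def)
    show "sol p q r z T (\<lambda>t. M t z $ 1 $ 1) (\<lambda>t. M t z $ 2 $ 1)" "sol p q r z T (\<lambda>t. M t z $ 1 $ 2) (\<lambda>t. M t z $ 2 $ 2)" if "0 \<le> T" for z T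
      by (rule sl[OF that])+
    show "M 0 z $ 1 $ 1 = 1" "M 0 z $ 1 $ 2 = 0" "M 0 z $ 2 $ 1 = 0" "M 0 z $ 2 $ 2 = 1" for z by (simp_all add: M0 mat_def)
    show "\<sigma> t > 0" if "t > 0" for t by (rule \<sigma>(1)[OF that])
    show "de_branges_space (\<lambda>z. M t z $ 1 $ 1 - \<i> * M t z $ 2 $ 1) = paley_wiener (\<sigma> t)" if "t > 0" for t
      using \<sigma>(2)[OF that] by (simp add: E_of_def[abs_def])
  qed
  have det: "det (H t) = p t * r t - (q t)\<^sup>2" if "good t" for t
    using that sym[of t] by (simp add: det_2 p_def q_def r_def good_def power2_eq_square)
  have sd: "sqrt (det (H t)) = d t" if "t \<ge> 0" "t \<notin> N" for t
    using det[OF goodN[OF that]] by (simp add: d_def)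
  have si: "set_integrable lborel {0..t} (\<lambda>\<tau>. sqrt (det (H \<tau>)))"
    and int: "set_lebesgue_integral lborel {0..t} (\<lambda>\<tau>. sqrt (det (H \<tau>))) = integral {0..t} d" for t
  proof -
    have hm: "(\<lambda>\<tau>. indicat_real {0..t} \<tau> * H \<tau> $ i $ j) \<in> borel_measurable lborel" for i j
      using Hint[of t i j] unfolding set_integrable_def by auto
    have e: "indicat_real {0..t} \<tau> *\<^sub>R sqrt (det (H \<tau>)) =
      sqrt ((indicat_real {0..t} \<tau> * H \<tau> $ 1 $ 1) * (indicat_real {0..t} \<tau> * H \<tau> $ 2 $ 2) -
        (indicat_real {0..t} \<tau> * H \<tau> $ 1 $ 2) * (indicat_real {0..t} \<tau> * H \<tau> $ 2 $ 1))" for \<tau>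
      by (simp add: det_2 indicator_def)
    \<comment> \<open>Agreement with \<open>d\<close> off a null set gives Lebesgue measurability
      only. Borel measurability comes from the entries, with the indicator moved inside the
      root.\<close>
    have m: "(\<lambda>\<tau>. indicat_real {0..t} \<tau> *\<^sub>R sqrt (det (H \<tau>))) \<in> borel_measurable lborel"
      unfolding e by (intro measurable_compose[OF _ borel_measurable_sqrt] borel_measurable_diff borel_measurable_times hm)
    have ai: "(\<lambda>\<tau>. sqrt (det (H \<tau>))) absolutely_integrable_on {0..t}" by (rule spike[OF d_abs_integrable sd])
    then show s: "set_integrable lborel {0..t} (\<lambda>\<tau>. sqrt (det (H \<tau>)))"
      unfolding set_integrable_def integrable_completion[OF m] .
    show "set_lebesgue_integral lborel {0..t} (\<lambda>\<tau>. sqrt (det (H \<tau>))) = integral {0..t} d"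
      unfolding set_integrable_lborel_imp_absolutely_integrable(2)[OF s] by (rule ispike[OF sd])
  qed
  \<comment> \<open>Time 0, about which \<open>det_nonzero_AE\<close> is silent, is discarded as a
    null set.\<close>
  have "AE t in lborel. t \<ge> 0 \<longrightarrow> det (H t) \<noteq> 0"
    using \<open>AE t in lborel. t \<ge> 0 \<longrightarrow> good t\<close> det_nonzero_AE AE_lborel_singleton[of "0::real"]
  proof eventually_elim
    case (elim t)
    show ?case
    proof (intro impI notI)
      assume t: "t \<ge> 0" and d0: "det (H t) = 0"
      have gt: "good t" using elim t by blast
      \<comment> \<open>A nonzero positive semidefinite matrix has positive trace: with zero
        diagonal the off-diagonal entry vanishes as well.\<close>
      have "p t + r t > 0"
      proof (rule ccontr)
        assume "\<not> ?thesis"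
        then have "p t = 0" "r t = 0" using p_nonneg[of t] r_nonneg[of t] by linarith+
        moreover have "q t = 0" using psd[of t] calculation by simp
        ultimately have "H t $ 1 $ 1 = 0" "H t $ 1 $ 2 = 0" "H t $ 2 $ 1 = 0" "H t $ 2 $ 2 = 0"
          using gt sym[OF t] by (auto simp: p_def q_def r_def)
        then have "H t = 0" by (simp add: vec_eq_iff forall_2)
        then show False using gt by (simp add: good_def)
      qed
      moreover have "d t = 0" using d0 det[OF gt] by (simp add: d_def)
      ultimately show False using elim t by auto
    qed
  qed
  moreover have "(\<integral>\<^sup>+ t. ennreal (sqrt (det (H t))) * indicator {0..} t \<partial>lborel) = \<infinity>"
  proof (rule ccontr)
    assume "(\<integral>\<^sup>+ t. ennreal (sqrt (det (H t))) * indicator {0..} t \<partial>lborel) \<noteq> \<infinity>"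
    then obtain K where K: "(\<integral>\<^sup>+ t. ennreal (sqrt (det (H t))) * indicator {0..} t \<partial>lborel) = ennreal K" "K \<ge> 0"
      by (cases "\<integral>\<^sup>+ t. ennreal (sqrt (det (H t))) * indicator {0..} t \<partial>lborel") auto
    \<comment> \<open>A finite total integral would bound \<open>\<sigma>\<close>, which tends to
      infinity.\<close>
    have "\<sigma> T \<le> K" if T: "T > 0" for T
    proof -
      have "ennreal (\<sigma> T) = ennreal (integral\<^sup>L lborel (\<lambda>t. indicat_real {0..T} t *\<^sub>R sqrt (det (H t))))"
        using \<sigma>_eq[OF T] int[of T] by (simp add: set_lebesgue_integral_def)
      also have "\<dots> = (\<integral>\<^sup>+ t. ennreal (indicat_real {0..T} t *\<^sub>R sqrt (det (H t))) \<partial>lborel)"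
      proof (rule nn_integral_eq_integral[symmetric])
        show "integrable lborel (\<lambda>t. indicat_real {0..T} t *\<^sub>R sqrt (det (H t)))" using si[of T] by (simp add: set_integrable_def)
        show "AE t in lborel. 0 \<le> indicat_real {0..T} t *\<^sub>R sqrt (det (H t))"
          using \<open>AE t in lborel. t \<ge> 0 \<longrightarrow> good t\<close>
        proof eventually_elim
          case (elim t)
          show ?case
          proof (cases "t \<in> {0..T}")
            case True
            then have "det (H t) \<ge> 0" using det[of t] elim psd[of t] by auto
            then show ?thesis by simp
          qed simp
        qed
      qed
      also have "\<dots> \<le> (\<integral>\<^sup>+ t. ennreal (sqrt (det (H t))) * indicator {0..} t \<partial>lborel)"
        by (intro nn_integral_mono) (auto simp: indicator_def)
      finally show ?thesis unfolding K(1) using K(2) by (simp add: ennreal_le_iff)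
    qed
    moreover have "\<forall>\<^sub>F T in at_top. \<sigma> T > K \<and> T > (0::real)"
      using \<sigma>(3) by (intro eventually_conj eventually_gt_at_top) (simp add: filterlim_at_top_dense)
    then obtain T where "\<sigma> T > K" "T > 0" using eventually_happens'[OF trivial_limit_at_top_linorder] by blast
    ultimately show False by force
  qed
  moreover have "de_branges_space (E_of M t) = paley_wiener (set_lebesgue_integral lborel {0..t} (\<lambda>\<tau>. sqrt (det (H \<tau>))))" if "t > 0" for t
    using \<sigma>(2)[OF that] \<sigma>_eq[OF that] int[of t] by simp
  ultimately show ?thesis by blast
qed

end
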